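(* Assume $\beta^2>\alpha$. Let $(H,\sigma)\sim\mathcal H(n,d,p_n,q_n)$ and $l=c\log n$ with $c\log\alpha<1/8$. Then asymptotically almost surely the eigenvectors of $B^{(l)}$ associated with its two largest eigenvalues are asymptotically aligned with the vectors $\vec S_l=(S_l(1),\dots,S_l(n))$ and $\vec D_l=(D_l(1),\dots,D_l(n))$ respectively, where the largest eigenvalue is of order $\Theta(\alpha^l)$ up to a logarithmic factor and the second largest eigenvalue is of order $\Omega(\beta^l)$; all other eigenvalues are of order $O(n^{\epsilon}\alpha^{l/2})$ for any $\epsilon>0$.
   Context: Fix an integer $d\ge3$ and constants $a\ge b>0$; $p_n=a/\binom{n}{d-1}$, $q_n=b/\binom{n}{d-1}$. Under $\mathcal H(n,d,p_n,q_n)$, $\sigma\in\{-1,+1\}^n$ has i.i.d. uniform entries, and given $\sigma$ each $d$-subset $e\subset[n]$ is independently a hyperedge of the $d$-uniform hypergraph $H$ on $[n]$ with probability $p_n$ if all spins in $e$ agree and $q_n$ otherwise. $\alpha=(d-1)\frac{a+(2^{d-1}-1)b}{2^{d-1}}$, $\beta=(d-1)\frac{a-b}{2^{d-1}}$; throughout $\alpha,\beta>1$. Asymptotically almost surely means with probability tending to 1 as $n\to\infty$. A walk of length $l$ is $(i_0,e_1,i_1,\dots,e_l,i_l)$ with hyperedges $e_j$ of $H$, $i_{j-1}\ne i_j$, $\{i_{j-1},i_j\}\subset e_j$; it is self-avoiding if $i_0,\dots,i_l$ are distinct, $e_{j-1}\cap e_j=\{i_{j-1}\}$ for $2\le j\le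 l$, and $e_j\cap e_k=\emptyset$ whenever $k\ge j+2$. $B^{(l)}_{ij}$ is the number of self-avoiding walks of length $l$ in $H$ from $i$ to $j$ for $i\ne j$, $B^{(l)}_{ii}=0$. $d(u,v)$ is the minimal length of a walk from $u$ to $v$; $S_l(i)=|\{j:d(i,j)=l\}|$, $D_l(i)=\sum_{j:d(i,j)=l}\sigma_j$. Sequences of vectors $v_n,w_n$ are asymptotically aligned if $|\langle v_n,w_n\rangle|/(\|v_n\|_2\|w_n\|_2)\to1$. *)

theory Defs
  imports "Jordan_Normal_Form.Char_Poly" "HOL-Probability.Product_PMF"
begin

definition alpha :: "nat \<Rightarrow> real \<Rightarrow> real \<Rightarrow> real" where
  "alpha d a b = (real d - 1) * (a + (2 ^ (d - 1) - 1) * b) / 2 ^ (d - 1)"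

definition beta :: "nat \<Rightarrow> real \<Rightarrow> real \<Rightarrow> real" where
  "beta d a b = (real d - 1) * (a - b) / 2 ^ (d - 1)"

definition dsubsets :: "nat \<Rightarrow> nat \<Rightarrow> nat set set" where
  "dsubsets n d = {e. e \<subseteq> {0..<n} \<and> card e = d}"

definition p_n :: "nat \<Rightarrow> nat \<Rightarrow> real \<Rightarrow> real" where
  "p_n n d a = a / real (n choose (d - 1))"

definition hsbm :: "nat \<Rightarrow> nat \<Rightarrow> real \<Rightarrow> real \<Rightarrow> ((nat \<Rightarrow> int) \<times> nat set set) pmf" where
  "hsbm n d a b =
     do { \<sigma> \<leftarrow> Pi_pmf {0..<n} 0 (\<lambda>_. pmf_of_set {-1, 1});
          f \<leftarrow> Pi_pmf (dsubsets n d) False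
                 (\<lambda>e. bernoulli_pmf (if (\<forall>i\<in>e. \<forall>j\<in>e. \<sigma> i = \<sigma> j)
                                       then p_n n d a else p_n n d b));
          return_pmf (\<sigma>, {e \<in> dsubsets n d. f e}) }"

text \<open>A walk of length l: vertex list vs = [i_0,...,i_l], edge list es = [e_1,...,e_l]
  (0-indexed: es!k = e_(k+1)).\<close>

definition is_walk :: "nat set set \<Rightarrow> nat \<Rightarrow> nat list \<Rightarrow> nat set list \<Rightarrow> bool" where
  "is_walk H l vs es \<longleftrightarrow> length vs = l + 1 \<and> length es = l \<and>
     (\<forall>k<l. es ! k \<in> H \<and> vs ! k \<noteq> vs ! (k+1) \<and> {vs ! k, vs ! (k+1)} \<subseteq> es ! k)"

definition is_sa_walk :: "nat set set \<Rightarrow> nat \<Rightarrow> nat list \<Rightarrow> nat set list \<Rightarrow> bool" where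
  "is_sa_walk H l vs es \<longleftrightarrow> is_walk H l vs es \<and> distinct vs \<and>
     (\<forall>m. 1 \<le> m \<and> m < l \<longrightarrow> es ! (m - 1) \<inter> es ! m = {vs ! m}) \<and>
     (\<forall>j k. j + 2 \<le> k \<and> k < l \<longrightarrow> es ! j \<inter> es ! k = {})"

definition Bl :: "nat set set \<Rightarrow> nat \<Rightarrow> nat \<Rightarrow> nat \<Rightarrow> nat" where
  "Bl H l i j = (if i = j then 0 else
      card {(vs, es). is_sa_walk H l vs es \<and> hd vs = i \<and> last vs = j})"

definition Bl_mat :: "nat \<Rightarrow> nat set set \<Rightarrow> nat \<Rightarrow> real Matrix.mat" where
  "Bl_mat n H l = Matrix.mat n n (\<lambda>(i, j). real (Bl H l i j))"

definition walk_exists :: "nat set set \<Rightarrow> nat \<Rightarrow> nat \<Rightarrow> nat \<Rightarrow> bool" where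
  "walk_exists H k u v \<longleftrightarrow> (\<exists>vs es. is_walk H k vs es \<and> hd vs = u \<and> last vs = v)"

definition hdist_eq :: "nat set set \<Rightarrow> nat \<Rightarrow> nat \<Rightarrow> nat \<Rightarrow> bool" where
  "hdist_eq H u v l \<longleftrightarrow> walk_exists H l u v \<and> (\<forall>k<l. \<not> walk_exists H k u v)"

definition S_vec :: "nat \<Rightarrow> nat set set \<Rightarrow> nat \<Rightarrow> real Matrix.vec" where
  "S_vec n H l = Matrix.vec n (\<lambda>i. real (card {j \<in> {0..<n}. hdist_eq H i j l}))"

definition D_vec :: "nat \<Rightarrow> (nat \<Rightarrow> int) \<Rightarrow> nat set set \<Rightarrow> nat \<Rightarrow> real Matrix.vec" where
  "D_vec n \<sigma> H l = Matrix.vec n (\<lambda>i. real_of_int (\<Sum>j \<in> {j \<in> {0..<n}. hdist_eq H i j l}. \<sigma> j))"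

text \<open>k-th largest eigenvalue (k \<ge> 1) of a real matrix whose characteristic polynomial
  splits over the reals (e.g. symmetric): the largest root mu of the characteristic
  polynomial such that at least k roots counted with multiplicity are \<ge> mu.\<close>

definition kth_eig :: "real Matrix.mat \<Rightarrow> nat \<Rightarrow> real" where
  "kth_eig A k = Max {\<mu>. poly (char_poly A) \<mu> = 0 \<and>
      k \<le> (\<Sum>\<nu> \<in> {\<nu>. poly (char_poly A) \<nu> = 0 \<and> \<mu> \<le> \<nu>}. order \<nu> (char_poly A))}"

definition cos_angle :: "real Matrix.vec \<Rightarrow> real Matrix.vec \<Rightarrow> real" where
  "cos_angle v w = \<bar>scalar_prod v w\<bar> / (sqrt (scalar_prod v v) * sqrt (scalar_prod w w))"

end

theory Submission
 imports Defs "HOL-Analysis.Function_Topology" "HOL-Analysis.L2_Norm"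
begin

text \<open>
 Let Delta be the self-avoiding walk matrix with edge indicators centred at their conditional
 probabilities given the spins. Replacing the centred weights one edge at a time gives
 B = Delta + (sum over the position of the first uncentred edge) of Delta * (expected adjacency) * B,
 minus a correction for walks that are self-avoiding only in parts. Up to a small error the expected
 adjacency is a combination of 1 1^T and s s^T, s being the spin vector. Trace moments bound
 Delta of length t by n^epsilon * alpha^(t/2), and second moments bound the corrections and show
 that the quadratic forms of B at 1 and s concentrate around n alpha^t and n beta^t.
 Hence B has norm O(n^epsilon alpha^(l/2)) orthogonally to B 1 and B s, and the
 variational characterisation of eigenvalues gives the theorem.

 All moments are reduced to one weighted count of tuples of walks: a step that closes a cycle
 in the union of the hyperedges costs a factor 1/n up to logarithms, so a bonus y of order
 n up to logarithms can be paid for every such step.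
\<close>

text \<open>The obstacle: orthogonality to B 1 and B s at length l has to control the inner products
  with B 1 and B s at all shorter lengths, since those are what the recursion produces. It does,
  because for z = 1 or s the vector B_t z is close to the sum of gamma^(t-m) Delta_m z over m <= t,
  with gamma = alpha or beta. Rescaling B_l z by gamma^(t-l) therefore leaves only the terms with m
  > t, and their total norm is of order alpha^(t/2) sqrt n up to the slack as long as sqrt alpha <=
  gamma. This is where beta^2 > alpha enters.

  S_l and D_l differ from B 1 and B s only through pairs of walks from one vertex that close a
  cycle, so they are handled by the same count.

  No concentration inequality is used. Every random input is a nonnegative statistic; each is
  divided by its threshold, and the sum has small expectation, so a single use of Markov's
  inequality gives all inputs at once. Norms of Delta are known only up to a slack eta = n^e0,
  obtained from traces of a number of walks of order 1/e0.\<close>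

section \<open>Walks and forests\<close>

text \<open>The start vertex is kept apart and the list holds pairs (edge, next vertex), so that
  walks split and join under append. \<open>walk_zip\<close> and \<open>walk_unzip\<close> connect
  this with the two lists of \<open>is_walk\<close>.\<close>

fun walk :: "nat => (nat set \<times> nat) list => bool" where
 "walk u [] = True"
| "walk u ((e, v) # w) = (u \<in> e \<and> v \<in> e \<and> v ~= u \<and> walk v w)"

fun dest :: "nat => (nat set \<times> nat) list => nat" where
 "dest u [] = u"
| "dest u ((e, v) # w) = dest v w"

abbreviation edges :: "(nat set \<times> nat) list => nat set set" where
 "edges w \<equiv> fst ` set w"

text \<open>The common class in which all counting is done: self-avoiding walks are trails by
  \<open>saws_trails\<close>, shortest walks by \<open>shortest_distinct\<close>, and a trail can
  use a given edge only once.\<close>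

definition trails :: "nat set set => nat => nat => (nat set \<times> nat) list set" where
 "trails X u t = {w. length w = t \<and> walk u w \<and> distinct (map fst w) \<and> edges w \<subseteq> X}"

lemma walk_append [simp]: "walk u (p @ q) \<longleftrightarrow> walk u p \<and> walk (dest u p) q"
 by (induction u p rule: walk.induct) auto

lemma dest_append [simp]: "dest u (p @ q) = dest (dest u p) q"
 by (induction u p rule: dest.induct) auto

lemma walk_snd_mem: "walk u w ==> (e, v) \<in> set w ==> v \<in> e"
 by (induction u w rule: walk.induct) auto

lemma dest_mem: "walk u w ==> w ~= [] ==> dest u w \<in> \<Union>(edges w)"
proof (induction u w rule: walk.induct)
 case (2 u e v w)
 then show ?case by (cases "w = []") auto
qed auto

lemma start_mem: "walk u w ==> w ~= [] ==> u \<in> \<Union>(edges w)"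
 by (cases w) auto

lemma trails_0 [simp]: "trails X u 0 = {[]}"
 by (auto simp: trails_def)

lemma trails_Suc: "trails X u (Suc t) =
 {(e, v) # w | e v w. e \<in> X \<and> u \<in> e \<and> v \<in> e - {u} \<and> w \<in> trails (X - {e}) v t}" (is "?L = ?R")
proof
 show "?L \<subseteq> ?R"
 proof
  fix x assume x: "x \<in> ?L"
  then obtain a w where xw: "x = a # w" "length w = t" by (auto simp: trails_def length_Suc_conv)
  moreover obtain e v where "a = (e, v)" by (cases a)
  ultimately show "x \<in> ?R" using x by (auto simp: trails_def)
 qed
qed (force simp: trails_def)

lemma trails_Cons_iff: "(e, v) # w \<in> trails X u (Suc t) \<longleftrightarrow>
  e \<in> X \<and> u \<in> e \<and> v \<in> e \<and> v ~= u \<and> w \<in> trails (X - {e}) v t"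
 by (auto simp: trails_def)

lemma trails_mono: "X \<subseteq> Y ==> trails X u t \<subseteq> trails Y u t"
 by (auto simp: trails_def)

lemma finite_trails [simp]:
 assumes "finite X" "!!e. e \<in> X ==> finite e"
 shows "finite (trails X u t)"
proof (rule finite_subset)
 show "trails X u t \<subseteq> {w. set w \<subseteq> X \<times> \<Union>X \<and> length w = t}"
 proof
  fix w assume w: "w \<in> trails X u t"
  have "(e, v) \<in> set w ==> e \<in> X \<and> v \<in> e" for e v
   using w walk_snd_mem[of u w e v] by (force simp: trails_def)
  then show "w \<in> {w. set w \<subseteq> X \<times> \<Union>X \<and> length w = t}"
   using w by (auto simp: trails_def)
 qed
 show "finite {w. set w \<subseteq> X \<times> \<Union>X \<and> length w = t}"
  using assms by (intro finite_lists_length_eq) auto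
qed

text \<open>Acyclicity of a hypergraph, witnessed by an order in which each edge meets the union of
  the earlier ones in at most one vertex. An empty intersection is allowed, so a new component may
  be opened at any time.\<close>

inductive forest :: "nat set set => bool" where
 forest_empty: "forest {}"
| forest_insert: "forest G ==> finite e ==> card (e \<inter> \<Union>G) \<le> 1 ==> forest (insert e G)"

lemma card_le_1_eq: "finite A ==> card A \<le> 1 ==> x \<in> A ==> y \<in> A ==> x = y"
 using card_le_Suc0_iff_eq by auto

text \<open>A trail repeats no edge, so removing its single use of \<open>e\<close> leaves two
  trails of \<open>G\<close>.\<close>

lemma trails_insert_cases:
 assumes "w \<in> trails (insert e G) u t"
 obtains (avoid) "w \<in> trails G u t"
 | (use) p v q where "w = p @ (e, v) # q" "p \<in> trails G u (length p)" "q \<in> trails G v (length q)"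
   "dest u p \<in> e" "v \<in> e" "v ~= dest u p"
proof (cases "e \<in> edges w")
 case False
 then have "w \<in> trails G u t" using assms by (auto simp: trails_def)
 then show ?thesis by (rule avoid)
next
 case True
 then obtain v where "(e, v) \<in> set w" by auto
 then obtain p q where w: "w = p @ (e, v) # q" by (meson split_list)
 show ?thesis
  by (rule use[OF w]) (use assms w in \<open>auto simp: trails_def\<close>)
qed

text \<open>The edge added last meets the rest in at most one vertex, so a trail can use it only as its
 first or its last edge.\<close>

lemma forest_unique:
 assumes "forest G" "w \<in> trails G u t" "w' \<in> trails G u t'" "dest u w = dest u w'"
 shows "w = w'"
 using assms
proof (induction arbitrary: u t t' w w' rule: forest.induct)
 case forest_empty
 then show ?case by (auto simp: trails_def)
next
 case (forest_insert G e)
 have st: "u \<in> \<Union>G" if "p \<in> trails G u k" "p ~= []" for p u k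
  using start_mem[of u p] that Union_mono[of "edges p" G] by (simp add: trails_def subset_iff)
 have en: "dest u p \<in> \<Union>G" if "p \<in> trails G u k" "p ~= []" for p u k
  using dest_mem[of u p] that Union_mono[of "edges p" G] by (simp add: trails_def subset_iff)
 \<comment> \<open>All contradictions below come from two distinct vertices of \<open>e\<close> that
   both lie in the old forest.\<close>
 have one: "x = y" if "x \<in> e" "y \<in> e" "x \<in> \<Union>G" "y \<in> \<Union>G" for x y
  using forest_insert.hyps that card_le_1_eq[of "e \<inter> \<Union>G" x y] by auto
 have IH: "w = w'" if "w \<in> trails G u t" "w' \<in> trails G u t'" "dest u w = dest u w'" for u t t' w w'
  using forest_insert.IH that by blast
 have nil: "[] \<in> trails G u 0" for u by simp
 have cyc: "p = []" if "p \<in> trails G u k" "dest u p = u" for p u k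
  using IH[OF that(1) nil[of u]] that(2) by simp
 \<comment> \<open>One trail avoids \<open>e\<close>, the other crosses it from
   \<open>dest u p\<close> to \<open>v\<close>. Both crossing vertices lie in the old forest: where
   an adjacent piece is empty, the vertex is a common end point and is visited by another
   piece.\<close>
 have mixed: False
  if a: "w \<in> trails G u t" and b: "p \<in> trails G u (length p)" "q \<in> trails G v (length q)"
   "dest u p \<in> e" "v \<in> e" "v ~= dest u p" and "dest u w = dest v q" for u w t p q v
 proof (cases "w = []")
  case True
  then have u: "u = dest v q" using that by simp
  show False
  proof (cases "q = []")
   case True
   then have "p ~= []" using u b by auto
   then show False using st[OF b(1)] en[OF b(1)] one u True b by auto
  next
   case False
   then have "p = []" using st[OF b(2)] en[OF b(1)] one b by metis
   then show False using en[OF b(2)] False st[OF b(2)] one u b by (metis dest.simps(1))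
  qed
 next
  case False
  then have "u \<in> \<Union>G" "dest v q \<in> \<Union>G" using st[OF a] en[OF a] that by auto
  then show False using one b st[OF b(2)] en[OF b(1)] by (metis dest.simps(1))
 qed
 \<comment> \<open>The exit vertex from \<open>e\<close> is forced: if the exits differed, the equal
   end points would put both of them into the old forest.\<close>
 have first: "q = q' \<and> v = v'"
  if "q \<in> trails G v (length q)" "q' \<in> trails G v' (length q')" "v \<in> e" "v' \<in> e"
    "dest v q = dest v' q'" for q v q' v'
 proof (cases "v = v'")
  case True
  then show ?thesis using IH that by metis
 next
  case False
  then show ?thesis using that st[OF that(1)] st[OF that(2)] en[OF that(1)] en[OF that(2)] one
   by (metis dest.simps(1))
 qed
 from forest_insert.prems(1) show ?case
 proof (cases rule: trails_insert_cases)
  case avoid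
  note w = this
  from forest_insert.prems(2) show ?thesis
  proof (cases rule: trails_insert_cases)
   case avoid
   then show ?thesis using IH w forest_insert.prems by blast
  next
   case (use p v q)
   then show ?thesis using mixed[OF w, of p q v] forest_insert.prems(3) by simp
  qed
 next
  case (use p v q)
  note w = this
  from forest_insert.prems(2) show ?thesis
  proof (cases rule: trails_insert_cases)
   case avoid
   then show ?thesis using mixed[OF avoid, of p q v] forest_insert.prems(3) w by simp
  next
   case (use p' v' q')
   have d: "dest v q = dest v' q'" using forest_insert.prems(3) w use by simp
   show ?thesis
   proof (cases "p = [] \<or> p' = []")
    case True
    then have "p = [] \<and> p' = []"
     using st[OF w(2)] st[OF use(2)] en[OF w(2)] en[OF use(2)] cyc[OF w(2)] cyc[OF use(2)] one w use
     by (metis dest.simps(1))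
    then show ?thesis using first[OF w(3) use(3) w(5) use(5) d] w use by simp
   next
    case False
    then have "dest u p = dest u p'" using en[OF w(2)] en[OF use(2)] one w use by blast
    then show ?thesis using first[OF w(3) use(3) w(5) use(5) d] w use IH[OF w(2) use(2)] by simp
   qed
  qed
 qed
qed

text \<open>By \<open>forest_unique\<close> a trail from \<open>u\<close> inside a forest is
  determined by its end point. This keeps the number of ways to move through old edges linear in the
  number of vertices seen.\<close>

lemma card_forest_trails:
 assumes "forest G" "\<Union>G \<subseteq> U" "u \<in> U" "finite U"
 shows "card (trails G u t) \<le> card U"
proof (rule card_inj_on_le[of "dest u"])
 show "inj_on (dest u) (trails G u t)"
  using forest_unique[OF assms(1)] by (auto simp: inj_on_def)
 show "dest u ` trails G u t \<subseteq> U"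
 proof
  fix x assume "x \<in> dest u ` trails G u t"
  then obtain w where w: "w \<in> trails G u t" "x = dest u w" by auto
  show "x \<in> U"
  proof (cases "w = []")
   case False
   then have "x \<in> \<Union>(edges w)" "edges w \<subseteq> G" using w dest_mem[of u w] by (auto simp: trails_def)
   then show ?thesis using assms by blast
  qed (use w assms in auto)
 qed
qed fact

section \<open>Edge weights\<close>

lemma sum_trails_Suc:
 assumes "finite X" "!!e. e \<in> X ==> finite e"
 shows "(\<Sum>w\<in>trails X u (Suc t). f w) =
  (\<Sum>(e, v)\<in>{(e, v). e \<in> X \<and> u \<in> e \<and> v \<in> e - {u}}. \<Sum>q\<in>trails (X - {e}) v t. f ((e, v) # q))"
proof -
 let ?P = "{(e, v). e \<in> X \<and> u \<in> e \<and> v \<in> e - {u}}"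
 have fP: "finite ?P"
  by (rule finite_subset[of _ "Sigma X (%e. e)"]) (use assms in auto)
 have "(\<Sum>z\<in>?P. \<Sum>q\<in>trails (X - {fst z}) (snd z) t. f (z # q))
   = (\<Sum>(z, q)\<in>Sigma ?P (%z. trails (X - {fst z}) (snd z) t). f (z # q))"
  by (rule sum.Sigma) (use assms fP in \<open>auto intro!: finite_trails\<close>)
 also have "... = (\<Sum>w\<in>trails X u (Suc t). f w)"
  by (rule sum.reindex_bij_witness[of _ "%w. (hd w, tl w)" "%z. fst z # snd z"])
    (auto simp: trails_Suc)
 finally show ?thesis by (simp add: split_beta)
qed

lemma dest_in: "walk u w ==> u \<in> U ==> \<Union>(edges w) \<subseteq> U ==> dest u w \<in> U"
 by (induction u w rule: walk.induct) auto

section \<open>Counting hyperedges and single steps\<close>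

lemma finite_dsubsets [simp]: "finite (dsubsets n d)"
 by (rule finite_subset[of _ "Pow {0..<n}"]) (auto simp: dsubsets_def)

lemma dsubsets_finite: "e \<in> dsubsets n d ==> finite e"
 by (auto simp: dsubsets_def intro: finite_subset[of _ "{0..<n}"])

lemma card_dsubsets_containing:
 assumes "W \<subseteq> {0..<n}" "card W \<le> d"
 shows "card {e \<in> dsubsets n d. W \<subseteq> e} = (n - card W) choose (d - card W)"
proof -
 have fW: "finite W" using assms finite_subset by blast
 have "bij_betw (%S. S \<union> W) {S. S \<subseteq> {0..<n} - W \<and> card S = d - card W} {e \<in> dsubsets n d. W \<subseteq> e}"
 proof (rule bij_betw_byWitness[of _ "%e. e - W"])
  show "(%S. S \<union> W) ` {S. S \<subseteq> {0..<n} - W \<and> card S = d - card W} \<subseteq> {e \<in> dsubsets n d. W \<subseteq> e}"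
  proof safe
   fix S assume S: "S \<subseteq> {0..<n} - W" "card S = d - card W"
   have "finite S" using S finite_subset by blast
   then have "card (S \<union> W) = card S + card W" using S fW by (intro card_Un_disjoint) auto
   then have "card (S \<union> W) = d" using S(2) assms(2) by simp
   moreover have "S \<union> W \<subseteq> {0..<n}" using S(1) assms(1) by blast
   ultimately show "S \<union> W \<in> dsubsets n d" by (simp add: dsubsets_def)
  qed
  show "(%e. e - W) ` {e \<in> dsubsets n d. W \<subseteq> e} \<subseteq> {S. S \<subseteq> {0..<n} - W \<and> card S = d - card W}"
  proof (rule image_subsetI)
   fix e assume "e \<in> {e \<in> dsubsets n d. W \<subseteq> e}"
   then have "e \<subseteq> {0..<n}" "card e = d" "W \<subseteq> e" by (simp_all add: dsubsets_def)
   moreover have "card (e - W) = card e - card W" using fW \<open>W \<subseteq> e\<close> by (rule card_Diff_subset)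
   ultimately show "e - W \<in> {S. S \<subseteq> {0..<n} - W \<and> card S = d - card W}" by blast
  qed
 qed auto
 then have "card {e \<in> dsubsets n d. W \<subseteq> e} = card {S. S \<subseteq> {0..<n} - W \<and> card S = d - card W}"
  by (simp add: bij_betw_same_card)
 also have "... = card ({0..<n} - W) choose (d - card W)"
  by (rule n_subsets) auto
 also have "card ({0..<n} - W) = n - card W"
  using assms fW by (simp add: card_Diff_subset)
 finally show ?thesis .
qed

lemma card_steps:
 assumes "u < n" "1 \<le> d"
 shows "card {(e, v). e \<in> dsubsets n d \<and> u \<in> e \<and> v \<in> e - {u}} = (d - 1) * ((n - 1) choose (d - 1))"
proof -
 have "{(e, v). e \<in> dsubsets n d \<and> u \<in> e \<and> v \<in> e - {u}} = Sigma {e \<in> dsubsets n d. {u} \<subseteq> e} (%e. e - {u})"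
  by auto
 also have "card ... = (\<Sum>e\<in>{e \<in> dsubsets n d. {u} \<subseteq> e}. card (e - {u}))"
  by (rule card_SigmaI) (auto intro: dsubsets_finite)
 also have "... = (\<Sum>e\<in>{e \<in> dsubsets n d. {u} \<subseteq> e}. d - 1)"
  by (intro sum.cong) (auto simp: dsubsets_def)
 finally show ?thesis using card_dsubsets_containing[of "{u}" n d] assms by simp
qed

text \<open>A bad step has an edge that meets \<open>U\<close> in a second vertex x. Fixing x as
  well as \<open>u\<close> replaces (n - 1 choose d - 1) by (n - 2 choose d - 2), a gain of order n,
  at the price of card \<open>U\<close> choices of x.\<close>

lemma card_bad_steps:
 assumes "u \<in> U" "U \<subseteq> {0..<n}" "2 \<le> d"
 shows "card {(e, v). e \<in> dsubsets n d \<and> u \<in> e \<and> v \<in> e - {u} \<and> 1 < card (e \<inter> U)}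
  \<le> card U * ((d - 1) * ((n - 2) choose (d - 2)))"
proof -
 let ?E = "%x. {e \<in> dsubsets n d. {u, x} \<subseteq> e}"
 have fU: "finite U" using assms finite_subset by blast
 have "{(e, v). e \<in> dsubsets n d \<and> u \<in> e \<and> v \<in> e - {u} \<and> 1 < card (e \<inter> U)}
  \<subseteq> (\<Union>x\<in>U - {u}. Sigma (?E x) (%e. e - {u}))"
 proof (rule subsetI)
  fix z assume "z \<in> {(e, v). e \<in> dsubsets n d \<and> u \<in> e \<and> v \<in> e - {u} \<and> 1 < card (e \<inter> U)}"
  then obtain e v where z: "z = (e, v)" and e: "e \<in> dsubsets n d" "u \<in> e" "v \<in> e" "1 < card (e \<inter> U)" "v ~= u"
   by auto
  have "\<not> e \<inter> U \<subseteq> {u}" using e(4) card_mono[of "{u}" "e \<inter> U"] by auto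
  then obtain x where "x \<in> e \<inter> U" "x ~= u" by auto
  then show "z \<in> (\<Union>x\<in>U - {u}. Sigma (?E x) (%e. e - {u}))" using e z by auto
 qed
 then have "card {(e, v). e \<in> dsubsets n d \<and> u \<in> e \<and> v \<in> e - {u} \<and> 1 < card (e \<inter> U)}
   \<le> card (\<Union>x\<in>U - {u}. Sigma (?E x) (%e. e - {u}))"
  by (intro card_mono finite_UN_I finite_SigmaI) (use fU in \<open>auto intro: dsubsets_finite\<close>)
 also have "... \<le> (\<Sum>x\<in>U - {u}. card (Sigma (?E x) (%e. e - {u})))"
  by (rule card_UN_le) (use fU in auto)
 also have "... = (\<Sum>x\<in>U - {u}. (d - 1) * ((n - 2) choose (d - 2)))"
 proof (rule sum.cong[OF refl])
  fix x assume x: "x \<in> U - {u}"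
  have "card (Sigma (?E x) (%e. e - {u})) = (\<Sum>e\<in>?E x. card (e - {u}))"
   by (rule card_SigmaI) (auto intro: dsubsets_finite)
  also have "... = (\<Sum>e\<in>?E x. d - 1)"
   by (intro sum.cong) (auto simp: dsubsets_def)
  also have "... = (d - 1) * card (?E x)" by simp
  also have "card (?E x) = (n - 2) choose (d - 2)"
  proof -
   have "card {u, x} = 2" using x by auto
   moreover have "{u, x} \<subseteq> {0..<n}" using x assms by auto
   ultimately show ?thesis using card_dsubsets_containing[of "{u, x}" n d] assms by simp
  qed
  finally show "card (Sigma (?E x) (%e. e - {u})) = (d - 1) * ((n - 2) choose (d - 2))" .
 qed
 also have "... \<le> card U * ((d - 1) * ((n - 2) choose (d - 2)))"
  using card_mono[of U "U - {u}"] fU by (simp add: mult_right_mono)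
 finally show ?thesis .
qed

text \<open>Counts the cycle-closing steps when a walk is explored in order. \<open>U\<close> and
  \<open>F\<close> are the vertices and edges seen so far; a step is charged if its edge is new and
  meets \<open>U\<close> at least twice. Reusing an old edge is free.\<close>

fun bd :: "nat set => nat set set => (nat set \<times> nat) list => nat" where
 "bd U F [] = 0"
| "bd U F ((e, v) # w) = (if e \<in> F \<or> card (e \<inter> U) \<le> 1 then 0 else 1) + bd (U \<union> e) (insert e F) w"

lemma bd_append_old:
 "edges p \<subseteq> F ==> \<Union>F \<subseteq> U ==> bd U F (p @ q) = bd U F q"
proof (induction p)
 case (Cons a p)
 then have "U \<union> fst a = U" "insert (fst a) F = F" by auto
 then show ?case using Cons by (cases a) auto
qed auto

text \<open>Only two facts about the model enter the count: attaching an edge in a tree-like way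
  multiplies the weight by at most \<open>g\<close>, any other new edge by at most \<open>h\<close>.
  By \<open>g1\<close> the tree-like steps from one vertex have total weight at most 1, so the
  growth alpha^t must be divided out of the weight beforehand.\<close>

locale edge_weight =
 fixes n d :: nat and \<Psi> :: "nat set set => real" and g h :: real
 assumes nonneg: "F \<subseteq> dsubsets n d ==> 0 \<le> \<Psi> F"
  and attach: "F \<subseteq> dsubsets n d ==> e \<in> dsubsets n d ==> e \<notin> F ==> card (e \<inter> \<Union>F) \<le> 1 ==>
   \<Psi> (insert e F) \<le> g * \<Psi> F"
  and insert: "F \<subseteq> dsubsets n d ==> e \<in> dsubsets n d ==> e \<notin> F ==> \<Psi> (insert e F) \<le> h * \<Psi> F"
  and g0: "0 \<le> g" and h0: "0 \<le> h" and d2: "2 \<le> d"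
  and g1: "g * real ((d - 1) * ((n - 1) choose (d - 1))) \<le> 1"
begin

abbreviation "M \<equiv> dsubsets n d"

text \<open>The case of a walk whose next edge is new. Good edges have total mass at most 1 and lead
  outside \<open>U\<close>, where the sharp bound \<open>1 + t * \<delta> * A\<close> is available;
  bad edges have mass at most \<open>\<delta>\<close> and only the crude bound \<open>A\<close>.
  Hence the error grows linearly, not geometrically, in the length.\<close>

lemma new_step:
 fixes y A \<delta> :: real
 assumes F: "F \<subseteq> M" "G \<subseteq> F" "\<Union>F \<subseteq> U" "U \<subseteq> {0..<n}" "u \<in> U" "real (card U) \<le> R"
  and y: "0 \<le> y" "0 \<le> A" "0 \<le> \<delta>" and \<delta>: "y * h * (R * real ((d - 1) * ((n - 2) choose (d - 2)))) \<le> \<delta>"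
  and good: "!!e v. e \<in> M - F ==> u \<in> e ==> v \<in> e - {u} ==> v \<notin> U ==> 
   (\<Sum>q\<in>trails (G \<union> (M - insert e F)) v t. \<Psi> (insert e F \<union> edges q) * y ^ bd (U \<union> e) (insert e F) q)
    \<le> (1 + t * \<delta> * A) * \<Psi> (insert e F)"
  and bad: "!!e v. e \<in> M - F ==> u \<in> e ==> v \<in> e - {u} ==> 
   (\<Sum>q\<in>trails (G \<union> (M - insert e F)) v t. \<Psi> (insert e F \<union> edges q) * y ^ bd (U \<union> e) (insert e F) q)
    \<le> A * \<Psi> (insert e F)"
 shows "(\<Sum>(e, v)\<in>{(e, v). e \<in> M - F \<and> u \<in> e \<and> v \<in> e - {u}}.
   \<Sum>q\<in>trails (G \<union> (M - insert e F)) v t. \<Psi> (F \<union> edges ((e, v) # q)) * y ^ bd U F ((e, v) # q))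
  \<le> (1 + Suc t * \<delta> * A) * \<Psi> F" (is "(\<Sum>(e, v)\<in>?P. ?f e v) \<le> _")
proof -
 let ?N1 = "real ((d - 1) * ((n - 1) choose (d - 1)))"
 let ?N2 = "real ((d - 1) * ((n - 2) choose (d - 2)))"
 define b where "b e = (1 < card (e \<inter> U))" for e
 let ?A = "{(e, v). e \<in> M \<and> u \<in> e \<and> v \<in> e - {u}}"
 let ?B = "{(e, v). e \<in> M \<and> u \<in> e \<and> v \<in> e - {u} \<and> 1 < card (e \<inter> U)}"
 let ?c = "(1 + t * \<delta> * A) * (g * \<Psi> F)" and ?k = "y * (A * (h * \<Psi> F))"
 have fA: "finite ?A"
  by (rule finite_subset[of _ "Sigma M (%e. e)"]) (auto intro: dsubsets_finite)
 have \<Psi>F: "0 \<le> \<Psi> F" by (rule nonneg[OF F(1)])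
 have R0: "0 \<le> R" using F(6) of_nat_0_le_iff order_trans by blast
 have c0: "0 \<le> ?c" and k0: "0 \<le> ?k" using y g0 h0 \<Psi>F by auto
 have step: "?f e v \<le> ?c + (if b e then ?k else 0)" if ev: "(e, v) \<in> ?P" for e v
 proof -
  let ?s = "\<Sum>q\<in>trails (G \<union> (M - insert e F)) v t. \<Psi> (insert e F \<union> edges q) * y ^ bd (U \<union> e) (insert e F) q"
  have e: "e \<in> M - F" "u \<in> e" "v \<in> e - {u}" using ev by auto
  have fin: "finite (e \<inter> U)" using e by (auto intro: dsubsets_finite)
  show ?thesis
  proof (cases "b e")
   case True
   then have "?f e v = y * ?s" using e by (simp add: b_def sum_distrib_left mult_ac)
   also have "... \<le> y * (A * \<Psi> (insert e F))" using bad[OF e] y by (intro mult_left_mono)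
   also have "... \<le> ?k" using insert[of F e] F e y by (intro mult_left_mono) auto
   finally show ?thesis using True c0 by simp
  next
   case False
   then have c1: "card (e \<inter> U) \<le> 1" by (simp add: b_def)
   then have vU: "v \<notin> U" using card_le_1_eq[OF fin, of u v] e F by auto
   have sub: "e \<inter> \<Union>F \<subseteq> e \<inter> U" using F by auto
   have c2: "card (e \<inter> \<Union>F) \<le> 1" by (rule order_trans[OF card_mono[OF fin sub] c1])
   have "?f e v = ?s" using e c1 by (simp add: b_def)
   also have "... \<le> (1 + t * \<delta> * A) * \<Psi> (insert e F)" using good[OF e vU] .
   also have "... \<le> ?c" using attach[OF F(1) _ _ c2] e y by (intro mult_left_mono) auto
   finally show ?thesis using False by simp
  qed
 qed
 have "(\<Sum>(e, v)\<in>?P. ?f e v) \<le> (\<Sum>(e, v)\<in>?P. ?c + (if b e then ?k else 0))"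
  by (rule sum_mono) (use step in \<open>simp add: split_beta\<close>)
 also have "... \<le> (\<Sum>(e, v)\<in>?A. ?c + (if b e then ?k else 0))"
  using c0 k0 fA by (intro sum_mono2) auto
 also have "... = card ?A * ?c + (\<Sum>(e, v)\<in>?A. if b e then ?k else 0)"
  by (simp add: sum.distrib split_beta)
 also have "(\<Sum>(e, v)\<in>?A. if b e then ?k else 0) = (\<Sum>z\<in>?B. ?k)"
  by (rule sum.mono_neutral_cong_right) (use fA in \<open>auto simp: b_def split: if_splits\<close>)
 also have "card ?A * ?c + (\<Sum>z\<in>?B. ?k) = card ?A * ?c + card ?B * ?k" by simp
 also have "card ?A * ?c \<le> 1 * ((1 + t * \<delta> * A) * \<Psi> F)"
 proof -
  have "card ?A * ?c = (g * ?N1) * ((1 + t * \<delta> * A) * \<Psi> F)"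
   using card_steps[of u n d] F d2 by auto
  also have "... \<le> 1 * ((1 + t * \<delta> * A) * \<Psi> F)"
   using g1 y \<Psi>F by (intro mult_right_mono) auto
  finally show ?thesis .
 qed
 also have "card ?B * ?k \<le> \<delta> * A * \<Psi> F"
 proof -
  have "real (card ?B) \<le> real (card U) * ?N2"
   using of_nat_mono[OF card_bad_steps[of u U n d], where 'a = real] F d2 by (simp only: of_nat_mult)
  also have "... \<le> R * ?N2" using F by (intro mult_right_mono) auto
  finally have "card ?B * ?k \<le> (R * ?N2) * ?k" using k0 by (intro mult_right_mono)
  also have "... = (y * h * (R * ?N2)) * (A * \<Psi> F)" by (simp add: mult_ac)
  also have "... \<le> \<delta> * (A * \<Psi> F)" using \<delta> y \<Psi>F by (intro mult_right_mono) auto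
  finally show ?thesis by simp
 qed
 finally show ?thesis by (simp add: algebra_simps)
qed

end

context edge_weight
begin

lemma finite_trails_M [simp]: "X \<subseteq> M ==> finite (trails X u t)"
 by (rule finite_trails) (auto intro: dsubsets_finite finite_subset[OF _ finite_dsubsets])

lemma card_steps_in:
 assumes "finite X" "X \<subseteq> M"
 shows "card {(e, v). e \<in> X \<and> x \<in> e \<and> v \<in> e - {x}} \<le> card X * d"
  and "finite {(e, v). e \<in> X \<and> x \<in> e \<and> v \<in> e - {x}}"
proof -
 have fin: "finite (Sigma X (%e. e))" using assms by (auto intro: dsubsets_finite)
 have sub: "{(e, v). e \<in> X \<and> x \<in> e \<and> v \<in> e - {x}} \<subseteq> Sigma X (%e. e)" by auto
 have "card (Sigma X (%e. e)) = (\<Sum>e\<in>X. card e)"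
  by (rule card_SigmaI) (use assms in \<open>auto intro: dsubsets_finite\<close>)
 also have "... = (\<Sum>e\<in>X. d)"
  by (rule sum.cong) (use assms in \<open>auto simp: dsubsets_def\<close>)
 finally have "card (Sigma X (%e. e)) = card X * d" by simp
 then show "card {(e, v). e \<in> X \<and> x \<in> e \<and> v \<in> e - {x}} \<le> card X * d"
  using card_mono[OF fin sub] by simp
 show "finite {(e, v). e \<in> X \<and> x \<in> e \<and> v \<in> e - {x}}" by (rule finite_subset[OF sub fin])
qed

text \<open>A trail is cut at the edges of \<open>X\<close> and at the new edges. The pieces in between run inside
 the forest \<open>G\<close> and are determined by their end points; each edge of \<open>X\<close> is used at most once.
 After a new edge that meets \<open>U\<close> in a single vertex the trail has left \<open>U\<close>, and can only continue
 with new edges.\<close>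

lemma sum_over_trails:
 fixes y \<delta> R Q :: real
 assumes G: "forest G" and y: "0 \<le> y" "0 \<le> \<delta>" 
  and \<delta>: "y * h * (R * real ((d - 1) * ((n - 2) choose (d - 2)))) \<le> \<delta>"
  and small: "2 * (real l + 1)\<^sup>2 * R * \<delta> \<le> 1"
  and Q: "2 * (real l + 1) * R * (2 + R * d) \<le> Q" and R1: "1 \<le> R"
  and "t \<le> l" "finite X" "card X \<le> R" "G \<union> X \<subseteq> F" "F \<subseteq> M" "\<Union>F \<subseteq> U" "U \<subseteq> {0..<n}"
   "card U + d * t \<le> R" "u \<in> U"
 shows "(\<Sum>w\<in>trails (G \<union> X \<union> (M - F)) u t. \<Psi> (F \<union> edges w) * y ^ bd U F w) \<le> Q ^ (card X + 1) * \<Psi> F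
  \<and> (u \<notin> \<Union>(G \<union> X) -->
   (\<Sum>w\<in>trails (G \<union> X \<union> (M - F)) u t. \<Psi> (F \<union> edges w) * y ^ bd U F w) \<le> (1 + t * \<delta> * Q ^ (card X + 1)) * \<Psi> F)"
 using assms(8-)
proof (induction t arbitrary: X F U u rule: less_induct)
 case (less t)
 define f where "f w = \<Psi> (F \<union> edges w) * y ^ bd U F w" for w
 define A where "A = Q ^ (card X + 1)"
 have XF: "X \<subseteq> F" "G \<subseteq> F" and FM: "F \<subseteq> M" using less.prems by auto
 have fU: "finite U" using less.prems finite_subset by blast
 have Q1: "1 \<le> Q"
 proof -
  have "1 \<le> 2 * (real l + 1) * R * (2 + R * d)"
   using R1 mult_mono[of 1 "2 * (real l + 1) * R" 1 "2 + R * d"] mult_mono[of 1 "2 * (real l + 1)" 1 R] by simp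
  then show ?thesis using Q by linarith
 qed
 have A1: "1 \<le> A" unfolding A_def using Q1 by (rule one_le_power)
 have \<Psi>F: "0 \<le> \<Psi> F" by (rule nonneg[OF FM])
 have f0: "0 \<le> f w" if "w \<in> trails (G \<union> X \<union> (M - F)) v s" for w v s
 proof -
  have "edges w \<subseteq> G \<union> X \<union> (M - F)" using that by (simp add: trails_def)
  then have "F \<union> edges w \<subseteq> M" using XF FM by blast
  then show ?thesis unfolding f_def using nonneg y by simp
 qed
 \<comment> \<open>\<open>R\<close> is a budget of vertices: those seen already and \<open>d\<close>
   for each step still to come.\<close>
 have grow: "card (U \<union> e) + d * s \<le> R" if "e \<in> M" "s < t" for e s
 proof -
  have "card (U \<union> e) \<le> card U + d"
   using card_Un_le[of U e] that(1) by (simp add: dsubsets_def)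
  moreover have "d * (s + 1) \<le> d * t" using that by (intro mult_le_mono) auto
  ultimately have "card (U \<union> e) + d * s \<le> card U + d * t" by simp
  then have "real (card (U \<union> e) + d * s) \<le> real (card U + d * t)" by linarith
  then show ?thesis using less.prems by linarith
 qed
 have "real (card U) \<le> real (card U + d * t)" by simp
 then have cU: "real (card U) \<le> R" using less.prems(8) by (rule order_trans)
 have step: "(\<Sum>(e, v)\<in>{(e, v). e \<in> M - F \<and> x \<in> e \<and> v \<in> e - {x}}.
   \<Sum>q\<in>trails (G \<union> X \<union> (M - insert e F)) v s. f ((e, v) # q)) \<le> (1 + real (Suc s) * \<delta> * A) * \<Psi> F"
  if x: "x \<in> U" and s: "s < t" for x s
  unfolding f_def
 proof (rule new_step[OF FM _ _ _ x cU _ _ _ \<delta>])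
  fix e v assume e: "e \<in> M - F" "x \<in> e" "v \<in> e - {x}"
  have pr: "s < t" "s \<le> l" "finite X" "card X \<le> R" "G \<union> X \<subseteq> insert e F" "insert e F \<subseteq> M" "\<Union>(insert e F) \<subseteq> U \<union> e"
   "U \<union> e \<subseteq> {0..<n}" "card (U \<union> e) + d * s \<le> R" "v \<in> U \<union> e"
   using s e less.prems grow[of e s] by (auto simp: dsubsets_def)
  show "(\<Sum>q\<in>trails (G \<union> X \<union> (M - insert e F)) v s. \<Psi> (insert e F \<union> edges q) * y ^ bd (U \<union> e) (insert e F) q)
    \<le> A * \<Psi> (insert e F)"
   unfolding A_def using less.IH[OF pr] by blast
  assume "v \<notin> U"
  then have "v \<notin> \<Union>(G \<union> X)" using less.prems by blast
  then show "(\<Sum>q\<in>trails (G \<union> X \<union> (M - insert e F)) v s. \<Psi> (insert e F \<union> edges q) * y ^ bd (U \<union> e) (insert e F) q)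
    \<le> (1 + s * \<delta> * A) * \<Psi> (insert e F)"
   unfolding A_def using less.IH[OF pr] by blast
 qed (use less.prems y A1 in auto)
 have fin: "finite (G \<union> X \<union> (M - F))" "!!e. e \<in> G \<union> X \<union> (M - F) ==> finite e"
  using XF FM finite_subset[OF _ finite_dsubsets, of "G \<union> X \<union> (M - F)" n d] by (auto intro: dsubsets_finite)
 have TM: "G \<union> X \<union> (M - F) \<subseteq> M" using XF FM by blast
 have sts: "(\<Sum>w\<in>trails (G \<union> X \<union> (M - F)) x (Suc s). f' w) =
   (\<Sum>(e, v)\<in>{(e, v). e \<in> G \<union> X \<union> (M - F) \<and> x \<in> e \<and> v \<in> e - {x}}.
    \<Sum>q\<in>trails (G \<union> X \<union> (M - F) - {e}) v s. f' ((e, v) # q))" for f' :: "_ => real" and x s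
  by (rule sum_trails_Suc[OF fin])
 \<comment> \<open>Outside \<open>G\<close> and \<open>X\<close> the first edge has to be new, so
   \<open>step\<close> alone applies.\<close>
 have outside: "(\<Sum>w\<in>trails (G \<union> X \<union> (M - F)) u t. f w) \<le> (1 + t * \<delta> * A) * \<Psi> F" if u: "u \<notin> \<Union>(G \<union> X)"
 proof (cases t)
  case 0
  then show ?thesis by (simp add: f_def)
 next
  case (Suc s)
  have P: "{(e, v). e \<in> G \<union> X \<union> (M - F) \<and> u \<in> e \<and> v \<in> e - {u}} = {(e, v). e \<in> M - F \<and> u \<in> e \<and> v \<in> e - {u}}"
   using u by auto
  have "(\<Sum>w\<in>trails (G \<union> X \<union> (M - F)) u t. f w) = (\<Sum>(e, v)\<in>{(e, v). e \<in> M - F \<and> u \<in> e \<and> v \<in> e - {u}}.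
   \<Sum>q\<in>trails (G \<union> X \<union> (M - F) - {e}) v s. f ((e, v) # q))"
   unfolding Suc P[symmetric] by (rule sum_trails_Suc[OF fin])
  also have "... = (\<Sum>(e, v)\<in>{(e, v). e \<in> M - F \<and> u \<in> e \<and> v \<in> e - {u}}.
   \<Sum>q\<in>trails (G \<union> X \<union> (M - insert e F)) v s. f ((e, v) # q))"
  proof (rule sum.cong[OF refl])
   fix z assume "z \<in> {(e, v). e \<in> M - F \<and> u \<in> e \<and> v \<in> e - {u}}"
   then obtain e v where z: "z = (e, v)" "e \<in> M - F" by blast
   then have "G \<union> X \<union> (M - F) - {e} = G \<union> X \<union> (M - insert e F)" using XF by blast
   then show "(case z of (e, v) => \<Sum>q\<in>trails (G \<union> X \<union> (M - F) - {e}) v s. f ((e, v) # q)) =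
    (case z of (e, v) => \<Sum>q\<in>trails (G \<union> X \<union> (M - insert e F)) v s. f ((e, v) # q))"
    by (simp only: z prod.case)
  qed
  also have "... \<le> (1 + real (Suc s) * \<delta> * A) * \<Psi> F"
   using step[of u s] Suc less.prems by simp
  finally show ?thesis using Suc by simp
 qed
 \<comment> \<open>\<open>D\<close> bounds the continuations that do not start with an edge of
   \<open>G\<close>: stop, use one of the at most \<open>R * d\<close> steps along \<open>X\<close>,
   or take a new edge.\<close>
 define D where "D = (2 + R * d * Q ^ card X + (real l + 1) * \<delta> * A) * \<Psi> F"
 define N where "N s x = {q \<in> trails (G \<union> X \<union> (M - F)) x s. q = [] \<or> fst (hd q) \<notin> G}" for s x
 have fN: "finite (N s x)" for s x
  unfolding N_def by (rule finite_subset[OF _ finite_trails_M[OF TM, of x s]]) blast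
 have N: "(\<Sum>q\<in>N s x. f q) \<le> D" if x: "x \<in> U" and s: "s \<le> t" for s x
 proof (cases s)
  case 0
  have "N 0 x = {[]}" by (auto simp: N_def)
  then have "(\<Sum>q\<in>N s x. f q) = 1 * \<Psi> F" using 0 by (simp add: f_def)
  also have "... \<le> D" unfolding D_def using R1 Q1 A1 y \<Psi>F by (intro mult_right_mono) auto
  finally show ?thesis .
 next
  case (Suc s')
  let ?P = "{(e, v). e \<in> X \<and> x \<in> e \<and> v \<in> e - {x}}"
  let ?P' = "{(e, v). e \<in> M - F \<and> x \<in> e \<and> v \<in> e - {x}}"
  let ?PA = "{(e, v). e \<in> G \<union> X \<union> (M - F) \<and> x \<in> e \<and> v \<in> e - {x}}"
  have XM: "X \<subseteq> M" using XF FM by auto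
  have fP0: "finite ?PA" by (rule card_steps_in) (use fin XF FM in auto)
  have fP: "finite ?P" "finite ?P'" by (rule finite_subset[OF _ fP0]; auto)+
  define S where "S z = (\<Sum>q\<in>trails (G \<union> X \<union> (M - F) - {fst z}) (snd z) s'. f (z # q))" for z
  have S0: "0 \<le> S z" if "z \<in> ?PA" for z
   unfolding S_def
  proof (rule sum_nonneg)
   fix q assume "q \<in> trails (G \<union> X \<union> (M - F) - {fst z}) (snd z) s'"
   then have "z # q \<in> trails (G \<union> X \<union> (M - F)) x (Suc s')"
    using that trails_Cons_iff[of "fst z" "snd z"] by auto
   then show "0 \<le> f (z # q)" by (rule f0)
  qed
  \<comment> \<open>A used edge of \<open>X\<close> is removed from \<open>X\<close>, since a trail
    cannot use it again. This lowers the exponent of \<open>Q\<close> by one, which later pays for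
    the factor \<open>R * d\<close>.\<close>
  have old: "S z \<le> Q ^ card X * \<Psi> F" if "z \<in> ?P" for z
  proof -
   obtain e v where z0: "z = (e, v)" by (cases z)
   then have z: "z = (e, v)" "e \<in> X" "x \<in> e" "v \<in> e" using that by auto
   have eU: "U \<union> e = U" "insert e F = F" using z XF less.prems by blast+
   have sub: "trails (G \<union> X \<union> (M - F) - {e}) v s' \<subseteq> trails (G \<union> (X - {e}) \<union> (M - F)) v s'"
    by (rule trails_mono) auto
   have eF: "e \<in> F" using z XF by blast
   have "f ((e, v) # q) = f q" for q
   proof -
    have "F \<union> edges ((e, v) # q) = F \<union> edges q" using eF by auto
    moreover have "bd U F ((e, v) # q) = bd U F q" by (simp add: eF eU)
    ultimately show ?thesis by (simp only: f_def)
   qed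
   then have "S z = (\<Sum>q\<in>trails (G \<union> X \<union> (M - F) - {e}) v s'. f q)"
    by (simp only: S_def z fst_conv snd_conv)
   also have "... \<le> (\<Sum>q\<in>trails (G \<union> (X - {e}) \<union> (M - F)) v s'. f q)"
   proof (rule sum_mono2[OF _ sub])
    show "finite (trails (G \<union> (X - {e}) \<union> (M - F)) v s')" by (rule finite_trails_M, rule subset_trans[OF _ TM]) blast
    fix q assume "q \<in> trails (G \<union> (X - {e}) \<union> (M - F)) v s' - trails (G \<union> X \<union> (M - F) - {e}) v s'"
    moreover have "trails (G \<union> (X - {e}) \<union> (M - F)) v s' \<subseteq> trails (G \<union> X \<union> (M - F)) v s'"
     by (rule trails_mono) blast
    ultimately have "q \<in> trails (G \<union> X \<union> (M - F)) v s'" by blast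
    then show "0 \<le> f q" by (rule f0)
   qed
   also have "... \<le> Q ^ (card (X - {e}) + 1) * \<Psi> F"
   proof -
    have "card (X - {e}) \<le> card X" using less.prems by (intro card_mono) auto
    then have "real (card (X - {e})) \<le> R" using less.prems(3) by linarith
    moreover have "d * s' \<le> d * t" using Suc s by simp
    then have "real (card U + d * s') \<le> R" using less.prems(8) by linarith
    moreover have "s' < t" "s' \<le> l" "finite (X - {e})" "G \<union> (X - {e}) \<subseteq> F" "v \<in> U"
     using Suc s less.prems z eU by auto
    ultimately show ?thesis
     unfolding f_def using less.IH[of s' "X - {e}" F U v] less.prems by blast
   qed
   also have "card (X - {e}) + 1 = card X"
    using z less.prems by (metis card_Suc_Diff1 Suc_eq_plus1)
   finally show ?thesis .
  qed
  have "(\<Sum>q\<in>N s x. f q) = (\<Sum>q\<in>trails (G \<union> X \<union> (M - F)) x s. if q = [] \<or> fst (hd q) \<notin> G then f q else 0)"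
   unfolding N_def by (rule sum.inter_filter) (rule finite_trails_M[OF TM])
  also have "... = (\<Sum>z\<in>?PA. if fst z \<notin> G then S z else 0)"
   unfolding Suc sts S_def by (rule sum.cong) (auto simp: split_beta)
  also have "... = (\<Sum>z\<in>{z \<in> ?PA. fst z \<notin> G}. S z)"
   by (rule sum.inter_filter[symmetric]) (rule fP0)
  also have "... \<le> (\<Sum>z\<in>?P \<union> ?P'. S z)"
   by (rule sum_mono2) (use fP S0 in auto)
  also have "... = (\<Sum>z\<in>?P. S z) + (\<Sum>z\<in>?P'. S z)"
   by (rule sum.union_disjoint) (use fP XF in auto)
  also have "(\<Sum>z\<in>?P. S z) \<le> (\<Sum>z\<in>?P. Q ^ card X * \<Psi> F)"
   by (rule sum_mono) (rule old)
  also have "... = real (card ?P) * (Q ^ card X * \<Psi> F)" by simp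
  also have "... \<le> (R * d) * (Q ^ card X * \<Psi> F)"
  proof (rule mult_right_mono)
   have "real (card ?P) \<le> real (card X * d)"
    using card_steps_in(1)[OF less.prems(2) XM, of x] by (simp only: of_nat_le_iff)
   also have "... = real (card X) * d" by simp
   also have "... \<le> R * d" using less.prems(3) by (rule mult_right_mono) simp
   finally show "real (card ?P) \<le> R * d" .
  qed (use Q1 \<Psi>F in auto)
  also have "(\<Sum>z\<in>?P'. S z) = (\<Sum>(e, v)\<in>?P'. \<Sum>q\<in>trails (G \<union> X \<union> (M - insert e F)) v s'. f ((e, v) # q))"
  proof (rule sum.cong[OF refl])
   fix z assume "z \<in> ?P'"
   then obtain e v where z: "z = (e, v)" "e \<in> M - F" by blast
   then have "G \<union> X \<union> (M - F) - {e} = G \<union> X \<union> (M - insert e F)" using XF by blast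
   then show "S z = (case z of (e, v) => \<Sum>q\<in>trails (G \<union> X \<union> (M - insert e F)) v s'. f ((e, v) # q))"
    by (simp only: z prod.case S_def fst_conv snd_conv)
  qed
  also have "... \<le> (1 + real (Suc s') * \<delta> * A) * \<Psi> F" using step[OF x, of s'] Suc s by simp
  also have "(R * d) * (Q ^ card X * \<Psi> F) + (1 + real (Suc s') * \<delta> * A) * \<Psi> F
    = (1 + R * d * Q ^ card X + real (Suc s') * \<delta> * A) * \<Psi> F" by (simp add: algebra_simps)
  also have "... \<le> D"
  proof -
   have "real (Suc s') \<le> real l + 1" using Suc s less.prems by simp
   then have "real (Suc s') * \<delta> * A \<le> (real l + 1) * \<delta> * A" using y A1 by (intro mult_right_mono) auto
   then show ?thesis unfolding D_def using \<Psi>F by (intro mult_right_mono) auto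
  qed
  finally show ?thesis by simp
 qed
 define Z where "Z = Sigma {..t} (%s. Sigma (trails G u s) (%p. N (t - s) (dest u p)))"
 have GM: "G \<subseteq> M" using XF FM by auto
 have destU: "dest u p \<in> U" if "p \<in> trails G u s" for p s
 proof (rule dest_in)
  have "edges p \<subseteq> F" using that XF by (auto simp: trails_def)
  then show "\<Union>(edges p) \<subseteq> U" using less.prems by blast
 qed (use that less.prems in \<open>auto simp: trails_def\<close>)
 \<comment> \<open>Cut each trail after its longest initial segment p inside \<open>G\<close>. That
   segment changes neither weight nor bonus, and for each length there are at most \<open>R\<close>
   of them by \<open>card_forest_trails\<close>.\<close>
 have "(\<Sum>w\<in>trails (G \<union> X \<union> (M - F)) u t. f w) \<le> (\<Sum>z\<in>Z. f (snd (snd z)))"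
 proof (rule sum_le_included[where i = "%z. fst (snd z) @ snd (snd z)"])
  show "finite Z" unfolding Z_def using GM fN by (intro finite_SigmaI) auto
  show "finite (trails (G \<union> X \<union> (M - F)) u t)" by (rule finite_trails_M[OF TM])
  show "\<forall>z\<in>Z. 0 \<le> f (snd (snd z))" using f0 by (auto simp: Z_def N_def)
  show "\<forall>w\<in>trails (G \<union> X \<union> (M - F)) u t. \<exists>z\<in>Z. fst (snd z) @ snd (snd z) = w \<and> f w \<le> f (snd (snd z))"
  proof
   fix w assume w: "w \<in> trails (G \<union> X \<union> (M - F)) u t"
   define p q where "p = takeWhile (%z. fst z \<in> G) w" and "q = dropWhile (%z. fst z \<in> G) w"
   have wpq: "w = p @ q" by (simp add: p_def q_def)
   have pG: "edges p \<subseteq> G" unfolding p_def by (auto dest: set_takeWhileD)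
   have qG: "q = [] \<or> fst (hd q) \<notin> G" unfolding q_def using hd_dropWhile[of "%z. fst z \<in> G" w] by auto
   have "(length p, p, q) \<in> Z"
    unfolding Z_def N_def using w pG qG by (auto simp: wpq trails_def)
   moreover have "f w = f q"
   proof -
    have "edges p \<subseteq> F" using pG XF by auto
    then have "bd U F w = bd U F q" "F \<union> edges w = F \<union> edges q"
     using bd_append_old[of p F U q] less.prems wpq by auto
    then show ?thesis by (simp add: f_def)
   qed
   ultimately show "\<exists>z\<in>Z. fst (snd z) @ snd (snd z) = w \<and> f w \<le> f (snd (snd z))"
    using wpq by (intro bexI[of _ "(length p, p, q)"]) auto
  qed
 qed
 also have "... = (\<Sum>s\<le>t. \<Sum>p\<in>trails G u s. \<Sum>q\<in>N (t - s) (dest u p). f q)"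
  unfolding Z_def using GM fN by (subst sum.Sigma, simp, simp)+ (auto intro!: sum.cong simp: split_beta)
 also have "... \<le> (\<Sum>s\<le>t. \<Sum>p\<in>trails G u s. D)"
  by (intro sum_mono N destU) auto
 also have "... = (\<Sum>s\<le>t. real (card (trails G u s)) * D)" by simp
 also have "... \<le> (\<Sum>s\<le>t. R * D)"
 proof (intro sum_mono mult_right_mono)
  fix s
  have "\<Union>G \<subseteq> U" using XF less.prems by blast
  then have "card (trails G u s) \<le> card U"
   by (rule card_forest_trails[OF G _ less.prems(9) fU])
  then show "real (card (trails G u s)) \<le> R" using cU by linarith
  show "0 \<le> D" unfolding D_def using R1 Q1 A1 y \<Psi>F by auto
 qed
 also have "... = (real t + 1) * R * D" by simp
 also have "... \<le> (real l + 1) * R * D"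
 proof (intro mult_right_mono)
  show "0 \<le> D" unfolding D_def using R1 Q1 A1 y \<Psi>F by auto
 qed (use less.prems R1 in auto)
 \<comment> \<open>The assumption on \<open>Q\<close> makes the part
   \<open>2 + R * d * Q ^ card X\<close> cost at most half of \<open>A\<close>; the assumption
   \<open>small\<close> fits the \<open>\<delta>\<close> part into the other half.\<close>
 also have "... \<le> A * \<Psi> F"
 proof -
  have Qc: "1 \<le> Q ^ card X" using Q1 by (rule one_le_power)
  have "2 + R * d * Q ^ card X \<le> (2 + R * d) * Q ^ card X" using Qc by (simp add: algebra_simps)
  then have "2 * (real l + 1) * R * (2 + R * d * Q ^ card X) \<le> 2 * (real l + 1) * R * ((2 + R * d) * Q ^ card X)"
   using R1 by (intro mult_left_mono) auto
  also have "... \<le> Q * Q ^ card X" using mult_right_mono[OF Q, of "Q ^ card X"] Qc by (simp add: mult_ac)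
  finally have 1: "2 * ((real l + 1) * R * (2 + R * d * Q ^ card X)) \<le> A" by (simp add: A_def algebra_simps)
  have "2 * ((real l + 1) * R * ((real l + 1) * \<delta> * A)) = (2 * (real l + 1)\<^sup>2 * R * \<delta>) * A"
   by (simp add: power2_eq_square mult_ac)
  also have "... \<le> 1 * A" using small A1 by (intro mult_right_mono) auto
  finally have "2 * ((real l + 1) * R * ((real l + 1) * \<delta> * A)) \<le> A" by simp
  with 1 have "(real l + 1) * R * (2 + R * d * Q ^ card X + (real l + 1) * \<delta> * A) \<le> A"
   by (simp only: distrib_left)
  then have "((real l + 1) * R * (2 + R * d * Q ^ card X + (real l + 1) * \<delta> * A)) * \<Psi> F \<le> A * \<Psi> F"
   by (rule mult_right_mono[OF _ \<Psi>F])
  then show ?thesis unfolding D_def by (simp only: mult.assoc)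
 qed
 finally have "(\<Sum>w\<in>trails (G \<union> X \<union> (M - F)) u t. f w) \<le> A * \<Psi> F" .
 from conjI[OF this[unfolded f_def A_def] impI[OF outside[unfolded f_def A_def]]] show ?case .
qed

end

section \<open>Tuples of walks\<close>

text \<open>Each walk starts at a vertex of \<open>U\<close> or of an earlier walk. The union stays
  connected, so one free vertex, worth a factor n, is chosen for the whole tuple.\<close>

fun tuple_of :: "nat set set => nat set => nat list => (nat \<times> (nat set \<times> nat) list) list => bool" where
 "tuple_of M U [] [] = True"
| "tuple_of M U (t # ts) ((u, w) # ws) = (u \<in> U \<and> w \<in> trails M u t \<and> tuple_of M (U \<union> \<Union>(edges w)) ts ws)"
| "tuple_of M U _ _ = False"

definition tuples :: "nat set set => nat set => nat list => (nat \<times> (nat set \<times> nat) list) list set" where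
 "tuples M U ts = {ws. tuple_of M U ts ws}"

fun bdt :: "nat set => nat set set => (nat \<times> (nat set \<times> nat) list) list => nat" where
 "bdt U F [] = 0"
| "bdt U F ((u, w) # ws) = bd U F w + bdt (U \<union> \<Union>(edges w)) (F \<union> edges w) ws"

fun tedges :: "(nat \<times> (nat set \<times> nat) list) list => nat set set" where
 "tedges [] = {}"
| "tedges ((u, w) # ws) = edges w \<union> tedges ws"

lemma tuples_Nil [simp]: "tuples M U [] = {[]}"
proof -
 have "tuple_of M U [] ws \<longleftrightarrow> ws = []" for ws by (cases ws) auto
 then show ?thesis by (auto simp: tuples_def)
qed

lemma tuples_Cons: "ws \<in> tuples M U (t # ts) \<longleftrightarrow>
  (\<exists>u w ws'. ws = (u, w) # ws' \<and> u \<in> U \<and> w \<in> trails M u t \<and> ws' \<in> tuples M (U \<union> \<Union>(edges w)) ts)"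
proof (cases ws)
 case (Cons z ws')
 then show ?thesis by (cases z) (auto simp: tuples_def)
qed (auto simp: tuples_def)

lemma bd_le_length: "bd U F w \<le> length w"
proof (induction w arbitrary: U F)
 case (Cons a w)
 show ?case using Cons[of "U \<union> fst a" "insert (fst a) F"] by (cases a) auto
qed simp

lemma card_Union_edges:
 assumes "edges w \<subseteq> dsubsets n d"
 shows "card (\<Union>(edges w)) \<le> d * length w" "\<Union>(edges w) \<subseteq> {0..<n}"
proof -
 have "card (\<Union>(edges w)) \<le> sum card (edges w)"
  by (rule card_Union_le_sum_card)
 also have "... = (\<Sum>e\<in>edges w. d)" using assms by (intro sum.cong) (auto simp: dsubsets_def)
 also have "... = card (edges w) * d" by simp
 also have "... \<le> length w * d"
  using card_image_le[of "set w" fst] card_length[of w] by (intro mult_right_mono) auto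
 finally show "card (\<Union>(edges w)) \<le> d * length w" by (simp add: mult.commute)
 show "\<Union>(edges w) \<subseteq> {0..<n}" using assms by (auto simp: dsubsets_def)
qed

text \<open>New edges that meet \<open>U\<close> at most once extend the forest; every other new
  edge is put into the exceptional set, which therefore grows by at most the number of bad
  steps.\<close>

lemma forest_extend:
 assumes "forest G" "finite X" "F = G \<union> X" "\<Union>F \<subseteq> U" "edges w \<subseteq> dsubsets n d"
 shows "\<exists>G' X'. forest G' \<and> finite X' \<and> F \<union> edges w = G' \<union> X' \<and> card X' \<le> card X + bd U F w"
 using assms
proof (induction w arbitrary: U F G X)
 case Nil
 then show ?case by auto
next
 case (Cons a w)
 obtain e v where a: "a = (e, v)" by (cases a)
 have fe: "finite e" using Cons.prems a by (auto intro: dsubsets_finite)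
 have w: "edges w \<subseteq> dsubsets n d" using Cons.prems by auto
 have U': "\<Union>(insert e F) \<subseteq> U \<union> e" using Cons.prems by blast
 have eq: "F \<union> edges (a # w) = insert e F \<union> edges w" by (auto simp: a)
 show ?case
 proof (cases "e \<in> F \<or> card (e \<inter> U) \<le> 1")
  case True
  have "\<exists>G' X'. forest G' \<and> finite X' \<and> insert e F = G' \<union> X' \<and> card X' \<le> card X"
  proof (cases "e \<in> F")
   case True
   then show ?thesis using Cons.prems by (auto simp: insert_absorb)
  next
   case False
   have "e \<inter> \<Union>G \<subseteq> e \<inter> U" using Cons.prems by blast
   then have "card (e \<inter> \<Union>G) \<le> card (e \<inter> U)" using fe by (intro card_mono) auto
   then have "forest (insert e G)" using Cons.prems fe True False by (intro forest_insert) auto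
   then show ?thesis using Cons.prems by (intro exI[of _ "insert e G"] exI[of _ X]) auto
  qed
  then obtain G' X' where 1: "forest G'" "finite X'" "insert e F = G' \<union> X'" "card X' \<le> card X" by blast
  have 2: "bd U F (a # w) = bd (U \<union> e) (insert e F) w" using True by (auto simp: a)
  show ?thesis unfolding eq 2 using Cons.IH[OF 1(1,2,3) U' w] 1(4) by (meson add_le_mono1 le_trans)
 next
  case False
  have 1: "insert e F = G \<union> insert e X" using Cons.prems by auto
  have 2: "bd U F (a # w) = 1 + bd (U \<union> e) (insert e F) w" using False by (auto simp: a)
  have 3: "card (insert e X) \<le> card X + 1" by (simp add: card_insert_le_m1 card_insert_if Cons.prems(2))
  have "finite (insert e X)" using Cons.prems by auto
  from Cons.IH[OF Cons.prems(1) this 1 U' w]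
  obtain G' X' where "forest G'" "finite X'" "insert e F \<union> edges w = G' \<union> X'"
    "card X' \<le> card (insert e X) + bd (U \<union> e) (insert e F) w" by blast
  then show ?thesis unfolding eq 2 using 3 by (intro exI[of _ G'] exI[of _ X']) auto
 qed
qed

section \<open>The weighted count of connected tuples of walks\<close>

context edge_weight
begin

lemma finite_tuples [simp]: "finite U ==> finite (tuples M U ts)"
proof (induction ts arbitrary: U)
 case (Cons t ts)
 have "tuples M U (t # ts) \<subseteq> (%((u, w), ws). (u, w) # ws) `
   (SIGMA z:(SIGMA u:U. trails M u t). tuples M (U \<union> \<Union>(edges (snd z))) ts)"
  by (force simp: tuples_Cons image_iff)
 moreover have "finite (U \<union> \<Union>(edges w))" if "w \<in> trails M u t" for u w
  using that Cons.prems card_Union_edges(2)[of w n d] finite_subset[of "\<Union>(edges w)" "{0..<n}"] by (auto simp: trails_def)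
 then have "finite (SIGMA z:(SIGMA u:U. trails M u t). tuples M (U \<union> \<Union>(edges (snd z))) ts)"
  using Cons by (intro finite_SigmaI) auto
 ultimately show ?case by (meson finite_imageI finite_subset)
qed simp

lemma sum_tuples_Cons:
 assumes "finite U"
 shows "(\<Sum>ws\<in>tuples M U (t # ts). f ws) =
  (\<Sum>u\<in>U. \<Sum>w\<in>trails M u t. \<Sum>ws\<in>tuples M (U \<union> \<Union>(edges w)) ts. f ((u, w) # ws))"
proof -
 have fin: "finite (tuples M (U \<union> \<Union>(edges w)) ts)" if "w \<in> trails M u t" for u w
  using that assms card_Union_edges(2)[of w n d] finite_subset[of "\<Union>(edges w)" "{0..<n}"]
  by (intro finite_tuples) (auto simp: trails_def)
 let ?S = "SIGMA u:U. SIGMA w:trails M u t. tuples M (U \<union> \<Union>(edges w)) ts"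
 have "(\<Sum>u\<in>U. \<Sum>w\<in>trails M u t. \<Sum>ws\<in>tuples M (U \<union> \<Union>(edges w)) ts. f ((u, w) # ws))
   = (\<Sum>u\<in>U. \<Sum>z\<in>(SIGMA w:trails M u t. tuples M (U \<union> \<Union>(edges w)) ts). f ((u, fst z) # snd z))"
  using fin by (intro sum.cong refl) (subst sum.Sigma, auto simp: split_beta)
 also have "... = (\<Sum>z\<in>?S. f ((fst z, fst (snd z)) # snd (snd z)))"
  using fin assms by (subst sum.Sigma) (auto simp: split_beta)
 also have "... = (\<Sum>ws\<in>tuples M U (t # ts). f ws)"
  by (rule sum.reindex_bij_witness[of _ "%ws. (fst (hd ws), snd (hd ws), tl ws)"
     "%z. (fst z, fst (snd z)) # snd (snd z)"]) (auto simp: tuples_Cons)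
 finally show ?thesis by simp
qed

text \<open>Walks are added one at a time, and the hypergraph seen so far is kept as a forest
  \<open>G\<close> with exceptional edges \<open>X\<close>. The factor \<open>(R * Q) ^ K\<close> in
  \<open>small\<close> leaves room for the bonus to grow with the number of walks still to
  come.\<close>

theorem sum_over_tuples:
 fixes y R Q :: real and K :: nat
 assumes y: "0 \<le> y" and R1: "1 \<le> R"
  and Q: "2 * (real l + 1) * R * (2 + R * d) \<le> Q"
  and small: "2 * (real l + 1)\<^sup>2 * R * (y * (R * Q) ^ K * h * (R * real ((d - 1) * ((n - 2) choose (d - 2))))) \<le> 1"
  and "\<forall>t\<in>set ts. t \<le> l" "length ts \<le> K"
   "forest G" "finite X" "F = G \<union> X" "F \<subseteq> M" "\<Union>F \<subseteq> U" "U \<subseteq> {0..<n}"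
   "card U + d * sum_list ts \<le> R" "card X + sum_list ts \<le> R"
 shows "(\<Sum>ws\<in>tuples M U ts. \<Psi> (F \<union> tedges ws) * y ^ bdt U F ws) \<le> (R * Q) ^ (length ts * (card X + 1)) * \<Psi> F"
 using assms(5-)
proof (induction ts arbitrary: U F G X)
 case Nil
 then show ?case by simp
next
 case (Cons t ts)
 let ?N = "real ((d - 1) * ((n - 2) choose (d - 2)))"
 define k where "k = length ts"
 define \<delta> where "\<delta> = y * (R * Q) ^ k * h * (R * ?N)"
 have fU: "finite U" by (rule finite_subset[OF Cons.prems(8)]) simp
 have "1 * 1 \<le> R * (2 * (real l + 1) * (2 + R * d))"
  using R1 mult_mono[of 1 "2 * (real l + 1)" 1 "2 + R * d"] by (intro mult_mono) auto
 then have Q1: "1 \<le> Q" using Q by (simp add: mult_ac)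
 have RQ: "1 \<le> R * Q" using R1 Q1 mult_mono[of 1 R 1 Q] by simp
 have \<delta>0: "0 \<le> \<delta>" unfolding \<delta>_def using y R1 h0 RQ by simp
 have \<Psi>F: "0 \<le> \<Psi> F" by (rule nonneg[OF Cons.prems(6)])
 have tl: "t \<le> l" and kK: "k \<le> K" using Cons.prems by (auto simp: k_def)
 have s: "2 * (real l + 1)\<^sup>2 * R * \<delta> \<le> 1"
 proof -
  have "(R * Q) ^ k \<le> (R * Q) ^ K" using RQ kK by (intro power_increasing) auto
  then have "\<delta> \<le> y * (R * Q) ^ K * h * (R * ?N)"
   unfolding \<delta>_def using y h0 R1 by (intro mult_right_mono mult_left_mono) auto
  then have "2 * (real l + 1)\<^sup>2 * R * \<delta> \<le> 2 * (real l + 1)\<^sup>2 * R * (y * (R * Q) ^ K * h * (R * ?N))"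
   using R1 by (intro mult_left_mono) auto
  then show ?thesis using small by linarith
 qed
 \<comment> \<open>Each bad step of the first walk may add an edge to \<open>X\<close>, hence a
   factor \<open>(R * Q) ^ k\<close> to the bound for the \<open>k\<close> walks that follow. It is
   absorbed into the bonus, so the count for one walk is used with
   \<open>y * (R * Q) ^ k\<close>.\<close>
 have inner: "(\<Sum>ws\<in>tuples M (U \<union> \<Union>(edges w)) ts. \<Psi> (F \<union> tedges ((u, w) # ws)) * y ^ bdt U F ((u, w) # ws))
   \<le> (R * Q) ^ (k * (card X + 1)) * (\<Psi> (F \<union> edges w) * (y * (R * Q) ^ k) ^ bd U F w)"
  if w: "w \<in> trails M u t" for u w
 proof -
  have wM: "edges w \<subseteq> M" and wt: "length w = t" using w by (auto simp: trails_def)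
  from forest_extend[OF Cons.prems(3,4,5,7) wM] obtain G' X' where
   st: "forest G'" "finite X'" "F \<union> edges w = G' \<union> X'" "card X' \<le> card X + bd U F w"
   by (elim exE conjE) (rule that)
  have 1: "F \<union> edges w \<subseteq> M" using Cons.prems(6) wM by simp
  have 2: "\<Union>(F \<union> edges w) \<subseteq> U \<union> \<Union>(edges w)" unfolding Union_Un_distrib by (rule Un_mono[OF Cons.prems(7) order_refl])
  have 3: "U \<union> \<Union>(edges w) \<subseteq> {0..<n}" using Cons.prems(8) card_Union_edges(2)[OF wM] by (rule Un_least)
  have "card (U \<union> \<Union>(edges w)) \<le> card U + d * t"
   using card_Un_le[of U "\<Union>(edges w)"] card_Union_edges(1)[OF wM] wt by simp
  then have "real (card (U \<union> \<Union>(edges w)) + d * sum_list ts) \<le> real (card U + d * sum_list (t # ts))"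
   by (simp only: of_nat_le_iff) (simp add: algebra_simps)
  then have 5: "real (card (U \<union> \<Union>(edges w)) + d * sum_list ts) \<le> R" using Cons.prems(9) by linarith
  have "card X' + sum_list ts \<le> card X + sum_list (t # ts)"
   using st(4) bd_le_length[of U F w] wt by simp
  then have 6: "real (card X' + sum_list ts) \<le> R" using Cons.prems(10) by linarith
  have 4: "\<forall>t\<in>set ts. t \<le> l" "length ts \<le> K" using Cons.prems by auto
  have \<Psi>w: "0 \<le> \<Psi> (F \<union> edges w)" by (rule nonneg[OF 1])
  have "(\<Sum>ws\<in>tuples M (U \<union> \<Union>(edges w)) ts. \<Psi> (F \<union> tedges ((u, w) # ws)) * y ^ bdt U F ((u, w) # ws))
    = y ^ bd U F w * (\<Sum>ws\<in>tuples M (U \<union> \<Union>(edges w)) ts. \<Psi> ((F \<union> edges w) \<union> tedges ws)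
      * y ^ bdt (U \<union> \<Union>(edges w)) (F \<union> edges w) ws)"
   by (simp add: sum_distrib_left power_add mult_ac Un_assoc)
  also have "... \<le> y ^ bd U F w * ((R * Q) ^ (length ts * (card X' + 1)) * \<Psi> (F \<union> edges w))"
   using Cons.IH[OF 4 st(1,2,3) 1 2 3 5 6] y by (intro mult_left_mono) auto
  also have "... \<le> y ^ bd U F w * ((R * Q) ^ (k * (card X + bd U F w + 1)) * \<Psi> (F \<union> edges w))"
   using RQ y st(4) \<Psi>w unfolding k_def
   by (intro mult_left_mono mult_right_mono power_increasing mult_le_mono) auto
  also have "... = (R * Q) ^ (k * (card X + 1)) * (\<Psi> (F \<union> edges w) * (y * (R * Q) ^ k) ^ bd U F w)"
   by (simp add: power_mult_distrib power_mult[symmetric] power_add[symmetric] algebra_simps)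
  finally show ?thesis .
 qed
 have XR: "real (card X) \<le> R"
 proof -
  have "real (card X) \<le> real (card X + sum_list (t # ts))" by linarith
  then show ?thesis using Cons.prems(10) by linarith
 qed
 have UR: "real (card U + d * t) \<le> R"
 proof -
  have "card U + d * t \<le> card U + d * sum_list (t # ts)" by simp
  then have "real (card U + d * t) \<le> real (card U + d * sum_list (t # ts))" by (simp only: of_nat_le_iff)
  then show ?thesis using Cons.prems(9) by (rule order_trans)
 qed
 have MF: "G \<union> X \<union> (M - F) = M" using Cons.prems(5,6) by blast
 have GX: "G \<union> X \<subseteq> F" using Cons.prems(5) by blast
 have one: "(\<Sum>w\<in>trails M u t. \<Psi> (F \<union> edges w) * (y * (R * Q) ^ k) ^ bd U F w) \<le> Q ^ (card X + 1) * \<Psi> F"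
  if u: "u \<in> U" for u
 proof -
  have y': "0 \<le> y * (R * Q) ^ k" using y RQ by simp
  have \<delta>': "y * (R * Q) ^ k * h * (R * ?N) \<le> \<delta>" by (simp add: \<delta>_def)
  show ?thesis
   using sum_over_trails[OF Cons.prems(3) y' \<delta>0 \<delta>' s Q R1 tl Cons.prems(4) XR GX Cons.prems(6,7,8) UR u]
   unfolding MF by blast
 qed
 have "(\<Sum>ws\<in>tuples M U (t # ts). \<Psi> (F \<union> tedges ws) * y ^ bdt U F ws)
  \<le> (\<Sum>u\<in>U. \<Sum>w\<in>trails M u t. (R * Q) ^ (k * (card X + 1)) * (\<Psi> (F \<union> edges w) * (y * (R * Q) ^ k) ^ bd U F w))"
  unfolding sum_tuples_Cons[OF fU] by (intro sum_mono inner)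
 also have "... = (R * Q) ^ (k * (card X + 1)) * (\<Sum>u\<in>U. \<Sum>w\<in>trails M u t. \<Psi> (F \<union> edges w) * (y * (R * Q) ^ k) ^ bd U F w)"
  by (simp add: sum_distrib_left)
 also have "... \<le> (R * Q) ^ (k * (card X + 1)) * (\<Sum>u\<in>U. Q ^ (card X + 1) * \<Psi> F)"
  using RQ by (intro mult_left_mono sum_mono one) auto
 also have "... = (R * Q) ^ (k * (card X + 1)) * (real (card U) * (Q ^ (card X + 1) * \<Psi> F))" by simp
 also have "... \<le> (R * Q) ^ (k * (card X + 1)) * (R ^ (card X + 1) * (Q ^ (card X + 1) * \<Psi> F))"
 proof (intro mult_left_mono mult_right_mono)
  have "real (card U) \<le> R" using UR by (rule order_trans[rotated]) simp
  also have "R \<le> R ^ (card X + 1)" using R1 by (simp add: self_le_power)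
  finally show "real (card U) \<le> R ^ (card X + 1)" .
 qed (use RQ Q1 \<Psi>F in auto)
 also have "... = (R * Q) ^ (length (t # ts) * (card X + 1)) * \<Psi> F"
  by (simp add: k_def power_mult_distrib power_add algebra_simps)
 finally show ?case .
qed

corollary sum_over_all_tuples:
 fixes y R Q :: real and K :: nat
 assumes "0 \<le> y" "1 + d * sum_list ts \<le> R"
  and "2 * (real l + 1) * R * (2 + R * d) \<le> Q"
  and "2 * (real l + 1)\<^sup>2 * R * (y * (R * Q) ^ K * h * (R * real ((d - 1) * ((n - 2) choose (d - 2))))) \<le> 1"
  and "\<forall>t\<in>set ts. t \<le> l" "length ts \<le> K"
 shows "(\<Sum>x<n. \<Sum>ws\<in>tuples M {x} ts. \<Psi> (tedges ws) * y ^ bdt {x} {} ws) \<le> n * ((R * Q) ^ length ts * \<Psi> {})"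
proof -
 have "(\<Sum>ws\<in>tuples M {x} ts. \<Psi> ({} \<union> tedges ws) * y ^ bdt {x} {} ws)
   \<le> (R * Q) ^ (length ts * (card ({} :: nat set set) + 1)) * \<Psi> {}" if "x < n" for x
 proof (rule sum_over_tuples[OF assms(1) _ assms(3-6) forest_empty])
  have "1 * sum_list ts \<le> d * sum_list ts" using d2 by (intro mult_le_mono) auto
  then have "real (sum_list ts) \<le> real (1 + d * sum_list ts)" by (simp only: of_nat_le_iff)
  then show "real (card ({} :: nat set set) + sum_list ts) \<le> R" using assms(2) by simp
  have "1 \<le> real (1 + d * sum_list ts)" by simp
  then show "1 \<le> R" using assms(2) by linarith
 qed (use assms that in auto)
 then have "(\<Sum>x<n. \<Sum>ws\<in>tuples M {x} ts. \<Psi> (tedges ws) * y ^ bdt {x} {} ws) \<le> (\<Sum>x<n. (R * Q) ^ length ts * \<Psi> {})"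
  by (intro sum_mono) auto
 then show ?thesis by simp
qed

end

section \<open>Random spins\<close>

definition spins :: "nat => (nat => int) set" where
 "spins n = PiE_dflt {0..<n} 0 (%_. {-1, 1})"

definition spin_avg :: "nat => ((nat => int) => real) => real" where
 "spin_avg n f = (\<Sum>\<sigma>\<in>spins n. f \<sigma>) / 2 ^ n"

definition depends_on :: "nat set => ((nat => int) => real) => bool" where
 "depends_on V f \<longleftrightarrow> (\<forall>\<sigma> \<tau>. (\<forall>i\<in>V. \<sigma> i = \<tau> i) --> f \<sigma> = f \<tau>)"

definition agree :: "(nat => int) => nat set => bool" where
 "agree \<sigma> e \<longleftrightarrow> (\<forall>i\<in>e. \<forall>j\<in>e. \<sigma> i = \<sigma> j)"

lemma agree_singleton [simp]: "agree \<sigma> {u}"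
 by (simp add: agree_def)

lemma agree_pair: "agree \<sigma> {u, v} \<longleftrightarrow> \<sigma> u = \<sigma> v"
 unfolding agree_def by (metis insert_iff empty_iff)

definition edge_prob :: "real => real => (nat => int) => nat set => real" where
 "edge_prob p q \<sigma> e = (if agree \<sigma> e then p else q)"

lemma finite_spins [simp]: "finite (spins n)"
 by (auto simp: spins_def intro!: finite_PiE_dflt)

lemma card_spins [simp]: "card (spins n) = 2 ^ n"
 by (simp add: spins_def card_PiE_dflt numeral_2_eq_2[symmetric])

lemma spins_ne [simp]: "spins n ~= {}"
 using card_spins[of n] by (metis card.empty power_not_zero zero_neq_numeral)

lemma spins_iff: "\<sigma> \<in> spins n \<longleftrightarrow> (\<forall>i. if i < n then \<sigma> i = -1 \<or> \<sigma> i = 1 else \<sigma> i = 0)"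
 by (auto simp: spins_def PiE_dflt_def)

lemma spins_val: "\<sigma> \<in> spins n ==> i < n ==> \<sigma> i = -1 \<or> \<sigma> i = 1"
 unfolding spins_iff by (drule spec[of _ i]) simp

lemma spins_sq: "\<sigma> \<in> spins n ==> i < n ==> \<sigma> i * \<sigma> i = 1"
 by (auto simp: spins_iff split: if_splits dest!: spec[of _ i])

lemma spins_abs: "\<sigma> \<in> spins n ==> \<bar>\<sigma> i\<bar> \<le> 1"
 by (auto simp: spins_iff split: if_splits dest!: spec[of _ i])

lemma spin_avg_add: "spin_avg n (%\<sigma>. f \<sigma> + g \<sigma>) = spin_avg n f + spin_avg n g"
 by (simp add: spin_avg_def sum.distrib add_divide_distrib)

lemma spin_avg_diff: "spin_avg n (%\<sigma>. f \<sigma> - g \<sigma>) = spin_avg n f - spin_avg n g"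
 by (simp add: spin_avg_def sum_subtractf diff_divide_distrib)

lemma spin_avg_cmult: "spin_avg n (%\<sigma>. c * f \<sigma>) = c * spin_avg n f"
 by (simp add: spin_avg_def sum_distrib_left[symmetric])

lemma spin_avg_const [simp]: "spin_avg n (%\<sigma>. c) = c"
 by (simp add: spin_avg_def)

lemma spin_avg_sum: "spin_avg n (%\<sigma>. \<Sum>i\<in>I. f i \<sigma>) = (\<Sum>i\<in>I. spin_avg n (f i))"
 unfolding spin_avg_def by (subst sum.swap) (simp add: sum_divide_distrib)

lemma spin_avg_cong: "(!!\<sigma>. \<sigma> \<in> spins n ==> f \<sigma> = g \<sigma>) ==> spin_avg n f = spin_avg n g"
 by (simp add: spin_avg_def)

lemma spin_avg_mono: "(!!\<sigma>. \<sigma> \<in> spins n ==> f \<sigma> \<le> g \<sigma>) ==> spin_avg n f \<le> spin_avg n g"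
 by (simp add: spin_avg_def divide_right_mono sum_mono)

lemma spin_avg_flip: "spin_avg n (%\<sigma>. f (%i. - \<sigma> i)) = spin_avg n f"
proof -
 have "(\<Sum>\<sigma>\<in>spins n. f (%i. - \<sigma> i)) = (\<Sum>\<sigma>\<in>spins n. f \<sigma>)"
  by (rule sum.reindex_bij_witness[of _ "%\<sigma> i. - \<sigma> i" "%\<sigma> i. - \<sigma> i"])
    (auto simp: spins_iff split: if_splits)
 then show ?thesis by (simp add: spin_avg_def)
qed

text \<open>Flipping one coordinate permutes \<open>spins n\<close>, so that coordinate can be
  averaged out first.\<close>

lemma spin_avg_coord:
 assumes "v < n"
 shows "spin_avg n f = spin_avg n (%\<sigma>. (f (\<sigma>(v := 1)) + f (\<sigma>(v := -1))) / 2)"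
proof -
 let ?s = "%\<sigma>. \<sigma>(v := - \<sigma> v)"
 have "(\<Sum>\<sigma>\<in>spins n. f (?s \<sigma>)) = (\<Sum>\<sigma>\<in>spins n. f \<sigma>)"
  by (rule sum.reindex_bij_witness[of _ ?s ?s]) (use assms in \<open>auto simp: spins_iff split: if_splits\<close>)
 moreover have "f \<sigma> + f (?s \<sigma>) = f (\<sigma>(v := 1)) + f (\<sigma>(v := -1))" if "\<sigma> \<in> spins n" for \<sigma>
 proof -
  have "\<sigma> v = -1 \<or> \<sigma> v = 1" by (rule spins_val[OF that assms])
  then show ?thesis
  proof
   assume *: "\<sigma> v = -1"
   then have "\<sigma>(v := -1) = \<sigma>" by (simp add: fun_upd_idem_iff)
   then show ?thesis using * by simp
  next
   assume *: "\<sigma> v = 1"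
   then have "\<sigma>(v := 1) = \<sigma>" by (simp add: fun_upd_idem_iff)
   then show ?thesis using * by simp
  qed
 qed
 then have "(\<Sum>\<sigma>\<in>spins n. f \<sigma> + f (?s \<sigma>)) = (\<Sum>\<sigma>\<in>spins n. f (\<sigma>(v := 1)) + f (\<sigma>(v := -1)))"
  by (intro sum.cong) auto
 ultimately show ?thesis
  by (simp add: spin_avg_def sum.distrib sum_divide_distrib[symmetric] field_simps)
qed

lemma depends_on_mono: "depends_on V f ==> V \<subseteq> W ==> depends_on W f"
 unfolding depends_on_def by blast

lemma depends_on_const: "depends_on V (%\<sigma>. c)"
 by (simp add: depends_on_def)

lemma depends_on_mult: "depends_on V f ==> depends_on V g ==> depends_on V (%\<sigma>. f \<sigma> * g \<sigma>)"
 unfolding depends_on_def by metis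

lemma depends_on_diff: "depends_on V f ==> depends_on V g ==> depends_on V (%\<sigma>. f \<sigma> - g \<sigma>)"
 unfolding depends_on_def by metis

lemma depends_on_spin: "i \<in> V ==> depends_on V (%\<sigma>. real_of_int (\<sigma> i))"
 by (simp add: depends_on_def)

lemma depends_on_edge_prob: "e \<subseteq> V ==> depends_on V (%\<sigma>. edge_prob p q \<sigma> e)"
 unfolding depends_on_def edge_prob_def agree_def by (intro allI impI) (simp add: subset_iff)

lemma depends_on_prod:
 "(!!e. e \<in> F ==> depends_on V (f e)) ==> depends_on V (%\<sigma>. \<Prod>e\<in>F. f e \<sigma>)"
 unfolding depends_on_def by (intro allI impI prod.cong) auto

lemma depends_on_upd: "depends_on V f ==> v \<notin> V ==> f (\<sigma>(v := s)) = f \<sigma>"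
 unfolding depends_on_def by (metis fun_upd_other)

text \<open>The coordinates of \<open>V\<close> are averaged out one by one; \<open>g\<close> is
  constant in each of them.\<close>

lemma spin_avg_indep:
 assumes "depends_on V f" "depends_on W g" "V \<inter> W = {}" "V \<subseteq> {0..<n}"
 shows "spin_avg n (%\<sigma>. f \<sigma> * g \<sigma>) = spin_avg n f * spin_avg n g"
proof -
 have "finite V" using assms finite_subset by blast
 then show ?thesis using assms
 proof (induction V arbitrary: f rule: finite_induct)
  case empty
  obtain c where "f = (%\<sigma>. c)"
   using empty.prems(1) unfolding depends_on_def by (metis empty_iff ext)
  then show ?case by (simp add: spin_avg_cmult)
 next
  case (insert v V)
  define h where "h \<sigma> = (f (\<sigma>(v := 1)) + f (\<sigma>(v := -1))) / 2" for \<sigma>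
  have v: "v < n" "v \<notin> W" using insert.prems by auto
  have "depends_on V h"
   unfolding depends_on_def
  proof (intro allI impI)
   fix \<sigma> \<tau> :: "nat => int" assume "\<forall>i\<in>V. \<sigma> i = \<tau> i"
   then have "f (\<sigma>(v := s)) = f (\<tau>(v := s))" for s
    using insert.prems(1) unfolding depends_on_def by simp
   then show "h \<sigma> = h \<tau>" by (simp add: h_def)
  qed
  then have IH: "spin_avg n (%\<sigma>. h \<sigma> * g \<sigma>) = spin_avg n h * spin_avg n g"
   using insert.IH insert.prems by auto
  have "spin_avg n (%\<sigma>. f \<sigma> * g \<sigma>) = spin_avg n (%\<sigma>. h \<sigma> * g \<sigma>)"
   by (subst spin_avg_coord[OF v(1)])
     (simp add: h_def depends_on_upd[OF insert.prems(2) v(2)] algebra_simps add_divide_distrib)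
  also have "... = spin_avg n f * spin_avg n g"
   unfolding IH by (subst spin_avg_coord[OF v(1), of f]) (simp add: h_def[abs_def])
  finally show ?case .
 qed
qed

text \<open>Each further vertex outside \<open>V\<close> and \<open>W\<close> agrees with a fixed
  reference vertex of \<open>W\<close> with probability one half, whatever the other spins are. The
  reference vertex is why \<open>W\<close> is nonempty.\<close>

lemma spin_avg_agree:
 assumes f: "depends_on V f" and W: "W ~= {}" "W \<subseteq> {0..<n}" and N: "N \<subseteq> {0..<n}" "N \<inter> (V \<union> W) = {}"
 shows "spin_avg n (%\<sigma>. f \<sigma> * of_bool (agree \<sigma> (W \<union> N))) = spin_avg n (%\<sigma>. f \<sigma> * of_bool (agree \<sigma> W)) / 2 ^ card N"
proof -
 have "finite N" using N finite_subset by blast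
 then show ?thesis using N
 proof (induction N rule: finite_induct)
  case empty
  then show ?case by simp
 next
  case (insert v N)
  have v: "v < n" "v \<notin> V" "v \<notin> W \<union> N" using insert.prems insert.hyps by auto
  obtain u where "u \<in> W" using W(1) by blast
  then have u: "u \<in> W" "u < n" using W(2) by auto
  have key: "of_bool (agree (\<sigma>(v := 1)) (W \<union> insert v N)) + of_bool (agree (\<sigma>(v := -1)) (W \<union> insert v N))
    = (of_bool (agree \<sigma> (W \<union> N)) :: real)" if \<sigma>: "\<sigma> \<in> spins n" for \<sigma>
  proof -
   have *: "agree (\<sigma>(v := s)) (W \<union> insert v N) \<longleftrightarrow> agree \<sigma> (W \<union> N) \<and> \<sigma> u = s" for s
   proof
    assume A: "agree (\<sigma>(v := s)) (W \<union> insert v N)"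
    have "\<sigma> i = \<sigma> j" if "i \<in> W \<union> N" "j \<in> W \<union> N" for i j
    proof -
     have "(\<sigma>(v := s)) i = (\<sigma>(v := s)) j" using A that unfolding agree_def by blast
     then show ?thesis using that v(3) by (auto split: if_splits)
    qed
    moreover have "(\<sigma>(v := s)) u = (\<sigma>(v := s)) v" using A u unfolding agree_def by blast
    then have "\<sigma> u = s" using u v(3) by (auto split: if_splits)
    ultimately show "agree \<sigma> (W \<union> N) \<and> \<sigma> u = s" unfolding agree_def by blast
   next
    assume A: "agree \<sigma> (W \<union> N) \<and> \<sigma> u = s"
    have "(\<sigma>(v := s)) i = s" if "i \<in> W \<union> insert v N" for i
    proof (cases "i = v")
     case False
     then have "i \<in> W \<union> N" "u \<in> W \<union> N" using that u by simp_all
     then have "\<sigma> i = \<sigma> u" using A unfolding agree_def by (elim conjE) (drule (1) bspec, drule (1) bspec, assumption)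
     then show ?thesis using A False by simp
    qed simp
    then show "agree (\<sigma>(v := s)) (W \<union> insert v N)" unfolding agree_def by metis
   qed
   have "\<sigma> u = -1 \<or> \<sigma> u = 1" by (rule spins_val[OF \<sigma> u(2)])
   then show ?thesis unfolding * by auto
  qed
  have "spin_avg n (%\<sigma>. f \<sigma> * of_bool (agree \<sigma> (W \<union> insert v N)))
    = spin_avg n (%\<sigma>. f \<sigma> * of_bool (agree \<sigma> (W \<union> N)) / 2)"
   by (subst spin_avg_coord[OF v(1)], rule spin_avg_cong)
     (simp only: depends_on_upd[OF f v(2)] key distrib_left[symmetric])
  also have "... = spin_avg n (%\<sigma>. f \<sigma> * of_bool (agree \<sigma> (W \<union> N))) / 2"
   using spin_avg_cmult[of n "1/2"] by simp
  finally show ?case using insert by simp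
 qed
qed

lemma edge_prob_alt: "edge_prob p q \<sigma> e = q + (p - q) * of_bool (agree \<sigma> e)"
 by (simp add: edge_prob_def)

text \<open>The vertices of \<open>e\<close> other than \<open>u\<close> are fresh for
  \<open>f\<close>, so \<open>e\<close> is monochromatic with probability 2^(1 - card e) whatever
  the spin of \<open>u\<close>.\<close>

lemma spin_avg_attach:
 assumes f: "depends_on V f" and e: "e \<subseteq> {0..<n}" "u \<in> e" "e \<inter> V \<subseteq> {u}"
 shows "spin_avg n (%\<sigma>. f \<sigma> * edge_prob p q \<sigma> e) = (q + (p - q) / 2 ^ (card e - 1)) * spin_avg n f"
proof -
 have "finite e" using e finite_subset by blast
 then have c: "card (e - {u}) = card e - 1" using e by simp
 have "spin_avg n (%\<sigma>. f \<sigma> * of_bool (agree \<sigma> ({u} \<union> (e - {u})))) = 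
   spin_avg n (%\<sigma>. f \<sigma> * of_bool (agree \<sigma> {u})) / 2 ^ card (e - {u})"
  by (rule spin_avg_agree[OF f]) (use e in auto)
 moreover have *: "{u} \<union> (e - {u}) = e" using e by auto
 ultimately have 1: "spin_avg n (%\<sigma>. f \<sigma> * of_bool (agree \<sigma> e)) = spin_avg n f / 2 ^ (card e - 1)"
  unfolding * by (simp add: c)
 have "spin_avg n (%\<sigma>. f \<sigma> * edge_prob p q \<sigma> e)
   = q * spin_avg n f + (p - q) * spin_avg n (%\<sigma>. f \<sigma> * of_bool (agree \<sigma> e))"
  unfolding edge_prob_alt spin_avg_cmult[symmetric] spin_avg_add[symmetric] by (rule spin_avg_cong) (simp add: algebra_simps)
 also have "... = (q + (p - q) / 2 ^ (card e - 1)) * spin_avg n f" unfolding 1 by (simp add: algebra_simps)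
 finally show ?thesis .
qed

lemma spin_avg_odd_coord:
 assumes "depends_on V f" "v \<notin> V" "v < n"
 shows "spin_avg n (%\<sigma>. f \<sigma> * real_of_int (\<sigma> v)) = 0"
 by (subst spin_avg_coord[OF assms(3)]) (simp add: depends_on_upd[OF assms(1,2)])

text \<open>The constant part \<open>q\<close> of the edge probability contributes nothing, because
  \<open>v\<close> is fresh and its sign averages to 0. On monochromatic edges the sign of
  \<open>v\<close> is that of \<open>u\<close>. So a sign is moved back along the edge, with the
  factor that produces beta.\<close>

lemma spin_avg_attach_sign:
 assumes f: "depends_on V f" and e: "e \<subseteq> {0..<n}" "u \<in> e" "e \<inter> V \<subseteq> {u}" "v \<in> e" "v ~= u"
 shows "spin_avg n (%\<sigma>. f \<sigma> * edge_prob p q \<sigma> e * real_of_int (\<sigma> v)) =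
  (p - q) / 2 ^ (card e - 1) * spin_avg n (%\<sigma>. f \<sigma> * real_of_int (\<sigma> u))"
proof -
 have "finite e" using e finite_subset by blast
 then have c: "card (e - {u}) = card e - 1" using e by simp
 let ?g = "%\<sigma>. f \<sigma> * real_of_int (\<sigma> u)"
 have g: "depends_on (insert u V) ?g"
  by (intro depends_on_mult depends_on_spin depends_on_mono[OF f]) auto
 have "spin_avg n (%\<sigma>. ?g \<sigma> * of_bool (agree \<sigma> ({u} \<union> (e - {u})))) = 
   spin_avg n (%\<sigma>. ?g \<sigma> * of_bool (agree \<sigma> {u})) / 2 ^ card (e - {u})"
  by (rule spin_avg_agree[OF g]) (use e in auto)
 moreover have *: "{u} \<union> (e - {u}) = e" using e by auto
 ultimately have 1: "spin_avg n (%\<sigma>. ?g \<sigma> * of_bool (agree \<sigma> e)) = spin_avg n ?g / 2 ^ (card e - 1)"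
  unfolding * by (simp add: c)
 have 2: "spin_avg n (%\<sigma>. f \<sigma> * real_of_int (\<sigma> v)) = 0"
  by (rule spin_avg_odd_coord[OF f]) (use e in auto)
 have ag: "agree \<sigma> e ==> \<sigma> v = \<sigma> u" for \<sigma>
  using e(2,4) unfolding agree_def by blast
 have "spin_avg n (%\<sigma>. f \<sigma> * edge_prob p q \<sigma> e * real_of_int (\<sigma> v))
   = q * spin_avg n (%\<sigma>. f \<sigma> * real_of_int (\<sigma> v)) + (p - q) * spin_avg n (%\<sigma>. ?g \<sigma> * of_bool (agree \<sigma> e))"
  unfolding edge_prob_alt spin_avg_cmult[symmetric] spin_avg_add[symmetric] 
 proof (rule spin_avg_cong)
  fix \<sigma>
  show "f \<sigma> * (q + (p - q) * of_bool (agree \<sigma> e)) * real_of_int (\<sigma> v) =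
   q * (f \<sigma> * real_of_int (\<sigma> v)) + (p - q) * (f \<sigma> * real_of_int (\<sigma> u) * of_bool (agree \<sigma> e))"
  proof (cases "agree \<sigma> e")
   case True
   then show ?thesis by (simp only: ag[OF True]) (simp add: algebra_simps)
  qed (simp add: algebra_simps)
 qed
 then show ?thesis unfolding 1 2 by simp
qed

text \<open>With \<open>u\<close> and \<open>v\<close> shared, the other card e - 2 vertices are
  fresh, and the agreement of \<open>u\<close> and \<open>v\<close> is (1 + s_u s_v) / 2. Hence the
  edge probability has, on average against \<open>f\<close>, the affine function of s_u s_v that is
  subtracted here.\<close>

lemma spin_avg_pair:
 assumes f: "depends_on V f" and e: "e \<subseteq> {0..<n}" "u \<in> e" "v \<in> e" "u ~= v" "e \<inter> V \<subseteq> {u, v}"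
 shows "spin_avg n (%\<sigma>. f \<sigma> * (edge_prob p q \<sigma> e - (q + (p - q) / 2 ^ (card e - 1))
   - (p - q) / 2 ^ (card e - 1) * real_of_int (\<sigma> u * \<sigma> v))) = 0"
proof -
 have fe: "finite e" using e finite_subset by blast
 have "card {u, v} \<le> card e" using fe e by (intro card_mono) auto
 then have c2: "2 \<le> card e" using e by simp
 have uv: "u < n" "v < n" using e(1,2,3) by auto
 have c: "card (e - {u, v}) = card e - 2" using e fe by (subst card_Diff_subset) auto
 have "spin_avg n (%\<sigma>. f \<sigma> * of_bool (agree \<sigma> ({u, v} \<union> (e - {u, v})))) = 
   spin_avg n (%\<sigma>. f \<sigma> * of_bool (agree \<sigma> {u, v})) / 2 ^ card (e - {u, v})"
  by (rule spin_avg_agree[OF f]) (use e in auto)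
 moreover have *: "{u, v} \<union> (e - {u, v}) = e" using e by auto
 moreover have **: "spin_avg n (%\<sigma>. f \<sigma> * of_bool (agree \<sigma> {u, v})) = spin_avg n (%\<sigma>. f \<sigma> * (1 + real_of_int (\<sigma> u * \<sigma> v))) / 2"
 proof -
  have ob: "of_bool (agree \<sigma> {u, v}) = (1 + real_of_int (\<sigma> u * \<sigma> v)) / 2" if "\<sigma> \<in> spins n" for \<sigma>
  proof -
   have "\<sigma> u = -1 \<or> \<sigma> u = 1" "\<sigma> v = -1 \<or> \<sigma> v = 1"
    by (rule spins_val[OF that uv(1)], rule spins_val[OF that uv(2)])
   then show ?thesis by (elim disjE) (simp_all add: agree_pair)
  qed
  have "spin_avg n (%\<sigma>. f \<sigma> * of_bool (agree \<sigma> {u, v})) = spin_avg n (%\<sigma>. (1/2) * (f \<sigma> * (1 + real_of_int (\<sigma> u * \<sigma> v))))"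
   by (rule spin_avg_cong) (simp add: ob)
  then show ?thesis by (simp only: spin_avg_cmult)
 qed
 ultimately have 0: "spin_avg n (%\<sigma>. f \<sigma> * of_bool (agree \<sigma> e)) =
   spin_avg n (%\<sigma>. f \<sigma> * (1 + real_of_int (\<sigma> u * \<sigma> v))) / 2 / 2 ^ (card e - 2)"
  unfolding * c by simp
 have "card e - 1 = Suc (card e - 2)" using c2 by simp
 then have 1: "spin_avg n (%\<sigma>. f \<sigma> * of_bool (agree \<sigma> e)) =
   spin_avg n (%\<sigma>. f \<sigma> * (1 + real_of_int (\<sigma> u * \<sigma> v))) / 2 ^ (card e - 1)"
  unfolding 0 by simp
 have "spin_avg n (%\<sigma>. f \<sigma> * (edge_prob p q \<sigma> e - (q + (p - q) / 2 ^ (card e - 1))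
   - (p - q) / 2 ^ (card e - 1) * real_of_int (\<sigma> u * \<sigma> v)))
  = (p - q) * (spin_avg n (%\<sigma>. f \<sigma> * of_bool (agree \<sigma> e))
    - (1 / 2 ^ (card e - 1)) * spin_avg n (%\<sigma>. f \<sigma> * (1 + real_of_int (\<sigma> u * \<sigma> v))))"
  unfolding edge_prob_alt spin_avg_cmult[symmetric] spin_avg_diff[symmetric]
  by (intro spin_avg_cong) (simp add: algebra_simps add_divide_distrib)
 also have "... = 0" unfolding 1 by simp
 finally show ?thesis .
qed

section \<open>The hypergraph model\<close>

lemma set_Pi_pmf_bool:
 assumes "finite A"
 shows "set_pmf (Pi_pmf A False p) \<subseteq> PiE_dflt A False (%_. UNIV :: bool set)"
proof
 fix y assume "y \<in> set_pmf (Pi_pmf A False p)"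
 then have "\<forall>x. x \<notin> A --> y x = False" using set_Pi_pmf_subset[OF assms, of False p] by auto
 then show "y \<in> PiE_dflt A False (%_. UNIV)" by (simp add: PiE_dflt_def)
qed

lemma expectation_prod_Pi_pmf_bool:
 fixes f :: "'a => bool => real"
 assumes A: "finite A"
 shows "measure_pmf.expectation (Pi_pmf A False p) (%y. \<Prod>x\<in>A. f x (y x)) =
  (\<Prod>x\<in>A. measure_pmf.expectation (p x) (f x))"
proof -
 let ?D = "PiE_dflt A False (%_. UNIV :: bool set)"
 have fD: "finite ?D" using A by (intro finite_PiE_dflt) auto
 have "measure_pmf.expectation (Pi_pmf A False p) (%y. \<Prod>x\<in>A. f x (y x))
   = (\<Sum>y\<in>?D. (\<Prod>x\<in>A. f x (y x)) * pmf (Pi_pmf A False p) y)"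
  by (rule integral_measure_pmf_real[OF fD])
    (use set_Pi_pmf_bool[OF A] in blast)
 also have "... = (\<Sum>y\<in>?D. \<Prod>x\<in>A. f x (y x) * pmf (p x) (y x))"
  by (rule sum.cong) (auto simp: pmf_Pi[OF A] PiE_dflt_def prod.distrib)
 also have "... = (\<Sum>y\<in>PiE A (%_. UNIV). \<Prod>x\<in>A. f x (y x) * pmf (p x) (y x))"
  by (rule sum.reindex_bij_witness[of _ "%y x. if x \<in> A then y x else False" "%y. restrict y A"])
    (auto simp: PiE_dflt_def fun_eq_iff PiE_def extensional_def restrict_def intro!: prod.cong)
 also have "... = (\<Prod>x\<in>A. \<Sum>v\<in>UNIV. f x v * pmf (p x) v)"
  by (rule prod_sum_PiE[symmetric]) (use A in auto)
 also have "... = (\<Prod>x\<in>A. measure_pmf.expectation (p x) (f x))"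
  by (intro prod.cong refl integral_measure_pmf_real[symmetric]) auto
 finally show ?thesis .
qed

lemma prod_list_as_prod:
 fixes g :: "'a => 'b :: comm_monoid_mult"
 assumes "finite F" "set xs \<subseteq> F"
 shows "prod_list (map g xs) = (\<Prod>e\<in>F. g e ^ count_list xs e)"
 using assms(2)
proof (induction xs)
 case (Cons x xs)
 have "(\<Prod>e\<in>F. g e ^ count_list (x # xs) e) = (\<Prod>e\<in>F. (if e = x then g x else 1) * g e ^ count_list xs e)"
  by (rule prod.cong) auto
 also have "... = (\<Prod>e\<in>F. if e = x then g x else 1) * (\<Prod>e\<in>F. g e ^ count_list xs e)"
  by (rule prod.distrib)
 also have "(\<Prod>e\<in>F. if e = x then g x else 1) = g x"
  using Cons.prems assms(1) by (subst prod.delta) auto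
 finally show ?case using Cons by simp
qed simp

text \<open>\<open>p1\<close> makes the Bernoulli parameters genuine probabilities. For fixed d, a
  and b everything here holds once n is large, by \<open>hsbm_params_large\<close>.\<close>

locale hsbm_params =
 fixes n d :: nat and a b :: real
 assumes d3: "3 \<le> d" and ab: "b \<le> a" "0 < b" and nd: "d \<le> n" and p1: "p_n n d a \<le> 1"
  and alpha1: "1 < alpha d a b"
begin

abbreviation "\<alpha> \<equiv> alpha d a b"
abbreviation "\<beta> \<equiv> beta d a b"
abbreviation "p \<equiv> p_n n d a"
abbreviation "q \<equiv> p_n n d b"
abbreviation "pr \<equiv> edge_prob p q"
text \<open>\<open>pb\<close> is the edge probability averaged over the spins, \<open>qb\<close> the
  factor with which a sign travels along an edge. Times the number (d - 1) * (n choose (d - 1)) they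
  give alpha and beta (\<open>pb_alpha\<close>, \<open>qb_beta\<close>).\<close>

definition "pb = q + (p - q) / 2 ^ (d - 1)"
definition "qb = (p - q) / 2 ^ (d - 1)"

lemma choose_pos: "0 < n choose (d - 1)"
 using nd by (simp add: zero_less_binomial_iff)

lemma q_pos: "0 < q" and q_le_p: "q \<le> p" and p_pos: "0 < p"
 using ab choose_pos by (auto simp: p_n_def divide_right_mono)

lemma pr_bounds: "q \<le> pr \<sigma> e" "0 < pr \<sigma> e" "pr \<sigma> e \<le> p" "pr \<sigma> e \<le> 1"
 using q_pos q_le_p p_pos p1 by (auto simp: edge_prob_def)

lemma pb_alpha: "real ((d - 1) * (n choose (d - 1))) * pb = \<alpha>"
proof -
 have c: "real (n choose (d - 1)) ~= 0" using choose_pos by simp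
 have d: "real (d - 1) = real d - 1" using d3 by (simp add: of_nat_diff)
 have e: "pb = (b + (a - b) / 2 ^ (d - 1)) / real (n choose (d - 1))"
  by (simp add: pb_def p_n_def add_divide_distrib diff_divide_distrib mult.commute)
 have "real ((d - 1) * (n choose (d - 1))) * pb = (real d - 1) * (b + (a - b) / 2 ^ (d - 1))"
  unfolding e of_nat_mult d using c by simp
 also have "... = \<alpha>" by (simp add: alpha_def field_simps)
 finally show ?thesis .
qed

lemma qb_beta: "real ((d - 1) * (n choose (d - 1))) * qb = \<beta>"
proof -
 have c: "real (n choose (d - 1)) ~= 0" using choose_pos by simp
 have d: "real (d - 1) = real d - 1" using d3 by (simp add: of_nat_diff)
 have e: "qb = ((a - b) / 2 ^ (d - 1)) / real (n choose (d - 1))"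
  by (simp add: qb_def p_n_def diff_divide_distrib mult.commute)
 show ?thesis
  unfolding e of_nat_mult d using c by (simp add: beta_def)
qed

lemma pb_pos: "0 < pb" and qb_nonneg: "0 \<le> qb" and qb_le_pb: "qb \<le> pb" and p_le_pb: "p \<le> 2 ^ (d - 1) * pb"
proof -
 show "0 < pb" using q_pos q_le_p by (simp add: pb_def add_pos_nonneg)
 show "0 \<le> qb" using q_le_p by (simp add: qb_def)
 show "qb \<le> pb" using q_pos by (simp add: qb_def pb_def)
 have "1 * q \<le> 2 ^ (d - 1) * q" using q_pos by (intro mult_right_mono) auto
 then show "p \<le> 2 ^ (d - 1) * pb" by (simp add: pb_def distrib_left)
qed

definition phi :: "nat set set => real" where
 "phi F = spin_avg n (%\<sigma>. \<Prod>e\<in>F. pr \<sigma> e)"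

text \<open>\<open>phi\<close> is the probability that all edges of \<open>F\<close> are present.
  The second summand is there because variances also involve products of means, which have that
  size; the division removes the growth alpha^(number of edges).\<close>

definition psi :: "nat set set => real" where
 "psi F = (phi F + pb ^ card F) / \<alpha> ^ card F"

lemma phi_nonneg: "0 \<le> phi F"
proof -
 have "spin_avg n (%\<sigma>. 0) \<le> phi F" unfolding phi_def
  by (intro spin_avg_mono prod_nonneg) (use pr_bounds(2) less_imp_le in blast)
 then show ?thesis by simp
qed

lemma dep_prod: "\<Union>F \<subseteq> V ==> depends_on V (%\<sigma>. \<Prod>e\<in>F. pr \<sigma> e)"
 by (intro depends_on_prod depends_on_edge_prob) blast

lemma phi_attach:
 assumes "F \<subseteq> dsubsets n d" "e \<in> dsubsets n d" "e \<notin> F" "card (e \<inter> \<Union>F) \<le> 1"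
 shows "phi (insert e F) = pb * phi F"
proof -
 have fF: "finite F" using assms(1) finite_subset[OF _ finite_dsubsets] by blast
 have fe: "finite e" and ce: "card e = d" and en: "e \<subseteq> {0..<n}" using dsubsets_finite[OF assms(2)] assms(2) by (simp_all add: dsubsets_def)
 obtain u where u: "u \<in> e" "e \<inter> \<Union>F \<subseteq> {u}"
 proof (cases "e \<inter> \<Union>F = {}")
  case True
  have "e ~= {}" using ce d3 by auto
  then show ?thesis using True that by blast
 next
  case False
  then obtain x where x: "x \<in> e" "x \<in> \<Union>F" by blast
  have "e \<inter> \<Union>F \<subseteq> {x}" using card_le_1_eq[OF _ assms(4), of _ x] fe x by blast
  then show ?thesis using x that by blast
 qed
 have "phi (insert e F) = spin_avg n (%\<sigma>. (\<Prod>e\<in>F. pr \<sigma> e) * pr \<sigma> e)"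
  unfolding phi_def using fF assms(3) by (simp add: mult.commute)
 also have "... = (q + (p - q) / 2 ^ (card e - 1)) * spin_avg n (%\<sigma>. \<Prod>e\<in>F. pr \<sigma> e)"
  by (rule spin_avg_attach[OF dep_prod[OF order_refl] en u])
 finally show ?thesis by (simp add: phi_def pb_def ce)
qed

lemma phi_insert:
 assumes "F \<subseteq> dsubsets n d" "e \<notin> F"
 shows "phi (insert e F) \<le> p * phi F"
proof -
 have fF: "finite F" using assms(1) finite_subset[OF _ finite_dsubsets] by blast
 have "phi (insert e F) = spin_avg n (%\<sigma>. pr \<sigma> e * (\<Prod>e\<in>F. pr \<sigma> e))"
  unfolding phi_def using fF assms by simp
 also have "... \<le> spin_avg n (%\<sigma>. p * (\<Prod>e\<in>F. pr \<sigma> e))"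
  by (intro spin_avg_mono mult_right_mono pr_bounds prod_nonneg) (use pr_bounds(2) less_imp_le in blast)
 finally show ?thesis by (simp add: spin_avg_cmult phi_def)
qed

lemma psi_nonneg: "0 \<le> psi F"
 unfolding psi_def using phi_nonneg pb_pos alpha1 by simp

lemma phi_le_psi: "phi F \<le> \<alpha> ^ card F * psi F" and pb_le_psi: "pb ^ card F \<le> \<alpha> ^ card F * psi F"
 unfolding psi_def using phi_nonneg pb_pos alpha1 by (simp_all add: less_imp_le)

lemma psi_empty: "psi {} = 2"
 by (simp add: psi_def phi_def)

text \<open>A tree-like edge multiplies \<open>phi\<close> by exactly \<open>pb\<close>, any edge by
  at most p <= 2^(d - 1) * pb. The normalisation \<open>g1\<close> is then \<open>pb_alpha\<close>
  with n - 1 in place of n.\<close>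

sublocale edge_weight n d psi "pb / \<alpha>" "2 ^ (d - 1) * pb / \<alpha>"
proof
 fix F assume F: "F \<subseteq> dsubsets n d"
 show "0 \<le> psi F" by (rule psi_nonneg)
 have fF: "finite F" using F finite_subset[OF _ finite_dsubsets] by blast
 fix e assume e: "e \<in> dsubsets n d" "e \<notin> F"
 have c: "card (insert e F) = Suc (card F)" using fF e by simp
 have \<alpha>0: "0 < \<alpha>" using alpha1 by simp
 show "psi (insert e F) \<le> 2 ^ (d - 1) * pb / \<alpha> * psi F"
 proof -
  have "phi (insert e F) \<le> p * phi F" by (rule phi_insert[OF F e(2)])
  also have "... \<le> (2 ^ (d - 1) * pb) * phi F" by (intro mult_right_mono p_le_pb phi_nonneg)
  finally have 1: "phi (insert e F) \<le> (2 ^ (d - 1) * pb) * phi F" .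
  have "1 * (pb * pb ^ card F) \<le> 2 ^ (d - 1) * (pb * pb ^ card F)"
   using pb_pos by (intro mult_right_mono) auto
  then have "phi (insert e F) + pb ^ card (insert e F) \<le> (2 ^ (d - 1) * pb) * (phi F + pb ^ card F)"
   using 1 unfolding c by (simp add: algebra_simps)
  then have "(phi (insert e F) + pb ^ card (insert e F)) / \<alpha> ^ card (insert e F)
    \<le> ((2 ^ (d - 1) * pb) * (phi F + pb ^ card F)) / \<alpha> ^ card (insert e F)"
   using \<alpha>0 by (intro divide_right_mono) auto
  then show ?thesis unfolding psi_def c by simp
 qed
 assume "card (e \<inter> \<Union>F) \<le> 1"
 from phi_attach[OF F e this] have "phi (insert e F) + pb ^ card (insert e F) = pb * (phi F + pb ^ card F)"
  unfolding c by (simp add: algebra_simps)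
 then show "psi (insert e F) \<le> pb / \<alpha> * psi F" unfolding psi_def c by simp
next
 show "0 \<le> pb / \<alpha>" "0 \<le> 2 ^ (d - 1) * pb / \<alpha>" "2 \<le> d" using pb_pos alpha1 d3 by auto
 have "real ((d - 1) * ((n - 1) choose (d - 1))) \<le> real ((d - 1) * (n choose (d - 1)))"
  by (intro of_nat_mono mult_le_mono binomial_right_mono) auto
 then have "pb * real ((d - 1) * ((n - 1) choose (d - 1))) \<le> pb * real ((d - 1) * (n choose (d - 1)))"
  using pb_pos by (intro mult_left_mono) auto
 also have "... = \<alpha>" using pb_alpha by (simp add: mult.commute)
 finally show "pb / \<alpha> * real ((d - 1) * ((n - 1) choose (d - 1))) \<le> 1"
  using alpha1 by (simp add: field_simps)
qed

section \<open>Expectations given the spins and over the whole model\<close>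

definition EH :: "(nat => int) => (nat set set => real) => real" where
 "EH \<sigma> g = measure_pmf.expectation (Pi_pmf M False (%e. bernoulli_pmf (pr \<sigma> e))) (%x. g {e \<in> M. x e})"

definition EE :: "((nat => int) => nat set set => real) => real" where
 "EE f = measure_pmf.expectation (hsbm n d a b) (%(\<sigma>, H). f \<sigma> H)"

lemma finite_Pi_M [simp]: "finite (set_pmf (Pi_pmf M False (%e. bernoulli_pmf (g e))))"
proof (rule finite_subset)
 show "finite (PiE_dflt M False (%_. UNIV :: bool set))" by (intro finite_PiE_dflt) auto
qed (rule set_Pi_pmf_bool, simp)

lemma hsbm_alt: "hsbm n d a b = pmf_of_set (spins n) \<bind>
  (%\<sigma>. map_pmf (%x. (\<sigma>, {e \<in> M. x e})) (Pi_pmf M False (%e. bernoulli_pmf (pr \<sigma> e))))"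
 unfolding hsbm_def map_pmf_def spins_def
 by (subst Pi_pmf_of_set) (auto simp: edge_prob_def agree_def)

lemma finite_hsbm [simp]: "finite (set_pmf (hsbm n d a b))"
 unfolding hsbm_alt by (auto simp: set_pmf_of_set)

lemma set_hsbm: "(\<sigma>, H) \<in> set_pmf (hsbm n d a b) ==> \<sigma> \<in> spins n \<and> H \<subseteq> M"
 unfolding hsbm_alt by (auto simp: set_pmf_of_set)

lemma EE_alt: "EE f = spin_avg n (%\<sigma>. EH \<sigma> (f \<sigma>))"
 unfolding EE_def hsbm_alt
 by (subst pmf_expectation_bind_pmf_of_set) (auto simp: EH_def spin_avg_def field_simps sum_divide_distrib)

lemma EE_sum: "EE (%\<sigma> H. \<Sum>i\<in>I. f i \<sigma> H) = (\<Sum>i\<in>I. EE (f i))"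
 unfolding EE_def split_beta by (rule Bochner_Integration.integral_sum) (rule integrable_measure_pmf_finite, simp)

lemma EE_cmult: "EE (%\<sigma> H. c * f \<sigma> H) = c * EE f"
 unfolding EE_def split_beta by simp

lemma EE_mono:
 assumes "!!\<sigma> H. \<sigma> \<in> spins n ==> H \<subseteq> M ==> f \<sigma> H \<le> g \<sigma> H"
 shows "EE f \<le> EE g"
 unfolding EE_def
proof (rule integral_mono_AE)
 show "AE x in measure_pmf (hsbm n d a b). (case x of (\<sigma>, H) => f \<sigma> H) \<le> (case x of (\<sigma>, H) => g \<sigma> H)"
  by (rule AE_pmfI) (use set_hsbm assms in auto)
qed (rule integrable_measure_pmf_finite, simp)+

lemma EE_cong:
 assumes "!!\<sigma> H. \<sigma> \<in> spins n ==> H \<subseteq> M ==> f \<sigma> H = g \<sigma> H"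
 shows "EE f = EE g"
 by (rule antisym) (auto intro!: EE_mono simp: assms)

lemma EH_prod:
 assumes F: "F \<subseteq> M"
 shows "EH \<sigma> (%H. \<Prod>e\<in>F. h e (e \<in> H)) = (\<Prod>e\<in>F. pr \<sigma> e * h e True + (1 - pr \<sigma> e) * h e False)"
proof -
 let ?h = "%e x. if e \<in> F then h e x else 1"
 have fF: "finite F" using F finite_subset[OF _ finite_dsubsets] by blast
 have 1: "(\<Prod>e\<in>F. k e) = (\<Prod>e\<in>M. if e \<in> F then k e else 1)" for k :: "nat set => real"
  by (rule prod.mono_neutral_cong_left) (use F in auto)
 have "EH \<sigma> (%H. \<Prod>e\<in>F. h e (e \<in> H)) =
   measure_pmf.expectation (Pi_pmf M False (%e. bernoulli_pmf (pr \<sigma> e))) (%x. \<Prod>e\<in>M. ?h e (x e))"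
  unfolding EH_def by (subst 1) (auto intro!: Bochner_Integration.integral_cong prod.cong)
 also have "... = (\<Prod>e\<in>M. measure_pmf.expectation (bernoulli_pmf (pr \<sigma> e)) (?h e))"
  by (rule expectation_prod_Pi_pmf_bool) simp
 also have "... = (\<Prod>e\<in>M. if e \<in> F then pr \<sigma> e * h e True + (1 - pr \<sigma> e) * h e False else 1)"
  using pr_bounds less_imp_le[OF pr_bounds(2)] by (intro prod.cong refl) (auto simp: mult.commute)
 finally show ?thesis by (simp only: 1[symmetric])
qed

abbreviation ind :: "nat set set => nat set => real" where "ind H e \<equiv> of_bool (e \<in> H)"

text \<open>An uncentred factor forces the indicator to be 1 and leaves x (1 - x)^m. Without one, m
  = 1 gives 0, and m >= 2 is dominated by the variance x (1 - x).\<close>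

lemma edge_moment:
 fixes x :: real
 assumes x: "0 < x" "x \<le> 1" and mk: "0 < m + k"
 shows "\<bar>x * ((1 - x) ^ m * 1 ^ k) + (1 - x) * ((0 - x) ^ m * 0 ^ k)\<bar> \<le> x"
proof (cases "k = 0")
 case False
 have "x * (1 - x) ^ m \<le> x * 1" using x by (intro mult_left_mono power_le_one) auto
 moreover have z: "(0::real) ^ k = 0" using False by simp
 moreover have "0 \<le> x * (1 - x) ^ m" using x by simp
 ultimately show ?thesis unfolding z by simp
next
 case True
 show ?thesis
 proof (cases "m = 1")
  case False
  then have m: "2 \<le> m" using True mk by simp
  have "\<bar>x * (1 - x) ^ m + (1 - x) * (0 - x) ^ m\<bar> \<le> \<bar>x * (1 - x) ^ m\<bar> + \<bar>(1 - x) * (0 - x) ^ m\<bar>"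
   by (rule abs_triangle_ineq)
  also have "... = x * (1 - x) ^ m + (1 - x) * x ^ m"
   using x by (simp add: abs_mult power_abs)
  also have "... \<le> x * (1 - x) ^ 1 + (1 - x) * x ^ 1"
   using x m by (intro add_mono mult_left_mono power_decreasing) auto
  finally have 1: "\<bar>x * (1 - x) ^ m + (1 - x) * (0 - x) ^ m\<bar> \<le> 2 * x * (1 - x)" by simp
  have 2: "x * (1 - x) ^ m \<le> x * (1 - x) ^ 2" "(1 - x) * x ^ m \<le> (1 - x) * x ^ 2"
   using x m by (auto intro!: mult_left_mono power_decreasing)
  have "x * (1 - x) ^ 2 + (1 - x) * x ^ 2 = x * (1 - x)" by (simp add: power2_eq_square algebra_simps)
  also have "... \<le> x * 1" using x by (intro mult_left_mono) auto
  finally have "x * (1 - x) ^ m + (1 - x) * x ^ m \<le> x" using 2 by linarith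
  then show ?thesis using True \<open>_ = x * (1 - x) ^ m + (1 - x) * x ^ m\<close> \<open>\<bar>x * (1 - x) ^ m + (1 - x) * (0 - x) ^ m\<bar> \<le> \<bar>x * (1 - x) ^ m\<bar> + \<bar>(1 - x) * (0 - x) ^ m\<bar>\<close> by simp
 qed (use True x in \<open>simp add: algebra_simps\<close>)
qed

definition monomial :: "(nat => int) => nat set set => nat set list => nat set list => real" where
 "monomial \<sigma> H xs ys = prod_list (map (%e. ind H e - pr \<sigma> e) xs) * prod_list (map (ind H) ys)"

lemma EH_monomial:
 assumes "set xs \<subseteq> M" "set ys \<subseteq> M"
 shows "EH \<sigma> (%H. monomial \<sigma> H xs ys) = (\<Prod>e\<in>set xs \<union> set ys.
  pr \<sigma> e * ((1 - pr \<sigma> e) ^ count_list xs e * 1 ^ count_list ys e)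
   + (1 - pr \<sigma> e) * ((0 - pr \<sigma> e) ^ count_list xs e * 0 ^ count_list ys e))"
proof -
 let ?F = "set xs \<union> set ys"
 let ?h = "%e (x::bool). (of_bool x - pr \<sigma> e) ^ count_list xs e * of_bool x ^ count_list ys e"
 have F: "?F \<subseteq> M" using assms by blast
 have "monomial \<sigma> H xs ys = (\<Prod>e\<in>?F. ?h e (e \<in> H))" for H
  unfolding monomial_def
  by (subst (1 2) prod_list_as_prod[where F = ?F]) (simp_all add: prod.distrib[symmetric])
 then have "EH \<sigma> (%H. monomial \<sigma> H xs ys) = EH \<sigma> (%H. \<Prod>e\<in>?F. ?h e (e \<in> H))" by simp
 also have "... = (\<Prod>e\<in>?F. pr \<sigma> e * ?h e True + (1 - pr \<sigma> e) * ?h e False)" by (rule EH_prod[OF F])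
 finally show ?thesis by simp
qed

lemma EH_monomial_bound:
 assumes "set xs \<subseteq> M" "set ys \<subseteq> M"
 shows "\<bar>EH \<sigma> (%H. monomial \<sigma> H xs ys)\<bar> \<le> (\<Prod>e\<in>set xs \<union> set ys. pr \<sigma> e)"
 unfolding EH_monomial[OF assms] abs_prod
proof (rule prod_mono, intro conjI)
 fix e assume e: "e \<in> set xs \<union> set ys"
 have "0 < count_list xs e + count_list ys e" using e by (metis Un_iff add_gr_0 count_list_0_iff neq0_conv)
 then show "\<bar>pr \<sigma> e * ((1 - pr \<sigma> e) ^ count_list xs e * 1 ^ count_list ys e)
   + (1 - pr \<sigma> e) * ((0 - pr \<sigma> e) ^ count_list xs e * 0 ^ count_list ys e)\<bar> \<le> pr \<sigma> e"
  by (intro edge_moment pr_bounds)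
qed simp

text \<open>An edge with a single, centred factor is independent of the rest given the spins and has
  mean 0. In centred traces this forces every edge to be repeated.\<close>

lemma EH_monomial_zero:
 assumes "set xs \<subseteq> M" "set ys \<subseteq> M" "count_list xs e = 1" "e \<notin> set ys"
 shows "EH \<sigma> (%H. monomial \<sigma> H xs ys) = 0"
proof -
 have "count_list ys e = 0" using assms(4) by (simp add: count_list_0_iff)
 moreover have "e \<in> set xs" using assms(3) by (metis count_list_0_iff zero_neq_one)
 ultimately show ?thesis
  unfolding EH_monomial[OF assms(1,2)] using assms(3) by (intro prod_zero) (auto intro!: bexI[of _ e] simp: algebra_simps)
qed

lemma EH_edges:
 assumes "set ys \<subseteq> M"
 shows "EH \<sigma> (%H. prod_list (map (ind H) ys)) = (\<Prod>e\<in>set ys. pr \<sigma> e)"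
proof -
 have "EH \<sigma> (%H. monomial \<sigma> H [] ys) = (\<Prod>e\<in>set ys. pr \<sigma> e)"
  using assms by (subst EH_monomial) (auto intro!: prod.cong simp: count_list_0_iff zero_power2)
 then show ?thesis by (simp add: monomial_def)
qed

lemma EH_cmult: "EH \<sigma> (%H. c * f H) = c * EH \<sigma> f"
 by (simp add: EH_def)

lemma EE_prod_edges:
 assumes "set ys \<subseteq> M"
 shows "EE (%\<sigma> H. g \<sigma> * prod_list (map (ind H) ys)) = spin_avg n (%\<sigma>. g \<sigma> * (\<Prod>e\<in>set ys. pr \<sigma> e))"
 unfolding EE_alt EH_cmult EH_edges[OF assms] ..

lemma EE_monomial_bound:
 assumes "set xs \<subseteq> M" "set ys \<subseteq> M" "!!\<sigma>. 0 \<le> g \<sigma>"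
 shows "EE (%\<sigma> H. g \<sigma> * monomial \<sigma> H xs ys) \<le> spin_avg n (%\<sigma>. g \<sigma> * (\<Prod>e\<in>set xs \<union> set ys. pr \<sigma> e))"
 unfolding EE_alt EH_cmult
 by (intro spin_avg_mono mult_left_mono order_trans[OF abs_ge_self EH_monomial_bound] assms)

lemma EE_monomial_zero:
 assumes "set xs \<subseteq> M" "set ys \<subseteq> M" "count_list xs e = 1" "e \<notin> set ys"
 shows "EE (%\<sigma> H. g \<sigma> * monomial \<sigma> H xs ys) = 0"
 unfolding EE_alt EH_cmult EH_monomial_zero[OF assms] by simp

end

section \<open>Self-avoiding walk matrices\<close>

text \<open>Self-avoidance in exploration form: each edge meets the vertices seen so far only in the
  current end point. \<open>sa_walk_equiv\<close> identifies this with the pairwise conditions of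
  \<open>is_sa_walk\<close>.\<close>

fun sa :: "nat set set => nat set => nat => (nat set \<times> nat) list => bool" where
 "sa M U u [] = True"
| "sa M U u ((e, v) # w) = (e \<in> M \<and> e \<inter> U = {u} \<and> v \<in> e \<and> v ~= u \<and> sa M (U \<union> e) v w)"

definition saws :: "nat set set => nat => nat => (nat set \<times> nat) list set" where
 "saws M u t = {w. length w = t \<and> sa M {u} u w}"

lemma sa_append: "sa M U u (p @ q) \<longleftrightarrow> sa M U u p \<and> sa M (U \<union> \<Union>(edges p)) (dest u p) q"
proof (induction M U u p rule: sa.induct)
 case (2 M U u e v w)
 have "U \<union> e \<union> \<Union>(edges w) = U \<union> \<Union>(edges ((e, v) # w))" by auto
 then show ?case using 2 by auto
qed simp

lemma sa_antimono: "sa M U u w ==> U' \<subseteq> U ==> u \<in> U' ==> sa M U' u w"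
proof (induction M U u w arbitrary: U' rule: sa.induct)
 case (2 M U u e v w)
 have "e \<inter> U' = {u}" using 2 by auto
 moreover have s: "sa M (U \<union> e) v w" "v \<in> e" using 2(2) by simp_all
 have "sa M (U' \<union> e) v w" by (rule 2(1)[OF s(1)]) (use s(2) 2(3) in blast)+
 ultimately show ?case using 2(2) \<open>sa M (U' \<union> e) v w\<close> by simp
qed simp

lemma sa_walk: "sa M U u w ==> walk u w \<and> edges w \<subseteq> M"
proof (induction M U u w rule: sa.induct)
 case (2 M U u e v w)
 then have "u \<in> e" by auto
 then show ?case using 2 by auto
qed simp

lemma sa_avoids: "sa M U u w ==> x \<in> U ==> x ~= u ==> x \<notin> \<Union>(edges w)"
proof (induction M U u w rule: sa.induct)
 case (2 M U u e v w)
 have "x \<notin> e" using 2 by auto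
 moreover have "v \<notin> U" using 2(2) by auto
 then have "x ~= v" using 2 by auto
 then have "x \<notin> \<Union>(edges w)" using 2 by auto
 ultimately show ?case by simp
qed simp

lemma sa_distinct: "sa M U u w ==> distinct (map fst w)"
proof (induction M U u w rule: sa.induct)
 case (2 M U u e v w)
 have "u \<in> e" "u ~= v" using 2(2) by auto
 then have "u \<notin> \<Union>(edges w)" using sa_avoids[of M "U \<union> e" v w u] 2(2) by auto
 then have "e \<notin> edges w" using \<open>u \<in> e\<close> by blast
 then show ?case using 2 by simp
qed simp

lemma saws_trails: "saws M u t \<subseteq> trails M u t"
 unfolding saws_def trails_def using sa_walk sa_distinct by blast

lemma sa_dest_new: "sa M U u w ==> w ~= [] ==> dest u w \<notin> U"
proof (induction M U u w rule: sa.induct)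
 case (2 M U u e v w)
 have "v \<notin> U" using 2(2) by auto
 then show ?case using 2 by (cases "w = []") auto
qed simp

fun rv :: "nat => (nat set \<times> nat) list => (nat set \<times> nat) list" where
 "rv u [] = []"
| "rv u ((e, v) # w) = rv v w @ [(e, u)]"

lemma map_fst_rv: "map fst (rv u w) = rev (map fst w)"
 by (induction u w rule: rv.induct) auto

lemma edges_rv [simp]: "edges (rv u w) = edges w"
 using map_fst_rv[of u w] by (metis set_map set_rev)

lemma length_rv [simp]: "length (rv u w) = length w"
 by (induction u w rule: rv.induct) auto

lemma dest_rv [simp]: "dest (dest u w) (rv u w) = u"
 by (induction u w rule: rv.induct) auto

lemma walk_rv: "walk u w ==> walk (dest u w) (rv u w)"
 by (induction u w rule: rv.induct) auto

lemma rv_append: "rv u (p @ q) = rv (dest u p) q @ rv u p"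
 by (induction u p rule: rv.induct) auto

lemma rv_rv [simp]: "rv (dest u w) (rv u w) = w"
 by (induction u w rule: rv.induct) (auto simp: rv_append)

lemma trails_rv: "w \<in> trails M u t ==> rv u w \<in> trails M (dest u w) t"
 by (auto simp: trails_def walk_rv map_fst_rv simp del: set_map)

text \<open>Makes the walk matrices symmetric. By \<open>sa_avoids\<close> the later edges meet
  \<open>e\<close> at most in \<open>v\<close>, so \<open>e\<close> can be appended at the far
  end.\<close>

lemma sa_rv: "sa M {u} u w ==> sa M {dest u w} (dest u w) (rv u w)"
proof (induction u w rule: rv.induct)
 case (2 u e v w)
 have e: "e \<in> M" "u \<in> e" "v \<in> e" "v ~= u" and w: "sa M ({u} \<union> e) v w" using 2(2) by auto
 have "sa M {v} v w" by (rule sa_antimono[OF w]) (use e in auto)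
 then have IH: "sa M {dest v w} (dest v w) (rv v w)" by (rule 2(1))
 have *: "x \<in> e ==> x ~= v ==> x \<notin> \<Union>(edges w)" for x using sa_avoids[OF w] by auto
 have "e \<inter> ({dest v w} \<union> \<Union>(edges w)) = {v}"
 proof (cases "w = []")
  case False
  then have "v \<in> \<Union>(edges w)" "dest v w \<in> \<Union>(edges w)"
   using start_mem[of v w] dest_mem[of v w] sa_walk[OF w] by auto
  then show ?thesis using * e by blast
 qed (use e in auto)
 then show ?case using IH e by (simp add: sa_append)
qed simp

lemma saws_rv: "w \<in> saws M u t ==> rv u w \<in> saws M (dest u w) t"
 by (auto simp: saws_def sa_rv)

text \<open>If the first edge is new and no new edge is bad, the trail never returns to a vertex seen
 before: each edge meets the seen vertices only in the current end point, so the next edge is new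
 as well.\<close>

lemma sa_if_no_bad:
 assumes "walk u w" "distinct (map fst w)" "edges w \<subseteq> M" "\<Union>F \<subseteq> U" "u \<in> U"
  "\<forall>e\<in>F. u \<in> e --> e \<notin> edges w" "\<forall>e\<in>M. finite e" "bd U F w = 0"
 shows "sa M U u w"
 using assms
proof (induction w arbitrary: u U F)
 case (Cons a w)
 obtain e v where a: "a = (e, v)" by (cases a)
 have e: "u \<in> e" "v \<in> e" "v ~= u" "walk v w" "e \<in> M" using Cons.prems a by auto
 have eF: "e \<notin> F" using Cons.prems(6) e a by auto
 then have c: "card (e \<inter> U) \<le> 1" and b: "bd (U \<union> e) (insert e F) w = 0"
  using Cons.prems(8) by (auto simp: a split: if_splits)
 have fe: "finite (e \<inter> U)" using Cons.prems(7) e by blast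
 have eU: "e \<inter> U = {u}" using card_le_1_eq[OF fe c, of _ u] e Cons.prems(5) by blast
 then have vU: "v \<notin> U" using e by blast
 have "sa M (U \<union> e) v w"
 proof (rule Cons.IH)
  show "\<forall>f\<in>insert e F. v \<in> f --> f \<notin> edges w"
  proof (intro ballI impI)
   fix f assume f: "f \<in> insert e F" "v \<in> f"
   then have "f \<notin> F" using vU Cons.prems(4) by blast
   then have "f = e" using f by blast
   then show "f \<notin> edges w" using Cons.prems(2) a by (simp add: image_iff)
  qed
  show "\<Union>(insert e F) \<subseteq> U \<union> e" using Cons.prems(4) by blast
 qed (use Cons.prems e b in auto)
 then show ?case using e eU a by simp
qed simp

section \<open>Weighted walk matrices and their decomposition\<close>

definition cw :: "(nat set => real) => (nat set \<times> nat) list => real" where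
 "cw c w = prod_list (map c (map fst w))"

lemma cw_Nil [simp]: "cw c [] = 1"
 and cw_Cons: "cw c (x # w) = c (fst x) * cw c w"
 and cw_append: "cw c (p @ q) = cw c p * cw c q"
 by (simp_all add: cw_def)

lemma cw_rv [simp]: "cw c (rv u w) = cw c w"
 by (induction u w rule: rv.induct) (auto simp: cw_append cw_Cons)

lemma cw_telescope: "cw A w = cw c w + (\<Sum>m<length w. cw c (take m w) * (A (fst (w ! m)) - c (fst (w ! m))) * cw A (drop (Suc m) w))"
proof (induction w)
 case (Cons x w)
 have "(\<Sum>m<length (x # w). cw c (take m (x # w)) * (A (fst ((x # w) ! m)) - c (fst ((x # w) ! m))) * cw A (drop (Suc m) (x # w)))
  = (A (fst x) - c (fst x)) * cw A w + c (fst x) * (\<Sum>m<length w. cw c (take m w) * (A (fst (w ! m)) - c (fst (w ! m))) * cw A (drop (Suc m) w))"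
  by (simp only: list.size(4) Nat.add_Suc_right add_0_right sum.lessThan_Suc_shift)
    (simp add: cw_Cons sum_distrib_left mult_ac)
 also have "... = (A (fst x) - c (fst x)) * cw A w + c (fst x) * (cw A w - cw c w)"
  using Cons by simp
 finally show ?case by (simp add: cw_Cons algebra_simps)
qed simp

definition sawmat :: "nat set set => (nat set => real) => nat => nat => nat => real" where
 "sawmat M c t i j = (\<Sum>w\<in>{w \<in> saws M i t. dest i w = j}. cw c w)"

text \<open>What a product of a walk matrix, a one-step matrix and a walk matrix counts: both outer
  walks are self-avoiding, but apart from incidence nothing relates them to each other or to the
  middle edge.\<close>

definition trip :: "nat set set => nat => nat => nat => nat => ((nat set \<times> nat) list \<times> (nat set \<times> nat) \<times> (nat set \<times> nat) list) set" where
 "trip M m k i j = {(w1, (e, v), w2) | w1 e v w2. w1 \<in> saws M i m \<and> e \<in> M \<and> dest i w1 \<in> e \<and> v \<in> e \<and> v ~= dest i w1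
   \<and> w2 \<in> saws M v k \<and> dest v w2 = j}"

definition nsa :: "nat set set => nat => nat => nat => nat => ((nat set \<times> nat) list \<times> (nat set \<times> nat) \<times> (nat set \<times> nat) list) set" where
 "nsa M m k i j = {(w1, z, w2) \<in> trip M m k i j. \<not> sa M {i} i (w1 @ z # w2)}"

text \<open>The surplus of that matrix product over the self-avoiding walks, with weights
  \<open>c\<close> before the middle edge and \<open>A\<close> after it.\<close>

definition gam :: "nat set set => (nat set => real) => (nat set => real) => nat => nat => nat => nat => real" where
 "gam M A c m k i j = (\<Sum>(w1, z, w2)\<in>nsa M m k i j. cw c w1 * (A (fst z) - c (fst z)) * cw A w2)"

definition link :: "nat set set => (nat set => real) => nat => nat => real" where
 "link M f u v = (\<Sum>e\<in>{e \<in> M. u \<in> e \<and> v \<in> e \<and> v ~= u}. f e)"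

lemma finite_saws [simp]: "finite (saws (dsubsets n d) u t)"
 by (rule finite_subset[OF saws_trails], rule finite_trails) (simp, rule dsubsets_finite)

lemma sawmat_sym: "sawmat M c t i j = sawmat M c t j i"
 unfolding sawmat_def
 by (rule sum.reindex_bij_witness[of _ "rv j" "rv i"]) (auto simp: saws_rv)

lemma dest_less: "w \<in> saws (dsubsets n d) i t ==> i < n ==> dest i w < n"
proof -
 assume w: "w \<in> saws (dsubsets n d) i t" and i: "i < n"
 then have "walk i w" "edges w \<subseteq> dsubsets n d" using sa_walk[of "dsubsets n d" "{i}" i w] by (simp_all add: saws_def)
 then have "dest i w \<in> {0..<n}" using i card_Union_edges(2)[of w n d] by (intro dest_in) auto
 then show "dest i w < n" by simp
qed

lemma finite_trip [simp]: "finite (trip (dsubsets n d) m k i j)"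
proof (rule finite_subset)
 let ?E = "SIGMA e:dsubsets n d. e"
 show "trip (dsubsets n d) m k i j \<subseteq> saws (dsubsets n d) i m \<times> (SIGMA z:?E. saws (dsubsets n d) (snd z) k)
   \<union> (%(w1, z, w2). (w1, z, w2)) ` (SIGMA w1:saws (dsubsets n d) i m. SIGMA z:?E. saws (dsubsets n d) (snd z) k)"
  by (auto simp: trip_def)
qed (auto intro!: finite_SigmaI dsubsets_finite)

lemma sum_trip:
 assumes i: "i < n"
 shows "(\<Sum>(w1, z, w2)\<in>trip (dsubsets n d) m k i j. cw c w1 * f (fst z) * cw A w2) =
  (\<Sum>u<n. \<Sum>v<n. sawmat (dsubsets n d) c m i u * link (dsubsets n d) f u v * sawmat (dsubsets n d) A k v j)"
proof -
 let ?M = "dsubsets n d"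
 let ?W1 = "%u. {w \<in> saws ?M i m. dest i w = u}" and ?L = "%u v. {e \<in> ?M. u \<in> e \<and> v \<in> e \<and> v ~= u}"
  and ?W2 = "%v. {w \<in> saws ?M v k. dest v w = j}"
 let ?S = "SIGMA u:{..<n}. SIGMA v:{..<n}. ?W1 u \<times> ?L u v \<times> ?W2 v"
 have prod3: "(\<Sum>x\<in>A. g x) * (\<Sum>y\<in>B. h y) * (\<Sum>z\<in>C. k z)
   = (\<Sum>x\<in>A \<times> B \<times> C. g (fst x) * h (fst (snd x)) * k (snd (snd x)))"
  for A :: "'x set" and B :: "'y set" and C :: "'z set" and g h and k :: "'z => real"
  by (simp only: sum.cartesian_product' fst_conv snd_conv sum_distrib_left[symmetric] sum_distrib_right[symmetric])
 have "(\<Sum>u<n. \<Sum>v<n. sawmat ?M c m i u * link ?M f u v * sawmat ?M A k v j)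
   = (\<Sum>u<n. \<Sum>v<n. \<Sum>x\<in>?W1 u \<times> ?L u v \<times> ?W2 v. cw c (fst x) * f (fst (snd x)) * cw A (snd (snd x)))"
  unfolding sawmat_def link_def prod3 ..
 also have "... = (\<Sum>y\<in>?S. cw c (fst (snd (snd y))) * f (fst (snd (snd (snd y)))) * cw A (snd (snd (snd (snd y)))))"
  by (simp add: sum.Sigma split_beta)
 also have "... = (\<Sum>(w1, z, w2)\<in>trip ?M m k i j. cw c w1 * f (fst z) * cw A w2)"
 proof (rule sum.reindex_bij_witness[of _ "%(w1, z, w2). (dest i w1, snd z, w1, fst z, w2)"
    "%(u, v, w1, e, w2). (w1, (e, v), w2)"])
  fix y assume "y \<in> trip ?M m k i j"
  then obtain w1 e v w2 where y: "y = (w1, (e, v), w2)" "w1 \<in> saws ?M i m" "e \<in> ?M" "dest i w1 \<in> e" "v \<in> e"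
   "v ~= dest i w1" "w2 \<in> saws ?M v k" "dest v w2 = j" by (auto simp: trip_def)
  moreover have "v < n" using y(3,5) by (auto simp: dsubsets_def)
  ultimately show "(case y of (w1, z, w2) => (dest i w1, snd z, w1, fst z, w2)) \<in> ?S"
   using dest_less[OF y(2) i] by simp
 qed (auto simp: trip_def)
 finally show ?thesis by simp
qed

text \<open>\<open>cw_telescope\<close> is summed over all walks. Cutting a self-avoiding walk at
  its edge number m gives exactly the triples outside \<open>nsa\<close>, so completing the sum to
  the matrix product overcounts by \<open>gam\<close>.\<close>

theorem sawmat_decomp:
 fixes d :: nat
 assumes i: "i < n"
 defines "M \<equiv> dsubsets n d"
 shows "sawmat M A t i j = sawmat M c t i j
  + (\<Sum>m<t. \<Sum>u<n. \<Sum>v<n. sawmat M c m i u * link M (%e. A e - c e) u v * sawmat M A (t - 1 - m) v j)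
  - (\<Sum>m<t. gam M A c m (t - 1 - m) i j)"
proof -
 let ?f = "%(w1, z, w2). cw c w1 * (A (fst z) - c (fst z)) * cw A w2"
 let ?W = "{w \<in> saws M i t. dest i w = j}"
 have "sawmat M A t i j = (\<Sum>w\<in>?W. cw c w + (\<Sum>m<t. ?f (take m w, w ! m, drop (Suc m) w)))"
  unfolding sawmat_def by (rule sum.cong[OF refl], subst cw_telescope[of A _ c]) (simp add: saws_def)
 also have "... = sawmat M c t i j + (\<Sum>m<t. \<Sum>w\<in>?W. ?f (take m w, w ! m, drop (Suc m) w))"
  by (simp add: sum.distrib sawmat_def sum.swap[of _ _ ?W])
 also have "(\<Sum>m<t. \<Sum>w\<in>?W. ?f (take m w, w ! m, drop (Suc m) w)) = (\<Sum>m<t.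
   (\<Sum>u<n. \<Sum>v<n. sawmat M c m i u * link M (%e. A e - c e) u v * sawmat M A (t - 1 - m) v j)
   - gam M A c m (t - 1 - m) i j)"
 proof (rule sum.cong[OF refl])
  fix m assume m: "m \<in> {..<t}"
  define k where "k = t - 1 - m"
  have t: "t = m + Suc k" using m by (auto simp: k_def)
  have sub: "nsa M m k i j \<subseteq> trip M m k i j" by (auto simp: nsa_def)
  have "(\<Sum>w\<in>?W. ?f (take m w, w ! m, drop (Suc m) w)) = (\<Sum>x\<in>trip M m k i j - nsa M m k i j. ?f x)"
  proof (rule sum.reindex_bij_witness[of _ "%(w1, z, w2). w1 @ z # w2" "%w. (take m w, w ! m, drop (Suc m) w)"])
   fix w assume "w \<in> ?W"
   then have w: "length w = t" "sa M {i} i w" "dest i w = j" by (auto simp: saws_def)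
   have eq: "w = take m w @ w ! m # drop (Suc m) w" using w(1) t by (simp add: id_take_nth_drop)
   show "(case (take m w, w ! m, drop (Suc m) w) of (w1, z, w2) => w1 @ z # w2) = w" using eq by simp
   obtain e v where ev: "w ! m = (e, v)" by (cases "w ! m")
   define w1 w2 where "w1 = take m w" and "w2 = drop (Suc m) w"
   have W: "w = w1 @ (e, v) # w2" using eq ev by (simp add: w1_def w2_def)
   have l: "length w1 = m" "length w2 = k" using w(1) t by (auto simp: w1_def w2_def)
   have s: "sa M {i} i w1" "e \<in> M" "dest i w1 \<in> e" "v \<in> e" "v ~= dest i w1"
     "sa M ({i} \<union> \<Union>(edges w1) \<union> e) v w2"
    using w(2) unfolding W sa_append by auto
   have "sa M {v} v w2" by (rule sa_antimono[OF s(6)]) (use s in auto)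
   then have "(w1, (e, v), w2) \<in> trip M m k i j"
    using s l w(3) by (auto simp: trip_def saws_def W)
   moreover have "(w1, (e, v), w2) \<notin> nsa M m k i j" using w(2) by (simp add: nsa_def W)
   ultimately show "(take m w, w ! m, drop (Suc m) w) \<in> trip M m k i j - nsa M m k i j"
    by (simp add: w1_def w2_def ev)
  next
   fix x assume x: "x \<in> trip M m k i j - nsa M m k i j"
   then obtain w1 e v w2 where X: "x = (w1, (e, v), w2)" "w1 \<in> saws M i m" "w2 \<in> saws M v k" "dest v w2 = j"
    by (auto simp: trip_def)
   have l: "length w1 = m" "length w2 = k" using X by (auto simp: saws_def)
   have "sa M {i} i (w1 @ (e, v) # w2)" using x X(1) by (auto simp: nsa_def)
   then show "(case x of (w1, z, w2) => w1 @ z # w2) \<in> ?W" using X l t by (simp add: saws_def)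
   show "(take m (case x of (w1, z, w2) => w1 @ z # w2), (case x of (w1, z, w2) => w1 @ z # w2) ! m,
     drop (Suc m) (case x of (w1, z, w2) => w1 @ z # w2)) = x" using X l by (simp add: nth_append)
  qed simp
  also have "... = (\<Sum>x\<in>trip M m k i j. ?f x) - (\<Sum>x\<in>nsa M m k i j. ?f x)"
   by (rule sum_diff) (use sub in \<open>auto simp: M_def\<close>)
  also have "(\<Sum>x\<in>trip M m k i j. ?f x) =
    (\<Sum>u<n. \<Sum>v<n. sawmat M c m i u * link M (%e. A e - c e) u v * sawmat M A k v j)"
   unfolding M_def by (rule sum_trip[OF i])
  finally show "(\<Sum>w\<in>?W. ?f (take m w, w ! m, drop (Suc m) w)) =
   (\<Sum>u<n. \<Sum>v<n. sawmat M c m i u * link M (%e. A e - c e) u v * sawmat M A (t - 1 - m) v j)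
   - gam M A c m (t - 1 - m) i j"
   by (simp add: k_def gam_def)
 qed
 finally show ?thesis by (simp add: sum_subtractf)
qed

section \<open>Trace moments\<close>

fun tel :: "(nat \<times> (nat set \<times> nat) list) list => nat set list" where
 "tel [] = []"
| "tel ((u, w) # ws) = map fst w @ tel ws"

lemma set_tel [simp]: "set (tel ws) = tedges ws"
 by (induction ws rule: tel.induct) auto

lemma length_tel: "ws \<in> tuples M U ts ==> length (tel ws) = sum_list ts"
proof (induction ts arbitrary: U ws)
 case (Cons t ts)
 then obtain u w ws' where "ws = (u, w) # ws'" "w \<in> trails M u t" "ws' \<in> tuples M (U \<union> \<Union>(edges w)) ts"
  by (auto simp: tuples_Cons)
 then show ?case using Cons.IH by (simp add: trails_def)
qed simp

lemma tedges_subset: "ws \<in> tuples M U ts ==> tedges ws \<subseteq> M"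
proof (induction ts arbitrary: U ws)
 case (Cons t ts)
 then obtain u w ws' where "ws = (u, w) # ws'" "w \<in> trails M u t" "ws' \<in> tuples M (U \<union> \<Union>(edges w)) ts"
  by (auto simp: tuples_Cons)
 then show ?case using Cons.IH by (simp add: trails_def)
qed simp

lemma card_tedges: "ws \<in> tuples M U ts ==> card (tedges ws) \<le> sum_list ts"
 using card_length[of "tel ws"] length_tel[of ws M U ts] by simp

lemma start_tuples: "ws \<in> tuples M {x} (t # ts) ==> fst (hd ws) = x"
 by (auto simp: tuples_Cons)

text \<open>The terms of a matrix power: each walk is self-avoiding and starts where the previous
  one ends, with no condition between different walks.\<close>

fun chain :: "nat set set => nat => nat => (nat \<times> (nat set \<times> nat) list) list => bool" where
 "chain M t i [] = True"
| "chain M t i ((u, w) # ws) = (u = i \<and> w \<in> saws M i t \<and> chain M t (dest i w) ws)"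

fun chain_end :: "nat => (nat \<times> (nat set \<times> nat) list) list => nat" where
 "chain_end i [] = i"
| "chain_end i ((u, w) # ws) = chain_end (dest i w) ws"

definition sa_chains :: "nat set set => nat => nat => nat => (nat \<times> (nat set \<times> nat) list) list set" where
 "sa_chains M t r i = {ws. length ws = r \<and> chain M t i ws}"

fun mpow :: "nat => (nat => nat => real) => nat => nat => nat => real" where
 "mpow n X 0 i j = of_bool (i = j)"
| "mpow n X (Suc r) i j = (\<Sum>u<n. X i u * mpow n X r u j)"

lemma chains_tuples: "i \<in> U ==> sa_chains M t r i \<subseteq> tuples M U (replicate r t)"
proof (induction r arbitrary: i U)
 case (Suc r)
 show ?case
 proof
  fix ws assume "ws \<in> sa_chains M t (Suc r) i"
  then obtain w ws' where ws: "ws = (i, w) # ws'" "w \<in> saws M i t" "ws' \<in> sa_chains M t r (dest i w)"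
   by (cases ws) (auto simp: sa_chains_def)
  have "w \<in> trails M i t" using ws(2) saws_trails by blast
  have "dest i w \<in> U \<union> \<Union>(edges w)"
  proof (rule dest_in)
   show "walk i w" using ws(2) sa_walk[of M "{i}" i w] by (simp add: saws_def)
  qed (use Suc.prems in auto)
  from subsetD[OF Suc.IH[OF this] ws(3)] have "ws' \<in> tuples M (U \<union> \<Union>(edges w)) (replicate r t)" .
  then show "ws \<in> tuples M U (replicate (Suc r) t)"
   unfolding replicate_Suc tuples_Cons using ws(1) Suc.prems \<open>w \<in> trails M i t\<close> by blast
 qed
qed (auto simp: sa_chains_def)

lemma mpow_chains:
 assumes fin: "!!r i. finite (sa_chains (dsubsets n d) t r i)" and "i < n"
 shows "mpow n (sawmat (dsubsets n d) c t) r i j =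
  (\<Sum>ws\<in>{ws \<in> sa_chains (dsubsets n d) t r i. chain_end i ws = j}. prod_list (map c (tel ws)))"
 using assms(2)
proof (induction r arbitrary: i)
 case 0
 have "{ws \<in> sa_chains (dsubsets n d) t 0 i. chain_end i ws = j} = (if i = j then {[]} else {})"
  by (auto simp: sa_chains_def)
 then show ?case by auto
next
 case (Suc r)
 let ?M = "dsubsets n d"
 let ?W = "%u. {w \<in> saws ?M i t. dest i w = u}" and ?C = "%u. {ws \<in> sa_chains ?M t r u. chain_end u ws = j}"
 let ?S = "SIGMA u:{..<n}. ?W u \<times> ?C u"
 have "mpow n (sawmat ?M c t) (Suc r) i j = (\<Sum>u<n. sawmat ?M c t i u * (\<Sum>ws\<in>?C u. prod_list (map c (tel ws))))"
  unfolding mpow.simps by (intro sum.cong refl arg_cong2[where f = "(*)"] Suc.IH) simp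
 also have "... = (\<Sum>u<n. \<Sum>z\<in>?W u \<times> ?C u. cw c (fst z) * prod_list (map c (tel (snd z))))"
  unfolding sawmat_def by (simp only: sum_product sum.cartesian_product' fst_conv snd_conv)
 also have "... = (\<Sum>y\<in>?S. cw c (fst (snd y)) * prod_list (map c (tel (snd (snd y)))))"
  using fin by (simp add: sum.Sigma split_beta)
 also have "... = (\<Sum>ws\<in>{ws \<in> sa_chains ?M t (Suc r) i. chain_end i ws = j}. prod_list (map c (tel ws)))"
 proof (rule sum.reindex_bij_witness[of _ "%ws. (dest i (snd (hd ws)), snd (hd ws), tl ws)" "%(u, w, ws). (i, w) # ws"])
  fix ws assume ws: "ws \<in> {ws \<in> sa_chains ?M t (Suc r) i. chain_end i ws = j}"
  then obtain w ws' where w: "ws = (i, w) # ws'" "w \<in> saws ?M i t" "ws' \<in> sa_chains ?M t r (dest i w)" "chain_end (dest i w) ws' = j"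
   by (cases ws) (auto simp: sa_chains_def)
  then show "(case (dest i (snd (hd ws)), snd (hd ws), tl ws) of (u, w, ws) => (i, w) # ws) = ws"
   and "(dest i (snd (hd ws)), snd (hd ws), tl ws) \<in> ?S"
   using dest_less[OF w(2) Suc.prems] by auto
 qed (auto simp: sa_chains_def cw_def)
 finally show ?case .
qed

context hsbm_params
begin

lemma finite_chains: "finite (sa_chains M t r i)"
 by (rule finite_subset[OF chains_tuples[OF insertI1[of i "{}"]] finite_tuples]) simp

lemma mpow_chains': "i < n ==> mpow n (sawmat M c t) r i j =
  (\<Sum>ws\<in>{ws \<in> sa_chains M t r i. chain_end i ws = j}. prod_list (map c (tel ws)))"
 by (rule mpow_chains[OF finite_chains])

text \<open>The interface between counting and moments: \<open>r\<close> bounds the number of walks,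
  \<open>l\<close> their lengths, \<open>y\<close> is the bonus for a bad step, and the factor n is
  the choice of the first vertex.\<close>

definition tuple_bound :: "nat => nat => real => real => bool" where
 "tuple_bound r l y C \<longleftrightarrow> 1 \<le> y \<and> 0 \<le> C \<and> (\<forall>ts. length ts \<le> r --> (\<forall>t\<in>set ts. t \<le> l) -->
   (\<Sum>x<n. \<Sum>ws\<in>tuples M {x} ts. psi (tedges ws) * y ^ bdt {x} {} ws) \<le> real n * C)"

text \<open>Every index is the decoding of some tuple, so the sum over indices is at most the sum
  over tuples. \<open>KS\<close> lists the shapes when one list of lengths does not suffice; only
  its cardinality is lost.\<close>

lemma tuple_transfer:
 fixes f :: "'z => real" and K :: real
 assumes tb: "tuple_bound r l y C"
  and ts: "!!k. k \<in> KS ==> length (ts k) \<le> r" "!!k t. k \<in> KS ==> t \<in> set (ts k) ==> t \<le> l"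
  and fin: "finite I" "finite KS" and K: "0 \<le> K"
  and ex: "!!z. z \<in> I ==> \<exists>k\<in>KS. \<exists>x<n. \<exists>ws\<in>tuples M {x} (ts k). decode k ws = z \<and>
   f z \<le> K * (psi (tedges ws) * y ^ bdt {x} {} ws)"
 shows "sum f I \<le> card KS * (K * (real n * C))"
proof -
 let ?S = "SIGMA k:KS. SIGMA x:{..<n}. tuples M {x} (ts k)"
 let ?g = "%(k, x, ws). K * (psi (tedges ws) * y ^ bdt {x} {} ws)"
 have y: "1 \<le> y" using tb by (simp add: tuple_bound_def)
 have "sum f I \<le> sum ?g ?S"
 proof (rule sum_le_included[where i = "%(k, x, ws). decode k ws"])
  show "finite ?S" using fin by (intro finite_SigmaI) auto
  show "\<forall>z\<in>?S. 0 \<le> ?g z" using K y psi_nonneg by auto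
  show "\<forall>z\<in>I. \<exists>s\<in>?S. (case s of (k, x, ws) => decode k ws) = z \<and> f z \<le> ?g s"
  proof
   fix z assume "z \<in> I"
   from ex[OF this] obtain k x ws where "k \<in> KS" "x < n" "ws \<in> tuples M {x} (ts k)" "decode k ws = z"
    "f z \<le> K * (psi (tedges ws) * y ^ bdt {x} {} ws)" by blast
   then show "\<exists>s\<in>?S. (case s of (k, x, ws) => decode k ws) = z \<and> f z \<le> ?g s"
    by (intro bexI[of _ "(k, x, ws)"]) auto
  qed
 qed (rule fin)
 also have "... = (\<Sum>k\<in>KS. K * (\<Sum>x<n. \<Sum>ws\<in>tuples M {x} (ts k). psi (tedges ws) * y ^ bdt {x} {} ws))"
 proof -
  have "(\<Sum>k\<in>KS. K * (\<Sum>x<n. \<Sum>ws\<in>tuples M {x} (ts k). psi (tedges ws) * y ^ bdt {x} {} ws))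
   = (\<Sum>k\<in>KS. \<Sum>x<n. \<Sum>ws\<in>tuples M {x} (ts k). ?g (k, x, ws))"
   by (simp only: sum_distrib_left prod.case)
  also have "... = (\<Sum>k\<in>KS. \<Sum>z\<in>(SIGMA x:{..<n}. tuples M {x} (ts k)). ?g (k, z))"
   by (intro sum.cong refl) (subst sum.Sigma, auto intro!: sum.cong)
  also have "... = sum ?g ?S"
   by (subst sum.Sigma) (use fin in \<open>auto intro!: sum.cong\<close>)
  finally show ?thesis by simp
 qed
 also have "... \<le> (\<Sum>k\<in>KS. K * (real n * C))"
  using tb ts K unfolding tuple_bound_def by (intro sum_mono mult_left_mono) auto
 finally show ?thesis by simp
qed

lemma phi_le_power:
 assumes "card F \<le> N"
 shows "phi F \<le> \<alpha> ^ N * psi F" "phi F + pb ^ card F \<le> \<alpha> ^ N * psi F"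
proof -
 have "\<alpha> ^ card F * psi F \<le> \<alpha> ^ N * psi F"
  using alpha1 assms by (intro mult_right_mono power_increasing psi_nonneg) auto
 then show "phi F \<le> \<alpha> ^ N * psi F" using phi_le_psi by (rule order_trans[rotated])
 have "phi F + pb ^ card F = \<alpha> ^ card F * psi F" unfolding psi_def using alpha1 by simp
 then show "phi F + pb ^ card F \<le> \<alpha> ^ N * psi F" using \<open>\<alpha> ^ card F * psi F \<le> \<alpha> ^ N * psi F\<close> by simp
qed

lemma psi_pow: "1 \<le> y ==> psi F \<le> psi F * y ^ k"
 using mult_left_mono[OF one_le_power[of y k] psi_nonneg[of F]] by simp

lemma EE_prod_bound:
 assumes "set ys \<subseteq> M"
 shows "EE (%\<sigma> H. prod_list (map (ind H) ys)) = phi (set ys)"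
 using EE_prod_edges[OF assms, of "%_. 1"] by (simp add: phi_def)

text \<open>A term of the centred trace survives only if every edge occurs at least twice, so the 2
  k t steps use at most k t distinct edges. This replaces the growth alpha^(2 k t) of the plain
  trace by its square root. The bonus is simply discarded.\<close>

theorem EE_trace:
 assumes tb: "tuple_bound r l y C" and k: "0 < k" "2 * k \<le> r" and t: "t \<le> l"
 shows "EE (%\<sigma> H. \<Sum>i<n. mpow n (sawmat M (%e. ind H e - pr \<sigma> e) t) (2 * k) i i) \<le> \<alpha> ^ (k * t) * (real n * C)"
  and "EE (%\<sigma> H. \<Sum>i<n. mpow n (sawmat M (ind H) t) (2 * k) i i) \<le> \<alpha> ^ (2 * k * t) * (real n * C)"
proof -
 let ?I = "SIGMA i:{..<n}. {ws \<in> sa_chains M t (2 * k) i. chain_end i ws = i}"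
 let ?ts = "%_::unit. replicate (2 * k) t"
 let ?decode = "%_::unit. %ws. (fst (hd ws), ws)"
 have y: "1 \<le> y" using tb by (simp add: tuple_bound_def)
 have fI: "finite ?I" by (intro finite_SigmaI finite_subset[OF _ finite_chains]) auto
 have *: "EE (%\<sigma> H. \<Sum>i<n. mpow n (sawmat M (c \<sigma> H) t) (2 * k) i i)
   = (\<Sum>z\<in>?I. EE (%\<sigma> H. prod_list (map (c \<sigma> H) (tel (snd z)))))" for c
 proof -
  have "(\<Sum>i<n. mpow n (sawmat M (c \<sigma> H) t) (2 * k) i i) = (\<Sum>z\<in>?I. prod_list (map (c \<sigma> H) (tel (snd z))))" for \<sigma> H
  proof -
   have "(\<Sum>i<n. mpow n (sawmat M (c \<sigma> H) t) (2 * k) i i) = (\<Sum>i<n. \<Sum>ws\<in>{ws \<in> sa_chains M t (2 * k) i. chain_end i ws = i}.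
    prod_list (map (c \<sigma> H) (tel ws)))" by (intro sum.cong refl mpow_chains') auto
   also have "... = (\<Sum>z\<in>?I. prod_list (map (c \<sigma> H) (tel (snd z))))"
    by (subst sum.Sigma) (auto intro!: sum.cong finite_subset[OF _ finite_chains])
   finally show ?thesis .
  qed
  then show ?thesis by (simp only: EE_sum)
 qed
 have tup: "ws \<in> tuples M {i} (replicate (2 * k) t) \<and> fst (hd ws) = i \<and> i < n" if "(i, ws) \<in> ?I" for i ws
 proof -
  have ws: "ws \<in> tuples M {i} (replicate (2 * k) t)" using that chains_tuples[of i "{i}"] by blast
  moreover have "replicate (2 * k) t = t # replicate (2 * k - 1) t" using k by (cases "2 * k") auto
  then have "fst (hd ws) = i" using ws start_tuples[of ws M i t] by simp
  ultimately show ?thesis using that by simp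
 qed
 have "(\<Sum>z\<in>?I. EE (%\<sigma> H. prod_list (map (%e. ind H e - pr \<sigma> e) (tel (snd z))))) \<le> card {()} * (\<alpha> ^ (k * t) * (real n * C))"
 proof (rule tuple_transfer[OF tb, where ts = ?ts and decode = ?decode])
  fix z assume z: "z \<in> ?I"
  obtain i ws where zi: "z = (i, ws)" by (cases z)
  have T: "ws \<in> tuples M {i} (replicate (2 * k) t)" "fst (hd ws) = i" "i < n" using tup z zi by auto
  have sub: "set (tel ws) \<subseteq> M" using tedges_subset[OF T(1)] by simp
  have mono: "EE (%\<sigma> H. prod_list (map (%e. ind H e - pr \<sigma> e) (tel ws))) = EE (%\<sigma> H. 1 * monomial \<sigma> H (tel ws) [])"
   by (simp add: monomial_def)
  have "EE (%\<sigma> H. prod_list (map (%e. ind H e - pr \<sigma> e) (tel ws))) \<le> \<alpha> ^ (k * t) * psi (tedges ws)"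
  proof (cases "\<exists>e. count_list (tel ws) e = 1")
   case True
   then have "EE (%\<sigma> H. 1 * monomial \<sigma> H (tel ws) []) = 0"
    using EE_monomial_zero[OF sub, of "[]" _ "%_. 1"] by (elim exE) simp
   then show ?thesis unfolding mono using psi_nonneg alpha1 by simp
  next
   case False
   have "(\<Sum>e\<in>tedges ws. 2) \<le> (\<Sum>e\<in>tedges ws. count_list (tel ws) e)"
   proof (rule sum_mono)
    fix e assume "e \<in> tedges ws"
    then have "count_list (tel ws) e ~= 0" by (simp add: count_list_0_iff)
    moreover have "count_list (tel ws) e ~= 1" using False by blast
    ultimately show "2 \<le> count_list (tel ws) e" by simp
   qed
   also have "... = length (tel ws)" by (rule sum_count_set) (simp_all add: set_tel[symmetric] del: set_tel)
   also have "... = 2 * (k * t)" using length_tel[OF T(1)] by (simp add: sum_list_replicate)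
   finally have c: "card (tedges ws) \<le> k * t" by simp
   have "EE (%\<sigma> H. 1 * monomial \<sigma> H (tel ws) []) \<le> spin_avg n (%\<sigma>. 1 * (\<Prod>e\<in>set (tel ws) \<union> set []. pr \<sigma> e))"
    by (rule EE_monomial_bound[OF sub]) auto
   also have "... = phi (tedges ws)" by (simp add: phi_def)
   also have "... \<le> \<alpha> ^ (k * t) * psi (tedges ws)" by (rule phi_le_power[OF c])
   finally show ?thesis unfolding mono .
  qed
  also have "... \<le> \<alpha> ^ (k * t) * (psi (tedges ws) * y ^ bdt {i} {} ws)"
   using alpha1 by (intro mult_left_mono psi_pow y) auto
  finally show "\<exists>k'\<in>{()}. \<exists>x<n. \<exists>ws\<in>tuples M {x} (?ts k'). ?decode k' ws = z \<and>
    EE (%\<sigma> H. prod_list (map (%e. ind H e - pr \<sigma> e) (tel (snd z)))) \<le> \<alpha> ^ (k * t) * (psi (tedges ws) * y ^ bdt {x} {} ws)"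
   using T zi by (intro bexI[of _ "()"] exI[of _ i] conjI bexI[of _ ws]) auto
 qed (use k t fI alpha1 in auto)
 then show "EE (%\<sigma> H. \<Sum>i<n. mpow n (sawmat M (%e. ind H e - pr \<sigma> e) t) (2 * k) i i) \<le> \<alpha> ^ (k * t) * (real n * C)"
  unfolding * by simp
 have "(\<Sum>z\<in>?I. EE (%\<sigma> H. prod_list (map (ind H) (tel (snd z))))) \<le> card {()} * (\<alpha> ^ (2 * k * t) * (real n * C))"
 proof (rule tuple_transfer[OF tb, where ts = ?ts and decode = ?decode])
  fix z assume z: "z \<in> ?I"
  obtain i ws where zi: "z = (i, ws)" by (cases z)
  have T: "ws \<in> tuples M {i} (replicate (2 * k) t)" "fst (hd ws) = i" "i < n" using tup z zi by auto
  have sub: "set (tel ws) \<subseteq> M" using tedges_subset[OF T(1)] by simp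
  have c: "card (tedges ws) \<le> 2 * k * t" using card_tedges[OF T(1)] by (simp add: sum_list_replicate)
  have "EE (%\<sigma> H. prod_list (map (ind H) (tel ws))) = phi (tedges ws)"
   using EE_prod_bound[OF sub] by simp
  also have "... \<le> \<alpha> ^ (2 * k * t) * psi (tedges ws)" by (rule phi_le_power[OF c])
  also have "... \<le> \<alpha> ^ (2 * k * t) * (psi (tedges ws) * y ^ bdt {i} {} ws)"
   using alpha1 by (intro mult_left_mono psi_pow y) auto
  finally show "\<exists>k'\<in>{()}. \<exists>x<n. \<exists>ws\<in>tuples M {x} (?ts k'). ?decode k' ws = z \<and>
    EE (%\<sigma> H. prod_list (map (ind H) (tel (snd z)))) \<le> \<alpha> ^ (2 * k * t) * (psi (tedges ws) * y ^ bdt {x} {} ws)"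
   using T zi by (intro bexI[of _ "()"] exI[of _ i] conjI bexI[of _ ws]) auto
 qed (use k t fI alpha1 in auto)
 then show "EE (%\<sigma> H. \<Sum>i<n. mpow n (sawmat M (ind H) t) (2 * k) i i) \<le> \<alpha> ^ (2 * k * t) * (real n * C)"
  unfolding * by simp
qed

end

section \<open>Row sums and tangles\<close>

text \<open>Variant of \<open>sa_if_no_bad\<close> in which the later edges may not be known to
  avoid \<open>u\<close>: it is enough that the first edge is new. After it the walk is outside
  \<open>U\<close>, so it cannot return to an old edge.\<close>

lemma sa_if_no_bad_step:
 assumes "walk u ((e, v) # w)" "distinct (map fst ((e, v) # w))" "edges ((e, v) # w) \<subseteq> M" "\<Union>F \<subseteq> U" "u \<in> U"
  "e \<notin> F" "\<forall>e\<in>M. finite e" "bd U F ((e, v) # w) = 0"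
 shows "sa M U u ((e, v) # w)"
proof -
 have e: "u \<in> e" "v \<in> e" "v ~= u" "walk v w" "e \<in> M" using assms(1,3) by simp_all
 have fe: "finite (e \<inter> U)" using assms(7) e by blast
 have c: "card (e \<inter> U) \<le> 1" using assms(6,8) by (auto split: if_splits)
 have eU: "e \<inter> U = {u}" using card_le_1_eq[OF fe c, of _ u] e assms(5) by blast
 then have vU: "v \<notin> U" using e by blast
 have "sa M (U \<union> e) v w"
 proof (rule sa_if_no_bad)
  show "\<forall>f\<in>insert e F. v \<in> f --> f \<notin> edges w"
  proof (intro ballI impI)
   fix f assume f: "f \<in> insert e F" "v \<in> f"
   then have "f \<notin> F" using vU assms(4) by blast
   then have "f = e" using f by blast
   then show "f \<notin> edges w" using assms(2) by (simp add: image_iff)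
  qed
  show "\<Union>(insert e F) \<subseteq> U \<union> e" using assms(4) by blast
  show "bd (U \<union> e) (insert e F) w = 0" using assms(8) by simp
 qed (use assms e in auto)
 then show ?thesis using e eU by simp
qed

lemma trails_len: "w \<in> trails M u t ==> length w = t"
 by (simp add: trails_def)

lemma saws_sub: "w \<in> saws M u t ==> edges w \<subseteq> M"
 using sa_walk[of M "{u}" u w] by (simp add: saws_def)

lemma saws_dest: "w \<in> saws M u t ==> u \<in> U ==> dest u w \<in> U \<union> \<Union>(edges w)"
 by (rule dest_in) (use sa_walk[of M "{u}" u w] in \<open>auto simp: saws_def\<close>)

text \<open>A tangle seen from \<open>i\<close>: exploring \<open>w\<close> and then
  \<open>w'\<close> meets a bad step. The same walk may be taken twice, which records a cycle closed
  by that walk alone.\<close>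

definition badpair :: "nat => (nat set \<times> nat) list => (nat set \<times> nat) list => bool" where
 "badpair i w w' \<longleftrightarrow> 1 \<le> bdt {i} {} [(i, w), (i, w')]"

context hsbm_params
begin

lemma M_finite: "\<forall>e\<in>M. finite e"
 by (blast intro: dsubsets_finite)

lemma cw_tel: "cw c w * cw c w' = prod_list (map c (tel [(u, w), (u', w')]))"
 by (simp add: cw_def)

theorem EE_row_sums:
 assumes tb: "tuple_bound r l y C" and r: "2 \<le> r" and t: "t \<le> l"
 shows "EE (%\<sigma> H. \<Sum>i<n. (\<Sum>w\<in>saws M i t. cw (ind H) w)\<^sup>2) \<le> \<alpha> ^ (2 * t) * (real n * C)"
proof -
 let ?I = "SIGMA i:{..<n}. saws M i t \<times> saws M i t"
 have y: "1 \<le> y" using tb by (simp add: tuple_bound_def)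
 have eq: "(\<Sum>i<n. (\<Sum>w\<in>saws M i t. cw (ind H) w)\<^sup>2) = (\<Sum>z\<in>?I. cw (ind H) (fst (snd z)) * cw (ind H) (snd (snd z)))" for H
  unfolding power2_eq_square sum_product sum.cartesian_product by (subst sum.Sigma) (auto simp: split_beta)
 have "(\<Sum>z\<in>?I. EE (%\<sigma> H. cw (ind H) (fst (snd z)) * cw (ind H) (snd (snd z)))) \<le> card {()} * (\<alpha> ^ (2 * t) * (real n * C))"
 proof (rule tuple_transfer[OF tb, where ts = "%_. [t, t]" and decode = "%_ ws. (fst (hd ws), snd (hd ws), snd (ws ! 1))"])
  fix z assume "z \<in> ?I"
  then obtain i w w' where z: "z = (i, w, w')" "i < n" "w \<in> saws M i t" "w' \<in> saws M i t" by auto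
  let ?ws = "[(i, w), (i, w')]"
  have T: "?ws \<in> tuples M {i} [t, t]"
   using z saws_trails[of M i t] by (auto simp: tuples_Cons)
  have sub: "set (tel ?ws) \<subseteq> M" using tedges_subset[OF T] by simp
  have c: "card (tedges ?ws) \<le> 2 * t" using card_tedges[OF T] by simp
  have "EE (%\<sigma> H. cw (ind H) w * cw (ind H) w') = phi (tedges ?ws)"
   unfolding cw_tel[of _ w w' i i] EE_prod_bound[OF sub] set_tel ..
  also have "... \<le> \<alpha> ^ (2 * t) * psi (tedges ?ws)" by (rule phi_le_power[OF c])
  also have "... \<le> \<alpha> ^ (2 * t) * (psi (tedges ?ws) * y ^ bdt {i} {} ?ws)"
   using alpha1 by (intro mult_left_mono psi_pow y) auto
  finally show "\<exists>k\<in>{()}. \<exists>x<n. \<exists>ws\<in>tuples M {x} [t, t]. (fst (hd ws), snd (hd ws), snd (ws ! 1)) = z \<and>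
    EE (%\<sigma> H. cw (ind H) (fst (snd z)) * cw (ind H) (snd (snd z))) \<le> \<alpha> ^ (2 * t) * (psi (tedges ws) * y ^ bdt {x} {} ws)"
   using T z by (intro bexI[of _ "()"] exI[of _ i] conjI bexI[of _ ?ws]) auto
 qed (use r t alpha1 in auto)
 then show ?thesis unfolding eq EE_sum by simp
qed

definition bad_pairs :: "nat => nat => ((nat set \<times> nat) list \<times> (nat set \<times> nat) list) set" where
 "bad_pairs l i = {(w, w'). w \<in> (\<Union>t\<le>l. trails M i t) \<and> w' \<in> (\<Union>t\<le>l. trails M i t) \<and> badpair i w w'}"

lemma finite_bad_pairs [simp]: "finite (bad_pairs l i)"
 by (rule finite_subset[of _ "(\<Union>t\<le>l. trails M i t) \<times> (\<Union>t\<le>l. trails M i t)"]) (auto simp: bad_pairs_def)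

text \<open>Squaring yields four trails from one root. One bad step, found in the first pair, gives
  the factor 1 / y. Since y is n up to logarithms and alpha^(4 l) <= n^(1/2) for c log alpha < 1/8,
  this is a negative power of n per vertex.\<close>

theorem EE_bad_pairs:
 assumes tb: "tuple_bound r l y C" and r: "4 \<le> r"
 shows "EE (%\<sigma> H. \<Sum>i<n. (\<Sum>(w, w')\<in>bad_pairs l i. cw (ind H) w * cw (ind H) w')\<^sup>2)
  \<le> (real l + 1) ^ 4 * (\<alpha> ^ (4 * l) / y * (real n * C))"
proof -
 let ?I = "SIGMA i:{..<n}. bad_pairs l i \<times> bad_pairs l i"
 let ?f = "%H z. cw (ind H) (fst z) * cw (ind H) (snd z)"
 let ?KS = "{..l} \<times> {..l} \<times> {..l} \<times> {..l}"
 let ?ts = "%(a, b, c, d). [a, b, c, d]"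
 let ?dec = "%_::nat \<times> nat \<times> nat \<times> nat. %ws. (fst (hd ws), (snd (hd ws), snd (ws ! 1)), (snd (ws ! 2), snd (ws ! 3)))"
 have y: "1 \<le> y" using tb by (simp add: tuple_bound_def)
 have eq: "(\<Sum>i<n. (\<Sum>(w, w')\<in>bad_pairs l i. cw (ind H) w * cw (ind H) w')\<^sup>2)
  = (\<Sum>z\<in>?I. ?f H (fst (snd z)) * ?f H (snd (snd z)))" for H
  unfolding power2_eq_square sum_product sum.cartesian_product by (subst sum.Sigma) (auto simp: split_beta)
 have "(\<Sum>z\<in>?I. EE (%\<sigma> H. ?f H (fst (snd z)) * ?f H (snd (snd z)))) \<le> card ?KS * (\<alpha> ^ (4 * l) / y * (real n * C))"
 proof (rule tuple_transfer[OF tb, where ts = ?ts and decode = ?dec])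
  fix z assume "z \<in> ?I"
  then obtain i w1 w2 w3 w4 where z: "z = (i, (w1, w2), (w3, w4))" "i < n" "(w1, w2) \<in> bad_pairs l i" "(w3, w4) \<in> bad_pairs l i"
   by (cases z) auto
  obtain t1 t2 t3 t4 where t: "t1 \<le> l" "t2 \<le> l" "t3 \<le> l" "t4 \<le> l"
   "w1 \<in> trails M i t1" "w2 \<in> trails M i t2" "w3 \<in> trails M i t3" "w4 \<in> trails M i t4"
   using z(3,4) by (auto simp: bad_pairs_def)
  let ?ws = "[(i, w1), (i, w2), (i, w3), (i, w4)]"
  have T: "?ws \<in> tuples M {i} [t1, t2, t3, t4]"
   using t by (auto simp: tuples_Cons)
  have sub: "set (tel ?ws) \<subseteq> M" using tedges_subset[OF T] by simp
  have c: "card (tedges ?ws) \<le> 4 * l" using card_tedges[OF T] t by simp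
  have "1 \<le> bdt {i} {} [(i, w1), (i, w2)]" using z(3) by (simp add: bad_pairs_def badpair_def)
  then have b: "1 \<le> bdt {i} {} ?ws" by simp
  have "EE (%\<sigma> H. ?f H (w1, w2) * ?f H (w3, w4)) = EE (%\<sigma> H. prod_list (map (ind H) (tel ?ws)))"
   by (simp add: cw_def mult.assoc)
  also have "... = phi (tedges ?ws)" unfolding EE_prod_bound[OF sub] set_tel ..
  also have "... \<le> \<alpha> ^ (4 * l) * psi (tedges ?ws)" by (rule phi_le_power[OF c])
  also have "... \<le> \<alpha> ^ (4 * l) * (psi (tedges ?ws) * (y ^ bdt {i} {} ?ws / y))"
  proof -
   have "y ^ 1 \<le> y ^ bdt {i} {} ?ws" using y b by (rule power_increasing[rotated])
   then have "1 \<le> y ^ bdt {i} {} ?ws / y" using y by simp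
   then have "psi (tedges ?ws) * 1 \<le> psi (tedges ?ws) * (y ^ bdt {i} {} ?ws / y)"
    by (rule mult_left_mono[OF _ psi_nonneg])
   then show ?thesis using alpha1 by (intro mult_left_mono) auto
  qed
  also have "... = \<alpha> ^ (4 * l) / y * (psi (tedges ?ws) * y ^ bdt {i} {} ?ws)" by simp
  finally show "\<exists>k\<in>?KS. \<exists>x<n. \<exists>ws\<in>tuples M {x} (?ts k). ?dec k ws = z \<and>
    EE (%\<sigma> H. ?f H (fst (snd z)) * ?f H (snd (snd z))) \<le> \<alpha> ^ (4 * l) / y * (psi (tedges ws) * y ^ bdt {x} {} ws)"
   using T z t by (intro bexI[of _ "(t1, t2, t3, t4)"] exI[of _ i] conjI bexI[of _ ?ws]) (auto simp: numeral_2_eq_2 numeral_3_eq_3)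
 next
  show "finite ?I" by (intro finite_SigmaI) auto
 qed (use r y alpha1 in auto)
 also have "real (card ?KS) = (real l + 1) ^ 4"
  by (simp add: card_cartesian_product power4_eq_xxxx algebra_simps)
 finally show ?thesis unfolding eq EE_sum .
qed

text \<open>Contrapositive of \<open>sa_if_no_bad_step\<close>, started from everything that
  \<open>w1\<close> has explored.\<close>

lemma nsa_bad:
 assumes w1: "w1 \<in> saws M i m" and e: "e \<in> M" "dest i w1 \<in> e" "v \<in> e" "v ~= dest i w1"
  and w2: "w2 \<in> saws M v k" and nsa: "\<not> sa M {i} i (w1 @ (e, v) # w2)" and new: "e \<notin> edges w1" "e \<notin> edges w2"
 shows "1 \<le> bd ({i} \<union> \<Union>(edges w1)) (edges w1) ((e, v) # w2)"
proof (rule ccontr)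
 assume "\<not> 1 \<le> bd ({i} \<union> \<Union>(edges w1)) (edges w1) ((e, v) # w2)"
 then have b: "bd ({i} \<union> \<Union>(edges w1)) (edges w1) ((e, v) # w2) = 0" by simp
 have s2: "walk v w2" "edges w2 \<subseteq> M" "distinct (map fst w2)"
  using w2 sa_walk[of M "{v}" v w2] sa_distinct[of M "{v}" v w2] by (simp_all add: saws_def)
 have "sa M ({i} \<union> \<Union>(edges w1)) (dest i w1) ((e, v) # w2)"
 proof (rule sa_if_no_bad_step[OF _ _ _ _ _ new(1) M_finite b])
  show "dest i w1 \<in> {i} \<union> \<Union>(edges w1)" by (rule saws_dest[OF w1]) simp
  show "distinct (map fst ((e, v) # w2))" using s2(3) new(2) by (simp add: image_iff)
 qed (use e s2 in auto)
 then have "sa M {i} i (w1 @ (e, v) # w2)" using w1 unfolding sa_append by (simp add: saws_def)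
 then show False using nsa by blast
qed

text \<open>If no step were bad, the walk would be self-avoiding relative to \<open>U\<close> and
  would end outside \<open>U\<close> by \<open>sa_dest_new\<close>.\<close>

lemma returning_bad:
 assumes e: "e \<in> M" "u \<in> e" "v \<in> e" "v ~= u" "u \<in> U" "\<Union>F \<subseteq> U"
  and w: "w \<in> saws M v k" and new: "e \<notin> F" "e \<notin> edges w" and ret: "dest v w \<in> U"
 shows "1 \<le> bd U F ((e, v) # w)"
proof (rule ccontr)
 assume "\<not> 1 \<le> bd U F ((e, v) # w)"
 then have b: "bd U F ((e, v) # w) = 0" by simp
 have s2: "walk v w" "edges w \<subseteq> M" "distinct (map fst w)"
  using w sa_walk[of M "{v}" v w] sa_distinct[of M "{v}" v w] by (simp_all add: saws_def)
 have "sa M U u ((e, v) # w)"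
 proof (rule sa_if_no_bad_step[OF _ _ _ e(6,5) new(1) M_finite b])
  show "distinct (map fst ((e, v) # w))" using s2(3) new(2) by (simp add: image_iff)
 qed (use e s2 in auto)
 from sa_dest_new[OF this] show False using ret by simp
qed

text \<open>If \<open>e\<close> and \<open>e'\<close> do not enlarge the edge set by two, the left
  side has a surplus probability factor, which is bounded by \<open>p\<close>.\<close>

lemma prod_insert2_le:
 assumes "finite F" and coin: "e \<in> F \<or> e' \<in> F \<or> e = e'"
 shows "pr \<sigma> e * pr \<sigma> e' * (\<Prod>f\<in>F. pr \<sigma> f) \<le> p * (\<Prod>f\<in>insert e (insert e' F). pr \<sigma> f)"
proof -
 have P0: "0 \<le> (\<Prod>f\<in>F. pr \<sigma> f)" by (intro prod_nonneg) (use pr_bounds(2) less_imp_le in blast)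
 note b = pr_bounds[of \<sigma>]
 have x: "0 \<le> pr \<sigma> f" "pr \<sigma> f \<le> 1" "pr \<sigma> f \<le> p" for f using b(2)[of f] b(3,4) by (simp_all add: less_imp_le)
 show ?thesis
 proof (cases "e \<in> F")
  case True
  show ?thesis
  proof (cases "e' \<in> F")
   case e': True
   have "pr \<sigma> e * pr \<sigma> e' * (\<Prod>f\<in>F. pr \<sigma> f) \<le> p * 1 * (\<Prod>f\<in>F. pr \<sigma> f)"
    by (intro mult_right_mono mult_mono x P0) (use p_pos in simp)
   then show ?thesis using True e' by (simp add: insert_absorb)
  next
   case False
   have "pr \<sigma> e * (pr \<sigma> e' * (\<Prod>f\<in>F. pr \<sigma> f)) \<le> p * (pr \<sigma> e' * (\<Prod>f\<in>F. pr \<sigma> f))"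
    by (intro mult_right_mono x mult_nonneg_nonneg P0)
   then show ?thesis using True False assms(1) by (simp add: insert_absorb insert_commute mult.assoc)
  qed
 next
  case False
  have "pr \<sigma> e' * (pr \<sigma> e * (\<Prod>f\<in>F. pr \<sigma> f)) \<le> p * (pr \<sigma> e * (\<Prod>f\<in>F. pr \<sigma> f))"
   by (intro mult_right_mono x mult_nonneg_nonneg P0)
  moreover have "insert e (insert e' F) = insert e F" using coin False by auto
  ultimately show ?thesis using False assms(1) by (simp add: mult_ac)
 qed
qed

text \<open>The square counts two failed concatenations with the same ends. If a middle edge
  coincides with another edge, \<open>prod_insert2_le\<close> gains a factor \<open>p\<close>.
  Otherwise there are two bad steps: one by \<open>nsa_bad\<close>, and one by
  \<open>returning_bad\<close>, as the second walk ends at the vertex \<open>j\<close> already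
  visited. For large n both gains are of order n^(-2) up to logarithms.\<close>

theorem EE_gam:
 assumes tb: "tuple_bound r l y C" and r: "6 \<le> r" and t: "m + k + 1 \<le> l"
 shows "EE (%\<sigma> H. \<Sum>i<n. \<Sum>j<n. (gam M (ind H) (%e. ind H e - pr \<sigma> e) m k i j)\<^sup>2)
  \<le> \<alpha> ^ (2 * l) * (p + 1 / y\<^sup>2) * (real n * C)"
proof -
 let ?I = "SIGMA ij:{..<n} \<times> {..<n}. nsa M m k (fst ij) (snd ij) \<times> nsa M m k (fst ij) (snd ij)"
 \<comment> \<open>For these weights \<open>A e - c e\<close> equals \<open>pr \<sigma> e\<close>,
   which is constant given the spins; only the outer walks are random.\<close>
 define val where "val \<sigma> H x = cw (%e. ind H e - pr \<sigma> e) (fst x) * pr \<sigma> (fst (fst (snd x))) * cw (ind H) (snd (snd x))"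
  for \<sigma> H and x :: "(nat set \<times> nat) list \<times> (nat set \<times> nat) \<times> (nat set \<times> nat) list"
 let ?ts = "%_::unit. [m, 1, k, m, 1, k]"
 let ?dec = "%_::unit. %ws. ((fst (hd ws), dest (fst (ws ! 2)) (snd (ws ! 2))),
   (snd (hd ws), hd (snd (ws ! 1)), snd (ws ! 2)), (snd (ws ! 3), hd (snd (ws ! 4)), snd (ws ! 5)))"
 have y: "1 \<le> y" using tb by (simp add: tuple_bound_def)
 have fn: "finite (nsa M m k i j)" for i j by (rule finite_subset[OF _ finite_trip]) (auto simp: nsa_def)
 have fI: "finite ?I" using fn by (intro finite_SigmaI finite_cartesian_product) auto
 have eq0: "(gam M (ind H) (%e. ind H e - pr \<sigma> e) m k i j)\<^sup>2 = (\<Sum>x\<in>nsa M m k i j \<times> nsa M m k i j. val \<sigma> H (fst x) * val \<sigma> H (snd x))"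
  for \<sigma> H i j unfolding power2_eq_square gam_def sum_product sum.cartesian_product val_def by (simp add: split_beta)
 have eq: "(\<Sum>i<n. \<Sum>j<n. (gam M (ind H) (%e. ind H e - pr \<sigma> e) m k i j)\<^sup>2)
  = (\<Sum>z\<in>?I. val \<sigma> H (fst (snd z)) * val \<sigma> H (snd (snd z)))" for \<sigma> H
 proof -
  have "(\<Sum>i<n. \<Sum>j<n. (gam M (ind H) (%e. ind H e - pr \<sigma> e) m k i j)\<^sup>2)
   = (\<Sum>ij\<in>{..<n} \<times> {..<n}. \<Sum>x\<in>nsa M m k (fst ij) (snd ij) \<times> nsa M m k (fst ij) (snd ij). val \<sigma> H (fst x) * val \<sigma> H (snd x))"
   by (simp only: eq0 sum.cartesian_product case_prod_unfold)
  also have "... = (\<Sum>(ij, x)\<in>?I. val \<sigma> H (fst x) * val \<sigma> H (snd x))"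
   by (rule sum.Sigma) (simp_all add: fn)
  finally show ?thesis by (simp only: case_prod_unfold)
 qed
 have "(\<Sum>z\<in>?I. EE (%\<sigma> H. val \<sigma> H (fst (snd z)) * val \<sigma> H (snd (snd z)))) \<le> card {()} * (\<alpha> ^ (2 * l) * (p + 1 / y\<^sup>2) * (real n * C))"
 proof (rule tuple_transfer[OF tb, where ts = ?ts and decode = ?dec])
  fix z assume zI: "z \<in> ?I"
  obtain i j x x' where z0: "z = ((i, j), x, x')" by (cases z) auto
  have ij: "i < n" "j < n" and xx: "x \<in> nsa M m k i j" "x' \<in> nsa M m k i j" using zI z0 by auto
  obtain w1 e v w2 where x: "x = (w1, (e, v), w2)" and X: "w1 \<in> saws M i m" "e \<in> M" "dest i w1 \<in> e" "v \<in> e" "v ~= dest i w1"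
   "w2 \<in> saws M v k" "dest v w2 = j" "\<not> sa M {i} i (w1 @ (e, v) # w2)"
   using xx(1) by (auto simp: nsa_def trip_def)
  obtain w1' e' v' w2' where x': "x' = (w1', (e', v'), w2')" and X': "w1' \<in> saws M i m" "e' \<in> M" "dest i w1' \<in> e'" "v' \<in> e'" "v' ~= dest i w1'"
   "w2' \<in> saws M v' k" "dest v' w2' = j" "\<not> sa M {i} i (w1' @ (e', v') # w2')"
   using xx(2) by (auto simp: nsa_def trip_def)
  let ?ws = "[(i, w1), (dest i w1, [(e, v)]), (v, w2), (i, w1'), (dest i w1', [(e', v')]), (v', w2')]"
  let ?F0 = "edges w1 \<union> edges w2 \<union> edges w1' \<union> edges w2'"
  have one: "[(e, v)] \<in> trails M (dest i w1) 1" "[(e', v')] \<in> trails M (dest i w1') 1" using X X' by (simp_all add: trails_def)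
  have tr: "w1 \<in> trails M i m" "w2 \<in> trails M v k" "w1' \<in> trails M i m" "w2' \<in> trails M v' k"
   using X X' saws_trails by blast+
  have T: "?ws \<in> tuples M {i} [m, 1, k, m, 1, k]"
   unfolding tuples_Cons tuples_Nil
   using tr one saws_dest[OF X(1), of "{i}"] saws_dest[OF X'(1), of "{i}"] X(4) X'(4)
   by auto
  have sub: "tedges ?ws \<subseteq> M" by (rule tedges_subset[OF T])
  have te: "tedges ?ws = insert e (insert e' ?F0)" by auto
  have c: "card (tedges ?ws) \<le> 2 * l" using card_tedges[OF T] t by simp
  have fF: "finite ?F0" by simp
  have "EE (%\<sigma> H. val \<sigma> H x * val \<sigma> H x') =
    EE (%\<sigma> H. (pr \<sigma> e * pr \<sigma> e') * monomial \<sigma> H (map fst w1 @ map fst w1') (map fst w2 @ map fst w2'))"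
   by (simp add: val_def x x' monomial_def cw_def mult_ac)
  also have "... \<le> spin_avg n (%\<sigma>. (pr \<sigma> e * pr \<sigma> e') * (\<Prod>f\<in>set (map fst w1 @ map fst w1') \<union> set (map fst w2 @ map fst w2'). pr \<sigma> f))"
   by (rule EE_monomial_bound) (use X X' saws_sub less_imp_le[OF pr_bounds(2)] in \<open>simp_all add: saws_sub[OF X(1)] saws_sub[OF X(6)] saws_sub[OF X'(1)] saws_sub[OF X'(6)]\<close>)
  also have "set (map fst w1 @ map fst w1') \<union> set (map fst w2 @ map fst w2') = ?F0" by auto
  finally have main: "EE (%\<sigma> H. val \<sigma> H x * val \<sigma> H x') \<le> spin_avg n (%\<sigma>. (pr \<sigma> e * pr \<sigma> e') * (\<Prod>f\<in>?F0. pr \<sigma> f))" .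
  have K: "EE (%\<sigma> H. val \<sigma> H x * val \<sigma> H x') \<le> (p + 1 / y\<^sup>2) * phi (tedges ?ws) * y ^ bdt {i} {} ?ws"
  proof (cases "e \<in> ?F0 \<or> e' \<in> ?F0 \<or> e = e'")
   case True
   have "spin_avg n (%\<sigma>. (pr \<sigma> e * pr \<sigma> e') * (\<Prod>f\<in>?F0. pr \<sigma> f)) \<le> spin_avg n (%\<sigma>. p * (\<Prod>f\<in>tedges ?ws. pr \<sigma> f))"
    unfolding te by (rule spin_avg_mono) (rule prod_insert2_le[OF fF True])
   also have "... = p * phi (tedges ?ws)" by (simp only: spin_avg_cmult phi_def)
   also have "... \<le> (p + 1 / y\<^sup>2) * phi (tedges ?ws)" by (intro mult_right_mono phi_nonneg) simp
   also have "... \<le> (p + 1 / y\<^sup>2) * phi (tedges ?ws) * y ^ bdt {i} {} ?ws"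
    using mult_left_mono[OF one_le_power[OF y, of "bdt {i} {} ?ws"], of "(p + 1 / y\<^sup>2) * phi (tedges ?ws)"] phi_nonneg p_pos by simp
   finally show ?thesis using main by linarith
  next
   case False
   \<comment> \<open>\<open>U1\<close> is what has been seen when the first middle edge is reached,
     \<open>U3\<close> and \<open>F4\<close> when the second one is, in the order of
     \<open>?ws\<close>.\<close>
   define U1 where "U1 = {i} \<union> \<Union>(edges w1)"
   define U3 where "U3 = U1 \<union> e \<union> \<Union>(edges w2) \<union> \<Union>(edges w1')"
   define F4 where "F4 = insert e (edges w1) \<union> edges w2 \<union> edges w1'"
   have b1: "1 \<le> bd U1 (edges w1) ((e, v) # w2)"
    unfolding U1_def using False by (intro nsa_bad[OF X(1-6,8)]) auto
   have b2: "1 \<le> bd U3 F4 ((e', v') # w2')"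
   proof (rule returning_bad[OF X'(2-5)])
    show "dest i w1' \<in> U3" using saws_dest[OF X'(1), of "{i}"] by (auto simp: U3_def U1_def)
    show "\<Union>F4 \<subseteq> U3" by (auto simp: F4_def U3_def U1_def)
    show "e' \<notin> F4" "e' \<notin> edges w2'" using False by (auto simp: F4_def)
    have "dest v w2 \<in> e \<union> \<Union>(edges w2)" by (rule saws_dest[OF X(6,4)])
    then show "dest v' w2' \<in> U3" using X(7) X'(7) by (auto simp: U3_def)
   qed (rule X'(6))
   have "bdt {i} {} ?ws \<ge> bd U1 (edges w1) ((e, v) # w2) + bd U3 F4 ((e', v') # w2')"
    by (simp add: U1_def U3_def F4_def Un_ac insert_commute)
   then have b: "2 \<le> bdt {i} {} ?ws" using b1 b2 by linarith
   have "spin_avg n (%\<sigma>. (pr \<sigma> e * pr \<sigma> e') * (\<Prod>f\<in>?F0. pr \<sigma> f)) = phi (tedges ?ws)"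
    unfolding te phi_def using False by (intro spin_avg_cong) (simp add: mult.assoc)
   also have "... \<le> phi (tedges ?ws) * (y ^ bdt {i} {} ?ws / y\<^sup>2)"
   proof -
    have "y ^ 2 \<le> y ^ bdt {i} {} ?ws" using b y by (rule power_increasing)
    then have "1 \<le> y ^ bdt {i} {} ?ws / y\<^sup>2" using y by simp
    from mult_left_mono[OF this phi_nonneg] show ?thesis by simp
   qed
   also have "... = (1 / y\<^sup>2) * phi (tedges ?ws) * y ^ bdt {i} {} ?ws" by simp
   also have "... \<le> (p + 1 / y\<^sup>2) * phi (tedges ?ws) * y ^ bdt {i} {} ?ws"
    using p_pos phi_nonneg y by (intro mult_right_mono) auto
   finally show ?thesis using main by linarith
  qed
  also have "(p + 1 / y\<^sup>2) * phi (tedges ?ws) * y ^ bdt {i} {} ?ws \<le> (p + 1 / y\<^sup>2) * (\<alpha> ^ (2 * l) * psi (tedges ?ws)) * y ^ bdt {i} {} ?ws"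
   using p_pos y by (intro mult_right_mono mult_left_mono phi_le_power(1)[OF c]) auto
  also have "... = \<alpha> ^ (2 * l) * (p + 1 / y\<^sup>2) * (psi (tedges ?ws) * y ^ bdt {i} {} ?ws)" by simp
  finally have fin: "EE (%\<sigma> H. val \<sigma> H x * val \<sigma> H x') \<le> \<alpha> ^ (2 * l) * (p + 1 / y\<^sup>2) * (psi (tedges ?ws) * y ^ bdt {i} {} ?ws)" .
  have "?dec () ?ws = z" using z0 x x' X(7) by (simp add: eval_nat_numeral)
  then show "\<exists>k'\<in>{()}. \<exists>x<n. \<exists>ws\<in>tuples M {x} (?ts k'). ?dec k' ws = z \<and>
    EE (%\<sigma> H. val \<sigma> H (fst (snd z)) * val \<sigma> H (snd (snd z))) \<le> \<alpha> ^ (2 * l) * (p + 1 / y\<^sup>2) * (psi (tedges ws) * y ^ bdt {x} {} ws)"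
   by (intro bexI[of _ "()"] exI[of _ i] conjI ij bexI[OF _ T]) (use fin z0 in simp_all)
 qed (use r t fI alpha1 p_pos in auto)
 then show ?thesis unfolding eq EE_sum by simp
qed

end

section \<open>Pairs of clusters\<close>

text \<open>For two clusters that meet at \<open>x\<close>: the second has to be explored from
  \<open>x\<close> and not from its root. Its walk is cut at an edge through \<open>x\<close>. A
  dummy step at \<open>x\<close> introduces this edge; then the tail starts at \<open>v\<close> and
  the head is run backwards from \<open>dest i P\<close>, both seen by then.\<close>

lemma split_at_vertex:
 assumes w: "w \<in> saws M i t" and x: "x \<in> \<Union>(edges w)"
 obtains P e v Q z where "w = P @ (e, v) # Q" "[(e, z)] \<in> trails M x 1" "Q \<in> trails M v (t - 1 - length P)"
  "v \<in> e" "dest i P \<in> e" "rv i P \<in> trails M (dest i P) (length P)" "length P < t" "i \<in> insert (dest i P) (\<Union>(edges P))"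
proof -
 obtain a where a: "a \<in> set w" "x \<in> fst a" using x by auto
 define e v where "e = fst a" and "v = snd a"
 have ev: "(e, v) \<in> set w" "x \<in> e" using a by (simp_all add: e_def v_def)
 then obtain P Q where W: "w = P @ (e, v) # Q" by (meson split_list)
 have tr: "length w = t" "walk i w" "distinct (map fst w)" "edges w \<subseteq> M"
  using w saws_trails[of M i t] by (auto simp: trails_def)
 have st: "dest i P \<in> e" "v \<in> e" "v ~= dest i P" "walk i P" "walk v Q" "e \<in> M" using tr(2,4) W by auto
 \<comment> \<open>The dummy step needs some vertex of \<open>e\<close> other than \<open>x\<close>;
   the two ends of the original step cannot both equal \<open>x\<close>.\<close>
 define z where "z = (if v = x then dest i P else v)"
 have "z \<in> e" "z ~= x" using st by (auto simp: z_def)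
 show thesis
 proof (rule that[of P e v Q z, OF W])
  show "[(e, z)] \<in> trails M x 1" using \<open>z \<in> e\<close> \<open>z ~= x\<close> ev st by (simp add: trails_def)
  show "Q \<in> trails M v (t - 1 - length P)" using tr W st by (auto simp: trails_def)
  have "P \<in> trails M i (length P)" using tr W st by (auto simp: trails_def)
  then show "rv i P \<in> trails M (dest i P) (length P)" by (rule trails_rv)
  show "length P < t" using tr W by auto
  show "i \<in> insert (dest i P) (\<Union>(edges P))" using start_mem[OF st(4)] by (cases "P = []") auto
 qed (use st in auto)
qed

context hsbm_params
begin

text \<open>A root with two self-avoiding walks. With \<open>t' = 0\<close> these are the terms of
  quadratic forms of B, with equal lengths those of the inner product of B 1 and B s.\<close>

definition clusters :: "nat => nat => (nat \<times> (nat set \<times> nat) list \<times> (nat set \<times> nat) list) set" where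
 "clusters t t' = (SIGMA i:{..<n}. saws M i t \<times> saws M i t')"

definition cverts :: "nat \<times> (nat set \<times> nat) list \<times> (nat set \<times> nat) list => nat set" where
 "cverts = (%(i, w, w'). {i} \<union> \<Union>(edges w) \<union> \<Union>(edges w'))"

definition cedges :: "nat \<times> (nat set \<times> nat) list \<times> (nat set \<times> nat) list => nat set set" where
 "cedges = (%(i, w, w'). edges w \<union> edges w')"

definition cprod :: "nat set set => nat \<times> (nat set \<times> nat) list \<times> (nat set \<times> nat) list => real" where
 "cprod H = (%(i, w, w'). cw (ind H) w * cw (ind H) w')"

lemma finite_clusters [simp]: "finite (clusters t t')"
 by (simp add: clusters_def)

lemma cedges_sub: "c \<in> clusters t t' ==> cedges c \<subseteq> M"
 by (auto simp: clusters_def cedges_def dest!: saws_sub)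

lemma cverts_sub: "c \<in> clusters t t' ==> cverts c \<subseteq> {0..<n}"
proof -
 assume "c \<in> clusters t t'"
 then obtain i w w' where c: "c = (i, w, w')" "i < n" "w \<in> saws M i t" "w' \<in> saws M i t'" by (auto simp: clusters_def)
 then show "cverts c \<subseteq> {0..<n}"
  using card_Union_edges(2)[OF saws_sub[OF c(3)]] card_Union_edges(2)[OF saws_sub[OF c(4)]] by (simp add: cverts_def)
qed

lemma EE_cluster_pair:
 assumes c: "c \<in> clusters t t'" "c' \<in> clusters t t'"
 shows "EE (%\<sigma> H. f \<sigma> * (cprod H c * cprod H c')) = spin_avg n (%\<sigma>. f \<sigma> * (\<Prod>e\<in>cedges c \<union> cedges c'. pr \<sigma> e))"
proof -
 obtain i w1 w2 where c1: "c = (i, w1, w2)" by (cases c)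
 obtain i' w3 w4 where c2: "c' = (i', w3, w4)" by (cases c')
 let ?ys = "map fst w1 @ map fst w2 @ map fst w3 @ map fst w4"
 have s: "set ?ys = cedges c \<union> cedges c'" by (auto simp: c1 c2 cedges_def)
 then have "set ?ys \<subseteq> M" using cedges_sub[OF c(1)] cedges_sub[OF c(2)] by simp
 from EE_prod_edges[OF this, of f] show ?thesis unfolding s by (simp add: c1 c2 cprod_def cw_def mult.assoc)
qed

text \<open>Disjoint clusters depend on disjoint sets of spins and edges, so their joint expectation
  is the product of the means and belongs to the squared mean. Intersecting clusters form one
  connected tuple, which costs a single factor n instead of n^2.\<close>

theorem EE_cluster_sq:
 assumes tb: "tuple_bound r l y C" and r: "6 \<le> r" and l: "t \<le> l" "t' \<le> l" "1 \<le> l"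
  and g: "!!c. c \<in> clusters t t' ==> depends_on (cverts c) (g c)"
  and g1: "!!c \<sigma>. c \<in> clusters t t' ==> \<sigma> \<in> spins n ==> \<bar>g c \<sigma>\<bar> \<le> 1"
  and m: "!!c. c \<in> clusters t t' ==> m c = spin_avg n (%\<sigma>. g c \<sigma> * (\<Prod>e\<in>cedges c. pr \<sigma> e))"
  and mm: "!!c c'. c \<in> clusters t t' ==> c' \<in> clusters t t' ==> \<bar>m c * m c'\<bar> \<le> pb ^ card (cedges c \<union> cedges c')"
 shows "EE (%\<sigma> H. (\<Sum>c\<in>clusters t t'. g c \<sigma> * cprod H c)\<^sup>2)
  \<le> (\<Sum>c\<in>clusters t t'. m c)\<^sup>2 + (1 + real t + real t') * (\<alpha> ^ (2 * (t + t')) * (real n * C))"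
proof -
 let ?CL = "clusters t t'"
 define ex where "ex z = spin_avg n (%\<sigma>. (g (fst z) \<sigma> * g (snd z) \<sigma>) * (\<Prod>e\<in>cedges (fst z) \<union> cedges (snd z). pr \<sigma> e))" for z
 define N where "N = {z \<in> ?CL \<times> ?CL. cverts (fst z) \<inter> cverts (snd z) ~= {}}"
 have y: "1 \<le> y" using tb by (simp add: tuple_bound_def)
 have fN: "finite N" unfolding N_def by simp
 have "EE (%\<sigma> H. (\<Sum>c\<in>?CL. g c \<sigma> * cprod H c)\<^sup>2) = (\<Sum>z\<in>?CL \<times> ?CL. ex z)"
 proof -
  have "(\<Sum>c\<in>?CL. g c \<sigma> * cprod H c)\<^sup>2 = (\<Sum>z\<in>?CL \<times> ?CL. (g (fst z) \<sigma> * g (snd z) \<sigma>) * (cprod H (fst z) * cprod H (snd z)))" for \<sigma> H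
   unfolding power2_eq_square sum_product sum.cartesian_product by (simp add: case_prod_unfold mult_ac)
  then have "EE (%\<sigma> H. (\<Sum>c\<in>?CL. g c \<sigma> * cprod H c)\<^sup>2)
    = (\<Sum>z\<in>?CL \<times> ?CL. EE (%\<sigma> H. (g (fst z) \<sigma> * g (snd z) \<sigma>) * (cprod H (fst z) * cprod H (snd z))))"
   by (simp only: EE_sum)
  also have "... = (\<Sum>z\<in>?CL \<times> ?CL. ex z)"
   unfolding ex_def by (intro sum.cong refl EE_cluster_pair) auto
  finally show ?thesis .
 qed
 also have "... = (\<Sum>z\<in>?CL \<times> ?CL. m (fst z) * m (snd z)) + (\<Sum>z\<in>?CL \<times> ?CL. ex z - m (fst z) * m (snd z))"
  by (simp add: sum.distrib[symmetric])
 also have "(\<Sum>z\<in>?CL \<times> ?CL. m (fst z) * m (snd z)) = (\<Sum>c\<in>?CL. m c)\<^sup>2"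
  unfolding power2_eq_square sum_product sum.cartesian_product by (simp add: case_prod_unfold)
 also have "(\<Sum>z\<in>?CL \<times> ?CL. ex z - m (fst z) * m (snd z)) = (\<Sum>z\<in>N. ex z - m (fst z) * m (snd z))"
 proof (rule sum.mono_neutral_right)
  show "\<forall>z\<in>?CL \<times> ?CL - N. ex z - m (fst z) * m (snd z) = 0"
  proof
   fix z assume z: "z \<in> ?CL \<times> ?CL - N"
   obtain c c' where cc: "z = (c, c')" by (cases z)
   have c: "c \<in> ?CL" "c' \<in> ?CL" "cverts c \<inter> cverts c' = {}" using z cc by (auto simp: N_def)
   have ev: "\<Union>(cedges c) \<subseteq> cverts c" for c by (cases c) (auto simp: cedges_def cverts_def)
   have ne: "e ~= {}" if "e \<in> M" for e using that d3 by (auto simp: dsubsets_def)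
   have dis: "cedges c \<inter> cedges c' = {}"
   proof (rule ccontr)
    assume "cedges c \<inter> cedges c' ~= {}"
    then obtain e where "e \<in> cedges c" "e \<in> cedges c'" by blast
    moreover then obtain x where "x \<in> e" using ne[of e] cedges_sub[OF c(1)] by blast
    ultimately show False using ev[of c] ev[of c'] c(3) by blast
   qed
   have fin: "finite (cedges c)" "finite (cedges c')" using cedges_sub[OF c(1)] cedges_sub[OF c(2)] finite_subset[OF _ finite_dsubsets] by blast+
   have "ex z = spin_avg n (%\<sigma>. (g c \<sigma> * (\<Prod>e\<in>cedges c. pr \<sigma> e)) * (g c' \<sigma> * (\<Prod>e\<in>cedges c'. pr \<sigma> e)))"
    unfolding ex_def cc by (simp add: prod.union_disjoint[OF fin dis] mult_ac)
   also have "... = m c * m c'"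
    unfolding m[OF c(1)] m[OF c(2)]
    by (rule spin_avg_indep[OF depends_on_mult[OF g[OF c(1)] dep_prod[OF ev]] depends_on_mult[OF g[OF c(2)] dep_prod[OF ev]] c(3) cverts_sub[OF c(1)]])
   finally show "ex z - m (fst z) * m (snd z) = 0" by (simp add: cc)
  qed
 qed (auto simp: N_def)
 also have "(\<Sum>z\<in>N. ex z - m (fst z) * m (snd z)) \<le> (\<Sum>z\<in>N. phi (cedges (fst z) \<union> cedges (snd z)) + pb ^ card (cedges (fst z) \<union> cedges (snd z)))"
 proof (rule sum_mono)
  fix z assume "z \<in> N"
  then have c: "fst z \<in> ?CL" "snd z \<in> ?CL" by (auto simp: N_def)
  have "ex z \<le> phi (cedges (fst z) \<union> cedges (snd z))"
   unfolding ex_def phi_def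
  proof (rule spin_avg_mono)
   fix \<sigma> assume s: "\<sigma> \<in> spins n"
   have "g (fst z) \<sigma> * g (snd z) \<sigma> \<le> \<bar>g (fst z) \<sigma>\<bar> * \<bar>g (snd z) \<sigma>\<bar>"
    by (metis abs_ge_self abs_mult)
   also have "... \<le> 1 * 1" by (intro mult_mono g1 c s) auto
   finally have "g (fst z) \<sigma> * g (snd z) \<sigma> \<le> 1" by simp
   moreover have "0 \<le> (\<Prod>e\<in>cedges (fst z) \<union> cedges (snd z). pr \<sigma> e)"
    by (intro prod_nonneg) (use pr_bounds(2) less_imp_le in blast)
   ultimately show "g (fst z) \<sigma> * g (snd z) \<sigma> * (\<Prod>e\<in>cedges (fst z) \<union> cedges (snd z). pr \<sigma> e)
    \<le> (\<Prod>e\<in>cedges (fst z) \<union> cedges (snd z). pr \<sigma> e)"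
    using mult_right_mono by fastforce
  qed
  moreover have "- (m (fst z) * m (snd z)) \<le> pb ^ card (cedges (fst z) \<union> cedges (snd z))"
   using mm[OF c] by linarith
  ultimately show "ex z - m (fst z) * m (snd z) \<le> phi (cedges (fst z) \<union> cedges (snd z)) + pb ^ card (cedges (fst z) \<union> cedges (snd z))"
   by linarith
 qed
 \<comment> \<open>Shape 0: the second root was already seen. Shapes 1 and 2: the clusters meet on
   the first or second walk of the second cluster, which is explored through
   \<open>split_at_vertex\<close>; s is the length of its head. Decoding reverses the head
   again.\<close>
 also have "... \<le> card (insert (0, 0) ({1} \<times> {..<t} \<union> {2} \<times> {..<t'}) :: (nat \<times> nat) set) * (\<alpha> ^ (2 * (t + t')) * (real n * C))"
 proof (rule tuple_transfer[OF tb, where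
   ts = "%(k, s). if k = 0 then [t, t', t, t'] else if k = 1 then [t, t', 1, t - 1 - s, s, t'] else [t, t', 1, t' - 1 - s, s, t]"
   and decode = "%(k, s) ws. ((fst (ws ! 0), snd (ws ! 0), snd (ws ! 1)),
     (let w = rv (fst (ws ! 4)) (snd (ws ! 4)) @ (fst (hd (snd (ws ! 2))), fst (ws ! 3)) # snd (ws ! 3) in
     if k = 0 then (fst (ws ! 2), snd (ws ! 2), snd (ws ! 3))
     else if k = 1 then (fst (ws ! 5), w, snd (ws ! 5)) else (fst (ws ! 5), snd (ws ! 5), w)))"])
  fix z assume zN: "z \<in> N"
  obtain i w1 w2 i' w3 w4 where z: "z = ((i, w1, w2), (i', w3, w4))" by (cases z) auto
  have c: "i < n" "i' < n" "w1 \<in> saws M i t" "w2 \<in> saws M i t'" "w3 \<in> saws M i' t" "w4 \<in> saws M i' t'"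
   using zN z by (auto simp: N_def clusters_def)
  let ?U = "{i} \<union> \<Union>(edges w1) \<union> \<Union>(edges w2)"
  have tr: "w1 \<in> trails M i t" "w2 \<in> trails M i t'" "w3 \<in> trails M i' t" "w4 \<in> trails M i' t'"
   using c saws_trails by blast+
  have ce: "cedges (fst z) \<union> cedges (snd z) = edges w1 \<union> edges w2 \<union> edges w3 \<union> edges w4"
   by (auto simp: z cedges_def)
  have fin: "phi (cedges (fst z) \<union> cedges (snd z)) + pb ^ card (cedges (fst z) \<union> cedges (snd z))
    \<le> \<alpha> ^ (2 * (t + t')) * (psi (tedges ws) * y ^ bdt {i} {} ws)"
   if te: "tedges ws = edges w1 \<union> edges w2 \<union> edges w3 \<union> edges w4" for ws
  proof -
   have "card (edges w) \<le> length w" for w :: "(nat set \<times> nat) list"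
    using card_image_le[of "set w" fst] card_length[of w] by (meson List.finite_set le_trans)
   then have cc: "card (edges w1) \<le> t" "card (edges w2) \<le> t'" "card (edges w3) \<le> t" "card (edges w4) \<le> t'"
    using tr trails_len by metis+
   have "card (tedges ws) \<le> t + t' + t + t'"
    unfolding te by (rule order_trans[OF card_Un_le add_mono[OF order_trans[OF card_Un_le add_mono[OF
      order_trans[OF card_Un_le add_mono[OF cc(1,2)]] cc(3)]] cc(4)]])
   then have "card (tedges ws) \<le> 2 * (t + t')" by simp
   from phi_le_power(2)[OF this] have "phi (cedges (fst z) \<union> cedges (snd z)) + pb ^ card (cedges (fst z) \<union> cedges (snd z))
    \<le> \<alpha> ^ (2 * (t + t')) * psi (tedges ws)" unfolding ce te .
   also have "... \<le> \<alpha> ^ (2 * (t + t')) * (psi (tedges ws) * y ^ bdt {i} {} ws)"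
    using alpha1 by (intro mult_left_mono psi_pow y) auto
   finally show ?thesis .
  qed
  obtain x where x: "x \<in> ?U" "x \<in> cverts (i', w3, w4)" using zN z by (auto simp: N_def cverts_def)
  let ?goal = "%k s ws tts. ws \<in> tuples M {i} tts \<and> tedges ws = edges w1 \<union> edges w2 \<union> edges w3 \<union> edges w4"
  consider "x = i'" | "x \<in> \<Union>(edges w3)" | "x \<in> \<Union>(edges w4)" using x(2) by (auto simp: cverts_def)
  then show "\<exists>k\<in>insert (0 :: nat, 0 :: nat) ({1} \<times> {..<t} \<union> {2} \<times> {..<t'}). \<exists>x<n. \<exists>ws\<in>tuples M {x} (case k of (k, s) =>
     if k = 0 then [t, t', t, t'] else if k = 1 then [t, t', 1, t - 1 - s, s, t'] else [t, t', 1, t' - 1 - s, s, t]).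
    (case k of (k, s) => %ws. ((fst (ws ! 0), snd (ws ! 0), snd (ws ! 1)),
     (let w = rv (fst (ws ! 4)) (snd (ws ! 4)) @ (fst (hd (snd (ws ! 2))), fst (ws ! 3)) # snd (ws ! 3) in
     if k = 0 then (fst (ws ! 2), snd (ws ! 2), snd (ws ! 3))
     else if k = 1 then (fst (ws ! 5), w, snd (ws ! 5)) else (fst (ws ! 5), snd (ws ! 5), w)))) ws = z
    \<and> phi (cedges (fst z) \<union> cedges (snd z)) + pb ^ card (cedges (fst z) \<union> cedges (snd z))
     \<le> \<alpha> ^ (2 * (t + t')) * (psi (tedges ws) * y ^ bdt {x} {} ws)"
  proof cases
   case 1
   let ?ws = "[(i, w1), (i, w2), (i', w3), (i', w4)]"
   have T: "?ws \<in> tuples M {i} [t, t', t, t']"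
    unfolding tuples_Cons tuples_Nil using tr x(1) 1 by auto
   show ?thesis
    by (intro bexI[of _ "(0, 0)"] exI[of _ i] conjI c(1) bexI[of _ ?ws] fin) (use T z in \<open>auto simp: eval_nat_numeral\<close>)
  next
   case 2
   from split_at_vertex[OF c(5) 2] obtain P e v Q zz where s: "w3 = P @ (e, v) # Q" "[(e, zz)] \<in> trails M x 1"
    "Q \<in> trails M v (t - 1 - length P)" "v \<in> e" "dest i' P \<in> e" "rv i' P \<in> trails M (dest i' P) (length P)" "length P < t"
    "i' \<in> insert (dest i' P) (\<Union>(edges P))" .
   let ?ws = "[(i, w1), (i, w2), (x, [(e, zz)]), (v, Q), (dest i' P, rv i' P), (i', w4)]"
   have T: "?ws \<in> tuples M {i} [t, t', 1, t - 1 - length P, length P, t']"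
    unfolding tuples_def mem_Collect_eq tuple_of.simps
    by (intro conjI TrueI s(2,3,6) tr) (use x(1) s(4,5,8) in auto)
   show ?thesis
    by (intro bexI[of _ "(1, length P)"] exI[of _ i] conjI c(1) bexI[of _ ?ws] fin) (use T z s in \<open>auto simp: eval_nat_numeral Let_def\<close>)
  next
   case 3
   from split_at_vertex[OF c(6) 3] obtain P e v Q zz where s: "w4 = P @ (e, v) # Q" "[(e, zz)] \<in> trails M x 1"
    "Q \<in> trails M v (t' - 1 - length P)" "v \<in> e" "dest i' P \<in> e" "rv i' P \<in> trails M (dest i' P) (length P)" "length P < t'"
    "i' \<in> insert (dest i' P) (\<Union>(edges P))" .
   let ?ws = "[(i, w1), (i, w2), (x, [(e, zz)]), (v, Q), (dest i' P, rv i' P), (i', w3)]"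
   have T: "?ws \<in> tuples M {i} [t, t', 1, t' - 1 - length P, length P, t]"
    unfolding tuples_def mem_Collect_eq tuple_of.simps
    by (intro conjI TrueI s(2,3,6) tr) (use x(1) s(4,5,8) in auto)
   show ?thesis
    by (intro bexI[of _ "(2, length P)"] exI[of _ i] conjI c(1) bexI[of _ ?ws] fin) (use T z s in \<open>auto simp: eval_nat_numeral Let_def\<close>)
  qed
 qed (use r l fN alpha1 in \<open>auto split: if_splits\<close>)
 also have "card (insert (0, 0) ({1} \<times> {..<t} \<union> {2} \<times> {..<t'}) :: (nat \<times> nat) set) = 1 + t + t'"
 proof -
  have "card ({1} \<times> {..<t} \<union> {2} \<times> {..<t'} :: (nat \<times> nat) set) = t + t'"
   by (subst card_Un_disjoint) (auto simp: card_cartesian_product)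
  then show ?thesis by (subst card_insert_disjoint) auto
 qed
 finally show ?thesis by (simp add: algebra_simps)
qed

text \<open>Edge probabilities depend only on agreements and are invariant under a global flip,
  which negates the single spin.\<close>

lemma avg_flip_odd:
 "spin_avg n (%\<sigma>. real_of_int (\<sigma> k) * (\<Prod>e\<in>F. pr \<sigma> e)) = 0"
proof -
 have "pr (%i. - \<sigma> i) e = pr \<sigma> e" for \<sigma> e by (simp add: edge_prob_def agree_def)
 then have "spin_avg n (%\<sigma>. (-1) * (real_of_int (\<sigma> k) * (\<Prod>e\<in>F. pr \<sigma> e))) = spin_avg n (%\<sigma>. real_of_int (\<sigma> k) * (\<Prod>e\<in>F. pr \<sigma> e))"
  using spin_avg_flip[of n "%\<sigma>. real_of_int (\<sigma> k) * (\<Prod>e\<in>F. pr \<sigma> e)"] by simp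
 then show ?thesis unfolding spin_avg_cmult by simp
qed

text \<open>Edges are peeled off at the start and \<open>f\<close> collects those already passed.
  Every next edge shares only the current end point with the past, so the two attachment lemmas
  apply.\<close>

lemma avg_saw:
 assumes "sa M U u w" "depends_on U f" "U \<subseteq> {0..<n}" "u \<in> U"
 shows "spin_avg n (%\<sigma>. f \<sigma> * (\<Prod>e\<in>edges w. pr \<sigma> e)) = pb ^ length w * spin_avg n f"
  and "spin_avg n (%\<sigma>. f \<sigma> * (\<Prod>e\<in>edges w. pr \<sigma> e) * real_of_int (\<sigma> (dest u w))) =
   qb ^ length w * spin_avg n (%\<sigma>. f \<sigma> * real_of_int (\<sigma> u))"
proof -
 have "spin_avg n (%\<sigma>. f \<sigma> * (\<Prod>e\<in>edges w. pr \<sigma> e)) = pb ^ length w * spin_avg n f \<and>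
  spin_avg n (%\<sigma>. f \<sigma> * (\<Prod>e\<in>edges w. pr \<sigma> e) * real_of_int (\<sigma> (dest u w))) =
   qb ^ length w * spin_avg n (%\<sigma>. f \<sigma> * real_of_int (\<sigma> u))"
  using assms
 proof (induction w arbitrary: U u f)
  case (Cons a w)
  obtain e v where a: "a = (e, v)" by (cases a)
  have e: "e \<in> M" "e \<inter> U = {u}" "v \<in> e" "v ~= u" "sa M (U \<union> e) v w" using Cons.prems(1) a by auto
  have en: "e \<subseteq> {0..<n}" "card e = d" using e(1) by (simp_all add: dsubsets_def)
  have "e \<notin> edges w" using sa_distinct[OF Cons.prems(1)] a by (simp add: image_iff)
  then have pe: "(\<Prod>e\<in>edges (a # w). pr \<sigma> e) = pr \<sigma> e * (\<Prod>e\<in>edges w. pr \<sigma> e)" for \<sigma> by (simp add: a)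
  let ?f = "%\<sigma>. f \<sigma> * pr \<sigma> e"
  have df: "depends_on (U \<union> e) ?f"
   by (intro depends_on_mult depends_on_edge_prob depends_on_mono[OF Cons.prems(2)]) auto
  have U': "U \<union> e \<subseteq> {0..<n}" "v \<in> U \<union> e" using Cons.prems(3) en e by auto
  note IH = Cons.IH[OF e(5) df U']
  have ue: "u \<in> e" "e \<inter> U \<subseteq> {u}" using e(2) by auto
  have 1: "spin_avg n ?f = pb * spin_avg n f"
   using spin_avg_attach[OF Cons.prems(2) en(1) ue, of p q] by (simp add: pb_def en)
  have 2: "spin_avg n (%\<sigma>. ?f \<sigma> * real_of_int (\<sigma> v)) = qb * spin_avg n (%\<sigma>. f \<sigma> * real_of_int (\<sigma> u))"
   using spin_avg_attach_sign[OF Cons.prems(2) en(1) ue e(3,4), of p q] by (simp add: qb_def en)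
  show ?case using IH unfolding pe 1 2 by (simp add: a mult.assoc)
 qed simp
 then show "spin_avg n (%\<sigma>. f \<sigma> * (\<Prod>e\<in>edges w. pr \<sigma> e)) = pb ^ length w * spin_avg n f"
  and "spin_avg n (%\<sigma>. f \<sigma> * (\<Prod>e\<in>edges w. pr \<sigma> e) * real_of_int (\<sigma> (dest u w))) =
   qb ^ length w * spin_avg n (%\<sigma>. f \<sigma> * real_of_int (\<sigma> u))" by auto
qed

section \<open>The number of self-avoiding walks\<close>

definition sa_steps :: "nat set => nat => (nat set \<times> nat) set" where
 "sa_steps U u = {(e, v). e \<in> M \<and> e \<inter> U = {u} \<and> v \<in> e - {u}}"

lemma card_sa_steps:
 assumes "u \<in> U" "U \<subseteq> {0..<n}"
 shows "real (card (sa_steps U u)) \<le> real ((d - 1) * ((n - 1) choose (d - 1)))"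
  "real ((d - 1) * ((n - 1) choose (d - 1))) - real (card U) * real ((d - 1) * ((n - 2) choose (d - 2))) \<le> real (card (sa_steps U u))"
  "finite (sa_steps U u)"
proof -
 let ?A = "{(e, v). e \<in> M \<and> u \<in> e \<and> v \<in> e - {u}}"
 let ?B = "{(e, v). e \<in> M \<and> u \<in> e \<and> v \<in> e - {u} \<and> 1 < card (e \<inter> U)}"
 have un: "u < n" using assms by auto
 have fA: "finite ?A" using card_steps_in(2)[of M u] by simp
 have sub: "sa_steps U u \<subseteq> ?A" by (auto simp: sa_steps_def)
 show fin: "finite (sa_steps U u)" by (rule finite_subset[OF sub fA])
 have cA: "card ?A = (d - 1) * ((n - 1) choose (d - 1))" by (rule card_steps[OF un]) (use d3 in simp)
 show "real (card (sa_steps U u)) \<le> real ((d - 1) * ((n - 1) choose (d - 1)))"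
  using card_mono[OF fA sub, unfolded cA] by (simp only: of_nat_le_iff)
 have "?A \<subseteq> sa_steps U u \<union> ?B"
 proof
  fix z assume z: "z \<in> ?A"
  obtain e v where ev: "z = (e, v)" by (cases z)
  have e: "e \<in> M" "u \<in> e" "v \<in> e - {u}" using z ev by auto
  have fe: "finite (e \<inter> U)" using dsubsets_finite[OF e(1)] by simp
  show "z \<in> sa_steps U u \<union> ?B"
  proof (cases "1 < card (e \<inter> U)")
   case False
   then have "e \<inter> U = {u}" using card_le_1_eq[OF fe, of _ u] e assms(1) by fastforce
   then show ?thesis using e ev by (simp add: sa_steps_def)
  qed (use e ev in auto)
 qed
 moreover have fB: "finite ?B" by (rule finite_subset[OF _ fA]) auto
 ultimately have "card ?A \<le> card (sa_steps U u) + card ?B"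
  using card_mono[of "sa_steps U u \<union> ?B" ?A] card_Un_le[of "sa_steps U u" ?B] fin by (meson finite_UnI le_trans)
 also have "card ?B \<le> card U * ((d - 1) * ((n - 2) choose (d - 2)))"
  by (rule card_bad_steps[OF assms]) (use d3 in simp)
 finally have "real (card ?A) \<le> real (card (sa_steps U u) + card U * ((d - 1) * ((n - 2) choose (d - 2))))"
  by (simp only: of_nat_le_iff)
 then show "real ((d - 1) * ((n - 1) choose (d - 1))) - real (card U) * real ((d - 1) * ((n - 2) choose (d - 2))) \<le> real (card (sa_steps U u))"
  unfolding cA by simp
qed

text \<open>As at most \<open>R\<close> vertices are ever seen, each step has at least
  \<open>L\<close> admissible continuations by \<open>card_bad_steps\<close>.\<close>

lemma count_saws:
 fixes L R :: real
 assumes L: "L = real ((d - 1) * ((n - 1) choose (d - 1))) - R * real ((d - 1) * ((n - 2) choose (d - 2)))" "0 \<le> L"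
  and "u \<in> U" "U \<subseteq> {0..<n}" "real (card U + d * t) \<le> R"
 shows "L ^ t \<le> real (card {w. length w = t \<and> sa M U u w}) \<and>
  real (card {w. length w = t \<and> sa M U u w}) \<le> real ((d - 1) * ((n - 1) choose (d - 1))) ^ t
  \<and> finite {w. length w = t \<and> sa M U u w}"
 using assms(3-)
proof (induction t arbitrary: U u)
 case 0
 have "{w. length w = 0 \<and> sa M U u w} = {[]}" by auto
 then show ?case by simp
next
 case (Suc t)
 let ?S = "%z. {w. length w = t \<and> sa M (U \<union> fst z) (snd z) w}"
 let ?N = "real ((d - 1) * ((n - 1) choose (d - 1)))"
 have eq: "{w. length w = Suc t \<and> sa M U u w} = (%(z, w). z # w) ` (SIGMA z:sa_steps U u. ?S z)" (is "?L = ?R")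
 proof
  show "?L \<subseteq> ?R"
  proof
   fix w assume "w \<in> ?L"
   then obtain e v w' where w: "w = (e, v) # w'" by (cases w) auto
   then have "((e, v), w') \<in> (SIGMA z:sa_steps U u. ?S z)" using \<open>w \<in> ?L\<close> by (auto simp: sa_steps_def)
   then show "w \<in> ?R" using w by (intro image_eqI[of _ _ "((e, v), w')"]) auto
  qed
  show "?R \<subseteq> ?L"
  proof (rule image_subsetI)
   fix y assume y: "y \<in> (SIGMA z:sa_steps U u. ?S z)"
   obtain e v w where Y: "y = ((e, v), w)" by (cases y) auto
   then show "(case y of (z, w) => z # w) \<in> ?L" using y unfolding sa_steps_def by simp
  qed
 qed
 have IH: "L ^ t \<le> real (card (?S z)) \<and> real (card (?S z)) \<le> ?N ^ t \<and> finite (?S z)" if z: "z \<in> sa_steps U u" for z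
 proof -
  have e: "fst z \<in> M" "snd z \<in> fst z" using z unfolding sa_steps_def case_prod_unfold by simp_all
  have 1: "snd z \<in> U \<union> fst z" using e by simp
  have 2: "U \<union> fst z \<subseteq> {0..<n}" using e(1) Suc.prems(2) by (simp add: dsubsets_def)
  have "card (U \<union> fst z) \<le> card U + d" using card_Un_le[of U "fst z"] e(1) by (simp add: dsubsets_def)
  then have "real (card (U \<union> fst z) + d * t) \<le> real (card U + d * Suc t)" by (simp only: of_nat_le_iff) simp
  then have 3: "real (card (U \<union> fst z) + d * t) \<le> R" using Suc.prems(3) by linarith
  show ?thesis by (rule Suc.IH[OF 1 2 3])
 qed
 note st = card_sa_steps[OF Suc.prems(1,2)]
 have inj: "inj_on (%(z, w). z # w) (SIGMA z:sa_steps U u. ?S z)" by (auto simp: inj_on_def)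
 have fin: "finite (SIGMA z:sa_steps U u. ?S z)" using st(3) IH by (intro finite_SigmaI) auto
 have card: "real (card {w. length w = Suc t \<and> sa M U u w}) = (\<Sum>z\<in>sa_steps U u. real (card (?S z)))"
  unfolding eq card_image[OF inj] using st(3) IH by (subst card_SigmaI) auto
 have cU: "real (card U) \<le> R" using Suc.prems(3) by (rule order_trans[rotated]) simp
 have "L \<le> ?N - real (card U) * real ((d - 1) * ((n - 2) choose (d - 2)))"
  unfolding L(1) using cU by (intro diff_left_mono mult_right_mono) auto
 then have "L \<le> real (card (sa_steps U u))" using st(2) by linarith
 then have "L * L ^ t \<le> real (card (sa_steps U u)) * L ^ t" using L(2) by (intro mult_right_mono) auto
 also have "... \<le> (\<Sum>z\<in>sa_steps U u. real (card (?S z)))"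
  using IH by (intro sum_bounded_below) auto
 finally have 1: "L ^ Suc t \<le> real (card {w. length w = Suc t \<and> sa M U u w})" unfolding card by simp
 have "(\<Sum>z\<in>sa_steps U u. real (card (?S z))) \<le> real (card (sa_steps U u)) * ?N ^ t"
  using IH by (intro sum_bounded_above) auto
 also have "... \<le> ?N * ?N ^ t" using st(1) by (intro mult_right_mono) auto
 finally have 2: "real (card {w. length w = Suc t \<and> sa M U u w}) \<le> ?N ^ Suc t" unfolding card by simp
 show ?case using 1 2 fin unfolding eq by blast
qed

end

section \<open>Links and distances\<close>

context hsbm_params
begin

text \<open>The number of possible hyperedges through a given pair of vertices. The expected
  adjacency of u and v is near \<open>codeg * pb + codeg * qb * real_of_int (\<sigma> u * \<sigma>
  v)\<close>.\<close>

abbreviation "codeg \<equiv> real ((n - 2) choose (d - 2))"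

text \<open>By \<open>spin_avg_pair\<close>, edges whose only common vertices are \<open>u\<close>
  and \<open>v\<close> are uncorrelated once this mean is subtracted. Only pairs of edges with a
  third common vertex remain, which are fewer by a factor of order n.\<close>

lemma link_second_moment:
 assumes u: "u < n" "v < n" "u ~= v"
 shows "spin_avg n (%\<sigma>. (link M (pr \<sigma>) u v - codeg * pb - codeg * qb * real_of_int (\<sigma> u * \<sigma> v))\<^sup>2)
  \<le> codeg * (d * real ((n - 3) choose (d - 3))) * p\<^sup>2"
proof -
 let ?E = "{e \<in> M. {u, v} \<subseteq> e}"
 define Y where "Y e \<sigma> = pr \<sigma> e - pb - qb * real_of_int (\<sigma> u * \<sigma> v)" for e \<sigma>
 have fE: "finite ?E" by simp
 have c2: "card {u, v} = 2" using u by simp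
 have cE: "card ?E = (n - 2) choose (d - 2)"
  using card_dsubsets_containing[of "{u, v}" n d] u d3 unfolding c2 by simp
 have lk: "link M (pr \<sigma>) u v - codeg * pb - codeg * qb * real_of_int (\<sigma> u * \<sigma> v) = (\<Sum>e\<in>?E. Y e \<sigma>)" for \<sigma>
 proof -
  have "{e \<in> M. u \<in> e \<and> v \<in> e \<and> v ~= u} = ?E" using u by auto
  then have "link M (pr \<sigma>) u v = (\<Sum>e\<in>?E. pr \<sigma> e)" by (simp only: link_def)
  then show ?thesis by (simp only: Y_def sum_subtractf sum_constant cE mult.assoc)
 qed
 \<comment> \<open>Both values of the subtracted mean, pb + qb and pb - qb, lie between
   \<open>q\<close> and \<open>p\<close>, hence \<open>Y\<close> is at most \<open>p\<close> in
   modulus.\<close>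
 have qp: "q \<le> pb - qb" "pb + qb \<le> p"
 proof -
  show "q \<le> pb - qb" by (simp add: pb_def qb_def)
  have "(2::real) ^ 1 \<le> 2 ^ (d - 1)" using d3 by (intro power_increasing) auto
  then have "2 / (2::real) ^ (d - 1) \<le> 1" by simp
  then have "(p - q) * (2 / 2 ^ (d - 1)) \<le> (p - q) * 1" using q_le_p by (intro mult_left_mono) auto
  then have "q + (p - q) * (2 / 2 ^ (d - 1)) \<le> q + (p - q) * 1" by (rule add_left_mono)
  then show "pb + qb \<le> p" by (simp add: pb_def qb_def algebra_simps)
 qed
 have Yb: "\<bar>Y e \<sigma>\<bar> \<le> p" if s: "\<sigma> \<in> spins n" for e \<sigma>
 proof -
  have "real_of_int (\<sigma> u * \<sigma> v) = 1 \<or> real_of_int (\<sigma> u * \<sigma> v) = -1"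
   using spins_val[OF s u(1)] spins_val[OF s u(2)] by (elim disjE) simp_all
  then have "q \<le> pb + qb * real_of_int (\<sigma> u * \<sigma> v)" "pb + qb * real_of_int (\<sigma> u * \<sigma> v) \<le> p"
   using qp qb_nonneg by (elim disjE; simp)+
  then show ?thesis unfolding Y_def using pr_bounds(1,3)[of \<sigma> e] pr_bounds(3)[of \<sigma> e] q_pos by (simp add: abs_le_iff)
 qed
 have dY: "depends_on e (Y e)" if "e \<in> ?E" for e
  unfolding Y_def of_int_mult
  by (intro depends_on_diff depends_on_mult depends_on_edge_prob depends_on_const depends_on_spin) (use that in auto)
 let ?B = "%e. {e' \<in> ?E. \<not> e' \<inter> e \<subseteq> {u, v}}"
 have cB: "card (?B e) \<le> d * ((n - 3) choose (d - 3))" if e: "e \<in> ?E" for e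
 proof -
  have "?B e \<subseteq> (\<Union>x\<in>e - {u, v}. {e' \<in> M. {u, v, x} \<subseteq> e'})" by auto
  then have "card (?B e) \<le> card (\<Union>x\<in>e - {u, v}. {e' \<in> M. {u, v, x} \<subseteq> e'})"
   by (rule card_mono[rotated], intro finite_UN_I) (use e in \<open>auto intro: dsubsets_finite\<close>)
  also have "... \<le> (\<Sum>x\<in>e - {u, v}. card {e' \<in> M. {u, v, x} \<subseteq> e'})"
   by (rule card_UN_le) (use e in \<open>auto intro: dsubsets_finite\<close>)
  also have "... = (\<Sum>x\<in>e - {u, v}. (n - 3) choose (d - 3))"
  proof (rule sum.cong[OF refl])
   fix x assume x: "x \<in> e - {u, v}"
   then have c3: "card {u, v, x} = 3" using u by auto
   have "x < n" using x e by (auto simp: dsubsets_def)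
   then show "card {e' \<in> M. {u, v, x} \<subseteq> e'} = (n - 3) choose (d - 3)"
    using card_dsubsets_containing[of "{u, v, x}" n d] u d3 unfolding c3 by simp
  qed
  also have "... \<le> d * ((n - 3) choose (d - 3))"
  proof -
   have "card (e - {u, v}) \<le> card e" using e by (intro card_mono) (auto intro: dsubsets_finite)
   then show ?thesis using e by (simp add: dsubsets_def)
  qed
  finally show ?thesis .
 qed
 have "spin_avg n (%\<sigma>. (\<Sum>e\<in>?E. Y e \<sigma>)\<^sup>2) = (\<Sum>e\<in>?E. \<Sum>e'\<in>?E. spin_avg n (%\<sigma>. Y e \<sigma> * Y e' \<sigma>))"
  unfolding power2_eq_square sum_product by (simp only: spin_avg_sum)
 also have "... = (\<Sum>e\<in>?E. \<Sum>e'\<in>?B e. spin_avg n (%\<sigma>. Y e \<sigma> * Y e' \<sigma>))"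
 proof (rule sum.cong[OF refl], rule sum.mono_neutral_right[OF fE])
  fix e assume e: "e \<in> ?E"
  show "\<forall>e'\<in>?E - ?B e. spin_avg n (%\<sigma>. Y e \<sigma> * Y e' \<sigma>) = 0"
  proof
   fix e' assume e': "e' \<in> ?E - ?B e"
   then have E': "e' \<subseteq> {0..<n}" "u \<in> e'" "v \<in> e'" "e' \<inter> e \<subseteq> {u, v}" "card e' = d" by (auto simp: dsubsets_def)
   have "spin_avg n (%\<sigma>. Y e \<sigma> * (edge_prob p q \<sigma> e' - (q + (p - q) / 2 ^ (card e' - 1))
     - (p - q) / 2 ^ (card e' - 1) * real_of_int (\<sigma> u * \<sigma> v))) = 0"
    by (rule spin_avg_pair[OF dY[OF e] E'(1,2,3) u(3) E'(4)])
   then show "spin_avg n (%\<sigma>. Y e \<sigma> * Y e' \<sigma>) = 0" unfolding Y_def[of e'] E'(5) pb_def qb_def .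
  qed
 qed auto
 also have "... \<le> (\<Sum>e\<in>?E. \<Sum>e'\<in>?B e. p\<^sup>2)"
 proof (intro sum_mono)
  fix e e'
  have "spin_avg n (%\<sigma>. Y e \<sigma> * Y e' \<sigma>) \<le> spin_avg n (%\<sigma>. p\<^sup>2)"
  proof (rule spin_avg_mono)
   fix \<sigma> assume s: "\<sigma> \<in> spins n"
   have "Y e \<sigma> * Y e' \<sigma> \<le> \<bar>Y e \<sigma>\<bar> * \<bar>Y e' \<sigma>\<bar>" unfolding abs_mult[symmetric] by (rule abs_ge_self)
   also have "... \<le> p * p" by (intro mult_mono Yb s) (use p_pos in auto)
   finally show "Y e \<sigma> * Y e' \<sigma> \<le> p\<^sup>2" by (simp add: power2_eq_square)
  qed
  then show "spin_avg n (%\<sigma>. Y e \<sigma> * Y e' \<sigma>) \<le> p\<^sup>2" by simp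
 qed
 also have "... = (\<Sum>e\<in>?E. real (card (?B e)) * p\<^sup>2)" by simp
 also have "... \<le> (\<Sum>e\<in>?E. real (d * ((n - 3) choose (d - 3))) * p\<^sup>2)"
  by (intro sum_mono mult_right_mono of_nat_mono cB) auto
 also have "... = codeg * (d * real ((n - 3) choose (d - 3))) * p\<^sup>2" by (simp only: sum_constant cE of_nat_mult mult.assoc)
 finally show ?thesis unfolding lk .
qed

text \<open>On the diagonal \<open>link\<close> vanishes but the approximating matrix does not; this
  gives the last term.\<close>

theorem EE_link:
 "EE (%\<sigma> H. \<Sum>u<n. \<Sum>v<n. (link M (pr \<sigma>) u v - codeg * pb - codeg * qb * real_of_int (\<sigma> u * \<sigma> v))\<^sup>2)
  \<le> (real n)\<^sup>2 * (codeg * (d * real ((n - 3) choose (d - 3))) * p\<^sup>2) + n * (2 * codeg * p)\<^sup>2"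
proof -
 let ?B = "codeg * (d * real ((n - 3) choose (d - 3))) * p\<^sup>2"
 let ?f = "%\<sigma> u v. (link M (pr \<sigma>) u v - codeg * pb - codeg * qb * real_of_int (\<sigma> u * \<sigma> v))\<^sup>2"
 have EHc: "EH \<sigma> (%H. c) = c" for \<sigma> c by (simp add: EH_def)
 have "EE (%\<sigma> H. \<Sum>u<n. \<Sum>v<n. ?f \<sigma> u v) = (\<Sum>u<n. \<Sum>v<n. spin_avg n (%\<sigma>. ?f \<sigma> u v))"
  unfolding EE_alt EHc spin_avg_sum ..
 also have "... \<le> (\<Sum>u<n. \<Sum>v<n. ?B + (if u = v then (2 * codeg * p)\<^sup>2 else 0))"
 proof (intro sum_mono)
  fix u v assume uv: "u \<in> {..<n}" "v \<in> {..<n}"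
  show "spin_avg n (%\<sigma>. ?f \<sigma> u v) \<le> ?B + (if u = v then (2 * codeg * p)\<^sup>2 else 0)"
  proof (cases "u = v")
   case False
   then show ?thesis using link_second_moment[of u v] uv by simp
  next
   case True
   have "spin_avg n (%\<sigma>. ?f \<sigma> u v) \<le> spin_avg n (%\<sigma>. (2 * codeg * p)\<^sup>2)"
   proof (rule spin_avg_mono)
    fix \<sigma> assume s: "\<sigma> \<in> spins n"
    have l0: "link M (pr \<sigma>) u v = 0" using True by (simp add: link_def)
    have "\<sigma> u * \<sigma> v = 1" using True spins_sq[OF s] uv by simp
    then have "?f \<sigma> u v = (codeg * (pb + qb))\<^sup>2" unfolding l0 by (simp add: algebra_simps power2_eq_square)
    also have "... \<le> (2 * codeg * p)\<^sup>2"
    proof (rule power_mono)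
     have "pb \<le> p"
     proof -
      have "(p - q) / 2 ^ (d - 1) \<le> (p - q) / 1" using q_le_p by (intro divide_left_mono) auto
      then show ?thesis by (simp add: pb_def)
     qed
     then have "pb + qb \<le> 2 * p" using qb_le_pb by linarith
     then show "codeg * (pb + qb) \<le> 2 * codeg * p" using mult_left_mono[of "pb + qb" "2 * p" codeg] by simp
    qed (use pb_pos qb_nonneg in simp)
    finally show "?f \<sigma> u v \<le> (2 * codeg * p)\<^sup>2" .
   qed
   then show ?thesis using True by (simp add: add_increasing)
  qed
 qed
 also have "... = (real n)\<^sup>2 * ?B + n * (2 * codeg * p)\<^sup>2"
  by (simp add: sum.distrib power2_eq_square algebra_simps)
 finally show ?thesis .
qed

end

section \<open>Translation to the walks and distances of the statement\<close>

lemma walk_zip: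
 assumes "is_walk H l vs es"
 shows "length (zip es (tl vs)) = l \<and> walk (hd vs) (zip es (tl vs)) \<and> edges (zip es (tl vs)) \<subseteq> H \<and>
  dest (hd vs) (zip es (tl vs)) = last vs"
 using assms
proof (induction es arbitrary: vs l)
 case Nil
 then have "l = 0" "length vs = 1" by (auto simp: is_walk_def)
 then show ?case by (cases vs) auto
next
 case (Cons e es)
 then obtain l' where l': "l = Suc l'" "length vs = Suc (Suc l')" "length es = l'" by (auto simp: is_walk_def)
 then obtain u v vs' where vs: "vs = u # v # vs'" by (metis length_Suc_conv)
 have W: "(e # es) ! k \<in> H \<and> vs ! k ~= vs ! (k + 1) \<and> {vs ! k, vs ! (k + 1)} \<subseteq> (e # es) ! k" if "k < l" for k
  using Cons.prems that by (auto simp: is_walk_def)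
 have "is_walk H l' (v # vs') es"
  unfolding is_walk_def
 proof (intro conjI allI impI)
  fix k assume "k < l'"
  then show "es ! k \<in> H" "(v # vs') ! k ~= (v # vs') ! (k + 1)" "{(v # vs') ! k, (v # vs') ! (k + 1)} \<subseteq> es ! k"
   using W[of "Suc k"] l' vs by simp_all
 qed (use l' vs in simp_all)
 from Cons.IH[OF this] show ?case using W[of 0] l' vs by simp
qed

lemma walk_unzip:
 assumes "walk u w" "edges w \<subseteq> H"
 shows "is_walk H (length w) (u # map snd w) (map fst w)" "last (u # map snd w) = dest u w"
proof -
 show "last (u # map snd w) = dest u w"
  by (induction u w rule: dest.induct) auto
 show "is_walk H (length w) (u # map snd w) (map fst w)"
  using assms
 proof (induction u w rule: walk.induct)
  case (2 u e v w)
  then have IH: "is_walk H (length w) (v # map snd w) (map fst w)" by simp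
  show ?case unfolding is_walk_def
  proof (intro conjI allI impI)
   fix k assume k: "k < length ((e, v) # w)"
   show "map fst ((e, v) # w) ! k \<in> H" "(u # map snd ((e, v) # w)) ! k ~= (u # map snd ((e, v) # w)) ! (k + 1)"
    "{(u # map snd ((e, v) # w)) ! k, (u # map snd ((e, v) # w)) ! (k + 1)} \<subseteq> map fst ((e, v) # w) ! k"
    using IH 2(2,3) k unfolding is_walk_def by (cases k; simp)+
  qed simp_all
 qed (simp add: is_walk_def)
qed

lemma walk_exists_iff: "walk_exists H k u v \<longleftrightarrow> (\<exists>w. length w = k \<and> walk u w \<and> edges w \<subseteq> H \<and> dest u w = v)"
proof
 assume "walk_exists H k u v"
 then obtain vs es where "is_walk H k vs es" "hd vs = u" "last vs = v" by (auto simp: walk_exists_def)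
 then show "\<exists>w. length w = k \<and> walk u w \<and> edges w \<subseteq> H \<and> dest u w = v" using walk_zip[of H k vs es] by blast
next
 assume "\<exists>w. length w = k \<and> walk u w \<and> edges w \<subseteq> H \<and> dest u w = v"
 then obtain w where "length w = k" "walk u w" "edges w \<subseteq> H" "dest u w = v" by blast
 then show "walk_exists H k u v" unfolding walk_exists_def
  using walk_unzip[of u w H] by (metis list.sel(1))
qed

lemma sa_nth: "sa H U u w \<longleftrightarrow> (\<forall>k<length w. fst (w ! k) \<in> H \<and>
  fst (w ! k) \<inter> (U \<union> \<Union>(edges (take k w))) = {(u # map snd w) ! k} \<and>
  snd (w ! k) \<in> fst (w ! k) \<and> snd (w ! k) ~= (u # map snd w) ! k)"
proof (induction H U u w rule: sa.induct)
 case (2 H U u e v w)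
 have *: "U \<union> \<Union>(edges (take (Suc k) ((e, v) # w))) = U \<union> e \<union> \<Union>(edges (take k w))" for k by auto
 show ?case
  unfolding sa.simps 2 length_Cons All_less_Suc2 * by simp
qed simp

text \<open>\<open>?seen k\<close> is the set of vertices met before step k. The conditions on
  adjacent and on distant edges say together that an edge meets all earlier ones only in its current
  vertex, which is what \<open>sa\<close> asks.\<close>

lemma sa_walk_equiv:
 "is_sa_walk H (length w) (i # map snd w) (map fst w) \<longleftrightarrow> sa H {i} i w"
proof
 let ?vs = "i # map snd w" and ?es = "map fst w"
 let ?seen = "%k. {i} \<union> \<Union>(edges (take k w))"
 have seen_mem: "?es ! j \<subseteq> ?seen k" if "j < k" "k \<le> length w" for j k
 proof -
  have "w ! j \<in> set (take k w)" using that by (auto simp: in_set_conv_nth intro!: exI[of _ j])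
  then show ?thesis using that by auto
 qed
 have seen_sub: "x = i \<or> (\<exists>j<k. x \<in> ?es ! j)" if "x \<in> ?seen k" "k \<le> length w" for x k
 proof -
  have "x = i \<or> (\<exists>z\<in>set (take k w). x \<in> fst z)" using that by auto
  then show ?thesis
  proof
   assume "\<exists>z\<in>set (take k w). x \<in> fst z"
   then obtain j where "j < length (take k w)" "x \<in> fst (take k w ! j)" by (metis in_set_conv_nth)
   then have "j < k" "x \<in> ?es ! j" using that(2) by simp_all
   then show ?thesis by blast
  qed simp
 qed
 {
  assume "sa H {i} i w"
  then have S: "fst (w ! k) \<in> H" "fst (w ! k) \<inter> ?seen k = {?vs ! k}" "snd (w ! k) \<in> fst (w ! k)" "snd (w ! k) ~= ?vs ! k"
   if "k < length w" for k using that unfolding sa_nth by blast+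
  have wk: "is_walk H (length w) ?vs ?es"
   by (rule walk_unzip) (use sa_walk[OF \<open>sa H {i} i w\<close>] in auto)
  have vin: "?vs ! k \<in> ?seen k" if "k \<le> length w" for k
  proof (cases k)
   case (Suc j)
   then have "?vs ! k \<in> ?es ! j" using S(3)[of j] that by simp
   then show ?thesis using seen_mem[of j k] Suc that by blast
  qed simp
  have new: "?vs ! Suc k \<notin> ?seen k" if "k < length w" for k
  proof
   assume "?vs ! Suc k \<in> ?seen k"
   then have "snd (w ! k) \<in> fst (w ! k) \<inter> ?seen k" using S(3)[OF that] that by simp
   then have "snd (w ! k) \<in> {?vs ! k}" unfolding S(2)[OF that] .
   then show False using S(4)[OF that] by simp
  qed
  have mono: "?seen j \<subseteq> ?seen k" if "j \<le> k" for j k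
   using set_take_subset_set_take[OF that, of w] by blast
  have dist: "distinct ?vs"
   unfolding distinct_conv_nth
  proof (intro allI impI)
   have *: "?vs ! a ~= ?vs ! b" if "a < b" "b < length ?vs" for a b
   proof -
    have "b ~= 0" using that(1) by simp
    then obtain k where k: "b = Suc k" using not0_implies_Suc by blast
    have ak: "a \<le> k" "a \<le> length w" "k < length w" using that k by simp_all
    have "?vs ! a \<in> ?seen k" by (rule subsetD[OF mono[OF ak(1)] vin[OF ak(2)]])
    moreover have "?vs ! b \<notin> ?seen k" unfolding k by (rule new[OF ak(3)])
    ultimately show ?thesis by metis
   qed
   fix a b assume ab: "a < length ?vs" "b < length ?vs" "a ~= b"
   show "?vs ! a ~= ?vs ! b"
   proof (cases "a < b")
    case True
    then show ?thesis using *[OF True ab(2)] by blast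
   next
    case False
    then have "b < a" using ab(3) by simp
    then show ?thesis using *[OF _ ab(1)] by metis
   qed
  qed
  show "is_sa_walk H (length w) ?vs ?es"
   unfolding is_sa_walk_def
  proof (intro conjI allI impI wk dist)
   fix m assume m: "1 \<le> m \<and> m < length w"
   then obtain j where j: "m = Suc j" by (cases m) auto
   have "?es ! (m - 1) \<inter> ?es ! m \<subseteq> {?vs ! m}" using S(2)[of m] seen_mem[of "m - 1" m] m by auto
   moreover have "?vs ! m \<in> ?es ! (m - 1)" using S(3)[of j] m j by simp
   moreover have "?vs ! m \<in> ?es ! m" using S(2)[of m] m by auto
   ultimately show "?es ! (m - 1) \<inter> ?es ! m = {?vs ! m}" by blast
  next
   fix j k assume jk: "j + 2 \<le> k \<and> k < length w"
   then obtain k' where k': "k = Suc k'" "j < k'" by (cases k) auto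
   have "?es ! j \<inter> ?es ! k \<subseteq> {?vs ! k}" using S(2)[of k] seen_mem[of j k] jk by auto
   moreover have "?vs ! k \<notin> ?es ! j" using new[of k'] seen_mem[of j k'] k' jk by auto
   ultimately show "?es ! j \<inter> ?es ! k = {}" by blast
  qed
 }
 {
  assume A: "is_sa_walk H (length w) ?vs ?es"
  then have W: "?es ! k \<in> H" "?vs ! k ~= ?vs ! (k + 1)" "?vs ! k \<in> ?es ! k" "?vs ! (k + 1) \<in> ?es ! k" if "k < length w" for k
   using that unfolding is_sa_walk_def is_walk_def by blast+
  have adj: "?es ! (m - 1) \<inter> ?es ! m = {?vs ! m}" if "1 \<le> m" "m < length w" for m
   using A that unfolding is_sa_walk_def by blast
  have far: "?es ! j \<inter> ?es ! k = {}" if "j + 2 \<le> k" "k < length w" for j k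
   using A that unfolding is_sa_walk_def by blast
  show "sa H {i} i w"
   unfolding sa_nth
  proof (intro allI impI conjI)
   fix k assume k: "k < length w"
   show "fst (w ! k) \<in> H" "snd (w ! k) \<in> fst (w ! k)" "snd (w ! k) ~= ?vs ! k" using W[OF k] k by auto
   have in1: "?vs ! k \<in> fst (w ! k)" using W(3)[OF k] k by simp
   have old: "x = ?vs ! k" if x: "x \<in> ?es ! k" "x \<in> ?es ! j" "j < k" for x j
   proof (cases "j + 2 \<le> k")
    case True
    then show ?thesis using far[OF True k] x by blast
   next
    case False
    then have "j = k - 1" "1 \<le> k" using x(3) by auto
    then show ?thesis using adj[of k] k x by blast
   qed
   have "x = ?vs ! k" if x: "x \<in> fst (w ! k) \<inter> ?seen k" for x
   proof -
    have xe: "x \<in> ?es ! k" using x k by simp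
    consider "x = i" | j where "j < k" "x \<in> ?es ! j" using seen_sub[of x k] x k by auto
    then show ?thesis
    proof cases
     case 1
     show ?thesis
     proof (cases k)
      case (Suc k')
      have "?vs ! 0 \<in> ?es ! 0" using W(3)[of 0] k Suc by (cases w) auto
      then show ?thesis using old[OF xe, of 0] 1 Suc by simp
     qed (use 1 in simp)
    next
     case 2
     then show ?thesis using old[OF xe] by blast
    qed
   qed
   moreover have "?vs ! k \<in> ?seen k"
   proof (cases k)
    case (Suc k')
    then have "?vs ! k \<in> ?es ! k'" using W(4)[of k'] k by simp
    then show ?thesis using seen_mem[of k' k] Suc k by auto
   qed simp
   ultimately show "fst (w ! k) \<inter> ?seen k = {?vs ! k}" using in1 by blast
  qed
 }
qed

lemma Bl_eq_card:
 assumes "i ~= j"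
 shows "Bl H l i j = card {w \<in> saws H i l. dest i w = j}"
proof -
 have "bij_betw (%w. (i # map snd w, map fst w)) {w \<in> saws H i l. dest i w = j}
   {(vs, es). is_sa_walk H l vs es \<and> hd vs = i \<and> last vs = j}"
 proof (rule bij_betw_byWitness[of _ "%(vs, es). zip es (tl vs)"])
  show "\<forall>w\<in>{w \<in> saws H i l. dest i w = j}. (case (i # map snd w, map fst w) of (vs, es) => zip es (tl vs)) = w"
   by (simp add: zip_map_fst_snd)
  show "\<forall>z\<in>{(vs, es). is_sa_walk H l vs es \<and> hd vs = i \<and> last vs = j}.
    (%w. (i # map snd w, map fst w)) (case z of (vs, es) => zip es (tl vs)) = z"
  proof
   fix z assume "z \<in> {(vs, es). is_sa_walk H l vs es \<and> hd vs = i \<and> last vs = j}"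
   then obtain vs es where z: "z = (vs, es)" "length vs = l + 1" "length es = l" "hd vs = i"
    by (auto simp: is_sa_walk_def is_walk_def)
   then have "i # tl vs = vs" by (metis Suc_eq_plus1 length_0_conv list.collapse nat.simps(3))
   then show "(%w. (i # map snd w, map fst w)) (case z of (vs, es) => zip es (tl vs)) = z" using z by simp
  qed
  show "(%w. (i # map snd w, map fst w)) ` {w \<in> saws H i l. dest i w = j} \<subseteq> {(vs, es). is_sa_walk H l vs es \<and> hd vs = i \<and> last vs = j}"
  proof (rule image_subsetI)
   fix w assume "w \<in> {w \<in> saws H i l. dest i w = j}"
   then have w: "length w = l" "sa H {i} i w" "dest i w = j" by (auto simp: saws_def)
   have "last (i # map snd w) = j" using walk_unzip(2)[of i w H] sa_walk[OF w(2)] w(3) by auto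
   then show "(i # map snd w, map fst w) \<in> {(vs, es). is_sa_walk H l vs es \<and> hd vs = i \<and> last vs = j}"
    using w sa_walk_equiv[of H w i] by simp
  qed
  show "(%(vs, es). zip es (tl vs)) ` {(vs, es). is_sa_walk H l vs es \<and> hd vs = i \<and> last vs = j} \<subseteq> {w \<in> saws H i l. dest i w = j}"
  proof (rule image_subsetI)
   fix z assume "z \<in> {(vs, es). is_sa_walk H l vs es \<and> hd vs = i \<and> last vs = j}"
   then obtain vs es where z: "z = (vs, es)" "is_sa_walk H l vs es" "hd vs = i" "last vs = j" by auto
   then have wk: "is_walk H l vs es" by (simp add: is_sa_walk_def)
   then have len: "length vs = l + 1" "length es = l" by (auto simp: is_walk_def)
   then have "i # tl vs = vs" using z(3) by (metis Suc_eq_plus1 length_0_conv list.collapse nat.simps(3))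
   then have eq: "i # map snd (zip es (tl vs)) = vs" "map fst (zip es (tl vs)) = es" using len by simp_all
   have "sa H {i} i (zip es (tl vs))"
    using sa_walk_equiv[of H "zip es (tl vs)" i] z(2) len unfolding eq by simp
   then show "(case z of (vs, es) => zip es (tl vs)) \<in> {w \<in> saws H i l. dest i w = j}"
    using walk_zip[OF wk] z by (simp add: saws_def)
  qed
 qed
 then show ?thesis unfolding Bl_def using assms by (simp add: bij_betw_same_card)
qed

text \<open>If an edge occurs twice, go directly from the entrance of the first use to the exit of
  the later one, or drop both uses when these vertices coincide. Either way the walk becomes
  shorter.\<close>

lemma shortest_distinct:
 assumes w: "walk u w" "edges w \<subseteq> H" and least: "\<forall>k<length w. \<not> walk_exists H k u (dest u w)"
 shows "distinct (map fst w)"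
proof (rule ccontr)
 assume "\<not> distinct (map fst w)"
 then obtain ps e qs rs where m: "map fst w = ps @ (e # (qs @ (e # rs)))"
  using not_distinct_decomp[of "map fst w"] by auto
 then obtain P z where z: "w = P @ z" "map fst z = e # (qs @ (e # rs))" by (auto simp: map_eq_append_conv)
 then obtain a z' where z': "z = a # z'" "fst a = e" "map fst z' = qs @ (e # rs)" by (cases z) auto
 then obtain Q y where y: "z' = Q @ y" "map fst y = e # rs" by (auto simp: map_eq_append_conv)
 then obtain a' R where R: "y = a' # R" "fst a' = e" by (cases y) auto
 have W: "w = P @ a # Q @ a' # R" "fst a = e" "fst a' = e" using z z' y R by simp_all
 obtain v v' where a: "a = (e, v)" "a' = (e, v')" using W by (metis prod.collapse)
 have P: "walk u P" "dest u P \<in> e" "v' \<in> e" "walk v' R" "edges P \<subseteq> H" "e \<in> H" "edges R \<subseteq> H" "dest u w = dest v' R"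
  using w by (auto simp: W a)
 show False
 proof (cases "v' = dest u P")
  case True
  then have "walk u (P @ R)" "dest u (P @ R) = dest u w" "edges (P @ R) \<subseteq> H" using P by auto
  then have "walk_exists H (length (P @ R)) u (dest u w)" unfolding walk_exists_iff by blast
  then show False using least W by simp
 next
  case False
  then have "walk u (P @ (e, v') # R)" "dest u (P @ (e, v') # R) = dest u w" "edges (P @ (e, v') # R) \<subseteq> H" using P by auto
  then have "walk_exists H (length (P @ (e, v') # R)) u (dest u w)" unfolding walk_exists_iff by blast
  then show False using least W by simp
 qed
qed

section \<open>Spheres compared with self-avoiding walks\<close>

context hsbm_params
begin

text \<open>Without a bad step the union of the two walks is a forest by
  \<open>forest_extend\<close>, and there \<open>forest_unique\<close> identifies trails with common
  ends.\<close>

lemma distinct_badpair: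
 assumes w: "w \<in> trails M i t" "w' \<in> trails M i t'" "dest i w = dest i w'" "w ~= w'"
 shows "badpair i w w'"
proof (rule ccontr)
 assume "\<not> badpair i w w'"
 then have b: "bd {i} {} w = 0" "bd ({i} \<union> \<Union>(edges w)) (edges w) w' = 0" by (auto simp: badpair_def)
 have e: "edges w \<subseteq> M" "edges w' \<subseteq> M" using w by (auto simp: trails_def)
 have "\<exists>G' X'. forest G' \<and> finite X' \<and> {} \<union> edges w = G' \<union> X' \<and> card X' \<le> card ({}::nat set set) + bd {i} {} w"
  by (rule forest_extend[OF forest_empty _ _ _ e(1)]) auto
 then obtain G1 X1 where "forest G1" "finite X1" "edges w = G1 \<union> X1" "card X1 \<le> 0" using b by auto
 then have f1: "forest (edges w)" by auto
 have "\<exists>G' X'. forest G' \<and> finite X' \<and> edges w \<union> edges w' = G' \<union> X' \<and>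
   card X' \<le> card ({}::nat set set) + bd ({i} \<union> \<Union>(edges w)) (edges w) w'"
  by (rule forest_extend[OF f1 _ _ _ e(2)]) auto
 then obtain G2 X2 where "forest G2" "finite X2" "edges w \<union> edges w' = G2 \<union> X2" "card X2 \<le> 0" using b by auto
 then have f2: "forest (edges w \<union> edges w')" by auto
 have "w \<in> trails (edges w \<union> edges w') i t" "w' \<in> trails (edges w \<union> edges w') i t'"
  using w(1,2) by (auto simp: trails_def)
 from forest_unique[OF f2 this w(3)] show False using w(4) by blast
qed

lemma cw_ind: "edges w \<subseteq> H ==> cw (ind H) w = 1" "\<not> edges w \<subseteq> H ==> cw (ind H) w = 0"
 by (induction w) (auto simp: cw_Cons)

lemma saws_sub_H: "H \<subseteq> M ==> {w \<in> saws M i t. edges w \<subseteq> H} = saws H i t"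
proof
 have sub: "sa H U u w" if "sa M U u w" "edges w \<subseteq> H" for U u w
  using that by (induction M U u w rule: sa.induct) auto
 have sub': "sa M U u w" if "sa H U u w" "H \<subseteq> M" for U u w
  using that by (induction H U u w rule: sa.induct) auto
 show "{w \<in> saws M i t. edges w \<subseteq> H} \<subseteq> saws H i t" using sub by (auto simp: saws_def)
 assume H: "H \<subseteq> M"
 show "saws H i t \<subseteq> {w \<in> saws M i t. edges w \<subseteq> H}"
 proof
  fix w assume w: "w \<in> saws H i t"
  then have "edges w \<subseteq> H" by (rule saws_sub)
  then show "w \<in> {w \<in> saws M i t. edges w \<subseteq> H}" using w sub'[OF _ H] by (simp add: saws_def)
 qed
qed

lemma sawmat_card:
 assumes "H \<subseteq> M"
 shows "sawmat M (ind H) t i j = real (card {w \<in> saws H i t. dest i w = j})"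
proof -
 have "sawmat M (ind H) t i j = (\<Sum>w\<in>{w \<in> saws M i t. dest i w = j}. if edges w \<subseteq> H then 1 else 0)"
  unfolding sawmat_def by (intro sum.cong) (auto simp: cw_ind)
 also have "... = (\<Sum>w\<in>{w \<in> {w \<in> saws M i t. dest i w = j}. edges w \<subseteq> H}. 1)"
  by (rule sum.inter_filter[symmetric]) simp
 also have "{w \<in> {w \<in> saws M i t. dest i w = j}. edges w \<subseteq> H} = {w \<in> saws H i t. dest i w = j}"
  using saws_sub_H[OF assms, of i t] by blast
 finally show ?thesis by simp
qed

lemma sawmat_diag: "0 < t ==> sawmat M c t i i = 0"
proof -
 assume t: "0 < t"
 have "{w \<in> saws M i t. dest i w = i} = {}"
 proof -
  have False if "w \<in> saws M i t" "dest i w = i" for w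
   using sa_dest_new[of M "{i}" i w] that t by (auto simp: saws_def)
  then show ?thesis by blast
 qed
 then show ?thesis unfolding sawmat_def by (simp only: sum.empty)
qed

lemma Bl_sawmat: "H \<subseteq> M ==> 0 < t ==> real (Bl H t i j) = sawmat M (ind H) t i j"
 using Bl_eq_card[of i j H t] sawmat_card[of H t i j] sawmat_diag[of t "ind H" i]
 by (cases "i = j") (auto simp: Bl_def)

text \<open>Let c be the number of self-avoiding walks of length l from i to j. At distance l with c
  = 0, a shortest walk g is a trail that is not self-avoiding, so (g, g) is bad. At distance l with
  c > 0, the c (c - 1) ordered pairs of distinct walks are bad. If the distance is not l, each of
  the c walks forms a bad pair with a shorter geodesic; therefore \<open>bad_pairs\<close> admits
  all lengths up to l.\<close>

lemma hdist_diff: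
 assumes H: "H \<subseteq> M" and i: "i < n" and l: "0 < l"
 shows "\<bar>of_bool (hdist_eq H i j l) - sawmat M (ind H) l i j\<bar> \<le>
  real (card {z \<in> bad_pairs l i. edges (fst z) \<subseteq> H \<and> edges (snd z) \<subseteq> H \<and> dest i (fst z) = j \<and> dest i (snd z) = j})"
  (is "?X \<le> real (card ?P)")
proof -
 let ?W = "{w \<in> saws H i l. dest i w = j}"
 define c where "c = card ?W"
 have fP: "finite ?P" by simp
 have fH: "finite (saws H i l)" unfolding saws_sub_H[OF H, symmetric] by simp
 then have fW: "finite ?W" by simp
 have Wt: "w \<in> trails M i l \<and> edges w \<subseteq> H \<and> dest i w = j" if "w \<in> ?W" for w
 proof -
  have "w \<in> trails H i l" using that saws_trails[of H i l] by blast
  then show ?thesis using that trails_mono[OF H] saws_sub by blast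
 qed
 have memP: "(w, w') \<in> ?P" if "w \<in> trails M i t" "w' \<in> trails M i t'" "t \<le> l" "t' \<le> l" "edges w \<subseteq> H" "edges w' \<subseteq> H"
   "dest i w = j" "dest i w' = j" "badpair i w w'" for w w' t t'
  using that by (auto simp: bad_pairs_def)
 have X: "?X = \<bar>of_bool (hdist_eq H i j l) - real c\<bar>" unfolding c_def sawmat_card[OF H] ..
 show ?thesis
 proof (cases "hdist_eq H i j l")
  case True
  then obtain g where g: "length g = l" "walk i g" "edges g \<subseteq> H" "dest i g = j" "\<forall>k<l. \<not> walk_exists H k i j"
   unfolding hdist_eq_def walk_exists_iff[of H l] by blast
  have dg: "distinct (map fst g)" by (rule shortest_distinct[OF g(2,3)]) (use g in simp)
  have gt: "g \<in> trails M i l" using g dg H by (auto simp: trails_def)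
  show ?thesis
  proof (cases "c = 0")
   case c0: True
   have "badpair i g g"
   proof (rule ccontr)
    assume "\<not> badpair i g g"
    then have "bd {i} {} g = 0" by (simp add: badpair_def)
    then have "sa H {i} i g"
     by (intro sa_if_no_bad[where F = "{}"]) (use g dg H in \<open>auto intro: dsubsets_finite\<close>)
    then have "g \<in> ?W" using g by (simp add: saws_def)
    moreover have "?W = {}" using c0 fW by (simp only: c_def card_0_eq)
    ultimately show False by (simp only: empty_iff)
   qed
   then have "(g, g) \<in> ?P" using memP[OF gt gt] g by simp
   then have "?P ~= {}" by blast
   then have "0 < card ?P" using fP by (simp only: card_gt_0_iff simp_thms)
   then have "1 \<le> card ?P" by linarith
   then show ?thesis unfolding X using True c0 by simp
  next
   case False
   have "(SIGMA w:?W. ?W - {w}) \<subseteq> ?P"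
   proof (rule subsetI)
    fix z assume z: "z \<in> (SIGMA w:?W. ?W - {w})"
    obtain w w' where zz: "z = (w, w')" by (cases z)
    then have w: "w \<in> ?W" "w' \<in> ?W" "w ~= w'" using z by auto
    have t: "w \<in> trails M i l" "edges w \<subseteq> H" "dest i w = j" using Wt[OF w(1)] by blast+
    have t': "w' \<in> trails M i l" "edges w' \<subseteq> H" "dest i w' = j" using Wt[OF w(2)] by blast+
    have "badpair i w w'" by (rule distinct_badpair[OF t(1) t'(1) _ w(3)]) (simp only: t(3) t'(3))
    then show "z \<in> ?P" unfolding zz by (rule memP[OF t(1) t'(1) order_refl order_refl t(2) t'(2) t(3) t'(3)])
   qed
   then have "card (SIGMA w:?W. ?W - {w}) \<le> card ?P" by (rule card_mono[OF fP])
   moreover have "card (SIGMA w:?W. ?W - {w}) = c * (c - 1)"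
    using fW by (subst card_SigmaI) (auto simp: c_def)
   moreover have "c - 1 \<le> c * (c - 1)" using False by simp
   ultimately have "c - 1 \<le> card ?P" by linarith
   then show ?thesis unfolding X using True False by (simp add: of_nat_diff)
  qed
 next
  case nd: False
  show ?thesis
  proof (cases "c = 0")
   case False
   then obtain w0 where w0: "w0 \<in> ?W" unfolding c_def by (metis card.empty ex_in_conv)
   have "walk_exists H l i j" unfolding walk_exists_iff
    using w0 sa_walk[of H "{i}" i w0] by (auto simp: saws_def)
   then have ex: "\<exists>k. k < l \<and> walk_exists H k i j" using nd by (auto simp: hdist_eq_def)
   define k where "k = (LEAST k. walk_exists H k i j)"
   have k: "walk_exists H k i j" "\<forall>k'<k. \<not> walk_exists H k' i j" "k < l"
    using ex LeastI[of "%k. walk_exists H k i j"] not_less_Least[of _ "%k. walk_exists H k i j"]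
     Least_le[of "%k. walk_exists H k i j"] unfolding k_def by (blast, blast, meson le_less_trans)
   obtain g where g: "length g = k" "walk i g" "edges g \<subseteq> H" "dest i g = j" using k(1) unfolding walk_exists_iff by blast
   have dg: "distinct (map fst g)" by (rule shortest_distinct[OF g(2,3)]) (use g k in simp)
   have gt: "g \<in> trails M i k" using g dg H by (auto simp: trails_def)
   have "(%w. (w, g)) ` ?W \<subseteq> ?P"
   proof (rule image_subsetI)
    fix w assume w: "w \<in> ?W"
    have t: "w \<in> trails M i l" "edges w \<subseteq> H" "dest i w = j" using Wt[OF w] by blast+
    have "length w = l" using w by (simp add: saws_def)
    then have "w ~= g" using g(1) k(3) by auto
    have "badpair i w g" by (rule distinct_badpair[OF t(1) gt _ \<open>w ~= g\<close>]) (simp only: t(3) g(4))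
    then show "(w, g) \<in> ?P"
     by (rule memP[OF t(1) gt order_refl less_imp_le[OF k(3)] t(2) g(3) t(3) g(4)])
   qed
   from card_mono[OF fP this] have "c \<le> card ?P" unfolding c_def by (subst (asm) card_image) (auto simp: inj_on_def)
   then show ?thesis unfolding X using nd by simp
  qed (use nd X in simp)
 qed
qed

text \<open>The bad pairs charged to different j are disjoint, since j is their common end; together
  they are at most all bad pairs present in \<open>H\<close>.\<close>

lemma sphere_diff:
 assumes H: "H \<subseteq> M" and i: "i < n" and l: "0 < l" and x: "!!j. \<bar>x j\<bar> \<le> 1"
 shows "\<bar>(\<Sum>j\<in>{j \<in> {0..<n}. hdist_eq H i j l}. x j) - (\<Sum>j<n. sawmat M (ind H) l i j * x j)\<bar>
  \<le> (\<Sum>(w, w')\<in>bad_pairs l i. cw (ind H) w * cw (ind H) w')"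
proof -
 let ?B = "{z \<in> bad_pairs l i. edges (fst z) \<subseteq> H \<and> edges (snd z) \<subseteq> H}"
 let ?P = "%j. {z \<in> bad_pairs l i. edges (fst z) \<subseteq> H \<and> edges (snd z) \<subseteq> H \<and> dest i (fst z) = j \<and> dest i (snd z) = j}"
 have "(\<Sum>j\<in>{j \<in> {0..<n}. hdist_eq H i j l}. x j) = (\<Sum>j<n. of_bool (hdist_eq H i j l) * x j)"
  by (rule sum.mono_neutral_cong_left) auto
 then have "\<bar>(\<Sum>j\<in>{j \<in> {0..<n}. hdist_eq H i j l}. x j) - (\<Sum>j<n. sawmat M (ind H) l i j * x j)\<bar>
  = \<bar>\<Sum>j<n. (of_bool (hdist_eq H i j l) - sawmat M (ind H) l i j) * x j\<bar>"
  by (simp add: sum_subtractf left_diff_distrib)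
 also have "... \<le> (\<Sum>j<n. \<bar>of_bool (hdist_eq H i j l) - sawmat M (ind H) l i j\<bar> * \<bar>x j\<bar>)"
  by (rule order_trans[OF sum_abs]) (simp add: abs_mult)
 also have "... \<le> (\<Sum>j<n. real (card (?P j)) * 1)"
  by (intro sum_mono mult_mono hdist_diff H i l x) auto
 also have "... = real (card (\<Union>j\<in>{..<n}. ?P j))"
  by (subst card_UN_disjoint) auto
 also have "... \<le> real (card ?B)"
  by (intro of_nat_mono card_mono) auto
 also have "... = (\<Sum>z\<in>bad_pairs l i. if edges (fst z) \<subseteq> H \<and> edges (snd z) \<subseteq> H then 1 else 0)"
  by (simp add: sum.inter_filter[symmetric])
 also have "... = (\<Sum>(w, w')\<in>bad_pairs l i. cw (ind H) w * cw (ind H) w')"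
 proof (rule sum.cong[OF refl])
  fix z :: "(nat set \<times> nat) list \<times> (nat set \<times> nat) list"
  obtain w w' where z: "z = (w, w')" by (cases z)
  show "(if edges (fst z) \<subseteq> H \<and> edges (snd z) \<subseteq> H then 1 else 0) = (case z of (w, w') => cw (ind H) w * cw (ind H) w')"
   unfolding z prod.case fst_conv snd_conv
   by (cases "edges w \<subseteq> H"; cases "edges w' \<subseteq> H")
     (simp_all only: cw_ind simp_thms if_True if_False mult_1 mult_zero_left mult_zero_right)
 qed
 finally show ?thesis .
qed

end

section \<open>The spectral theorem and the order of eigenvalues\<close>

definition ip :: "nat => (nat => real) => (nat => real) => real" where
 "ip n x y = (\<Sum>i<n. x i * y i)"

definition mv :: "nat => (nat => nat => real) => (nat => real) => nat => real" where
 "mv n A x i = (\<Sum>j<n. A i j * x j)"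

abbreviation nm :: "nat => (nat => real) => real" where
 "nm n x \<equiv> L2_set x {..<n}"

definition symm :: "nat => (nat => nat => real) => bool" where
 "symm n A \<longleftrightarrow> (\<forall>i<n. \<forall>j<n. A i j = A j i)"

lemma nm_sq: "(nm n x)^2 = ip n x x"
 unfolding L2_set_def ip_def by (simp add: sum_nonneg power2_eq_square)

lemma ip_sym: "ip n x y = ip n y x"
 unfolding ip_def by (simp add: mult.commute)

lemma ip_add: "ip n (%i. x i + y i) z = ip n x z + ip n y z" "ip n z (%i. x i + y i) = ip n z x + ip n z y"
 unfolding ip_def by (simp_all add: algebra_simps sum.distrib)

lemma ip_diff: "ip n (%i. x i - y i) z = ip n x z - ip n y z" "ip n z (%i. x i - y i) = ip n z x - ip n z y"
 unfolding ip_def by (simp_all add: algebra_simps sum_subtractf)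

lemma ip_scale: "ip n (%i. c * x i) z = c * ip n x z" "ip n z (%i. c * x i) = c * ip n z x"
 unfolding ip_def by (simp_all add: sum_distrib_left mult_ac)

lemma ip_nonneg: "0 \<le> ip n x x"
 unfolding ip_def by (intro sum_nonneg) auto

lemma ip_cong: "(!!i. i < n ==> x i = x' i) ==> (!!i. i < n ==> y i = y' i) ==> ip n x y = ip n x' y'"
 unfolding ip_def by (intro sum.cong) auto

lemma ip_eq_0: "ip n x x = 0 ==> i < n ==> x i = 0"
 unfolding ip_def by (subst (asm) sum_nonneg_eq_0_iff) auto

lemma ip_le: "\<bar>ip n x y\<bar> \<le> nm n x * nm n y"
proof -
 have "\<bar>ip n x y\<bar> \<le> (\<Sum>i<n. \<bar>x i\<bar> * \<bar>y i\<bar>)"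
  unfolding ip_def by (rule order.trans[OF sum_abs]) (simp add: abs_mult)
 also have "... \<le> nm n x * nm n y" by (rule L2_set_mult_ineq)
 finally show ?thesis .
qed

lemma mv_add: "mv n A (%i. x i + y i) = (%i. mv n A x i + mv n A y i)"
 unfolding mv_def by (simp add: algebra_simps sum.distrib)

lemma mv_scale: "mv n A (%i. c * x i) = (%i. c * mv n A x i)"
 unfolding mv_def by (simp add: sum_distrib_left mult_ac)

lemma ip_mv: "symm n A ==> ip n x (mv n A y) = ip n (mv n A x) y"
proof -
 assume S: "symm n A"
 have "ip n x (mv n A y) = (\<Sum>i<n. \<Sum>j<n. x i * (A i j * y j))"
  unfolding ip_def mv_def by (simp add: sum_distrib_left)
 also have "... = (\<Sum>j<n. \<Sum>i<n. x i * (A i j * y j))" by (rule sum.swap)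
 also have "... = (\<Sum>j<n. \<Sum>i<n. A j i * x i * y j)"
  using S unfolding symm_def by (intro sum.cong refl) (simp add: mult_ac)
 also have "... = ip n (mv n A x) y" unfolding ip_def mv_def by (simp add: sum_distrib_right)
 finally show ?thesis .
qed

text \<open>Vectors are functions on nat, so the coordinates from n on are pinned to 0; this makes
  the set compact in the product topology.\<close>

definition unit_perp :: "nat => (nat => nat => real) => nat => (nat => real) set" where
 "unit_perp n v k = {x. (\<forall>i\<ge>n. x i = 0) \<and> ip n x x = 1 \<and> (\<forall>j<k. ip n x (v j) = 0)}"

lemma compact_unit_perp: "compact (unit_perp n v k)"
proof -
 let ?B = "PiE UNIV (%i. if i < n then {-1..1::real} else {0}) :: (nat => real) set"
 have "compactin (product_topology (%_. euclidean) UNIV) ?B"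
  by (subst compactin_PiE) auto
 then have B: "compact ?B" by (simp add: euclidean_product_topology)
 have c[continuous_intros]: "continuous_on UNIV (%x::nat=>real. x i)" for i
  by (rule continuous_on_product_coordinates)
 have cl: "closed (unit_perp n v k)"
  unfolding unit_perp_def ip_def
  by (intro closed_Collect_conj closed_Collect_all closed_Collect_imp closed_Collect_eq open_Collect_const continuous_intros)
 have "x i \<in> (if i < n then {-1..1} else {0})" if x: "x \<in> unit_perp n v k" for x i
 proof (cases "i < n")
  case True
  have "x i * x i \<le> ip n x x" unfolding ip_def
   by (rule member_le_sum[of i "{..<n}" "%i. x i * x i"]) (use True in auto)
  then have "(x i)^2 \<le> 1" using x unfolding unit_perp_def by (simp add: power2_eq_square)
  then have "\<bar>x i\<bar> \<le> 1" by (simp add: abs_square_le_1)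
  then show ?thesis using True by auto
 qed (use x in \<open>auto simp: unit_perp_def\<close>)
 then have "unit_perp n v k \<subseteq> ?B" unfolding PiE_def by auto
 then have "unit_perp n v k = ?B \<inter> unit_perp n v k" by blast
 then show ?thesis using compact_Int_closed[OF B cl] by metis
qed

lemma unit_perp_nonempty:
 assumes k: "k < n"
 shows "unit_perp n v k ~= {}"
proof -
 \<comment> \<open>Row k is replaced by 0, so the matrix is singular, and a kernel vector satisfies
   the constraints j < k.\<close>
 define M where "M = Matrix.mat_of_row_fun n n (%i. if i = k then 0\<^sub>v n else Matrix.vec n (v i))"
 have M: "(M::real mat) \<in> carrier_mat n n" unfolding M_def by simp
 have "Determinant.det M = 0" unfolding M_def
  by (rule Determinant.det_row_0[OF k, of "%i. Matrix.vec n (v i)"]) auto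
 then obtain z where z: "z \<in> carrier_vec n" "z ~= 0\<^sub>v n" "M *\<^sub>v z = 0\<^sub>v n"
  using det_0_iff_vec_prod_zero[OF M] by blast
 define y where "y i = (if i < n then vec_index z i else 0)" for i
 have yv: "ip n y (v j) = 0" if "j < k" for j
 proof -
  have jn: "j < n" using that k by simp
  have "0 = vec_index (M *\<^sub>v z) j" using z jn by simp
  also have "... = scalar_prod (Matrix.row M j) z" using jn M by simp
  also have "Matrix.row M j = Matrix.vec n (v j)" unfolding M_def using that jn by (subst row_mat_of_row_fun) auto
  finally show ?thesis using z unfolding ip_def y_def scalar_prod_def
   by (simp add: atLeast0LessThan mult.commute)
 qed
 have "\<exists>i<n. vec_index z i ~= 0" using z by (metis carrier_vecD eq_vecI index_zero_vec)
 then obtain i0 where i0: "i0 < n" "y i0 ~= 0" unfolding y_def by auto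
 have "ip n y y ~= 0" using ip_eq_0[of n y i0] i0 by blast
 then have pos: "0 < ip n y y" using ip_nonneg[of n y] by simp
 let ?x = "%i. (1 / sqrt (ip n y y)) * y i"
 have "ip n ?x ?x = 1" unfolding ip_scale using pos by simp
 moreover have "ip n ?x (v j) = 0" if "j < k" for j unfolding ip_scale yv[OF that] by simp
 moreover have "?x i = 0" if "i \<ge> n" for i using that unfolding y_def by simp
 ultimately have "?x \<in> unit_perp n v k" unfolding unit_perp_def by blast
 then show ?thesis by blast
qed

text \<open>A maximiser of the quadratic form on \<open>unit_perp\<close> is an eigenvector: its
  residual \<open>w\<close> is again orthogonal to the earlier eigenvectors, and moving along
  \<open>w\<close> would otherwise increase the Rayleigh quotient.\<close>

lemma spectral_step:
 assumes S: "symm n A" and k: "k < n"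
  and ev: "!!j i. j < k ==> i < n ==> mv n A (v j) i = lam j * v j i"
 shows "\<exists>x \<mu>. ip n x x = 1 \<and> (\<forall>j<k. ip n x (v j) = 0) \<and> (\<forall>i<n. mv n A x i = \<mu> * x i) \<and>
  (\<forall>y. (\<forall>j<k. ip n y (v j) = 0) --> ip n y (mv n A y) \<le> \<mu> * ip n y y)"
proof -
 have c[continuous_intros]: "continuous_on X (%x::nat=>real. x i)" for i X
  by (rule continuous_on_subset[OF continuous_on_product_coordinates]) simp
 have "continuous_on (unit_perp n v k) (%x. ip n x (mv n A x))"
  unfolding ip_def mv_def by (intro continuous_intros)
 from continuous_attains_sup[OF compact_unit_perp unit_perp_nonempty[OF k] this]
 obtain x where x: "x \<in> unit_perp n v k"
  and mx: "!!y. y \<in> unit_perp n v k ==> ip n y (mv n A y) \<le> ip n x (mv n A x)" by blast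
 define \<mu> where "\<mu> = ip n x (mv n A x)"
 have x1: "ip n x x = 1" and xv: "!!j. j < k ==> ip n x (v j) = 0" using x unfolding unit_perp_def by auto
 have R: "ip n y (mv n A y) \<le> \<mu> * ip n y y" if y: "!!j. j < k ==> ip n y (v j) = 0" for y
 proof (cases "ip n y y = 0")
  case True
  then have "!!i. i < n ==> y i = 0" by (rule ip_eq_0)
  then have "ip n y (mv n A y) = 0" unfolding ip_def by simp
  then show ?thesis using True by simp
 next
  case False
  then have pos: "ip n y y > 0" using ip_nonneg[of n y] by simp
  define c where "c = 1 / sqrt (ip n y y)"
  have c2: "c * c * ip n y y = 1" unfolding c_def using pos by simp
  define z where "z i = (if i < n then c * y i else 0)" for i
  have zy: "ip n z w = c * ip n y w" for w
  proof -
   have "ip n z w = ip n (%i. c * y i) w" by (rule ip_cong) (auto simp: z_def)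
   then show ?thesis by (simp add: ip_scale)
  qed
  have "mv n A z = mv n A (%i. c * y i)" unfolding mv_def z_def by (intro ext sum.cong) auto
  then have mz: "mv n A z = (%i. c * mv n A y i)" by (simp add: mv_scale)
  have "z \<in> unit_perp n v k" unfolding unit_perp_def
  proof (intro CollectI conjI allI impI)
   show "ip n z z = 1" using c2 unfolding zy ip_sym[of n y z] by (simp add: mult_ac)
  qed (use y in \<open>auto simp: zy z_def\<close>)
  from mx[OF this] have "c * (c * ip n y (mv n A y)) \<le> \<mu>" unfolding \<mu>_def mz zy by (simp add: ip_scale)
  then have "c * (c * ip n y (mv n A y)) * ip n y y \<le> \<mu> * ip n y y" using pos by (intro mult_right_mono) auto
  moreover have "c * (c * ip n y (mv n A y)) * ip n y y = ip n y (mv n A y)"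
   using c2 by (metis mult.assoc mult.commute mult_1)
  ultimately show ?thesis by simp
 qed
 define w where "w i = mv n A x i - \<mu> * x i" for i
 have wv: "ip n w (v j) = 0" if j: "j < k" for j
 proof -
  have "ip n (mv n A x) (v j) = ip n x (mv n A (v j))" using ip_mv[OF S] by simp
  also have "... = ip n x (%i. lam j * v j i)" by (rule ip_cong) (auto simp: ev[OF j])
  also have "... = 0" using xv[OF j] by (simp add: ip_scale)
  finally show ?thesis unfolding w_def using xv[OF j] by (simp add: ip_diff ip_scale)
 qed
 define K where "K = \<mu> * ip n w w - ip n w (mv n A w)"
 \<comment> \<open>Maximality tested at x + t w: the term linear in t is
   \<open>2 * t * ip n w w\<close>, the others are quadratic. A small positive t then forces
   \<open>w\<close> to vanish.\<close>
 have q: "2 * t * ip n w w \<le> t * t * K" for t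
 proof -
  let ?y = "%i. x i + t * w i"
  have "ip n ?y (v j) = 0" if "j < k" for j using xv[OF that] wv[OF that] by (simp add: ip_add ip_scale)
  from R[OF this] have "ip n ?y (mv n A ?y) \<le> \<mu> * ip n ?y ?y" by simp
  moreover have "ip n ?y (mv n A ?y) = \<mu> + 2 * t * ip n w (mv n A x) + t * t * ip n w (mv n A w)"
   unfolding mv_add mv_scale ip_add ip_scale \<mu>_def
   using ip_mv[OF S, of x w] ip_sym[of n "mv n A x" w] by (simp add: algebra_simps)
  moreover have "ip n ?y ?y = 1 + 2 * t * ip n w x + t * t * ip n w w"
   unfolding ip_add ip_scale x1 using ip_sym[of n x w] by (simp add: algebra_simps)
  moreover have "ip n w w = ip n w (%i. mv n A x i - \<mu> * x i)" by (rule ip_cong) (auto simp: w_def)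
  then have "2 * t * ip n w w = 2 * t * (ip n w (mv n A x) - \<mu> * ip n w x)" by (simp add: ip_diff ip_scale)
  ultimately show ?thesis unfolding K_def by (simp add: algebra_simps del: mult_cancel_left)
 qed
 have w0: "ip n w w = 0"
 proof (rule ccontr)
  assume "ip n w w ~= 0"
  then have p: "ip n w w > 0" using ip_nonneg[of n w] by simp
  define t where "t = ip n w w / (\<bar>K\<bar> + 1)"
  have t: "t > 0" unfolding t_def using p by simp
  have "2 * t * ip n w w \<le> t * (t * K)" using q[of t] by (simp add: mult.assoc)
  then have "2 * ip n w w \<le> t * K" using t by (simp add: mult.assoc mult.left_commute[of 2 t])
  also have "... \<le> t * (\<bar>K\<bar> + 1)" using t by (intro mult_left_mono) auto
  also have "... = ip n w w" unfolding t_def by simp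
  finally show False using p by simp
 qed
 have "mv n A x i = \<mu> * x i" if "i < n" for i using ip_eq_0[OF w0 that] unfolding w_def by simp
 then show ?thesis using x1 xv R by blast
qed

text \<open>The maximality on orthogonal complements is kept as a third property: it orders the
  eigenvalues and bounds them from below by test vectors.\<close>

lemma spectral_theorem:
 assumes S: "symm n A"
 obtains v lam where
  "!!j i. j < n ==> i < n ==> mv n A (v j) i = lam j * v j i"
  "!!j m. j < n ==> m < n ==> ip n (v j) (v m) = of_bool (j = m)"
  "!!j y. j < n ==> (!!m. m < j ==> ip n y (v m) = 0) ==> ip n y (mv n A y) \<le> lam j * ip n y y"
proof -
 have "\<exists>v lam. (\<forall>j<k. \<forall>i<n. mv n A (v j) i = lam j * v j i) \<and>
   (\<forall>j<k. \<forall>m<k. ip n (v j) (v m) = of_bool (j = m)) \<and>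
   (\<forall>j<k. \<forall>y. (\<forall>m<j. ip n y (v m) = 0) --> ip n y (mv n A y) \<le> lam j * ip n y y)" if "k \<le> n" for k
  using that
 proof (induction k)
  case 0
  show ?case by simp
 next
  case (Suc k)
  then obtain v lam where vl: "!!j i. j<k ==> i<n ==> mv n A (v j) i = lam j * v j i"
   "!!j m. j<k ==> m<k ==> ip n (v j) (v m) = of_bool (j = m)"
   "!!j y. j<k ==> (\<forall>m<j. ip n y (v m) = 0) ==> ip n y (mv n A y) \<le> lam j * ip n y y"
   by (metis Suc_leD)
  have "k < n" using Suc.prems by simp
  from spectral_step[where v = v and lam = lam, OF S this vl(1)] obtain x \<mu> where x: "ip n x x = 1" "!!j. j<k ==> ip n x (v j) = 0"
   "!!i. i<n ==> mv n A x i = \<mu> * x i"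
   "!!y. (\<forall>j<k. ip n y (v j) = 0) ==> ip n y (mv n A y) \<le> \<mu> * ip n y y" by blast
  have x': "ip n (v j) x = 0" if "j < k" for j using x(2)[OF that] by (simp add: ip_sym)
  show ?case
   by (rule exI[of _ "v(k := x)"], rule exI[of _ "lam(k := \<mu>)"])
    (use vl x x' in \<open>auto simp: less_Suc_eq\<close>)
 qed
 from this[OF order.refl] show ?thesis
 proof (elim exE conjE)
  fix v lam
  assume h: "\<forall>j<n. \<forall>i<n. mv n A (v j) i = lam j * v j i"
   "\<forall>j<n. \<forall>m<n. ip n (v j) (v m) = of_bool (j = m)"
   "\<forall>j<n. \<forall>y. (\<forall>m<j. ip n y (v m) = 0) --> ip n y (mv n A y) \<le> lam j * ip n y y"
  show ?thesis
  proof (rule that[of v lam])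
   fix j y assume "j < n" "!!m. m < j ==> ip n y (v m) = 0"
   then show "ip n y (mv n A y) \<le> lam j * ip n y y" using h(3) by simp
  qed (use h(1,2) in simp_all)
 qed
qed

text \<open>A left inverse of a square matrix is a right inverse, so orthonormal rows give
  orthonormal columns.\<close>

lemma complete:
 assumes on: "!!j m. j < n ==> m < n ==> ip n (v j) (v m) = of_bool (j = m)"
  and ij: "i < n" "j < n"
 shows "(\<Sum>k<n. v k i * v k j) = of_bool (i = j)"
proof -
 define P where "P = Matrix.mat n n (%(i, k). v k i)"
 define Q where "Q = Matrix.mat n n (%(k, i). v k i)"
 have P: "(P::real mat) \<in> carrier_mat n n" and Q: "(Q::real mat) \<in> carrier_mat n n" unfolding P_def Q_def by auto
 have "Q * P = 1\<^sub>m n"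
 proof (rule eq_matI)
  fix i j assume "i < dim_row (1\<^sub>m n :: real mat)" "j < dim_col (1\<^sub>m n :: real mat)"
  then have ij: "i < n" "j < n" by auto
  then have "(Q * P) $$ (i, j) = ip n (v i) (v j)"
   unfolding Q_def P_def ip_def by (simp add: scalar_prod_def atLeast0LessThan)
  then show "(Q * P) $$ (i, j) = 1\<^sub>m n $$ (i, j)" using on ij by simp
 qed (auto simp: P_def Q_def)
 from mat_mult_left_right_inverse[OF Q P this] have "(P * Q) $$ (i, j) = 1\<^sub>m n $$ (i, j)" by simp
 moreover have "(P * Q) $$ (i, j) = (\<Sum>k<n. v k i * v k j)"
  unfolding Q_def P_def using ij by (simp add: scalar_prod_def atLeast0LessThan)
 ultimately show ?thesis using ij by simp
qed

lemma expand:
 assumes on: "!!j m. j < n ==> m < n ==> ip n (v j) (v m) = of_bool (j = m)" and i: "i < n"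
 shows "x i = (\<Sum>k<n. ip n x (v k) * v k i)"
proof -
 have "(\<Sum>k<n. ip n x (v k) * v k i) = (\<Sum>k<n. \<Sum>j<n. x j * (v k j * v k i))"
  unfolding ip_def sum_distrib_right by (simp add: mult_ac)
 also have "... = (\<Sum>j<n. x j * (\<Sum>k<n. v k j * v k i))"
  by (subst sum.swap) (simp add: sum_distrib_left)
 also have "... = (\<Sum>j<n. x j * of_bool (j = i))"
  by (intro sum.cong refl arg_cong2[of _ _ _ _ "(*)"] complete[OF on]) (use i in auto)
 also have "... = x i" using i by simp
 finally show ?thesis by simp
qed

lemma order_linear_factors:
 fixes n :: nat
 shows "order x (\<Prod>k<n. [:- lam k, 1::real:]) = card {k\<in>{..<n}. lam k = x}"
proof (induction n)
 case (Suc n)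
 have nz: "(\<Prod>k<n. [:- lam k, 1::real:]) * [:- lam n, 1:] ~= 0"
  by (simp only: mult_eq_0_iff prod_zero_iff finite_lessThan) auto
 have o: "order x [:- lam n, 1:] = of_bool (lam n = x)"
  using order_power_n_n[of x 1] order_0I[of "[:- lam n, 1:]" x] by auto
 have "{k\<in>{..<Suc n}. lam k = x} = {k\<in>{..<n}. lam k = x} \<union> (if lam n = x then {n} else {})"
  by (auto simp: less_Suc_eq)
 then have "card {k\<in>{..<Suc n}. lam k = x} = card {k\<in>{..<n}. lam k = x} + of_bool (lam n = x)"
  by (simp add: card_insert_if)
 then show ?case using nz by (simp only: prod.lessThan_Suc order_mult[OF nz] Suc.IH o)
qed simp

text \<open>Diagonalisation writes the characteristic polynomial as a product of linear factors, so
  counting roots with multiplicity above a level becomes counting indices. \<open>kth_eig\<close>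
  counts from 1 and \<open>lam\<close> from 0, hence \<open>Suc k\<close>.\<close>

lemma kth_eig_eq:
 assumes ev: "!!j i. j < n ==> i < n ==> mv n A (v j) i = lam j * v j i"
  and on: "!!j m. j < n ==> m < n ==> ip n (v j) (v m) = of_bool (j = m)"
  and dec: "!!j m. j \<le> m ==> m < n ==> lam m \<le> lam j"
  and k: "k < n"
 shows "kth_eig (Matrix.mat n n (%(i, j). A i j)) (Suc k) = lam k"
proof -
 define B where "B = Matrix.mat n n (%(i, j). A i j)"
 define P where "P = Matrix.mat n n (%(i, k). v k i)"
 define Q where "Q = Matrix.mat n n (%(k, i). v k i)"
 define L where "L = Matrix.mat n n (%(i, j). if i = j then lam i else 0)"
 have car: "B \<in> carrier_mat n n" "P \<in> carrier_mat n n" "Q \<in> carrier_mat n n" "L \<in> carrier_mat n n"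
  unfolding B_def P_def Q_def L_def by auto
 have PQ: "P * Q = 1\<^sub>m n"
 proof (rule eq_matI)
  fix i j assume "i < dim_row (1\<^sub>m n :: real mat)" "j < dim_col (1\<^sub>m n :: real mat)"
  then have ij: "i < n" "j < n" by auto
  then have "(P * Q) $$ (i, j) = (\<Sum>k<n. v k i * v k j)"
   unfolding Q_def P_def by (simp add: scalar_prod_def atLeast0LessThan)
  then show "(P * Q) $$ (i, j) = 1\<^sub>m n $$ (i, j)" using complete[OF on, of i j] ij by simp
 qed (auto simp: P_def Q_def)
 have QP: "Q * P = 1\<^sub>m n" by (rule mat_mult_left_right_inverse[OF car(2,3) PQ])
 have BP: "B * P = P * L"
 proof (rule eq_matI)
  fix i j assume "i < dim_row (P * L)" "j < dim_col (P * L)"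
  then have ij: "i < n" "j < n" using car by auto
  then have "(B * P) $$ (i, j) = mv n A (v j) i"
   unfolding B_def P_def mv_def by (simp add: scalar_prod_def atLeast0LessThan)
  moreover have "(P * L) $$ (i, j) = v j i * lam j"
   unfolding P_def L_def using ij by (simp add: scalar_prod_def atLeast0LessThan if_distrib cong: if_cong)
  ultimately show "(B * P) $$ (i, j) = (P * L) $$ (i, j)" using ev ij by simp
 qed (use car in auto)
 have "B = B * (P * Q)" using car PQ by simp
 also have "... = (B * P) * Q" using assoc_mult_mat[OF car(1,2,3)] by simp
 finally have "B = P * L * Q" using BP by simp
 then have "similar_mat B L" using car PQ QP by (intro similar_matI[of _ _ P Q n]) auto
 then have "char_poly B = char_poly L" by (rule char_poly_similar)
 also have "... = (\<Prod>a\<leftarrow>diag_mat L. [:- a, 1:])"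
  by (rule char_poly_upper_triangular[OF car(4)]) (auto simp: upper_triangular_def L_def)
 also have "diag_mat L = map lam [0..<n]" unfolding diag_mat_def L_def by simp
 also have "(\<Prod>a\<leftarrow>map lam [0..<n]. [:- a, 1:]) = (\<Prod>k<n. [:- lam k, 1:])"
  by (simp add: prod.list_conv_set_nth atLeast0LessThan comp_def)
 finally have cp: "char_poly B = (\<Prod>k<n. [:- lam k, 1:])" .
 have rt: "poly (char_poly B) x = 0 \<longleftrightarrow> x \<in> lam ` {..<n}" for x
  unfolding cp poly_prod by (auto simp: prod_zero_iff)
 have cnt: "(\<Sum>\<nu>\<in>{\<nu>. poly (char_poly B) \<nu> = 0 \<and> \<mu> \<le> \<nu>}. order \<nu> (char_poly B)) = card {j\<in>{..<n}. \<mu> \<le> lam j}" for \<mu>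
 proof -
  have s: "{\<nu>. poly (char_poly B) \<nu> = 0 \<and> \<mu> \<le> \<nu>} = lam ` {j\<in>{..<n}. \<mu> \<le> lam j}" unfolding rt by auto
  have "card {j\<in>{..<n}. \<mu> \<le> lam j} = (\<Sum>\<nu>\<in>lam ` {j\<in>{..<n}. \<mu> \<le> lam j}. card {j\<in>{j\<in>{..<n}. \<mu> \<le> lam j}. lam j = \<nu>})"
   unfolding card_eq_sum by (rule sum.image_gen) auto
  also have "... = (\<Sum>\<nu>\<in>lam ` {j\<in>{..<n}. \<mu> \<le> lam j}. order \<nu> (char_poly B))"
   unfolding cp order_linear_factors by (intro sum.cong refl arg_cong[of _ _ card]) auto
  finally show ?thesis unfolding s by simp
 qed
 have "kth_eig B (Suc k) = lam k"
  unfolding kth_eig_def unfolding cnt unfolding rt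
 proof (rule Max_eqI)
  show "finite {\<mu>. \<mu> \<in> lam ` {..<n} \<and> Suc k \<le> card {j\<in>{..<n}. \<mu> \<le> lam j}}"
   by (rule finite_subset[of _ "lam ` {..<n}"]) auto
  have "{..k} \<subseteq> {j\<in>{..<n}. lam k \<le> lam j}" using k dec by auto
  then have "card {..k} \<le> card {j\<in>{..<n}. lam k \<le> lam j}" by (intro card_mono) auto
  then show "lam k \<in> {\<mu>. \<mu> \<in> lam ` {..<n} \<and> Suc k \<le> card {j\<in>{..<n}. \<mu> \<le> lam j}}" using k by auto
  fix \<mu> assume "\<mu> \<in> {\<mu>. \<mu> \<in> lam ` {..<n} \<and> Suc k \<le> card {j\<in>{..<n}. \<mu> \<le> lam j}}"
  then have c: "Suc k \<le> card {j\<in>{..<n}. \<mu> \<le> lam j}" by simp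
  have "\<exists>j\<ge>k. j < n \<and> \<mu> \<le> lam j"
  proof (rule ccontr)
   assume "\<not> ?thesis"
   then have "{j\<in>{..<n}. \<mu> \<le> lam j} \<subseteq> {..<k}" by (auto simp: not_le[symmetric])
   then have "card {j\<in>{..<n}. \<mu> \<le> lam j} \<le> card {..<k}" by (intro card_mono) auto
   then show False using c by simp
  qed
  then show "\<mu> \<le> lam k" using dec order.trans by blast
 qed
 then show ?thesis unfolding B_def .
qed

section \<open>Two spikes above a bulk\<close>

lemma ip_sum: "ip n (%i. \<Sum>t\<in>T. c t * w t i) z = (\<Sum>t\<in>T. c t * ip n (w t) z)"
proof -
 have "ip n (%i. \<Sum>t\<in>T. c t * w t i) z = (\<Sum>i<n. \<Sum>t\<in>T. c t * (w t i * z i))"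
  unfolding ip_def sum_distrib_right by (simp add: mult.assoc)
 then show ?thesis by (subst (asm) sum.swap) (simp add: ip_def sum_distrib_left)
qed

lemma nm_pos: "0 \<le> nm n x" by (rule L2_set_nonneg)

lemma nm_scale: "nm n (%i. c * x i) = \<bar>c\<bar> * nm n x"
proof -
 have "nm n (%i. c * x i) = sqrt (c^2 * (\<Sum>i<n. (x i)^2))"
  unfolding L2_set_def by (simp add: power_mult_distrib sum_distrib_left)
 then show ?thesis unfolding L2_set_def by (simp add: real_sqrt_mult)
qed

lemma nm_add: "nm n (%i. x i + y i) \<le> nm n x + nm n y"
 by (rule L2_set_triangle_ineq)

lemma nm_cong: "(!!i. i < n ==> x i = y i) ==> nm n x = nm n y"
 by (intro L2_set_cong) auto

lemma nm_add3:
 assumes "!!i. i < n ==> x i = u i + v i + w i" "nm n u \<le> U" "nm n v \<le> V" "nm n w \<le> W"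
 shows "nm n x \<le> U + V + W"
proof -
 have "nm n x = nm n (%i. u i + v i + w i)" by (rule nm_cong) (rule assms(1))
 also have "... \<le> nm n u + nm n v + nm n w"
  using nm_add[of "%i. u i + v i" w n] nm_add[of u v n] by simp
 finally show ?thesis using assms(2-) by linarith
qed

lemma nm_minus: "nm n (%i. - x i) = nm n x" "nm n (%i. x i - y i) = nm n (%i. y i - x i)"
 unfolding L2_set_def by (simp_all add: power2_commute)

text \<open>A Courant-Fischer argument: the span of m > k eigenvectors contains a unit vector
  orthogonal to the k vectors \<open>u\<close>. If all these eigenvalues exceeded
  \<open>\<rho>\<close> in modulus, A would stretch it by more than \<open>\<rho>\<close>.\<close>

lemma min_eig:
 fixes f :: "nat => nat" and m k n :: nat
 assumes ev: "!!j i. j < n ==> i < n ==> mv n A (v j) i = lam j * v j i"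
  and on: "!!j m. j < n ==> m < n ==> ip n (v j) (v m) = of_bool (j = m)"
  and f: "inj_on f {..<m}" "!!t. t < m ==> f t < n" and k: "k < m" and \<rho>: "0 \<le> \<rho>"
  and bd: "!!x. (!!j. j < k ==> ip n x (u j) = 0) ==> nm n (mv n A x) \<le> \<rho> * nm n x"
 shows "\<exists>t<m. \<bar>lam (f t)\<bar> \<le> \<rho>"
proof (rule ccontr)
 assume "\<not> ?thesis"
 then have big: "\<rho> < \<bar>lam (f t)\<bar>" if "t < m" for t using that by force
 from unit_perp_nonempty[OF k, of "%j t. ip n (v (f t)) (u j)"]
 obtain c where c: "ip m c c = 1" "!!j. j < k ==> ip m c (%t. ip n (v (f t)) (u j)) = 0"
  unfolding unit_perp_def by blast
 define x where "x i = (\<Sum>t<m. c t * v (f t) i)" for i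
 have ff: "ip n (v (f t)) (v (f t')) = of_bool (t = t')" if "t < m" "t' < m" for t t'
  using on[of "f t" "f t'"] f that by (auto simp: inj_on_def)
 have ipx: "ip n (%i. \<Sum>t<m. g t * v (f t) i) (%i. \<Sum>t<m. h t * v (f t) i) = (\<Sum>t<m. g t * h t)" for g h
 proof -
  have "ip n (%i. \<Sum>t<m. g t * v (f t) i) (%i. \<Sum>t<m. h t * v (f t) i)
   = (\<Sum>t<m. g t * (\<Sum>t'<m. h t' * ip n (v (f t')) (v (f t))))"
   by (simp add: ip_sum ip_sym[of n "v (f _)" "%i. \<Sum>t<m. h t * v (f t) i"])
  also have "... = (\<Sum>t<m. g t * (\<Sum>t'<m. h t' * of_bool (t' = t)))"
   by (intro sum.cong refl arg_cong2[of _ _ _ _ "(*)"] ff) auto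
  also have "... = (\<Sum>t<m. g t * h t)" by (intro sum.cong refl) auto
  finally show ?thesis .
 qed
 have "(nm n x)^2 = 1^2" unfolding nm_sq x_def[abs_def] ipx using c(1) by (simp add: ip_def)
 then have "nm n x = 1" by (rule power2_eq_imp_eq) (use nm_pos in auto)
 moreover have "ip n x (u j) = 0" if "j < k" for j
  using c(2)[OF that] unfolding x_def ip_sum by (simp add: ip_def[of m])
 ultimately have "nm n (mv n A x) \<le> \<rho>" using bd[of x] by simp
 then have le: "(nm n (mv n A x))^2 \<le> \<rho>^2" by (intro power_mono nm_pos)
 have mx: "mv n A x i = (\<Sum>t<m. (c t * lam (f t)) * v (f t) i)" if i: "i < n" for i
 proof -
  have "mv n A x i = (\<Sum>t<m. c t * mv n A (v (f t)) i)"
   unfolding mv_def x_def sum_distrib_left by (subst sum.swap) (simp add: mult_ac)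
  also have "... = (\<Sum>t<m. (c t * lam (f t)) * v (f t) i)"
   using ev[OF f(2) i] by (intro sum.cong refl) simp
  finally show ?thesis .
 qed
 have "(nm n (mv n A x))^2 = (\<Sum>t<m. (c t * lam (f t)) * (c t * lam (f t)))"
  unfolding nm_sq using ip_cong[OF mx mx] ipx[of "%t. c t * lam (f t)" "%t. c t * lam (f t)"] by simp
 then have "(\<Sum>t<m. (c t)^2 * ((lam (f t))^2 - \<rho>^2)) \<le> 0"
 proof -
  have "(\<Sum>t<m. (c t)^2 * ((lam (f t))^2 - \<rho>^2)) = (\<Sum>t<m. (c t * lam (f t)) * (c t * lam (f t))) - \<rho>^2 * (\<Sum>t<m. c t * c t)"
   by (simp add: sum_subtractf[symmetric] sum_distrib_left algebra_simps power2_eq_square)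
  then show ?thesis using le c(1) \<open>(nm n (mv n A x))^2 = _\<close> by (simp add: ip_def)
 qed
 moreover have lt: "\<rho>^2 < (lam (f t))^2" if "t < m" for t
  using power_strict_mono[OF big[OF that] \<rho>, of 2] by simp
 moreover have nn: "0 \<le> (c t)^2 * ((lam (f t))^2 - \<rho>^2)" if "t < m" for t using lt[OF that] by simp
 ultimately have "(\<Sum>t<m. (c t)^2 * ((lam (f t))^2 - \<rho>^2)) = 0"
  by (meson antisym sum_nonneg lessThan_iff)
 then have "\<forall>t\<in>{..<m}. (c t)^2 * ((lam (f t))^2 - \<rho>^2) = 0"
  by (subst (asm) sum_nonneg_eq_0_iff) (use nn in auto)
 then have "\<forall>t<m. c t = 0" using lt by force
 then show False using c(1) unfolding ip_def by simp
qed

text \<open>Pairing x with x - c D bounds c <x, D> from below, the triangle inequality bounds |c|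
  |D| from above, and (1 - 2 delta) (1 + delta) <= 1 - delta combines the two.\<close>

lemma nearly_parallel:
 assumes X: "0 < nm n x" and r: "nm n (%i. x i - c * D i) \<le> \<delta> * nm n x" and d: "0 \<le> \<delta>" "\<delta> < 1"
 shows "(1 - 2 * \<delta>) * (nm n x * nm n D) \<le> \<bar>ip n x D\<bar>" "0 < nm n D"
proof -
 let ?r = "%i. x i - c * D i"
 have "nm n (%i. c * D i) \<le> nm n x + nm n ?r"
  using nm_add[of x "%i. - ?r i" n] unfolding nm_minus(1)[of ?r n] by simp
 then have cD: "\<bar>c\<bar> * nm n D \<le> (1 + \<delta>) * nm n x" using r unfolding nm_scale by (simp add: algebra_simps)
 have "ip n x ?r = (nm n x)^2 - c * ip n x D" by (simp add: ip_diff ip_scale nm_sq)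
 moreover have "\<bar>ip n x ?r\<bar> \<le> nm n x * (\<delta> * nm n x)"
  by (rule order.trans[OF ip_le]) (rule mult_left_mono[OF r nm_pos])
 ultimately have "(1 - \<delta>) * (nm n x * nm n x) \<le> c * ip n x D" by (simp add: algebra_simps power2_eq_square)
 also have "... \<le> \<bar>c\<bar> * \<bar>ip n x D\<bar>" by (metis abs_ge_self abs_mult)
 finally have a: "(1 - \<delta>) * (nm n x * nm n x) \<le> \<bar>c\<bar> * \<bar>ip n x D\<bar>" .
 then have "(1 - \<delta>) * (nm n x * nm n x) * nm n D \<le> (\<bar>c\<bar> * \<bar>ip n x D\<bar>) * nm n D"
  by (intro mult_right_mono a nm_pos)
 also have "... \<le> \<bar>ip n x D\<bar> * ((1 + \<delta>) * nm n x)"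
  using mult_left_mono[OF cD abs_ge_zero[of "ip n x D"]] by (simp add: mult_ac)
 finally have "nm n x * ((1 - \<delta>) * (nm n x * nm n D)) \<le> nm n x * (\<bar>ip n x D\<bar> * (1 + \<delta>))" by (simp add: mult_ac)
 then have b: "(1 - \<delta>) * (nm n x * nm n D) \<le> \<bar>ip n x D\<bar> * (1 + \<delta>)" using X by simp
 have "(1 - 2 * \<delta>) * (1 + \<delta>) \<le> 1 - \<delta>" using d by (simp add: algebra_simps)
 then have "(1 - 2 * \<delta>) * (1 + \<delta>) * (nm n x * nm n D) \<le> (1 - \<delta>) * (nm n x * nm n D)"
  by (intro mult_right_mono a nm_pos) auto
 then have "(1 + \<delta>) * ((1 - 2 * \<delta>) * (nm n x * nm n D)) \<le> (1 + \<delta>) * \<bar>ip n x D\<bar>" using b by (simp add: mult_ac)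
 then show "(1 - 2 * \<delta>) * (nm n x * nm n D) \<le> \<bar>ip n x D\<bar>" using d by simp
 show "0 < nm n D"
 proof (rule ccontr)
  assume "\<not> ?thesis"
  then have "nm n D = 0" using nm_pos[of D n] by simp
  then have "ip n x D = 0" using ip_le[of n x D] by simp
  then have "(1 - \<delta>) * (nm n x * nm n x) \<le> 0" using a by simp
  then show False using X d by (simp add: mult_le_0_iff)
 qed
qed

text \<open>The deterministic input, applied with a = alpha^l and b = beta^l. \<open>\<rho>\<close>
  bounds A orthogonally to both spikes and \<open>\<tau>\<close> orthogonally to the first one only;
  \<open>K\<close> is the loss in the norm of \<open>s\<close>, and \<open>\<delta>\<close> the
  relative error.\<close>

locale spikes =
 fixes n :: nat and A :: "nat => nat => real" and sp S D :: "nat => real" and a b \<rho> \<tau> \<delta> K :: real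
  and s dv :: "nat => real"
 defines "s \<equiv> mv n A (%_. 1)" and "dv \<equiv> mv n A sp"
 assumes sy: "symm n A" and n2: "2 \<le> n" and spin: "!!i. i < n ==> sp i * sp i = 1"
  and bulk: "!!x. ip n x s = 0 ==> ip n x dv = 0 ==> nm n (mv n A x) \<le> \<rho> * nm n x"
  and bulk1: "!!x. ip n x s = 0 ==> nm n (mv n A x) \<le> \<tau> * nm n x"
  and ab: "1 \<le> b" "b \<le> a" and pos: "0 \<le> \<rho>" "0 \<le> \<tau>" "0 \<le> \<delta>"
  and small: "8 * \<rho> \<le> \<delta> * b" "2 * \<tau> \<le> \<delta> * a" "\<delta> \<le> 1/100" "1 \<le> K" "\<delta> * K \<le> 1/100"
  and es: "real n * a / 2 \<le> ip n (%_. 1) s" and ed: "real n * b / 2 \<le> ip n sp dv"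
  and cross: "\<bar>ip n (%_. 1) dv\<bar> \<le> real n * b / 8"
  and sd: "\<bar>ip n s dv\<bar> \<le> \<delta> * (real n * a * b)"
  and snorm: "nm n s \<le> K * sqrt (real n) * a"
  and appr: "nm n (%i. s i - S i) \<le> \<delta> * sqrt (real n)" "nm n (%i. dv i - D i) \<le> \<delta> * sqrt (real n)"
begin

lemma np: "0 < sqrt (real n)" "sqrt (real n) * sqrt (real n) = real n" using n2 by auto

lemma nm_one: "nm n (%_. 1) = sqrt (real n)" unfolding L2_set_def by simp
lemma nm_sp: "nm n sp = sqrt (real n)"
proof -
 have "(\<Sum>i<n. (sp i)^2) = (\<Sum>i<n. 1)" by (intro sum.cong) (auto simp: power2_eq_square spin)
 then show ?thesis unfolding L2_set_def by simp
qed

lemma s_lower: "sqrt (real n) * a / 2 \<le> nm n s"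
proof -
 have "real n * a / 2 \<le> sqrt (real n) * nm n s"
  using es ip_le[of n "%_. 1" s] unfolding nm_one by simp
 then have "sqrt (real n) * (sqrt (real n) * a / 2) \<le> sqrt (real n) * nm n s" using np(2) by (simp add: mult.assoc[symmetric])
 then show ?thesis using np(1) by (simp only: mult_le_cancel_left_pos)
qed

lemma d_lower: "sqrt (real n) * b / 2 \<le> nm n dv"
proof -
 have "real n * b / 2 \<le> sqrt (real n) * nm n dv"
  using ed ip_le[of n sp dv] unfolding nm_sp by simp
 then have "sqrt (real n) * (sqrt (real n) * b / 2) \<le> sqrt (real n) * nm n dv" using np(2) by (simp add: mult.assoc[symmetric])
 then show ?thesis using np(1) by (simp only: mult_le_cancel_left_pos)
qed

lemma s_pos: "0 < nm n s" using s_lower np ab by (smt (verit) divide_pos_pos mult_pos_pos)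

text \<open>Gram-Schmidt: the part of \<open>dv\<close> orthogonal to \<open>s\<close>. By
  \<open>sd\<close> the removed part is small compared with \<open>dv\<close>.\<close>

definition u :: "nat => real" where "u i = dv i - (ip n s dv / ip n s s) * s i"

lemma ss: "ip n s s = nm n s * nm n s" using nm_sq[of s n] by (simp add: power2_eq_square)

lemma su: "ip n s u = 0"
 unfolding u_def[abs_def] ip_diff ip_scale ss using s_pos by simp

lemma proj_norm: "nm n (%i. (ip n s dv / ip n s s) * s i) \<le> 2 * \<delta> * sqrt (real n) * b"
proof -
 have "nm n (%i. (ip n s dv / ip n s s) * s i) = \<bar>ip n s dv\<bar> / nm n s"
  unfolding nm_scale ss using s_pos by (simp add: abs_divide)
 also have "... \<le> (\<delta> * (real n * a * b)) / (sqrt (real n) * a / 2)"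
  using sd s_lower np ab by (intro frac_le) auto
 also have "... = 2 * \<delta> * sqrt (real n) * b" using np ab by (simp add: field_simps)
 finally show ?thesis .
qed

lemma u_lower: "sqrt (real n) * b / 4 \<le> nm n u"
proof -
 have "nm n dv \<le> nm n u + nm n (%i. (ip n s dv / ip n s s) * s i)"
  using nm_add[of u "%i. (ip n s dv / ip n s s) * s i" n] unfolding u_def by simp
 moreover have "2 * \<delta> * (sqrt (real n) * b) \<le> 2 * (1/100) * (sqrt (real n) * b)"
  using small(3) np ab by (intro mult_right_mono) auto
 moreover have "0 \<le> sqrt (real n) * b" using np ab by simp
 ultimately show ?thesis using d_lower proj_norm by linarith
qed

lemma u_pos: "0 < nm n u" using u_lower np ab by (smt (verit) divide_pos_pos mult_pos_pos)

lemma u_near_D: "nm n (%i. u i - D i) \<le> 3 * \<delta> * (sqrt (real n) * b)"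
proof -
 let ?w = "%i. (ip n s dv / ip n s s) * s i"
 have "nm n (%i. u i - D i) \<le> \<delta> * sqrt (real n) + 2 * \<delta> * sqrt (real n) * b + 0"
  by (rule nm_add3[of _ _ "%i. dv i - D i" "%i. - ?w i" "%_. 0"])
   (use appr(2) proj_norm in \<open>auto simp: u_def nm_minus(1)[of ?w n] L2_set_def\<close>)
 moreover have "\<delta> * sqrt (real n) * 1 \<le> \<delta> * sqrt (real n) * b"
  using pos np ab by (intro mult_left_mono) auto
 ultimately show ?thesis by (simp add: algebra_simps)
qed

lemma uu: "ip n u u = nm n u * nm n u" using nm_sq[of u n] by (simp add: power2_eq_square)

definition ca where "ca x = ip n x s / ip n s s"
definition cu where "cu x = ip n x u / ip n u u"
definition rest where "rest x i = x i - ca x * s i - cu x * u i"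

lemma ca_norm: "nm n (%i. ca x * s i) = \<bar>ip n x s\<bar> / nm n s"
 unfolding nm_scale ca_def ss using s_pos by (simp add: abs_divide)
lemma cu_norm: "nm n (%i. cu x * u i) = \<bar>ip n x u\<bar> / nm n u"
 unfolding nm_scale cu_def uu using u_pos by (simp add: abs_divide)

lemma rest_perp: "ip n (rest x) s = 0" "ip n (rest x) u = 0" "ip n (rest x) dv = 0"
proof -
 show 1: "ip n (rest x) s = 0" "ip n (rest x) u = 0"
  unfolding rest_def[abs_def] ip_diff ip_scale using s_pos u_pos su ip_sym[of n u s]
  by (auto simp: ca_def cu_def ss uu)
 have "ip n (rest x) dv = ip n (rest x) (%i. u i + (ip n s dv / ip n s s) * s i)"
  by (rule ip_cong) (auto simp: u_def)
 then show "ip n (rest x) dv = 0" using 1 by (simp add: ip_add(2) ip_scale(2) del: times_divide_eq_left)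
qed

text \<open>Pairing the eigenvector equation with the remainder r gives lam |r|^2 = <A r, x>, and r
  is orthogonal to both spikes, so \<open>bulk\<close> applies.\<close>

lemma rest_bound:
 assumes ev: "!!i. i < n ==> mv n A x i = lam * x i" and lam: "b / 8 \<le> lam"
 shows "nm n (rest x) \<le> \<delta> * nm n x"
proof -
 let ?r = "rest x"
 have "ip n ?r x = ip n ?r (%i. ?r i + (ca x * s i + cu x * u i))" by (rule ip_cong) (auto simp: rest_def)
 also have "... = ip n ?r ?r" by (simp add: ip_add ip_scale rest_perp)
 finally have rr: "ip n ?r x = nm n ?r * nm n ?r" using nm_sq[of ?r n] by (simp add: power2_eq_square)
 have "ip n ?r (mv n A x) = ip n ?r (%i. lam * x i)" by (rule ip_cong) (auto simp: ev)
 then have "lam * (nm n ?r * nm n ?r) = ip n (mv n A ?r) x" using ip_mv[OF sy] rr by (simp add: ip_scale)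
 also have "... \<le> nm n (mv n A ?r) * nm n x" using ip_le[of n "mv n A ?r" x] by simp
 also have "... \<le> (\<rho> * nm n ?r) * nm n x" using bulk[OF rest_perp(1,3)] by (intro mult_right_mono nm_pos)
 finally have h: "nm n ?r * (lam * nm n ?r) \<le> nm n ?r * (\<rho> * nm n x)" by (simp add: mult_ac)
 show ?thesis
 proof (cases "nm n ?r = 0")
  case True
  then show ?thesis using pos nm_pos by simp
 next
  case False
  then have "0 < nm n ?r" by (metis nm_pos order_less_le)
  then have "lam * nm n ?r \<le> \<rho> * nm n x" using h by simp
  moreover have "b / 8 * nm n ?r \<le> lam * nm n ?r" using lam by (intro mult_right_mono nm_pos)
  moreover have "\<rho> * nm n x \<le> \<delta> * b / 8 * nm n x" using small(1) by (intro mult_right_mono mult_nonneg_nonneg nm_pos) auto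
  ultimately have "b * nm n ?r \<le> b * (\<delta> * nm n x)" by (simp add: mult_ac)
  then show ?thesis using ab by simp
 qed
qed

lemma ip_one_s: assumes ev: "!!i. i < n ==> mv n A x i = lam * x i" shows "ip n x s = lam * ip n x (%_. 1)"
proof -
 have "ip n x s = ip n (mv n A x) (%_. 1)" unfolding s_def by (rule ip_mv[OF sy])
 also have "... = ip n (%i. lam * x i) (%_. 1)" by (rule ip_cong) (auto simp: ev)
 finally show ?thesis by (simp add: ip_scale)
qed

text \<open>By symmetry <x, s> = lam <x, 1> is at most tau sqrt n |x|, while \<open>s\<close> has
  norm at least sqrt n * a / 2.\<close>

lemma ca_small:
 assumes ev: "!!i. i < n ==> mv n A x i = lam * x i" and lam: "\<bar>lam\<bar> \<le> \<tau>"
 shows "nm n (%i. ca x * s i) \<le> \<delta> * nm n x"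
proof -
 have "\<bar>ip n x s\<bar> \<le> \<bar>lam\<bar> * (nm n x * sqrt (real n))"
 proof -
  have "ip n x s = lam * ip n x (%_. 1)" by (rule ip_one_s[OF ev])
  then have "\<bar>ip n x s\<bar> = \<bar>lam\<bar> * \<bar>ip n x (%_. 1)\<bar>" by (simp add: abs_mult)
  then show ?thesis using mult_left_mono[OF ip_le[of n x "%_. 1"] abs_ge_zero[of lam]] unfolding nm_one by simp
 qed
 also have "... \<le> \<tau> * (nm n x * sqrt (real n))" using lam nm_pos[of x n] np by (intro mult_right_mono) auto
 also have "... \<le> \<delta> * a / 2 * (nm n x * sqrt (real n))" using small(2) nm_pos[of x n] np by (intro mult_right_mono) auto
 also have "... = \<delta> * nm n x * (sqrt (real n) * a / 2)" by simp
 also have "... \<le> \<delta> * nm n x * nm n s" using s_lower pos nm_pos[of x n] by (intro mult_left_mono) auto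
 finally show ?thesis unfolding ca_norm using s_pos by (simp add: divide_le_eq)
qed

text \<open>x is its \<open>u\<close> component up to \<open>2 * \<delta>\<close>; replacing
  \<open>u\<close> by \<open>D\<close> costs another \<open>12 * \<delta>\<close>, and
  \<open>nearly_parallel\<close> doubles the sum, whence 28.\<close>

lemma second:
 assumes ev: "!!i. i < n ==> mv n A x i = lam * x i" and lam: "b / 8 \<le> lam" "\<bar>lam\<bar> \<le> \<tau>" and X: "0 < nm n x"
 shows "nm n (%i. x i - cu x * u i) \<le> 2 * \<delta> * nm n x"
  "(1 - 28 * \<delta>) * (nm n x * nm n D) \<le> \<bar>ip n x D\<bar>" "0 < nm n D"
proof -
 have r: "nm n (rest x) \<le> \<delta> * nm n x" by (rule rest_bound[OF ev lam(1)])
 have c: "nm n (%i. ca x * s i) \<le> \<delta> * nm n x" by (rule ca_small[OF ev lam(2)])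
 have "nm n (%i. x i - cu x * u i) \<le> \<delta> * nm n x + \<delta> * nm n x + 0"
  by (rule nm_add3[OF _ r c, of _ "%_. 0"]) (auto simp: rest_def L2_set_def)
 then show 1: "nm n (%i. x i - cu x * u i) \<le> 2 * \<delta> * nm n x" by simp
 have "\<bar>cu x\<bar> * nm n u \<le> nm n x" using ip_le[of n x u] u_pos cu_norm[of x] unfolding nm_scale by (simp add: divide_le_eq)
 then have "\<bar>cu x\<bar> * (sqrt (real n) * b / 4) \<le> nm n x" using mult_left_mono[OF u_lower abs_ge_zero[of "cu x"]] by simp
 then have "12 * \<delta> * (\<bar>cu x\<bar> * (sqrt (real n) * b / 4)) \<le> 12 * \<delta> * nm n x" using pos by (intro mult_left_mono) auto
 moreover have "\<bar>cu x\<bar> * nm n (%i. u i - D i) \<le> \<bar>cu x\<bar> * (3 * \<delta> * (sqrt (real n) * b))"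
  using u_near_D by (intro mult_left_mono) auto
 ultimately have D: "nm n (%i. cu x * (u i - D i)) \<le> 12 * \<delta> * nm n x" unfolding nm_scale by (simp add: mult_ac)
 have "nm n (%i. x i - cu x * D i) \<le> 2 * \<delta> * nm n x + 12 * \<delta> * nm n x + 0"
  by (rule nm_add3[OF _ 1 D, of _ "%_. 0"]) (auto simp: algebra_simps L2_set_def)
 then have "nm n (%i. x i - cu x * D i) \<le> (14 * \<delta>) * nm n x" by simp
 from nearly_parallel[OF X this] show "(1 - 28 * \<delta>) * (nm n x * nm n D) \<le> \<bar>ip n x D\<bar>" "0 < nm n D"
  using pos small by auto
qed

text \<open>The vector y for the second eigenvalue is nearly parallel to \<open>u\<close>, and x is
  orthogonal to y, so x has little of \<open>u\<close>; by \<open>rest_bound\<close> it has little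
  outside the span of \<open>s\<close> and \<open>u\<close>. The upper bound on lam comes from lam
  <x, 1> = <x, s> and a lower bound on <x, 1>.\<close>

lemma first:
 assumes ev: "!!i. i < n ==> mv n A x i = lam * x i" and lam: "a / 2 \<le> lam" and X: "0 < nm n x"
  and ev': "!!i. i < n ==> mv n A y i = lam' * y i" and lam': "b / 8 \<le> lam'" "\<bar>lam'\<bar> \<le> \<tau>" and Y: "0 < nm n y"
 shows "lam \<le> 8 * K^2 * a" "(1 - 14 * \<delta>) * (nm n x * nm n S) \<le> \<bar>ip n x S\<bar>" "0 < nm n S"
proof -
 have "lam * ip n x y = lam' * ip n x y"
 proof -
  have "lam * ip n x y = ip n (mv n A x) y"
   by (subst ip_scale(1)[symmetric]) (rule ip_cong, auto simp: ev)
  also have "... = ip n x (mv n A y)" by (rule ip_mv[OF sy, symmetric])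
  also have "... = lam' * ip n x y"
   by (subst ip_scale(2)[symmetric]) (rule ip_cong, auto simp: ev')
  finally show ?thesis .
 qed
 moreover have "\<delta> * a \<le> 1/100 * a" using small(3) ab by (intro mult_right_mono) auto
 then have "lam' ~= lam" using lam lam' small(2) ab by linarith
 ultimately have xy: "ip n x y = 0" by simp
 let ?r = "%i. y i - cu y * u i"
 have r: "nm n ?r \<le> 2 * \<delta> * nm n y" by (rule second(1)[OF ev' lam' Y])
 have cy: "nm n y / 2 \<le> \<bar>cu y\<bar> * nm n u"
 proof -
  have "nm n y \<le> nm n ?r + nm n (%i. cu y * u i)" using nm_add[of ?r "%i. cu y * u i" n] by simp
  moreover have "2 * \<delta> * nm n y \<le> 2 * (1/100) * nm n y" using small Y by (intro mult_right_mono) auto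
  ultimately show ?thesis using r Y unfolding nm_scale by linarith
 qed
 have "ip n x ?r = - (cu y * ip n x u)" using xy by (simp add: ip_diff ip_scale)
 then have "\<bar>cu y\<bar> * \<bar>ip n x u\<bar> \<le> nm n x * nm n ?r" using ip_le[of n x ?r] by (simp add: abs_mult)
 also have "... \<le> nm n x * (2 * \<delta> * nm n y)" using r X by (intro mult_left_mono) auto
 finally have "(\<bar>cu y\<bar> * \<bar>ip n x u\<bar>) * nm n u \<le> nm n x * (2 * \<delta> * nm n y) * nm n u" using u_pos by (intro mult_right_mono) auto
 moreover have "nm n y / 2 * \<bar>ip n x u\<bar> \<le> \<bar>cu y\<bar> * nm n u * \<bar>ip n x u\<bar>" using cy by (intro mult_right_mono) auto
 ultimately have "nm n y * \<bar>ip n x u\<bar> \<le> nm n y * (4 * \<delta> * nm n x * nm n u)" by (simp add: mult_ac)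
 then have "\<bar>ip n x u\<bar> \<le> 4 * \<delta> * nm n x * nm n u" using Y by simp
 then have c: "nm n (%i. cu x * u i) \<le> 4 * \<delta> * nm n x" unfolding cu_norm using u_pos by (simp add: divide_le_eq)
 have "b / 8 \<le> lam" using lam ab by simp
 from rest_bound[OF ev this] have rx: "nm n (rest x) \<le> \<delta> * nm n x" .
 have "nm n (%i. x i - ca x * s i) \<le> \<delta> * nm n x + 4 * \<delta> * nm n x + 0"
  by (rule nm_add3[OF _ rx c, of _ "%_. 0"]) (auto simp: rest_def L2_set_def)
 then have 1: "nm n (%i. x i - ca x * s i) \<le> 5 * \<delta> * nm n x" by simp
 have cs: "\<bar>ca x\<bar> * nm n s \<le> nm n x" using ip_le[of n x s] s_pos ca_norm[of x] unfolding nm_scale by (simp add: divide_le_eq)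
 then have "\<bar>ca x\<bar> * (sqrt (real n) * a / 2) \<le> nm n x" using mult_left_mono[OF s_lower abs_ge_zero[of "ca x"]] by simp
 moreover have "\<bar>ca x\<bar> * (sqrt (real n) * 1 / 2) \<le> \<bar>ca x\<bar> * (sqrt (real n) * a / 2)" using ab np
  by (intro mult_left_mono divide_right_mono) auto
 ultimately have "2 * \<delta> * (\<bar>ca x\<bar> * (sqrt (real n) / 2)) \<le> 2 * \<delta> * nm n x" using pos by (intro mult_left_mono) auto
 moreover have "\<bar>ca x\<bar> * nm n (%i. s i - S i) \<le> \<bar>ca x\<bar> * (\<delta> * sqrt (real n))" using appr(1) by (intro mult_left_mono) auto
 ultimately have SS: "nm n (%i. ca x * (s i - S i)) \<le> 2 * \<delta> * nm n x" unfolding nm_scale by (simp add: mult_ac)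
 have "nm n (%i. x i - ca x * S i) \<le> 5 * \<delta> * nm n x + 2 * \<delta> * nm n x + 0"
  by (rule nm_add3[OF _ 1 SS, of _ "%_. 0"]) (auto simp: algebra_simps L2_set_def)
 then have "nm n (%i. x i - ca x * S i) \<le> (7 * \<delta>) * nm n x" by simp
 from nearly_parallel[OF X this] show "(1 - 14 * \<delta>) * (nm n x * nm n S) \<le> \<bar>ip n x S\<bar>" "0 < nm n S"
  using pos small by auto
 let ?q = "%i. x i - ca x * s i"
 have big: "nm n x / 2 \<le> \<bar>ca x\<bar> * nm n s"
 proof -
  have "nm n x \<le> nm n ?q + nm n (%i. ca x * s i)" using nm_add[of ?q "%i. ca x * s i" n] by simp
  moreover have "5 * \<delta> * nm n x \<le> 5 * (1/100) * nm n x" using small X by (intro mult_right_mono) auto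
  ultimately show ?thesis using 1 X unfolding nm_scale by linarith
 qed
 have Kp: "0 < K" using small by simp
 \<comment> \<open>x is close to a multiple of \<open>s\<close>, and by \<open>es\<close> and
   \<open>snorm\<close> the cosine between \<open>s\<close> and the constant vector is at least 1 /
   (2 K).\<close>
 have e1: "nm n x * sqrt (real n) / (8 * K) \<le> \<bar>ip n x (%_. 1)\<bar>"
 proof -
  have "ip n x (%_. 1) = ip n ?q (%_. 1) + ca x * ip n s (%_. 1)" by (simp add: ip_diff ip_scale)
  moreover have "\<bar>ip n ?q (%_. 1)\<bar> \<le> 5 * \<delta> * nm n x * sqrt (real n)"
   using ip_le[of n ?q "%_. 1"] mult_right_mono[OF 1 less_imp_le[OF np(1)]] unfolding nm_one by linarith
  moreover have "nm n x * sqrt (real n) / (4 * K) \<le> \<bar>ca x * ip n s (%_. 1)\<bar>"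
  proof -
   have "nm n x / 2 \<le> \<bar>ca x\<bar> * (K * sqrt (real n) * a)"
    using big mult_left_mono[OF snorm abs_ge_zero[of "ca x"]] by linarith
   then have "nm n x / 2 * (sqrt (real n) / (2 * K)) \<le> \<bar>ca x\<bar> * (K * sqrt (real n) * a) * (sqrt (real n) / (2 * K))"
    using Kp np by (intro mult_right_mono) auto
   also have "... = \<bar>ca x\<bar> * (real n * a / 2)" using Kp np(2) by (simp add: field_simps)
   also have "... \<le> \<bar>ca x\<bar> * \<bar>ip n s (%_. 1)\<bar>" using es by (intro mult_left_mono) (auto simp: ip_sym[of n s])
   finally show ?thesis by (simp add: abs_mult)
  qed
  moreover have "5 * \<delta> * nm n x * sqrt (real n) \<le> nm n x * sqrt (real n) / (8 * K)"
  proof -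
   have "5 * \<delta> \<le> 1 / (8 * K)" using small(5) Kp by (simp add: field_simps)
   from mult_right_mono[OF this, of "nm n x * sqrt (real n)"] show ?thesis using X np by (simp add: mult_ac)
  qed
  moreover have "nm n x * sqrt (real n) / (4 * K) = 2 * (nm n x * sqrt (real n) / (8 * K))" by simp
  ultimately show ?thesis by linarith
 qed
 have "lam * (nm n x * sqrt (real n) / (8 * K)) \<le> lam * \<bar>ip n x (%_. 1)\<bar>" using e1 lam ab by (intro mult_left_mono) auto
 also have "... = \<bar>ip n x s\<bar>" using ip_one_s[OF ev] lam ab by (simp add: abs_mult)
 also have "... \<le> nm n x * (K * sqrt (real n) * a)" using ip_le[of n x s] mult_left_mono[OF snorm nm_pos[of x n]] by linarith
 finally have "(nm n x * sqrt (real n)) * (lam / (8 * K)) \<le> (nm n x * sqrt (real n)) * (K * a)" by (simp add: mult_ac)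
 then have "lam / (8 * K) \<le> K * a" using X np by (simp only: mult_le_cancel_left_pos mult_pos_pos)
 then show "lam \<le> 8 * K^2 * a" using Kp by (simp add: divide_le_eq power2_eq_square mult_ac)
qed

lemma conclusion:
 fixes B :: "real mat"
 defines "B \<equiv> Matrix.mat n n (%(i, j). A i j)"
 shows "a / 2 \<le> kth_eig B 1" "kth_eig B 1 \<le> 8 * K^2 * a" "b / 8 \<le> kth_eig B 2"
  "!!k. 3 \<le> k ==> k \<le> n ==> \<bar>kth_eig B k\<bar> \<le> \<rho>"
  "!!x. eigenvector B x (kth_eig B 1) ==> 1 - 14 * \<delta> \<le> cos_angle x (Matrix.vec n S)"
  "!!x. eigenvector B x (kth_eig B 2) ==> 1 - 28 * \<delta> \<le> cos_angle x (Matrix.vec n D)"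
proof -
 from spectral_theorem[OF sy] obtain v lam where
  ev: "!!j i. j < n ==> i < n ==> mv n A (v j) i = lam j * v j i"
  and on: "!!j m. j < n ==> m < n ==> ip n (v j) (v m) = of_bool (j = m)"
  and R: "!!j y. j < n ==> (!!m. m < j ==> ip n y (v m) = 0) ==> ip n y (mv n A y) \<le> lam j * ip n y y"
  by blast
 have dec: "lam m \<le> lam j" if "j \<le> m" "m < n" for j m
 proof -
  have "ip n (v m) (mv n A (v m)) = ip n (v m) (%i. lam m * v m i)" by (rule ip_cong) (use ev that in auto)
  then have "ip n (v m) (mv n A (v m)) = lam m" using on[of m m] that by (simp add: ip_scale)
  moreover have "ip n (v m) (mv n A (v m)) \<le> lam j * ip n (v m) (v m)"
   by (rule R) (use that on in auto)
  ultimately show ?thesis using on[of m m] that by simp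
 qed
 have kth: "kth_eig B (Suc k) = lam k" if "k < n" for k
  unfolding B_def by (rule kth_eig_eq[where v = v and lam = lam]) (use ev on dec that in auto)
 have k1: "kth_eig B 1 = lam 0" and k2: "kth_eig B 2 = lam 1" using kth[of 0] kth[of 1] n2 by (auto simp: numeral_2_eq_2)
 have v1: "nm n (v k) = 1" if "k < n" for k
  using on[of k k] that nm_sq[of "v k" n] nm_pos[of "v k" n] by (simp add: power2_eq_1_iff)
 have l0: "a / 2 \<le> lam 0"
 proof -
  have "real n * a / 2 \<le> lam 0 * ip n (%_. 1) (%_. 1)"
   using R[of 0 "%_. 1"] es n2 unfolding s_def by simp
  also have "ip n (%_. 1) (%_. 1) = real n" unfolding ip_def by simp
  finally have "real n * (a / 2) \<le> real n * lam 0" by (simp add: mult.commute)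
  then show ?thesis using n2 by simp
 qed
 have l1: "b / 8 \<le> lam 1"
 proof -
  \<comment> \<open>One constraint in dimension 2: this provides a combination y of the constant
    vector and \<open>sp\<close> orthogonal to the top eigenvector. The second eigenvalue is bounded
    below by testing with y.\<close>
  from unit_perp_nonempty[of 1 2 "%_ t. if t = 0 then ip n (%_. 1) (v 0) else ip n sp (v 0)"]
  obtain c where "c \<in> unit_perp 2 (%_ t. if t = 0 then ip n (%_. 1) (v 0) else ip n sp (v 0)) 1" by auto
  then have c: "c 0 * c 0 + c 1 * c 1 = 1" "c 0 * ip n (%_. 1) (v 0) + c 1 * ip n sp (v 0) = 0"
   unfolding unit_perp_def ip_def[of 2] by (auto simp: numeral_2_eq_2)
  define y where "y i = c 0 * 1 + c 1 * sp i" for i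
  have my: "mv n A y = (%i. c 0 * s i + c 1 * dv i)"
   unfolding y_def[abs_def] mv_add mv_scale s_def dv_def ..
  have sp1: "ip n sp s = ip n (%_. 1) dv" unfolding s_def dv_def ip_mv[OF sy, of sp] by (rule ip_sym)
  have q: "ip n y (mv n A y) = c 0 * c 0 * ip n (%_. 1) s + c 1 * c 1 * ip n sp dv + 2 * (c 0 * c 1) * ip n (%_. 1) dv"
   unfolding my unfolding y_def[abs_def] ip_add ip_scale sp1 by (simp add: algebra_simps)
  have oo: "ip n (%_. 1) (%_. 1) = real n" "ip n sp sp = real n"
   using nm_sq[of "%_. 1" n] nm_sq[of sp n] unfolding nm_one nm_sp by simp_all
  have yy: "ip n y y = real n + 2 * (c 0 * c 1) * ip n (%_. 1) sp"
  proof -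
   have "ip n y y = (c 0 * c 0 + c 1 * c 1) * real n + 2 * (c 0 * c 1) * ip n (%_. 1) sp"
    unfolding y_def[abs_def] ip_add ip_scale oo ip_sym[of n sp "%_. 1"] by (simp add: algebra_simps)
   then show ?thesis using c(1) by simp
  qed
  have "\<bar>2 * (c 0 * c 1)\<bar> \<le> c 0 * c 0 + c 1 * c 1"
   using sum_squares_bound[of "\<bar>c 0\<bar>" "\<bar>c 1\<bar>"] by (simp add: power2_eq_square abs_mult)
  then have cc: "\<bar>2 * (c 0 * c 1)\<bar> \<le> 1" using c(1) by simp
  have "\<bar>ip n (%_. 1) sp\<bar> \<le> real n" using ip_le[of n "%_. 1" sp] np unfolding nm_one nm_sp by simp
  then have "\<bar>2 * (c 0 * c 1)\<bar> * \<bar>ip n (%_. 1) sp\<bar> \<le> 1 * real n" using cc by (intro mult_mono) auto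
  then have yle: "ip n y y \<le> 2 * real n" unfolding yy abs_mult[symmetric] by linarith
  have "\<bar>2 * (c 0 * c 1)\<bar> * \<bar>ip n (%_. 1) dv\<bar> \<le> 1 * (real n * b / 8)"
   using cc cross by (intro mult_mono) auto
  moreover have "c 0 * c 0 * (real n * b / 2) \<le> c 0 * c 0 * ip n (%_. 1) s"
   using es mult_left_mono[OF ab(2), of "real n"] by (intro mult_left_mono) auto
  moreover have "c 1 * c 1 * (real n * b / 2) \<le> c 1 * c 1 * ip n sp dv"
   using ed by (intro mult_left_mono) auto
  moreover have "c 0 * c 0 * (real n * b / 2) + c 1 * c 1 * (real n * b / 2) = real n * b / 2"
   using c(1) by (metis distrib_right mult_1)
  ultimately have "real n * b / 2 - real n * b / 8 \<le> ip n y (mv n A y)" unfolding q abs_mult[symmetric] by linarith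
  also have "... \<le> lam 1 * ip n y y"
  proof (rule R)
   fix m :: nat assume "m < 1"
   then show "ip n y (v m) = 0" using c(2) unfolding y_def[abs_def] ip_add ip_scale by simp
  qed (use n2 in auto)
  finally have h: "real n * b / 2 - real n * b / 8 \<le> lam 1 * ip n y y" .
  have nb: "0 < real n * b" using n2 ab by simp
  then have "0 < lam 1 * ip n y y" using h by linarith
  then have "0 < lam 1" using ip_nonneg[of n y] by (auto simp: zero_less_mult_iff)
  then have "lam 1 * ip n y y \<le> lam 1 * (2 * real n)" using yle by (intro mult_left_mono) auto
  then have "real n * (b / 4) \<le> real n * (2 * lam 1)" using h nb by (simp add: algebra_simps)
  then show ?thesis using n2 by simp
 qed
 have "\<delta> * a \<le> 1/100 * a" and da: "\<delta> * b \<le> 1/100 * b" using small(3) ab by (auto intro!: mult_right_mono)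
 then have "\<tau> < lam 0" using l0 small(2) ab by linarith
 \<comment> \<open>Two eigenvectors against the one constraint \<open>s\<close>; the top eigenvalue
   is too large, so the bound falls on the second.\<close>
 moreover have "\<exists>t<2. \<bar>lam t\<bar> \<le> \<tau>"
  by (rule min_eig[where f = "%t. t" and k = 1 and u = "%_. s" and v = v and n = n and A = A])
   (use ev on n2 pos bulk1 in auto)
 ultimately have l1\<tau>: "\<bar>lam 1\<bar> \<le> \<tau>" using l0 by (auto simp: less_2_cases_iff)
 show "a / 2 \<le> kth_eig B 1" unfolding k1 by (rule l0)
 show "b / 8 \<le> kth_eig B 2" unfolding k2 by (rule l1)
 show "\<bar>kth_eig B k\<bar> \<le> \<rho>" if k: "3 \<le> k" "k \<le> n" for k
 proof -
  \<comment> \<open>The eigenvectors with indices 0, 1 and k - 1 against two constraints: one of the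
    three eigenvalues is at most \<open>\<rho>\<close>, and the first two are too large.\<close>
  define f where "f t = (if t = 2 then k - 1 else t)" for t :: nat
  have "\<exists>t<3. \<bar>lam (f t)\<bar> \<le> \<rho>"
  proof (rule min_eig[where k = 2 and u = "%j. if j = 0 then s else dv" and v = v and n = n and A = A])
   show "inj_on f {..<3}" using k by (auto simp: inj_on_def f_def)
   show "f t < n" if "t < 3" for t using k that unfolding f_def by auto
   fix x assume "!!j. j < 2 ==> ip n x (if j = (0::nat) then s else dv) = 0"
   from this[of 0] this[of 1] show "nm n (mv n A x) \<le> \<rho> * nm n x" by (intro bulk) auto
  qed (use ev on pos in auto)
  moreover have "\<rho> < lam 1" using l1 small(1) da ab by linarith
  moreover have "lam 1 \<le> lam 0" using dec[of 0 1] n2 by simp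
  ultimately have "\<bar>lam (f 2)\<bar> \<le> \<rho>"
   by (auto simp: f_def numeral_3_eq_3 numeral_2_eq_2 less_Suc_eq split: if_splits)
  moreover have "kth_eig B k = lam (f 2)" using kth[of "k - 1"] k unfolding f_def by simp
  ultimately show ?thesis by simp
 qed
 show "kth_eig B 1 \<le> 8 * K^2 * a" unfolding k1
  by (rule first(1)[where x = "v 0" and y = "v 1" and lam' = "lam 1"]) (use ev v1 l0 l1 l1\<tau> n2 in auto)
 have conv: "0 < nm n (vec_index x)" "!!i. i < n ==> mv n A (vec_index x) i = \<mu> * vec_index x i"
  "!!w. cos_angle x (Matrix.vec n w) = \<bar>ip n (vec_index x) w\<bar> / (nm n (vec_index x) * nm n w)"
  if "eigenvector B x \<mu>" for x \<mu>
 proof -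
  have x: "x \<in> carrier_vec n" "x ~= 0\<^sub>v n" "B *\<^sub>v x = \<mu> \<cdot>\<^sub>v x"
   using that unfolding eigenvector_def B_def by auto
  obtain i where i: "i < n" "vec_index x i ~= 0" using x by (metis carrier_vecD eq_vecI index_zero_vec)
  have "nm n (vec_index x) ~= 0" using i ip_eq_0[of n "vec_index x" i] nm_sq[of "vec_index x" n] by auto
  then show "0 < nm n (vec_index x)" by (metis nm_pos order_less_le)
  fix i assume i: "i < n"
  have "vec_index (B *\<^sub>v x) i = mv n A (vec_index x) i"
   using i x(1) unfolding B_def mv_def by (simp add: scalar_prod_def atLeast0LessThan)
  then show "mv n A (vec_index x) i = \<mu> * vec_index x i" using x i by simp
 next
  fix w
  have x: "x \<in> carrier_vec n" using that unfolding eigenvector_def B_def by auto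
  have "nm n (vec_index x) = sqrt (scalar_prod x x)" "nm n w = sqrt (scalar_prod (Matrix.vec n w) (Matrix.vec n w))"
   "ip n (vec_index x) w = scalar_prod x (Matrix.vec n w)"
   using x unfolding L2_set_def ip_def scalar_prod_def by (simp_all add: power2_eq_square atLeast0LessThan)
  then show "cos_angle x (Matrix.vec n w) = \<bar>ip n (vec_index x) w\<bar> / (nm n (vec_index x) * nm n w)"
   unfolding cos_angle_def by simp
 qed
 show "1 - 14 * \<delta> \<le> cos_angle x (Matrix.vec n S)" if x: "eigenvector B x (kth_eig B 1)" for x
 proof -
  note c = conv[OF x[unfolded k1]]
  have "(1 - 14 * \<delta>) * (nm n (vec_index x) * nm n S) \<le> \<bar>ip n (vec_index x) S\<bar>" "0 < nm n S"
   by (rule first(2,3)[where x = "vec_index x" and y = "v 1" and lam' = "lam 1" and lam = "lam 0"], use c ev v1 l0 l1 l1\<tau> n2 in auto)+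
  then show ?thesis unfolding c(3) using c(1) by (simp add: le_divide_eq)
 qed
 show "1 - 28 * \<delta> \<le> cos_angle x (Matrix.vec n D)" if x: "eigenvector B x (kth_eig B 2)" for x
 proof -
  note c = conv[OF x[unfolded k2]]
  have "(1 - 28 * \<delta>) * (nm n (vec_index x) * nm n D) \<le> \<bar>ip n (vec_index x) D\<bar>" "0 < nm n D"
   by (rule second(2,3)[where x = "vec_index x" and lam = "lam 1"], use c l1 l1\<tau> in auto)+
  then show ?thesis unfolding c(3) using c(1) by (simp add: le_divide_eq)
 qed
qed

end

section \<open>The recursion for the walk matrices\<close>

definition opb :: "nat => (nat => nat => real) => real => bool" where
 "opb n X K \<longleftrightarrow> 0 \<le> K \<and> (\<forall>x. nm n (mv n X x) \<le> K * nm n x)"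

lemma opbD: "opb n X K ==> nm n (mv n X x) \<le> K * nm n x" unfolding opb_def by blast

lemma opb_comp:
 assumes "opb n X K" "nm n y \<le> b"
 shows "nm n (mv n X y) \<le> K * b"
 using opbD[OF assms(1), of y] mult_left_mono[OF assms(2)] assms(1) unfolding opb_def by fastforce

lemma opb_frobenius:
 assumes "(\<Sum>i<n. \<Sum>j<n. (X i j)^2) \<le> K^2" "0 \<le> K"
 shows "opb n X K"
 unfolding opb_def
proof (intro conjI allI)
 fix x
 have "(mv n X x i)^2 \<le> (\<Sum>j<n. (X i j)^2) * (nm n x)^2" for i
 proof -
  have "\<bar>mv n X x i\<bar> \<le> nm n (X i) * nm n x" using ip_le[of n "X i" x] unfolding mv_def ip_def .
  then have "\<bar>mv n X x i\<bar>^2 \<le> (nm n (X i) * nm n x)^2" by (intro power_mono) auto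
  moreover have "(nm n (X i))^2 = (\<Sum>j<n. (X i j)^2)" by (simp only: nm_sq ip_def power2_eq_square[of "X i _", symmetric])
  ultimately show ?thesis by (simp add: power_mult_distrib)
 qed
 then have "(nm n (mv n X x))^2 \<le> (\<Sum>i<n. (\<Sum>j<n. (X i j)^2) * (nm n x)^2)"
  unfolding nm_sq[of "mv n X x"] ip_def[of n "mv n X x"] power2_eq_square[of "mv n X x _", symmetric] by (intro sum_mono)
 also have "... \<le> K^2 * (nm n x)^2"
  unfolding sum_distrib_right[symmetric] using assms by (intro mult_right_mono) auto
 finally have "(nm n (mv n X x))^2 \<le> (K * nm n x)^2" by (simp add: power_mult_distrib)
 then show "nm n (mv n X x) \<le> K * nm n x" by (rule power2_le_imp_le) (use assms nm_pos in auto)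
qed (rule assms)

lemma mpow_spectral:
 assumes ev: "!!j i. j < n ==> i < n ==> mv n X (v j) i = lam j * v j i"
  and on: "!!j m. j < n ==> m < n ==> ip n (v j) (v m) = of_bool (j = m)"
  and ij: "i < n" "j < n"
 shows "mpow n X r i j = (\<Sum>k<n. lam k ^ r * (v k i * v k j))"
 using ij
proof (induction r arbitrary: i)
 case 0
 then show ?case using complete[OF on, of i j] by simp
next
 case (Suc r)
 have "mpow n X (Suc r) i j = (\<Sum>u<n. X i u * (\<Sum>k<n. lam k ^ r * (v k u * v k j)))"
  unfolding mpow.simps by (intro sum.cong refl arg_cong2[of _ _ _ _ "(*)"] Suc.IH) (use Suc.prems in auto)
 also have "... = (\<Sum>k<n. lam k ^ r * v k j * mv n X (v k) i)"
  unfolding mv_def sum_distrib_left by (subst sum.swap) (simp add: mult_ac)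
 also have "... = (\<Sum>k<n. lam k ^ Suc r * (v k i * v k j))"
  by (intro sum.cong refl) (simp add: ev Suc.prems)
 finally show ?case .
qed

text \<open>The trace of an even power is the sum of the powers of the eigenvalues, all nonnegative,
  so it bounds each of them.\<close>

lemma opb_trace:
 assumes S: "symm n X" and tr: "(\<Sum>i<n. mpow n X (2 * k) i i) \<le> K ^ (2 * k)" and K: "0 \<le> K" and k: "0 < k"
 shows "opb n X K"
proof -
 from spectral_theorem[OF S] obtain v lam where
  ev: "!!j i. j < n ==> i < n ==> mv n X (v j) i = lam j * v j i"
  and on: "!!j m. j < n ==> m < n ==> ip n (v j) (v m) = of_bool (j = m)"
  and "!!j y. j < n ==> (!!m. m < j ==> ip n y (v m) = 0) ==> ip n y (mv n X y) \<le> lam j * ip n y y" by blast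
 have "(\<Sum>i<n. mpow n X (2 * k) i i) = (\<Sum>i<n. \<Sum>j<n. lam j ^ (2*k) * (v j i * v j i))"
  by (intro sum.cong refl mpow_spectral[OF ev on]) auto
 also have "... = (\<Sum>j<n. lam j ^ (2*k) * ip n (v j) (v j))"
  unfolding ip_def sum_distrib_left by (rule sum.swap)
 also have "... = (\<Sum>j<n. lam j ^ (2*k))" by (intro sum.cong refl) (simp add: on)
 finally have t: "(\<Sum>j<n. lam j ^ (2*k)) \<le> K ^ (2 * k)" using tr by simp
 have lam: "\<bar>lam j\<bar> \<le> K" if "j < n" for j
 proof -
  have "lam j ^ (2*k) \<le> (\<Sum>j<n. lam j ^ (2*k))"
   by (rule member_le_sum[of j "{..<n}" "%j. lam j ^ (2*k)"]) (use that in \<open>auto simp: power_mult\<close>)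
  then have "\<bar>lam j\<bar> ^ (2*k) \<le> K ^ (2*k)" using t by (simp add: power_mult)
  then show ?thesis using K k by (simp add: power_mono_iff)
 qed
 show ?thesis unfolding opb_def
 proof (intro conjI allI)
  fix x
  let ?c = "%k. ip n x (v k)"
  have par: "ip n (%i. \<Sum>k<n. g k * v k i) (%i. \<Sum>k<n. g k * v k i) = (\<Sum>k<n. (g k)^2)" for g
  proof -
   have "ip n (%i. \<Sum>k<n. g k * v k i) (%i. \<Sum>k<n. g k * v k i) = (\<Sum>t<n. g t * (\<Sum>t'<n. g t' * ip n (v t') (v t)))"
    by (simp add: ip_sum ip_sym[of n "v _" "%i. \<Sum>t<n. g t * v t i"])
   also have "... = (\<Sum>t<n. g t * (\<Sum>t'<n. g t' * of_bool (t' = t)))"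
    by (intro sum.cong refl arg_cong2[of _ _ _ _ "(*)"] on) auto
   also have "... = (\<Sum>t<n. (g t)^2)" by (intro sum.cong refl) (auto simp: power2_eq_square)
   finally show ?thesis .
  qed
  have x: "x i = (\<Sum>k<n. ?c k * v k i)" if "i < n" for i by (rule expand[OF on that])
  have Xx: "mv n X x i = (\<Sum>k<n. (lam k * ?c k) * v k i)" if i: "i < n" for i
  proof -
   have "mv n X x i = (\<Sum>j<n. X i j * (\<Sum>k<n. ?c k * v k j))"
    unfolding mv_def by (intro sum.cong refl arg_cong2[of _ _ _ _ "(*)"] x) auto
   also have "... = (\<Sum>k<n. ?c k * mv n X (v k) i)"
    unfolding mv_def sum_distrib_left by (subst sum.swap) (simp add: mult_ac)
   also have "... = (\<Sum>k<n. (lam k * ?c k) * v k i)" by (intro sum.cong refl) (simp add: ev i)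
   finally show ?thesis .
  qed
  have "(nm n (mv n X x))^2 = (\<Sum>k<n. (lam k * ?c k)^2)"
   unfolding nm_sq par[symmetric] by (rule ip_cong) (rule Xx, assumption)+
  also have "... \<le> (\<Sum>k<n. K^2 * (?c k)^2)"
   unfolding power_mult_distrib using lam by (intro sum_mono mult_right_mono) (auto simp: abs_le_square_iff[symmetric] K)
  also have "... = K^2 * (nm n x)^2"
   unfolding sum_distrib_left[symmetric] nm_sq par[symmetric] by (rule arg_cong[of _ _ "(*) (K^2)"], rule ip_cong) (rule x[symmetric], assumption)+
  finally have "(nm n (mv n X x))^2 \<le> (K * nm n x)^2" by (simp add: power_mult_distrib)
  then show "nm n (mv n X x) \<le> K * nm n x" by (rule power2_le_imp_le) (use K nm_pos in auto)
 qed (rule K)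
qed

lemma nm_sum:
 assumes "!!m. m \<in> T ==> nm n (w m) \<le> b m" "finite T"
 shows "nm n (%i. \<Sum>m\<in>T. w m i) \<le> (\<Sum>m\<in>T. b m)"
 using assms(2,1)
proof (induction T rule: finite_induct)
 case empty
 show ?case by (simp add: L2_set_def)
next
 case (insert a F)
 have "nm n (%i. \<Sum>m\<in>insert a F. w m i) = nm n (%i. w a i + (\<Sum>m\<in>F. w m i))" using insert by simp
 also have "... \<le> nm n (w a) + nm n (%i. \<Sum>m\<in>F. w m i)" by (rule nm_add)
 also have "... \<le> b a + (\<Sum>m\<in>F. b m)" using insert by (intro add_mono) auto
 finally show ?case using insert by simp
qed

text \<open>The walk recursion without probability: \<open>rt\<close> stands for sqrt alpha,
  \<open>be\<close> for beta, \<open>\<eta>\<close> for the slack n^e0, \<open>Dl\<close> for the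
  centred walks, \<open>Gm\<close> for the corrections; \<open>a1\<close> and \<open>b1\<close> are
  near alpha / n and beta / n. \<open>bB\<close> is only a crude bound on the walk matrices, enough
  because it meets the small factor \<open>bE\<close>.\<close>

locale recursion =
 fixes n l :: nat and B Dl :: "nat => nat => nat => real" and Er :: "nat => nat => real"
  and Gm :: "nat => nat => nat => nat => real" and sp :: "nat => real"
  and rt be a1 b1 \<eta> bB bE bG :: real
 assumes n2: "2 \<le> n" and spin: "!!i. i < n ==> sp i * sp i = 1"
  and rec: "!!t i j. t \<le> l ==> i < n ==> j < n ==> B t i j = Dl t i j
   + (\<Sum>m<t. \<Sum>u<n. \<Sum>v<n. Dl m i u * (a1 + b1 * sp u * sp v + Er u v) * B (t - 1 - m) v j)
   - (\<Sum>m<t. Gm m (t - 1 - m) i j)"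
  and symB: "!!t. symm n (B t)"
  and opD: "!!t. t \<le> l ==> opb n (Dl t) (\<eta> * rt ^ t)"
  and opB: "!!t. t \<le> l ==> opb n (B t) bB" and opE: "opb n Er bE"
  and opG: "!!m k. m + k + 1 \<le> l ==> opb n (Gm m k) bG"
  and rem_small: "real l * (\<eta> * rt ^ l * bE * bB + bG) \<le> 1"
  and rt: "1 \<le> rt" "rt \<le> be" "be \<le> rt^2" and eta: "1 \<le> \<eta>"
  and E: "!!t. t \<le> l ==> \<bar>ip n (%_. 1) (mv n (B t) (%_. 1)) - real n * rt ^ (2*t)\<bar> \<le> sqrt (real n) * \<eta> * rt ^ (2*t)"
  and G: "!!t. t \<le> l ==> \<bar>ip n (%_. 1) (mv n (B t) sp)\<bar> \<le> sqrt (real n) * \<eta> * rt ^ (2*t)"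
  and K: "!!t. t \<le> l ==> \<bar>ip n sp (mv n (B t) sp) - real n * be ^ t\<bar> \<le> sqrt (real n) * \<eta> * rt ^ (2*t)"
  and a1: "0 \<le> a1" "\<bar>a1 * real n - rt^2\<bar> \<le> rt^2 / sqrt (real n)" "a1 * real n \<le> 2 * rt^2"
  and b1: "0 \<le> b1" "\<bar>b1 * real n - be\<bar> \<le> rt^2 / sqrt (real n)" "b1 * real n \<le> 2 * rt^2"
  and big_n: "10 * (real l + 1) * \<eta>^2 * rt ^ (2*l) \<le> sqrt (real n)"
begin

abbreviation "ee \<equiv> (%_::nat. 1::real)"

lemma np: "0 < sqrt (real n)" "sqrt (real n) * sqrt (real n) = real n" "0 < real n" using n2 by auto

lemma nm_one: "nm n ee = sqrt (real n)" unfolding L2_set_def by simp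
lemma nm_sp: "nm n sp = sqrt (real n)"
proof -
 have "(\<Sum>i<n. (sp i)^2) = (\<Sum>i<n. 1)" by (intro sum.cong) (auto simp: power2_eq_square spin)
 then show ?thesis unfolding L2_set_def by simp
qed

lemma rt_mono: "i \<le> j ==> rt ^ i \<le> rt ^ j" using rt by (intro power_increasing) auto
lemma rt_pos: "0 < rt ^ i" using rt by simp
lemma be_pos: "0 < be ^ i" using rt by simp

definition rem where "rem t x i = (\<Sum>m<t. mv n (Dl m) (mv n Er (mv n (B (t - 1 - m)) x)) i) - (\<Sum>m<t. mv n (Gm m (t - 1 - m)) x i)"

text \<open>\<open>rem_small\<close> is made for this: errors of the expected adjacency and
  corrections together stay below the norm of the argument.\<close>

lemma rem_bound: assumes t: "t \<le> l" shows "nm n (rem t x) \<le> nm n x"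
proof -
 have b0: "0 \<le> bE" "0 \<le> bB" "0 \<le> bG \<or> l = 0" using opE opB[of 0] opG[of 0 0] unfolding opb_def by auto
 have 1: "nm n (mv n (Dl m) (mv n Er (mv n (B (t - 1 - m)) x))) \<le> \<eta> * rt ^ l * bE * bB * nm n x" if m: "m < t" for m
 proof -
  have "nm n (mv n (Dl m) (mv n Er (mv n (B (t - 1 - m)) x))) \<le> \<eta> * rt ^ m * (bE * (bB * nm n x))"
   by (rule opb_comp[OF opD opb_comp[OF opE opbD[OF opB]]]) (use m t in auto)
  also have "... \<le> \<eta> * rt ^ l * (bE * (bB * nm n x))"
   using rt_mono[of m l] m t b0 eta nm_pos[of x n] by (intro mult_right_mono mult_left_mono mult_nonneg_nonneg) auto
  finally show ?thesis by (simp add: mult_ac)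
 qed
 have 2: "nm n (%i. - mv n (Gm m (t - 1 - m)) x i) \<le> bG * nm n x" if m: "m < t" for m
  unfolding nm_minus by (rule opbD[OF opG]) (use m t in auto)
 have "nm n (rem t x) = nm n (%i. \<Sum>m<t. mv n (Dl m) (mv n Er (mv n (B (t - 1 - m)) x)) i + - mv n (Gm m (t - 1 - m)) x i)"
  by (rule nm_cong) (simp add: rem_def sum_subtractf)
 also have "... \<le> (\<Sum>m<t. \<eta> * rt ^ l * bE * bB * nm n x + bG * nm n x)"
  by (rule nm_sum) (rule order.trans[OF nm_add], rule add_mono, use 1 2 in auto)
 also have "... = real t * ((\<eta> * rt ^ l * bE * bB + bG) * nm n x)" by (simp add: algebra_simps)
 also have "... \<le> real l * ((\<eta> * rt ^ l * bE * bB + bG) * nm n x)"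
 proof (cases "l = 0")
  case False
  then show ?thesis using t b0 eta rt_pos[of l] nm_pos[of x n] by (intro mult_right_mono mult_nonneg_nonneg add_nonneg_nonneg) auto
 qed (use t in simp)
 also have "... \<le> 1 * nm n x" using mult_right_mono[OF rem_small nm_pos[of x n]] by (simp add: mult.assoc)
 finally show ?thesis by simp
qed

text \<open>The rank-one parts of the expected adjacency see x only through its inner products with
  the shorter B_r 1 and B_r s; what is left is the centred matrix and the remainder.\<close>

lemma expand_B:
 assumes t: "t \<le> l" and i: "i < n"
 shows "mv n (B t) x i = mv n (Dl t) x i + (\<Sum>m<t. a1 * ip n (mv n (B (t - 1 - m)) ee) x * mv n (Dl m) ee i
   + b1 * ip n (mv n (B (t - 1 - m)) sp) x * mv n (Dl m) sp i) + rem t x i"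
proof -
 define y where "y m = mv n (B (t - 1 - m)) x" for m
 have "mv n (B t) x i = (\<Sum>j<n. Dl t i j * x j + (\<Sum>m<t. \<Sum>u<n. \<Sum>v<n. Dl m i u * (a1 + b1 * sp u * sp v + Er u v) * (B (t - 1 - m) v j * x j))
   - (\<Sum>m<t. Gm m (t - 1 - m) i j * x j))"
  unfolding mv_def by (intro sum.cong refl, subst rec[OF t i]) (simp_all only: left_diff_distrib distrib_right sum_distrib_right mult.assoc lessThan_iff)
 also have "... = mv n (Dl t) x i + (\<Sum>j<n. \<Sum>m<t. \<Sum>u<n. \<Sum>v<n. Dl m i u * (a1 + b1 * sp u * sp v + Er u v) * (B (t - 1 - m) v j * x j))
   - (\<Sum>m<t. mv n (Gm m (t - 1 - m)) x i)"
  unfolding mv_def by (simp add: sum.distrib sum_subtractf) (rule sum.swap)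
 also have "(\<Sum>j<n. \<Sum>m<t. \<Sum>u<n. \<Sum>v<n. Dl m i u * (a1 + b1 * sp u * sp v + Er u v) * (B (t - 1 - m) v j * x j))
   = (\<Sum>m<t. \<Sum>u<n. \<Sum>v<n. \<Sum>j<n. Dl m i u * (a1 + b1 * sp u * sp v + Er u v) * (B (t - 1 - m) v j * x j))"
  by (subst sum.swap, rule sum.cong[OF refl], subst sum.swap, rule sum.cong[OF refl], rule sum.swap)
 also have "... = (\<Sum>m<t. \<Sum>u<n. \<Sum>v<n. Dl m i u * (a1 + b1 * sp u * sp v + Er u v) * y m v)"
  unfolding y_def mv_def by (simp add: sum_distrib_left)
 also have "... = (\<Sum>m<t. a1 * ip n ee (y m) * mv n (Dl m) ee i + b1 * ip n sp (y m) * mv n (Dl m) sp i + mv n (Dl m) (mv n Er (y m)) i)"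
 proof (rule sum.cong[OF refl])
  fix m
  have "(\<Sum>u<n. \<Sum>v<n. Dl m i u * (a1 + b1 * sp u * sp v + Er u v) * y m v)
    = (\<Sum>u<n. Dl m i u * (a1 * ip n ee (y m) + b1 * ip n sp (y m) * sp u + mv n Er (y m) u))"
   unfolding ip_def mv_def by (intro sum.cong refl) (simp add: sum_distrib_left sum.distrib algebra_simps)
  also have "... = a1 * ip n ee (y m) * mv n (Dl m) ee i + b1 * ip n sp (y m) * mv n (Dl m) sp i + mv n (Dl m) (mv n Er (y m)) i"
   unfolding mv_def[of _ "Dl m"] sum_distrib_left sum.distrib[symmetric] by (intro sum.cong refl) (simp add: algebra_simps)
  finally show "(\<Sum>u<n. \<Sum>v<n. Dl m i u * (a1 + b1 * sp u * sp v + Er u v) * y m v)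
    = a1 * ip n ee (y m) * mv n (Dl m) ee i + b1 * ip n sp (y m) * mv n (Dl m) sp i + mv n (Dl m) (mv n Er (y m)) i" .
 qed
 finally show ?thesis unfolding rem_def y_def ip_mv[OF symB] by (simp add: sum.distrib)
qed

lemma D_bound: "t \<le> l ==> nm n z = sqrt (real n) ==> nm n (mv n (Dl t) z) \<le> \<eta> * rt ^ t * sqrt (real n)"
 using opbD[OF opD, of t z] by simp

lemma coef_bounds:
 assumes r: "r \<le> l"
 shows "\<bar>a1 * ip n ee (mv n (B r) ee) - rt ^ (2 * Suc r)\<bar> \<le> 3 * \<eta> * rt ^ (2 * Suc r) / sqrt (real n)"
  "\<bar>a1 * ip n ee (mv n (B r) sp)\<bar> \<le> 3 * \<eta> * rt ^ (2 * Suc r) / sqrt (real n)"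
  "\<bar>b1 * ip n ee (mv n (B r) sp)\<bar> \<le> 3 * \<eta> * rt ^ (2 * Suc r) / sqrt (real n)"
  "\<bar>b1 * ip n sp (mv n (B r) sp) - be ^ Suc r\<bar> \<le> 3 * \<eta> * rt ^ (2 * Suc r) / sqrt (real n)"
proof -
 let ?N = "sqrt (real n)"
 have main: "\<bar>c * x - \<mu> * g\<bar> \<le> 3 * \<eta> * rt ^ (2 * Suc r) / ?N"
  if c: "0 \<le> c" "\<bar>c * real n - \<mu>\<bar> \<le> rt^2 / ?N \<or> g = 0" "c * real n \<le> 2 * rt^2"
   and x: "\<bar>x - real n * g\<bar> \<le> ?N * \<eta> * rt ^ (2*r)" and g: "0 \<le> g" "g \<le> rt ^ (2*r)" for c x \<mu> g
 proof -
  have "c * x - \<mu> * g = c * (x - real n * g) + (c * real n - \<mu>) * g" by (simp add: algebra_simps)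
  then have "\<bar>c * x - \<mu> * g\<bar> \<le> \<bar>c\<bar> * \<bar>x - real n * g\<bar> + \<bar>c * real n - \<mu>\<bar> * \<bar>g\<bar>"
   by (simp only: abs_mult[symmetric] abs_triangle_ineq)
  also have "... \<le> c * (?N * \<eta> * rt ^ (2*r)) + rt^2 / ?N * rt ^ (2*r)"
  proof (rule add_mono)
   show "\<bar>c\<bar> * \<bar>x - real n * g\<bar> \<le> c * (?N * \<eta> * rt ^ (2*r))" using c x by (simp add: mult_left_mono)
   show "\<bar>c * real n - \<mu>\<bar> * \<bar>g\<bar> \<le> rt^2 / ?N * rt ^ (2*r)"
    using c(2)
   proof
    assume "\<bar>c * real n - \<mu>\<bar> \<le> rt^2 / ?N"
    then show ?thesis using g np by (intro mult_mono) auto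
   next
    assume "g = 0"
    then show ?thesis using rt_pos[of "2*r"] np by simp
   qed
  qed
  also have "c * (?N * \<eta> * rt ^ (2*r)) = (c * real n) * (\<eta> * rt ^ (2*r)) / ?N"
   using np by (simp add: field_simps)
  also have "... \<le> (2 * rt^2) * (\<eta> * rt ^ (2*r)) / ?N"
   using c eta rt np by (intro divide_right_mono mult_right_mono) auto
  also have "(2 * rt^2) * (\<eta> * rt ^ (2*r)) / ?N = 2 * (\<eta> * rt ^ (2 * Suc r) / ?N)"
   by (simp add: power_add power2_eq_square mult_ac)
  also have "rt^2 / ?N * rt ^ (2*r) = 1 * (rt ^ (2 * Suc r) / ?N)" by (simp add: power_add power2_eq_square mult_ac)
  also have "... \<le> \<eta> * (rt ^ (2 * Suc r) / ?N)" using eta rt np by (intro mult_right_mono) auto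
  finally show ?thesis by simp
 qed
 show "\<bar>a1 * ip n ee (mv n (B r) ee) - rt ^ (2 * Suc r)\<bar> \<le> 3 * \<eta> * rt ^ (2 * Suc r) / ?N"
 proof -
  have P: "rt^2 * rt ^ (2*r) = rt ^ (2 * Suc r)" by (simp add: power_add power2_eq_square)
  show ?thesis by (rule main[where \<mu> = "rt^2" and g = "rt ^ (2*r)", unfolded P]) (use a1 E[OF r] rt_pos[of "2*r"] in auto)
 qed
 show "\<bar>a1 * ip n ee (mv n (B r) sp)\<bar> \<le> 3 * \<eta> * rt ^ (2 * Suc r) / ?N"
  using main[of a1 0 0] a1 G[OF r] rt_pos rt by simp
 show "\<bar>b1 * ip n ee (mv n (B r) sp)\<bar> \<le> 3 * \<eta> * rt ^ (2 * Suc r) / ?N"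
  using main[of b1 0 0] b1 G[OF r] rt_pos rt by simp
 have "be ^ r \<le> rt ^ (2*r)" unfolding power_mult using rt by (intro power_mono) auto
 then show "\<bar>b1 * ip n sp (mv n (B r) sp) - be ^ Suc r\<bar> \<le> 3 * \<eta> * rt ^ (2 * Suc r) / ?N"
  using main[of b1 be "be^r"] b1 K[OF r] be_pos[of r] by simp
qed

text \<open>Each coefficient differs from its limit by at most order eta rt^(2 (t - m)) / sqrt n,
  and the centred term has norm at most eta rt^m sqrt n; \<open>big_n\<close> keeps the sum of these
  errors below sqrt n.\<close>

lemma approx:
 assumes t: "t \<le> l" and z: "nm n z = sqrt (real n)" "nm n z' = sqrt (real n)"
  and c1: "!!m. m < t ==> \<bar>c1 m - \<gamma> ^ (t - m)\<bar> \<le> 3 * \<eta> * rt ^ (2 * (t - m)) / sqrt (real n)"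
  and c2: "!!m. m < t ==> \<bar>c2 m\<bar> \<le> 3 * \<eta> * rt ^ (2 * (t - m)) / sqrt (real n)"
  and eq: "!!i. i < n ==> mv n (B t) z i = mv n (Dl t) z i + (\<Sum>m<t. c1 m * mv n (Dl m) z i + c2 m * mv n (Dl m) z' i) + rem t z i"
 shows "nm n (%i. mv n (B t) z i - (\<Sum>m\<le>t. \<gamma> ^ (t - m) * mv n (Dl m) z i)) \<le> 2 * sqrt (real n)"
proof -
 let ?N = "sqrt (real n)"
 have tm: "nm n (%i. c * mv n (Dl m) y i) \<le> 3 * \<eta>^2 * rt ^ (2*l)"
  if c: "\<bar>c\<bar> \<le> 3 * \<eta> * rt ^ (2 * (t - m)) / ?N" and m: "m < t" and y: "nm n y = ?N" for c m y
 proof -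
  have "nm n (%i. c * mv n (Dl m) y i) \<le> (3 * \<eta> * rt ^ (2 * (t - m)) / ?N) * (\<eta> * rt ^ m * ?N)"
   unfolding nm_scale by (rule mult_mono[OF c D_bound[OF _ y]]) (use m t eta rt np in auto)
  also have "... = 3 * \<eta>^2 * rt ^ (2 * (t - m) + m)" using np by (simp add: power_add power2_eq_square)
  also have "... \<le> 3 * \<eta>^2 * rt ^ (2*l)" using m t by (intro mult_left_mono rt_mono) auto
  finally show ?thesis .
 qed
 let ?w = "%m i. (c1 m - \<gamma> ^ (t - m)) * mv n (Dl m) z i + c2 m * mv n (Dl m) z' i"
 have "nm n (%i. \<Sum>m<t. ?w m i) \<le> (\<Sum>m<t. 3 * \<eta>^2 * rt ^ (2*l) + 3 * \<eta>^2 * rt ^ (2*l))"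
  by (rule nm_sum) (rule order.trans[OF nm_add], rule add_mono, use tm c1 c2 z in auto)
 also have "... = 6 * (real t * \<eta>^2 * rt ^ (2*l))" by simp
 also have "... \<le> 6 * ((real l + 1) * \<eta>^2 * rt ^ (2*l))" using t rt by (intro mult_left_mono mult_right_mono) auto
 also have "... \<le> ?N"
 proof -
  have "0 \<le> (real l + 1) * \<eta>^2 * rt ^ (2*l)" using rt by simp
  then show ?thesis using big_n unfolding mult.assoc by linarith
 qed
 finally have 1: "nm n (%i. \<Sum>m<t. ?w m i) \<le> ?N" .
 have "nm n (%i. mv n (B t) z i - (\<Sum>m\<le>t. \<gamma> ^ (t - m) * mv n (Dl m) z i)) \<le> ?N + ?N + 0"
 proof (rule nm_add3[OF _ 1, of _ "rem t z" "%_. 0"])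
  fix i assume i: "i < n"
  show "mv n (B t) z i - (\<Sum>m\<le>t. \<gamma> ^ (t - m) * mv n (Dl m) z i) = (\<Sum>m<t. ?w m i) + rem t z i + 0"
   unfolding eq[OF i] lessThan_Suc_atMost[symmetric] by (simp add: sum.distrib sum_subtractf left_diff_distrib)
 qed (use rem_bound[OF t, of z] z in \<open>auto simp: L2_set_def\<close>)
 then show ?thesis by simp
qed

lemma s_approx:
 assumes t: "t \<le> l"
 shows "nm n (%i. mv n (B t) ee i - (\<Sum>m\<le>t. (rt^2) ^ (t - m) * mv n (Dl m) ee i)) \<le> 2 * sqrt (real n)"
proof (rule approx[OF t nm_one nm_sp])
 fix m assume m: "m < t"
 then have "Suc (t - 1 - m) = t - m" "t - 1 - m \<le> l" using t by auto
 note c = coef_bounds[OF this(2), unfolded this(1)]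
 show "\<bar>a1 * ip n (mv n (B (t - 1 - m)) ee) ee - (rt^2) ^ (t - m)\<bar> \<le> 3 * \<eta> * rt ^ (2 * (t - m)) / sqrt (real n)"
  using c(1) unfolding ip_sym[of n ee] power_mult by simp
 show "\<bar>b1 * ip n (mv n (B (t - 1 - m)) sp) ee\<bar> \<le> 3 * \<eta> * rt ^ (2 * (t - m)) / sqrt (real n)"
  using c(3) unfolding ip_sym[of n ee] by simp
qed (rule expand_B[OF t])

lemma d_approx:
 assumes t: "t \<le> l"
 shows "nm n (%i. mv n (B t) sp i - (\<Sum>m\<le>t. be ^ (t - m) * mv n (Dl m) sp i)) \<le> 2 * sqrt (real n)"
proof (rule approx[OF t nm_sp nm_one])
 fix m assume m: "m < t"
 then have "Suc (t - 1 - m) = t - m" "t - 1 - m \<le> l" using t by auto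
 note c = coef_bounds[OF this(2), unfolded this(1)]
 show "\<bar>b1 * ip n (mv n (B (t - 1 - m)) sp) sp - be ^ (t - m)\<bar> \<le> 3 * \<eta> * rt ^ (2 * (t - m)) / sqrt (real n)"
  using c(4) unfolding ip_sym[of n sp] by simp
 have "ip n (mv n (B (t - 1 - m)) ee) sp = ip n ee (mv n (B (t - 1 - m)) sp)" by (rule ip_mv[OF symB, symmetric])
 then show "\<bar>a1 * ip n (mv n (B (t - 1 - m)) ee) sp\<bar> \<le> 3 * \<eta> * rt ^ (2 * (t - m)) / sqrt (real n)"
  using c(2) by simp
next
 fix i assume "i < n"
 from expand_B[OF t this, of sp]
 show "mv n (B t) sp i = mv n (Dl t) sp i + (\<Sum>m<t. b1 * ip n (mv n (B (t - 1 - m)) sp) sp * mv n (Dl m) sp i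
   + a1 * ip n (mv n (B (t - 1 - m)) ee) sp * mv n (Dl m) ee i) + rem t sp i" by (simp only: add.commute)
qed

text \<open>Up to a scalar, B_t z is B_l z with an error of order rt^t sqrt n up to the slack. Hence
  a vector orthogonal to B_l z is nearly orthogonal to all shorter B_t z. The condition
  \<open>rt \<le> \<gamma>\<close> keeps the discarded tail at that size; for gamma = beta it is
  beta^2 >= alpha.\<close>

lemma rescale:
 assumes t: "t \<le> l" and z: "nm n z = sqrt (real n)" and \<gamma>: "rt \<le> \<gamma>"
  and ap: "!!t. t \<le> l ==> nm n (%i. mv n (B t) z i - (\<Sum>m\<le>t. \<gamma> ^ (t - m) * mv n (Dl m) z i)) \<le> 2 * sqrt (real n)"
 shows "nm n (%i. mv n (B t) z i - (1 / \<gamma> ^ (l - t)) * mv n (B l) z i) \<le> 5 * (real l + 1) * \<eta> * rt ^ t * sqrt (real n)"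
  "nm n (mv n (B t) z) \<le> 5 * (real l + 1) * \<eta> * \<gamma> ^ t * sqrt (real n)"
proof -
 let ?N = "sqrt (real n)"
 let ?h = "%t i. \<Sum>m\<le>t. \<gamma> ^ (t - m) * mv n (Dl m) z i"
 have g1: "1 \<le> \<gamma>" using \<gamma> rt by simp
 have le1: "rt ^ i \<le> \<gamma> ^ i" for i using \<gamma> rt by (intro power_mono) auto
 have ge: "(1::real) \<le> (real l + 1) * (\<eta> * X)" if "1 \<le> X" for X
  using mult_mono[OF _ mult_mono[OF eta that], of 1 "real l + 1"] eta that by simp
 let ?g = "1 / \<gamma> ^ (l - t)"
 have gg: "0 < ?g" "?g \<le> 1" using g1 by auto
 \<comment> \<open>After rescaling, the terms with m <= t agree and cancel; only the tail
   remains.\<close>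
 have split: "?h t i - ?g * ?h l i = (\<Sum>m\<in>{t<..l}. (- (?g * \<gamma> ^ (l - m))) * mv n (Dl m) z i)" for i
 proof -
  have "{..l} = {..t} \<union> {t<..l}" using t by auto
  then have "?h l i = (\<Sum>m\<le>t. \<gamma> ^ (l - m) * mv n (Dl m) z i) + (\<Sum>m\<in>{t<..l}. \<gamma> ^ (l - m) * mv n (Dl m) z i)"
   by (simp only:) (rule sum.union_disjoint, auto)
  moreover have "?g * (\<Sum>m\<le>t. \<gamma> ^ (l - m) * mv n (Dl m) z i) = ?h t i"
   unfolding sum_distrib_left
  proof (rule sum.cong[OF refl])
   fix m assume "m \<in> {..t}"
   then have "\<gamma> ^ (l - m) = \<gamma> ^ (l - t) * \<gamma> ^ (t - m)" using t by (simp add: power_add[symmetric])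
   then show "?g * (\<gamma> ^ (l - m) * mv n (Dl m) z i) = \<gamma> ^ (t - m) * mv n (Dl m) z i" using g1 by simp
  qed
  ultimately show ?thesis by (simp add: distrib_left sum_negf sum_distrib_left mult_ac)
 qed
 have "nm n (%i. ?h t i - ?g * ?h l i) \<le> (\<Sum>m\<in>{t<..l}. \<eta> * rt ^ t * ?N)"
  unfolding split
 proof (rule nm_sum)
  fix m assume m: "m \<in> {t<..l}"
  then have "\<gamma> ^ (l - t) = \<gamma> ^ (l - m) * \<gamma> ^ (m - t)" by (simp add: power_add[symmetric])
  then have e: "?g * \<gamma> ^ (l - m) = 1 / \<gamma> ^ (m - t)" using g1 by simp
  have "nm n (%i. (- (?g * \<gamma> ^ (l - m))) * mv n (Dl m) z i) \<le> (1 / \<gamma> ^ (m - t)) * (\<eta> * rt ^ m * ?N)"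
   unfolding nm_scale e using D_bound[OF _ z, of m] m g1 by (intro mult_mono) auto
  also have "rt ^ m = rt ^ (m - t) * rt ^ t" using m by (simp add: power_add[symmetric])
  also have "(1 / \<gamma> ^ (m - t)) * (\<eta> * (rt ^ (m - t) * rt ^ t) * ?N) = (rt ^ (m - t) / \<gamma> ^ (m - t)) * (\<eta> * rt ^ t * ?N)" by simp
  also have "... \<le> 1 * (\<eta> * rt ^ t * ?N)"
   using le1[of "m - t"] g1 eta rt np by (intro mult_right_mono) auto
  finally show "nm n (%i. (- (?g * \<gamma> ^ (l - m))) * mv n (Dl m) z i) \<le> \<eta> * rt ^ t * ?N" by simp
 qed simp
 also have "... \<le> real l * (\<eta> * rt ^ t * ?N)" using eta rt np by (simp add: mult_right_mono)
 finally have 1: "nm n (%i. ?h t i - ?g * ?h l i) \<le> real l * (\<eta> * rt ^ t * ?N)" .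
 have 2: "nm n (%i. - (?g * (mv n (B l) z i - ?h l i))) \<le> 2 * ?N"
 proof -
  have "nm n (%i. - (?g * (mv n (B l) z i - ?h l i))) = ?g * nm n (%i. mv n (B l) z i - ?h l i)"
   unfolding nm_minus nm_scale using gg by simp
  also have "... \<le> 1 * (2 * ?N)" using gg ap[of l] by (intro mult_mono nm_pos) auto
  finally show ?thesis by simp
 qed
 have "nm n (%i. mv n (B t) z i - ?g * mv n (B l) z i) \<le> 2 * ?N + real l * (\<eta> * rt ^ t * ?N) + 2 * ?N"
  by (rule nm_add3[OF _ ap[OF t] 1 2]) (simp add: algebra_simps)
 also have "... \<le> 5 * ((real l + 1) * (\<eta> * rt ^ t)) * ?N"
 proof -
  have "4 * 1 \<le> 4 * ((real l + 1) * (\<eta> * rt ^ t))" using ge[of "rt ^ t"] rt by (intro mult_left_mono) auto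
  then have "4 + real l * (\<eta> * rt ^ t) \<le> 5 * ((real l + 1) * (\<eta> * rt ^ t))"
  proof -
   have "0 \<le> \<eta> * rt ^ t" using eta rt_pos[of t] by simp
   then have "real l * (\<eta> * rt ^ t) \<le> (real l + 1) * (\<eta> * rt ^ t)" by (intro mult_right_mono) auto
   then show ?thesis using \<open>4 * 1 \<le> _\<close> by linarith
  qed
  from mult_right_mono[OF this, of ?N] np show ?thesis by (simp add: algebra_simps)
 qed
 finally show "nm n (%i. mv n (B t) z i - ?g * mv n (B l) z i) \<le> 5 * (real l + 1) * \<eta> * rt ^ t * ?N" by (simp only: mult.assoc)
 have "nm n (?h t) \<le> (\<Sum>m\<in>{..t}. \<eta> * \<gamma> ^ t * ?N)"
 proof (rule nm_sum)
  fix m assume m: "m \<in> {..t}"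
  have "nm n (%i. \<gamma> ^ (t - m) * mv n (Dl m) z i) \<le> \<gamma> ^ (t - m) * (\<eta> * rt ^ m * ?N)"
   unfolding nm_scale using D_bound[OF _ z, of m] m t g1 by (intro mult_mono) auto
  also have "... \<le> \<gamma> ^ (t - m) * (\<eta> * \<gamma> ^ m * ?N)"
   using le1[of m] g1 eta np by (intro mult_left_mono mult_right_mono) auto
  also have "... = \<eta> * \<gamma> ^ t * ?N" using m by (simp add: mult_ac power_add[symmetric])
  finally show "nm n (%i. \<gamma> ^ (t - m) * mv n (Dl m) z i) \<le> \<eta> * \<gamma> ^ t * ?N" .
 qed simp
 also have "... \<le> (real l + 1) * (\<eta> * \<gamma> ^ t * ?N)" using eta g1 np t by (simp add: mult_right_mono)
 finally have 3: "nm n (?h t) \<le> (real l + 1) * (\<eta> * \<gamma> ^ t * ?N)" .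
 have "nm n (mv n (B t) z) \<le> 2 * ?N + (real l + 1) * (\<eta> * \<gamma> ^ t * ?N) + 0"
  by (rule nm_add3[OF _ ap[OF t] 3, of _ "%_. 0"]) (auto simp: L2_set_def)
 also have "... \<le> 5 * ((real l + 1) * (\<eta> * \<gamma> ^ t)) * ?N"
 proof -
  have "2 * 1 \<le> 4 * ((real l + 1) * (\<eta> * \<gamma> ^ t))" using ge[OF one_le_power[OF g1, of t]] by linarith
  from mult_right_mono[OF this, of ?N] np show ?thesis by (simp add: algebra_simps)
 qed
 finally show "nm n (mv n (B t) z) \<le> 5 * (real l + 1) * \<eta> * \<gamma> ^ t * ?N" by (simp only: mult.assoc)
qed

lemma sq_ge: "rt \<le> rt^2" using rt by (simp add: power2_eq_square)

lemmas s_rescale = rescale[OF _ nm_one sq_ge s_approx]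
lemmas d_rescale = rescale[OF _ nm_sp rt(2) d_approx]

end

locale recursion_spikes = recursion +
 fixes S D :: "nat => real" and \<delta> L :: real
 assumes rtbe: "8 * (22 * (real l + 1)^2 * \<eta>^2 * rt^2 * rt ^ l) \<le> \<delta> * be ^ l"
  and beal: "2 * (22 * (real l + 1)^2 * \<eta>^2 * rt^2 * be ^ l) \<le> \<delta> * rt ^ (2*l)"
  and delta: "0 \<le> \<delta>" "\<delta> \<le> 1/100" "1 \<le> L" "\<delta> * L \<le> 1/100"
  and sd: "\<bar>ip n (mv n (B l) ee) (mv n (B l) sp)\<bar> \<le> \<delta> * (real n * rt ^ (2*l) * be ^ l)"
  and snorm: "nm n (mv n (B l) ee) \<le> L * sqrt (real n) * rt ^ (2*l)"
  and appr: "nm n (%i. mv n (B l) ee i - S i) \<le> \<delta> * sqrt (real n)" "nm n (%i. mv n (B l) sp i - D i) \<le> \<delta> * sqrt (real n)"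
begin

text \<open>\<open>expand_B\<close> with all inner products bounded at rate gamma. With gamma = rt,
  for vectors orthogonal to both spikes, it yields \<open>\<rho>\<close> of \<open>spikes\<close>;
  with gamma = be, for vectors orthogonal to the first only, it yields
  \<open>\<tau>\<close>.\<close>

lemma bulk_bound:
 assumes \<gamma>: "rt \<le> \<gamma>"
  and s: "!!r. r \<le> l ==> \<bar>ip n (mv n (B r) ee) x\<bar> \<le> 5 * (real l + 1) * \<eta> * \<gamma> ^ r * sqrt (real n) * nm n x"
  and d: "!!r. r \<le> l ==> \<bar>ip n (mv n (B r) sp) x\<bar> \<le> 5 * (real l + 1) * \<eta> * \<gamma> ^ r * sqrt (real n) * nm n x"
 shows "nm n (mv n (B l) x) \<le> 22 * (real l + 1)^2 * \<eta>^2 * rt^2 * \<gamma> ^ l * nm n x"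
proof -
 let ?N = "sqrt (real n)" let ?X = "nm n x"
 have g1: "1 \<le> \<gamma>" using \<gamma> rt by simp
 have le1: "rt ^ i \<le> \<gamma> ^ i" for i using \<gamma> rt by (intro power_mono) auto
 define T where "T = (real l + 1) * \<eta>^2 * rt^2 * \<gamma> ^ l * ?X"
 have T0: "0 \<le> T" unfolding T_def using g1 nm_pos by simp
 have tm: "nm n (%i. c * q * mv n (Dl m) y i) \<le> 10 * T"
  if c: "0 \<le> c" "c * real n \<le> 2 * rt^2" and q: "\<bar>q\<bar> \<le> 5 * (real l + 1) * \<eta> * \<gamma> ^ (l - 1 - m) * ?N * ?X"
   and m: "m < l" and y: "nm n y = ?N" for c q m y
 proof -
  have "nm n (%i. c * q * mv n (Dl m) y i) \<le> (c * (5 * (real l + 1) * \<eta> * \<gamma> ^ (l - 1 - m) * ?N * ?X)) * (\<eta> * rt ^ m * ?N)"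
   unfolding nm_scale abs_mult using c D_bound[OF _ y, of m] m q eta rt g1 by (intro mult_mono mult_nonneg_nonneg) auto
  also have "... = (c * (?N * ?N)) * (5 * (real l + 1) * \<eta>^2 * (\<gamma> ^ (l - 1 - m) * rt ^ m) * ?X)"
   by (simp add: power2_eq_square mult_ac)
  also have "... \<le> (2 * rt^2) * (5 * (real l + 1) * \<eta>^2 * (\<gamma> ^ (l - 1 - m) * \<gamma> ^ m) * ?X)"
   unfolding np(2)
  proof (rule mult_mono[OF c(2)])
   show "5 * (real l + 1) * \<eta>^2 * (\<gamma> ^ (l - 1 - m) * rt ^ m) * ?X \<le> 5 * (real l + 1) * \<eta>^2 * (\<gamma> ^ (l - 1 - m) * \<gamma> ^ m) * ?X"
    using le1[of m] g1 nm_pos[of x n] by (intro mult_left_mono mult_right_mono) auto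
   show "0 \<le> 5 * (real l + 1) * \<eta>^2 * (\<gamma> ^ (l - 1 - m) * rt ^ m) * ?X"
    using g1 nm_pos[of x n] rt by simp
  qed simp
  also have "\<gamma> ^ (l - 1 - m) * \<gamma> ^ m = \<gamma> ^ (l - 1)" using m by (simp add: power_add[symmetric])
  also have "(2 * rt^2) * (5 * (real l + 1) * \<eta>^2 * \<gamma> ^ (l - 1) * ?X) \<le> (2 * rt^2) * (5 * (real l + 1) * \<eta>^2 * \<gamma> ^ l * ?X)"
   using g1 nm_pos[of x n] by (intro mult_left_mono mult_right_mono power_increasing mult_nonneg_nonneg) auto
  also have "... = 10 * T" unfolding T_def by simp
  finally show ?thesis .
 qed
 let ?w = "%m i. a1 * ip n (mv n (B (l - 1 - m)) ee) x * mv n (Dl m) ee i + b1 * ip n (mv n (B (l - 1 - m)) sp) x * mv n (Dl m) sp i"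
 have "nm n (%i. \<Sum>m<l. ?w m i) \<le> (\<Sum>m<l. 10 * T + 10 * T)"
  by (rule nm_sum) (rule order.trans[OF nm_add], rule add_mono, use tm a1 b1 s d nm_one nm_sp in auto)
 then have 1: "nm n (%i. \<Sum>m<l. ?w m i) \<le> 20 * (real l * T)" by simp
 have X: "?X \<le> T" and DX: "\<eta> * rt ^ l * ?X \<le> T"
 proof -
  have "1 * 1 * 1 * (1 * \<gamma> ^ l) \<le> (real l + 1) * \<eta> * rt^2 * (\<eta> * \<gamma> ^ l)"
   using rt eta g1 by (intro mult_mono) (auto simp: one_le_power)
  moreover have "rt ^ l \<le> 1 * 1 * 1 * (1 * \<gamma> ^ l)" using le1 by simp
  ultimately have a: "rt ^ l \<le> (real l + 1) * \<eta> * rt^2 * (\<eta> * \<gamma> ^ l)" by linarith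
  have "1 * 1 * 1 * \<gamma> ^ l \<le> (real l + 1) * \<eta> * rt^2 * \<gamma> ^ l"
   using rt eta g1 by (intro mult_mono) (auto simp: one_le_power)
  then have "rt ^ l \<le> (real l + 1) * \<eta> * rt^2 * \<gamma> ^ l" using le1[of l] by linarith
  then have "\<eta> * rt ^ l \<le> \<eta> * ((real l + 1) * \<eta> * rt^2 * \<gamma> ^ l)" using eta by (intro mult_left_mono) auto
  from mult_right_mono[OF this nm_pos[of x n]] show "\<eta> * rt ^ l * ?X \<le> T" unfolding T_def by (simp add: power2_eq_square mult_ac)
  have "1 \<le> (real l + 1) * \<eta> * rt^2 * (\<eta> * \<gamma> ^ l)" using a rt(1) one_le_power[of rt l] by linarith
  from mult_right_mono[OF this nm_pos[of x n]] show "?X \<le> T" unfolding T_def by (simp add: power2_eq_square mult_ac)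
 qed
 have "nm n (mv n (B l) x) \<le> \<eta> * rt ^ l * ?X + 20 * (real l * T) + ?X"
  by (rule nm_add3[OF expand_B[OF order.refl] opbD[OF opD[OF order.refl]] 1 rem_bound[OF order.refl]])
 \<comment> \<open>22 is 10 for each of the two rank-one parts, 1 for the centred matrix and 1 for
   the remainder.\<close>
 also have "... \<le> 22 * ((real l + 1) * T)"   proof -
  have arith: "p + 20 * M + q \<le> 22 * (M + N)" if "q \<le> N" "p \<le> N" "0 \<le> N" "0 \<le> M" for p q M N :: real
  proof -
   have "p + q \<le> 2 * N" using that(1,2) by simp
   moreover have "20 * M + 2 * N \<le> 22 * M + 22 * N" using that(3,4) by (intro add_mono mult_right_mono) simp_all
   ultimately show ?thesis by (simp add: distrib_left)
  qed
  show ?thesis unfolding distrib_right mult_1 by (rule arith[OF X DX T0]) (use T0 in simp)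
 qed
 finally show ?thesis unfolding T_def by (simp only: power2_eq_square mult_ac)
qed

sublocale spikes n "B l" sp S D "rt ^ (2*l)" "be ^ l" "22 * (real l + 1)^2 * \<eta>^2 * rt^2 * rt ^ l"
 "22 * (real l + 1)^2 * \<eta>^2 * rt^2 * be ^ l" \<delta> L "mv n (B l) ee" "mv n (B l) sp"
proof unfold_locales
 let ?N = "sqrt (real n)"
 show "symm n (B l)" by (rule symB)
 show "sp i * sp i = 1" if "i < n" for i by (rule spin[OF that])
 have perp: "\<bar>ip n (mv n (B r) z) x\<bar> \<le> 5 * (real l + 1) * \<eta> * rt ^ r * ?N * nm n x"
  if "ip n x (mv n (B l) z) = 0" "r \<le> l"
   "nm n (%i. mv n (B r) z i - c * mv n (B l) z i) \<le> 5 * (real l + 1) * \<eta> * rt ^ r * ?N" for r z x c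
 proof -
  have "ip n (mv n (B r) z) x = ip n (%i. mv n (B r) z i - c * mv n (B l) z i) x"
   using that(1) ip_sym[of n x] by (simp add: ip_diff ip_scale)
  also have "\<bar>...\<bar> \<le> (5 * (real l + 1) * \<eta> * rt ^ r * ?N) * nm n x"
   by (rule order.trans[OF ip_le mult_right_mono[OF that(3) nm_pos]])
  finally show ?thesis .
 qed
 show "nm n (mv n (B l) x) \<le> 22 * (real l + 1)^2 * \<eta>^2 * rt^2 * rt ^ l * nm n x"
  if "ip n x (mv n (B l) ee) = 0" "ip n x (mv n (B l) sp) = 0" for x
  by (rule bulk_bound[OF order.refl], rule perp[OF that(1) _ s_rescale(1)], simp, assumption+)
   (rule perp[OF that(2) _ d_rescale(1)], assumption+)
 show "nm n (mv n (B l) x) \<le> 22 * (real l + 1)^2 * \<eta>^2 * rt^2 * be ^ l * nm n x"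
  if x: "ip n x (mv n (B l) ee) = 0" for x
 proof (rule bulk_bound[OF rt(2)])
  fix r assume r: "r \<le> l"
  have "rt ^ r \<le> be ^ r" using rt by (intro power_mono) auto
  then have "5 * (real l + 1) * \<eta> * rt ^ r * ?N * nm n x \<le> 5 * (real l + 1) * \<eta> * be ^ r * ?N * nm n x"
   using eta nm_pos[of x n] by (intro mult_right_mono mult_left_mono) auto
  then show "\<bar>ip n (mv n (B r) ee) x\<bar> \<le> 5 * (real l + 1) * \<eta> * be ^ r * ?N * nm n x"
   using perp[OF x r s_rescale(1)[OF r]] by linarith
  show "\<bar>ip n (mv n (B r) sp) x\<bar> \<le> 5 * (real l + 1) * \<eta> * be ^ r * ?N * nm n x"
   by (rule order.trans[OF ip_le mult_right_mono[OF d_rescale(2)[OF r] nm_pos]])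
 qed
 show "1 \<le> be ^ l" using rt by simp
 show "be ^ l \<le> rt ^ (2*l)" unfolding power_mult using rt by (intro power_mono) auto
 show "0 \<le> 22 * (real l + 1)^2 * \<eta>^2 * rt^2 * rt ^ l" "0 \<le> 22 * (real l + 1)^2 * \<eta>^2 * rt^2 * be ^ l" using rt by auto
 \<comment> \<open>\<open>big_n\<close> makes the fluctuations of the quadratic forms at most n /
   10, which leaves half of their main terms.\<close>
 have "10 * (1 * (\<eta> * rt ^ (2*l))) \<le> 10 * ((real l + 1) * (\<eta>^2 * rt ^ (2*l)))"
  using eta rt by (intro mult_left_mono mult_mono mult_right_mono) (auto simp: power2_eq_square)
 then have big: "10 * (\<eta> * rt ^ (2*l)) \<le> ?N" using big_n unfolding mult.assoc by linarith
 have N: "?N * (10 * (\<eta> * rt ^ (2*l))) \<le> real n" using mult_left_mono[OF big less_imp_le[OF np(1)]] np(2) by simp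
 have one: "1 \<le> rt ^ (2*l)" "1 \<le> be ^ l" using rt by auto
 have nb: "real n * 1 \<le> real n * be ^ l" "real n * 1 \<le> real n * rt ^ (2*l)" using one by (intro mult_left_mono; simp)+
 show "real n * rt ^ (2*l) / 2 \<le> ip n ee (mv n (B l) ee)" using E[of l] N nb by (simp add: abs_le_iff)
 show "real n * be ^ l / 2 \<le> ip n sp (mv n (B l) sp)" using K[of l] N nb by (simp add: abs_le_iff)
 show "\<bar>ip n ee (mv n (B l) sp)\<bar> \<le> real n * be ^ l / 8" using G[of l] N nb by simp
qed (use n2 rtbe beal delta sd snorm appr in auto)

lemmas spectral_conclusion = conclusion

end

section \<open>First and second moments\<close>

lemma le_choose: "1 \<le> k ==> k < m ==> m \<le> m choose k"
proof (induction m arbitrary: k)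
 case (Suc m)
 obtain j where k: "k = Suc j" using Suc.prems by (cases k) auto
 show ?case
 proof (cases "k < m")
  case True
  then have "m \<le> m choose k" using Suc by simp
  moreover have "0 < m choose j" using True k zero_less_binomial[of j m] by simp
  ultimately show ?thesis unfolding k binomial_Suc_Suc by linarith
 next
  case False
  then have "k = m" using Suc.prems by simp
  then show ?thesis by simp
 qed
qed simp

context hsbm_params begin

lemma codeg_identity: "real n * (real n - 1) * codeg = (real n - real d + 1) * real ((d - 1) * (n choose (d - 1)))"
proof -
 have 1: "(d - 1) * (n choose (d - 1)) = n * ((n - 1) choose (d - 2))"
  using times_binomial_minus1_eq[of "d - 1" n] d3 by (simp add: numeral_2_eq_2)
 have 2: "(n - 1 - (d - 2)) * ((n - 1) choose (d - 2)) = (n - 1) * ((n - 2) choose (d - 2))"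
  using binomial_absorb_comp[of "n - 1" "d - 2"] by (simp add: numeral_2_eq_2)
 have r: "real (n - 1 - (d - 2)) = real n - real d + 1" "real (n - 1) = real n - 1" using d3 nd by auto
 have "(real n - real d + 1) * real ((n - 1) choose (d - 2)) = (real n - 1) * codeg"
  using arg_cong[OF 2, of real] unfolding of_nat_mult r .
 then show ?thesis unfolding 1 by (simp add: mult_ac)
qed

lemma codeg_mult:
 assumes "real ((d - 1) * (n choose (d - 1))) * x = \<mu>"
 shows "codeg * x * real n * (real n - 1) = \<mu> * (real n - real d + 1)"
proof -
 have "codeg * x * real n * (real n - 1) = (real n * (real n - 1) * codeg) * x" by (simp only: mult_ac)
 then show ?thesis unfolding codeg_identity assms[symmetric] by (simp only: mult_ac)
qed

lemma deg_mult:
 assumes "real ((d - 1) * (n choose (d - 1))) * x = \<mu>"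
 shows "real ((d - 1) * ((n - 1) choose (d - 1))) * x * real n = \<mu> * (real n - real d + 1)"
proof -
 have "(n - (d - 1)) * (n choose (d - 1)) = n * ((n - 1) choose (d - 1))" by (rule binomial_absorb_comp)
 moreover have "real (n - (d - 1)) = real n - real d + 1" using d3 nd by auto
 ultimately have h: "real n * real ((n - 1) choose (d - 1)) = (real n - real d + 1) * real (n choose (d - 1))"
  by (metis of_nat_mult)
 have "real ((d - 1) * ((n - 1) choose (d - 1))) * x * real n = real (d - 1) * x * (real n * real ((n - 1) choose (d - 1)))"
  by (simp only: of_nat_mult mult_ac)
 also have "... = \<mu> * (real n - real d + 1)" unfolding h assms[symmetric] by (simp only: of_nat_mult mult_ac)
 finally show ?thesis .
qed

lemma n3: "3 \<le> real n" "real d \<le> real n" "3 \<le> real d" using d3 nd by auto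

lemma codeg_le:
 assumes "real ((d - 1) * (n choose (d - 1))) * x = \<mu>" "0 \<le> \<mu>" "0 \<le> x"
 shows "codeg * x * real n \<le> \<mu>" "\<bar>codeg * x * real n - \<mu>\<bar> \<le> 2 * \<mu> * real d / real n"
  "real (d - 1) * codeg * x \<le> \<mu> * real d / real n"
proof -
 have e: "codeg * x * real n = \<mu> * (real n - real d + 1) / (real n - 1)"
  using codeg_mult[OF assms(1)] n3 by (simp add: field_simps)
 show 1: "codeg * x * real n \<le> \<mu>" unfolding e using n3 assms(2) by (simp add: divide_le_eq mult_left_mono)
 have "codeg * x * real n - \<mu> = - (\<mu> * (real d - 2) / (real n - 1))" unfolding e using n3 by (simp add: field_simps)
 then have "\<bar>codeg * x * real n - \<mu>\<bar> = \<mu> * (real d - 2) / (real n - 1)" using n3 assms(2) by simp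
 also have "... \<le> \<mu> * real d / (real n / 2)" using n3 assms(2) by (intro frac_le mult_left_mono) auto
 finally show "\<bar>codeg * x * real n - \<mu>\<bar> \<le> 2 * \<mu> * real d / real n" by (simp add: mult_ac)
 have "real (d - 1) * codeg * x * real n \<le> real d * \<mu>"
  using mult_mono[of "real (d - 1)" "real d" "codeg * x * real n" \<mu>] 1 assms(2)
  assms by (simp only: mult.assoc) simp
 then show "real (d - 1) * codeg * x \<le> \<mu> * real d / real n" using n3 by (simp add: field_simps)
qed

definition c1 :: real where "c1 = 2 ^ (d - 1) * \<alpha> * real d"

lemma codeg_p: "codeg * p \<le> c1 / real n"
proof -
 have "codeg * p \<le> codeg * (2 ^ (d - 1) * pb)" using p_le_pb by (intro mult_left_mono) auto
 also have "... = 2 ^ (d - 1) * (1 * codeg * pb)" by simp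
 also have "... \<le> 2 ^ (d - 1) * (real (d - 1) * codeg * pb)"
  using d3 pb_pos by (intro mult_left_mono mult_right_mono) auto
 also have "... \<le> 2 ^ (d - 1) * (\<alpha> * real d / real n)"
  using codeg_le(3)[OF pb_alpha] alpha1 pb_pos by (intro mult_left_mono) auto
 finally show ?thesis unfolding c1_def by simp
qed

lemma c1_pos: "0 < c1" unfolding c1_def using alpha1 d3 by simp

text \<open>Since d >= 3, a pair lies in at least n - 2 possible hyperedges, so
  \<open>codeg_p\<close> forces p to be of order n^(-2).\<close>

lemma p_small: "p * (real n)^2 \<le> 4 * c1" if "4 \<le> n" "d < n"
proof -
 have "n - 2 \<le> (n - 2) choose (d - 2)" by (rule le_choose) (use d3 that in auto)
 then have "real n / 2 \<le> codeg" using that by (simp add: field_simps)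
 then have "real n / 2 * p \<le> c1 / real n" using codeg_p mult_right_mono[of "real n / 2" codeg p] p_pos by linarith
 then show ?thesis using n3 c1_pos by (simp add: field_simps power2_eq_square)
qed

text \<open>A lower bound for the number of self-avoiding steps while at most 1 + d t vertices are
  seen; \<open>kap\<close> below is the relative loss against the full number.\<close>

definition Ldeg :: "nat => real" where
 "Ldeg t = real ((d - 1) * ((n - 1) choose (d - 1))) - real (1 + d * t) * real ((d - 1) * ((n - 2) choose (d - 2)))"

definition kap :: "nat => real" where "kap t = real d * (real d * real t + 2) / real n"

lemma Ldeg_ge:
 assumes "real ((d - 1) * (n choose (d - 1))) * x = \<mu>" "0 \<le> \<mu>" "0 \<le> x"
 shows "\<mu> * (1 - kap t) \<le> Ldeg t * x"
proof -
 have 1: "real ((d - 1) * ((n - 1) choose (d - 1))) * x = \<mu> - \<mu> * (real d - 1) / real n"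
  using deg_mult[OF assms(1)] n3 by (simp add: field_simps)
 have 2: "real (1 + d * t) * (real (d - 1) * codeg * x) \<le> real (1 + d * t) * (\<mu> * real d / real n)"
  using codeg_le(3)[OF assms] by (intro mult_left_mono) auto
 have 3: "\<mu> * (real d - 1) / real n \<le> \<mu> * real d / real n" using assms n3 by (intro divide_right_mono mult_left_mono) auto
 have "Ldeg t * x = real ((d - 1) * ((n - 1) choose (d - 1))) * x - real (1 + d * t) * (real (d - 1) * codeg * x)"
  unfolding Ldeg_def of_nat_mult by (simp only: left_diff_distrib mult.assoc)
 then have "\<mu> - \<mu> * real d / real n - real (1 + d * t) * (\<mu> * real d / real n) \<le> Ldeg t * x" using 1 2 3 by linarith
 moreover have "\<mu> - \<mu> * real d / real n - real (1 + d * t) * (\<mu> * real d / real n) = \<mu> * (1 - kap t)"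
  unfolding kap_def using n3 by (simp add: field_simps)
 ultimately show ?thesis by simp
qed

text \<open>Times x, each step contributes a factor between mu (1 - kap t) and mu. Bernoulli's
  inequality turns the t-th power of the loss into t * kap t.\<close>

lemma count_dev:
 assumes x: "real ((d - 1) * (n choose (d - 1))) * x = \<mu>" "0 \<le> \<mu>" "0 \<le> x" and k: "kap t \<le> 1"
 shows "\<bar>(\<Sum>i<n. real (card (saws M i t)) * x ^ t) - real n * \<mu> ^ t\<bar> \<le> real n * (\<mu> ^ t * (real t * kap t))"
proof -
 have L0: "0 \<le> Ldeg t"
 proof -
  have "0 \<le> \<alpha> * (1 - kap t)" using k alpha1 by simp
  also have "... \<le> Ldeg t * pb" by (rule Ldeg_ge[OF pb_alpha]) (use alpha1 pb_pos in simp_all)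
  finally show ?thesis using pb_pos by (simp add: zero_le_mult_iff)
 qed
 have c: "(Ldeg t) ^ t \<le> real (card (saws M i t)) \<and> real (card (saws M i t)) \<le> real ((d - 1) * ((n - 1) choose (d - 1))) ^ t" if "i < n" for i
  unfolding saws_def using count_saws[of "Ldeg t" "real (1 + d * t)" i "{i}" t] L0 that by (simp add: Ldeg_def)
 have k0: "0 \<le> kap t" unfolding kap_def by simp
 have up: "real (card (saws M i t)) * x ^ t \<le> \<mu> ^ t" if "i < n" for i
 proof -
  have "real (card (saws M i t)) * x ^ t \<le> real ((d - 1) * ((n - 1) choose (d - 1))) ^ t * x ^ t"
   using c[OF that] x by (intro mult_right_mono) auto
  also have "... = (real ((d - 1) * ((n - 1) choose (d - 1))) * x) ^ t" by (simp add: power_mult_distrib)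
  also have "... \<le> \<mu> ^ t"
  proof (rule power_mono)
   have "real ((d - 1) * ((n - 1) choose (d - 1))) * x = \<mu> - \<mu> * (real d - 1) / real n"
    using deg_mult[OF x(1)] n3 by (simp add: field_simps)
   moreover have "0 \<le> \<mu> * (real d - 1) / real n" using x n3 by simp
   ultimately show "real ((d - 1) * ((n - 1) choose (d - 1))) * x \<le> \<mu>" by linarith
  qed (use x in simp)
  finally show ?thesis .
 qed
 have low: "\<mu> ^ t - \<mu> ^ t * (real t * kap t) \<le> real (card (saws M i t)) * x ^ t" if "i < n" for i
 proof -
  have "1 + real t * (- kap t) \<le> (1 + - kap t) ^ t" by (rule Bernoulli_inequality) (use k in simp)
  then have "\<mu> ^ t * (1 - real t * kap t) \<le> \<mu> ^ t * (1 - kap t) ^ t" using x by (intro mult_left_mono) auto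
  also have "... = (\<mu> * (1 - kap t)) ^ t" by (simp add: power_mult_distrib)
  also have "... \<le> (Ldeg t * x) ^ t" using Ldeg_ge[OF x] x k by (intro power_mono) auto
  also have "... \<le> real (card (saws M i t)) * x ^ t"
   unfolding power_mult_distrib using c[OF that] x by (intro mult_right_mono) auto
  finally show ?thesis by (simp add: algebra_simps)
 qed
 have "(\<Sum>i<n. real (card (saws M i t)) * x ^ t) \<le> (\<Sum>i<n. \<mu> ^ t)" using up by (intro sum_mono) auto
 moreover have "(\<Sum>i<n. \<mu> ^ t - \<mu> ^ t * (real t * kap t)) \<le> (\<Sum>i<n. real (card (saws M i t)) * x ^ t)"
  using low by (intro sum_mono) auto
 moreover have "0 \<le> real n * (\<mu> ^ t * (real t * kap t))" using x k0 by simp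
 ultimately show ?thesis by (simp add: abs_le_iff right_diff_distrib)
qed

lemma EE_add: "EE (%\<sigma> H. f \<sigma> H + g \<sigma> H) = EE f + EE g"
 unfolding EE_def split_beta by (rule Bochner_Integration.integral_add) (rule integrable_measure_pmf_finite, simp)+

lemma EE_const: "EE (%\<sigma> H. x) = x"
proof -
 have "(%(\<sigma>, H). x) = (%_::(nat => int) \<times> nat set set. x)" by (intro ext) auto
 then show ?thesis unfolding EE_def by simp
qed

lemma cprod_mean:
 assumes c: "c \<in> clusters t t'"
 shows "EE (%\<sigma> H. g \<sigma> * cprod H c) = spin_avg n (%\<sigma>. g \<sigma> * (\<Prod>e\<in>cedges c. pr \<sigma> e))"
proof -
 obtain i w w' where ce: "c = (i, w, w')" by (cases c)
 have "cprod H c = prod_list (map (ind H) (map fst w @ map fst w'))" for H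
  unfolding ce cprod_def cw_def by (simp add: comp_def)
 moreover have "set (map fst w @ map fst w') = cedges c" unfolding ce cedges_def by simp
 ultimately show ?thesis using EE_prod_edges[of "map fst w @ map fst w'" g] cedges_sub[OF c] by simp
qed

lemma EE_cluster_dev:
 assumes tb: "tuple_bound r l y C" and r: "6 \<le> r" and l: "t \<le> l" "t' \<le> l" "1 \<le> l"
  and g: "!!c. c \<in> clusters t t' ==> depends_on (cverts c) (g c)"
  and g1: "!!c \<sigma>. c \<in> clusters t t' ==> \<sigma> \<in> spins n ==> \<bar>g c \<sigma>\<bar> \<le> 1"
  and m: "!!c. c \<in> clusters t t' ==> m c = spin_avg n (%\<sigma>. g c \<sigma> * (\<Prod>e\<in>cedges c. pr \<sigma> e))"
  and mm: "!!c c'. c \<in> clusters t t' ==> c' \<in> clusters t t' ==> \<bar>m c * m c'\<bar> \<le> pb ^ card (cedges c \<union> cedges c')"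
 shows "EE (%\<sigma> H. ((\<Sum>c\<in>clusters t t'. g c \<sigma> * cprod H c) - c0)\<^sup>2)
  \<le> ((\<Sum>c\<in>clusters t t'. m c) - c0)\<^sup>2 + (1 + real t + real t') * (\<alpha> ^ (2 * (t + t')) * (real n * C))"
proof -
 let ?X = "%\<sigma> H. \<Sum>c\<in>clusters t t'. g c \<sigma> * cprod H c"
 have mean: "EE ?X = (\<Sum>c\<in>clusters t t'. m c)"
  unfolding EE_sum by (intro sum.cong refl) (simp add: cprod_mean m)
 have "EE (%\<sigma> H. (?X \<sigma> H - c0)\<^sup>2) = EE (%\<sigma> H. (?X \<sigma> H)\<^sup>2) + EE (%\<sigma> H. (- 2 * c0) * ?X \<sigma> H) + EE (%\<sigma> H. c0\<^sup>2)"
  unfolding EE_add[symmetric] by (rule EE_cong) (simp add: power2_diff algebra_simps)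
 also have "... = EE (%\<sigma> H. (?X \<sigma> H)\<^sup>2) - 2 * c0 * EE ?X + c0\<^sup>2"
  unfolding EE_cmult EE_const by simp
 also have "... \<le> (\<Sum>c\<in>clusters t t'. m c)\<^sup>2 + (1 + real t + real t') * (\<alpha> ^ (2 * (t + t')) * (real n * C)) - 2 * c0 * EE ?X + c0\<^sup>2"
  using EE_cluster_sq[OF tb r l g g1 m mm] by simp
 finally show ?thesis unfolding mean by (simp add: power2_diff algebra_simps)
qed

lemma ip_sawmat:
 "ip n x (mv n (sawmat M A t) y) = (\<Sum>i<n. \<Sum>w\<in>saws M i t. x i * cw A w * y (dest i w))"
 unfolding ip_def
proof (rule sum.cong[OF refl])
 fix i assume i: "i \<in> {..<n}"
 have "mv n (sawmat M A t) y i = (\<Sum>j<n. \<Sum>w\<in>{w\<in>saws M i t. dest i w = j}. cw A w * y (dest i w))"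
  unfolding mv_def sawmat_def sum_distrib_right by (intro sum.cong refl) auto
 also have "... = (\<Sum>w\<in>saws M i t. cw A w * y (dest i w))"
  by (rule sum.group) (use dest_less i in auto)
 finally show "x i * mv n (sawmat M A t) y i = (\<Sum>w\<in>saws M i t. x i * cw A w * y (dest i w))"
  by (simp add: sum_distrib_left mult.assoc)
qed

lemma sawmat_row: "i < n ==> mv n (sawmat M A t) y i = (\<Sum>w\<in>saws M i t. cw A w * y (dest i w))"
proof -
 assume i: "i < n"
 have "ip n (%k. of_bool (k = i)) (mv n (sawmat M A t) y) = mv n (sawmat M A t) y i"
  unfolding ip_def using i by simp
 moreover have "(\<Sum>k<n. \<Sum>w\<in>saws M k t. of_bool (k = i) * cw A w * y (dest k w)) = (\<Sum>w\<in>saws M i t. cw A w * y (dest i w))"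
  using i by (subst sum.remove[of _ i]) auto
 ultimately show ?thesis using ip_sawmat[of "%k. of_bool (k = i)" A t y] by simp
qed

lemma saws_0: "saws M i 0 = {[]}" unfolding saws_def by auto

lemma clusters_0_sum: "(\<Sum>c\<in>clusters t 0. F c) = (\<Sum>i<n. \<Sum>w\<in>saws M i t. F (i, w, []))"
proof -
 have "(\<Sum>c\<in>clusters t 0. F c) = (\<Sum>i<n. \<Sum>z\<in>saws M i t \<times> {[]}. F (i, z))"
  unfolding clusters_def saws_0 by (subst sum.Sigma) auto
 also have "... = (\<Sum>i<n. \<Sum>w\<in>saws M i t. F (i, w, []))"
  by (intro sum.cong refl, rule sum.reindex_bij_witness[of _ "%w. (w, [])" fst]) auto
 finally show ?thesis .
qed

end

text \<open>Lets the traces serve as nonnegative statistics in \<open>markov\<close>.\<close>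

lemma trace_nonneg:
 assumes S: "symm n X"
 shows "0 \<le> (\<Sum>i<n. mpow n X (2 * k) i i)"
proof -
 from spectral_theorem[OF S] obtain v lam where
  ev: "!!j i. j < n ==> i < n ==> mv n X (v j) i = lam j * v j i"
  and on: "!!j m. j < n ==> m < n ==> ip n (v j) (v m) = of_bool (j = m)"
  and "!!j y. j < n ==> (!!m. m < j ==> ip n y (v m) = 0) ==> ip n y (mv n X y) \<le> lam j * ip n y y" by blast
 have "(\<Sum>i<n. mpow n X (2 * k) i i) = (\<Sum>i<n. \<Sum>j<n. lam j ^ (2*k) * (v j i * v j i))"
  by (intro sum.cong refl mpow_spectral[OF ev on]) auto
 also have "0 \<le> ..." by (intro sum_nonneg) (simp add: power_mult)
 finally show ?thesis .
qed

context hsbm_params begin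

lemma pb_le_1: "pb \<le> 1"
proof -
 have "0 \<le> (p - q) * (1 - 1 / 2 ^ (d - 1))" using q_le_p by (intro mult_nonneg_nonneg) auto
 then have "pb \<le> p" unfolding pb_def by (simp add: algebra_simps)
 then show ?thesis using p1 by simp
qed

lemma sp_abs: "\<sigma> \<in> spins n ==> \<bar>real_of_int (\<sigma> i)\<bar> \<le> 1"
 using spins_abs[of \<sigma> n i] by linarith

lemma cw_Nil: "cw c [] = 1" unfolding cw_def by simp

lemma saws_dest_in: "w \<in> saws M i t ==> dest i w \<in> {i} \<union> \<Union>(edges w)"
 by (rule saws_dest, assumption) simp

lemma card_cedges0: "(i, w, w') \<in> clusters t 0 ==> card (cedges (i, w, w')) \<le> t"
proof -
 assume c: "(i, w, w') \<in> clusters t 0"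
 then have "length w = t" "w' = []" unfolding clusters_def saws_0 by (auto simp: saws_def)
 then show ?thesis using card_image_le[of "set w" fst] card_length[of w] unfolding cedges_def by simp
qed

text \<open>The union has at most 2 t edges and \<open>pb\<close> is at most 1, so coinciding edges
  only enlarge the right-hand side.\<close>

lemma mean_pair:
 assumes c: "c \<in> clusters t 0" "c' \<in> clusters t 0" and x: "0 \<le> x" "x \<le> pb"
 shows "\<bar>x ^ t * x ^ t\<bar> \<le> pb ^ card (cedges c \<union> cedges c')"
proof -
 have "card (cedges c \<union> cedges c') \<le> t + t"
 proof -
  have "card (cedges c) \<le> t" using card_cedges0 c(1) by (cases c) auto
  moreover have "card (cedges c') \<le> t" using card_cedges0 c(2) by (cases c') auto
  ultimately show ?thesis using card_Un_le[of "cedges c" "cedges c'"] by linarith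
 qed
 then have "pb ^ (t + t) \<le> pb ^ card (cedges c \<union> cedges c')" using pb_pos pb_le_1 by (intro power_decreasing) auto
 moreover have "x ^ (t + t) \<le> pb ^ (t + t)" using x by (intro power_mono) auto
 ultimately show ?thesis using x by (simp add: power_add)
qed

abbreviation "ee \<equiv> (%_::nat. 1::real)"
abbreviation "Bt H t \<equiv> sawmat M (ind H) t"
abbreviation "Dt \<sigma> H t \<equiv> sawmat M (%e. ind H e - pr \<sigma> e) t"
abbreviation "sr \<sigma> \<equiv> (%i::nat. real_of_int (\<sigma> i))"

text \<open>The squared bias of the walk counts in units of alpha^(2 t) * n, as used in
  \<open>mean_dev\<close>.\<close>

definition dev :: "nat => real" where "dev l = real n * (real l * kap l)^2"

lemma kap_mono: "t \<le> l ==> kap t \<le> kap l" "0 \<le> kap t"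
 unfolding kap_def by (auto intro!: divide_right_mono mult_left_mono)

lemma beta_nonneg: "0 \<le> \<beta>" and beta_le: "\<beta> \<le> \<alpha>"
proof -
 have "0 \<le> real ((d - 1) * (n choose (d - 1))) * qb" using qb_nonneg by simp
 then show "0 \<le> \<beta>" unfolding qb_beta .
 have "real ((d - 1) * (n choose (d - 1))) * qb \<le> real ((d - 1) * (n choose (d - 1))) * pb"
  using qb_le_pb by (intro mult_left_mono) auto
 then show "\<beta> \<le> \<alpha>" unfolding qb_beta pb_alpha .
qed

lemma mean_dev:
 assumes x: "real ((d - 1) * (n choose (d - 1))) * x = \<mu>" "0 \<le> \<mu>" "0 \<le> x" "\<mu> \<le> \<alpha>" and k: "kap l \<le> 1" and t: "t \<le> l"
 shows "((\<Sum>c\<in>clusters t 0. x ^ t) - real n * \<mu> ^ t)^2 \<le> \<alpha> ^ (2*t) * (real n * dev l)"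
proof -
 have "\<bar>(\<Sum>c\<in>clusters t 0. x ^ t) - real n * \<mu> ^ t\<bar> \<le> real n * (\<mu> ^ t * (real t * kap t))"
  using count_dev[OF x(1-3), of t] kap_mono(1)[OF t] k unfolding clusters_0_sum by simp
 also have "... \<le> real n * (\<alpha> ^ t * (real l * kap l))"
  using x kap_mono(1)[OF t] t kap_mono(2)[of t] alpha1 by (intro mult_left_mono mult_mono power_mono) auto
 finally have "\<bar>(\<Sum>c\<in>clusters t 0. x ^ t) - real n * \<mu> ^ t\<bar>^2 \<le> (real n * (\<alpha> ^ t * (real l * kap l)))^2"
  by (rule power_mono) simp
 then have "((\<Sum>c\<in>clusters t 0. x ^ t) - real n * \<mu> ^ t)^2 \<le> (real n * (\<alpha> ^ t * (real l * kap l)))^2"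
  unfolding power2_abs .
 also have "... = \<alpha> ^ (2*t) * (real n * dev l)"
 proof -
  have "\<alpha> ^ (2*t) = \<alpha> ^ t * \<alpha> ^ t" by (simp add: mult_2 power_add)
  then show ?thesis unfolding dev_def power2_eq_square by (simp only: mult_ac)
 qed
 finally show ?thesis .
qed

context
 fixes r l k :: nat and y C :: real
 assumes tb: "tuple_bound r l y C" and r: "6 \<le> r" and l1: "1 \<le> l" and kl: "kap l \<le> 1"
begin

lemma C0: "0 \<le> C" using tb by (simp add: tuple_bound_def)
lemma var_le: "t \<le> l ==> (1 + real t) * (\<alpha> ^ (2 * t) * (real n * C)) \<le> (1 + real l) * (\<alpha> ^ (2 * t) * (real n * C))"
 using C0 alpha1 by (intro mult_right_mono mult_nonneg_nonneg) auto

lemma EE_E: assumes t: "t \<le> l"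
 shows "EE (%\<sigma> H. (ip n ee (mv n (Bt H t) ee) - real n * \<alpha> ^ t)^2) \<le> \<alpha> ^ (2*t) * (real n * (dev l + (1 + real l) * C))"
proof -
 have X: "ip n ee (mv n (Bt H t) ee) = (\<Sum>c\<in>clusters t 0. 1 * cprod H c)" for H
  unfolding clusters_0_sum ip_sawmat by (simp add: cprod_def cw_Nil)
 have "EE (%\<sigma> H. ((\<Sum>c\<in>clusters t 0. 1 * cprod H c) - real n * \<alpha> ^ t)^2)
  \<le> ((\<Sum>c\<in>clusters t 0. pb ^ t) - real n * \<alpha> ^ t)^2 + (1 + real t + real 0) * (\<alpha> ^ (2 * (t + 0)) * (real n * C))"
 proof (rule EE_cluster_dev[where m = "%_. pb ^ t", OF tb r t _ l1])
  fix c assume c: "c \<in> clusters t 0"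
  then obtain i w where e: "c = (i, w, [])" "i < n" "w \<in> saws M i t" unfolding clusters_def saws_0 by auto
  have "spin_avg n (%\<sigma>. 1 * (\<Prod>e\<in>edges w. pr \<sigma> e)) = pb ^ length w * spin_avg n (%_. 1)"
   by (rule avg_saw(1)[of "{i}" i]) (use e in \<open>auto simp: saws_def depends_on_const\<close>)
  then show "pb ^ t = spin_avg n (%\<sigma>. 1 * (\<Prod>e\<in>cedges c. pr \<sigma> e))" using e by (simp add: cedges_def saws_def)
  fix c' assume c': "c' \<in> clusters t 0"
  show "\<bar>pb ^ t * pb ^ t\<bar> \<le> pb ^ card (cedges c \<union> cedges c')"
   by (rule mean_pair[OF c c']) (use pb_pos in auto)
 qed (auto simp: depends_on_const)
 also have "... \<le> \<alpha> ^ (2*t) * (real n * dev l) + (1 + real l) * (\<alpha> ^ (2 * t) * (real n * C))"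
  using mean_dev[OF pb_alpha _ _ _ kl t] var_le[OF t] alpha1 pb_pos by (intro add_mono) auto
 finally show ?thesis unfolding X by (simp add: algebra_simps)
qed

lemma EE_K: assumes t: "t \<le> l"
 shows "EE (%\<sigma> H. (ip n (sr \<sigma>) (mv n (Bt H t) (sr \<sigma>)) - real n * \<beta> ^ t)^2) \<le> \<alpha> ^ (2*t) * (real n * (dev l + (1 + real l) * C))"
proof -
 let ?g = "%(i, w, w'::(nat set \<times> nat) list) \<sigma>. sr \<sigma> i * sr \<sigma> (dest i w)"
 have X: "ip n (sr \<sigma>) (mv n (Bt H t) (sr \<sigma>)) = (\<Sum>c\<in>clusters t 0. ?g c \<sigma> * cprod H c)" for H \<sigma>
  unfolding clusters_0_sum ip_sawmat by (simp add: cprod_def cw_Nil mult_ac)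
 have "EE (%\<sigma> H. ((\<Sum>c\<in>clusters t 0. ?g c \<sigma> * cprod H c) - real n * \<beta> ^ t)^2)
  \<le> ((\<Sum>c\<in>clusters t 0. qb ^ t) - real n * \<beta> ^ t)^2 + (1 + real t + real 0) * (\<alpha> ^ (2 * (t + 0)) * (real n * C))"
 proof (rule EE_cluster_dev[where m = "%_. qb ^ t", OF tb r t _ l1])
  fix c assume c: "c \<in> clusters t 0"
  then obtain i w where e: "c = (i, w, [])" "i < n" "w \<in> saws M i t" unfolding clusters_def saws_0 by auto
  show "depends_on (cverts c) (?g c)" using saws_dest_in[OF e(3)]
   unfolding e by (auto simp: cverts_def intro!: depends_on_mult depends_on_spin)
  show "\<bar>?g c \<sigma>\<bar> \<le> 1" if "\<sigma> \<in> spins n" for \<sigma>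
   using mult_mono[OF sp_abs[OF that, of i] sp_abs[OF that, of "dest i w"]] unfolding e by (simp add: abs_mult)
  have "spin_avg n (%\<sigma>. sr \<sigma> i * (\<Prod>e\<in>edges w. pr \<sigma> e) * sr \<sigma> (dest i w)) = qb ^ length w * spin_avg n (%\<sigma>. sr \<sigma> i * sr \<sigma> i)"
   by (rule avg_saw(2)[of "{i}" i]) (use e in \<open>auto simp: saws_def intro!: depends_on_spin\<close>)
  also have "spin_avg n (%\<sigma>. sr \<sigma> i * sr \<sigma> i) = spin_avg n (%_. 1)"
   by (rule spin_avg_cong) (use spins_sq[OF _ e(2)] in \<open>simp flip: of_int_mult\<close>)
  finally show "qb ^ t = spin_avg n (%\<sigma>. ?g c \<sigma> * (\<Prod>e\<in>cedges c. pr \<sigma> e))"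
   using e by (simp add: cedges_def saws_def mult_ac)
  fix c' assume c': "c' \<in> clusters t 0"
  show "\<bar>qb ^ t * qb ^ t\<bar> \<le> pb ^ card (cedges c \<union> cedges c')"
   by (rule mean_pair[OF c c' qb_nonneg qb_le_pb])
 qed simp
 also have "... \<le> \<alpha> ^ (2*t) * (real n * dev l) + (1 + real l) * (\<alpha> ^ (2 * t) * (real n * C))"
  using mean_dev[OF qb_beta _ _ _ kl t] var_le[OF t] beta_nonneg beta_le qb_nonneg by (intro add_mono) auto
 finally show ?thesis unfolding X by (simp add: algebra_simps)
qed

text \<open>Mean zero by the global spin flip, so only the fluctuation remains.\<close>

lemma EE_G: assumes t: "t \<le> l"
 shows "EE (%\<sigma> H. (ip n ee (mv n (Bt H t) (sr \<sigma>)))^2) \<le> \<alpha> ^ (2*t) * (real n * (dev l + (1 + real l) * C))"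
proof -
 let ?g = "%(i, w, w'::(nat set \<times> nat) list) \<sigma>. sr \<sigma> (dest i w)"
 have X: "ip n ee (mv n (Bt H t) (sr \<sigma>)) = (\<Sum>c\<in>clusters t 0. ?g c \<sigma> * cprod H c)" for H \<sigma>
  unfolding clusters_0_sum ip_sawmat by (simp add: cprod_def cw_Nil mult_ac)
 have "EE (%\<sigma> H. ((\<Sum>c\<in>clusters t 0. ?g c \<sigma> * cprod H c) - 0)^2)
  \<le> ((\<Sum>c\<in>clusters t 0. 0) - 0)^2 + (1 + real t + real 0) * (\<alpha> ^ (2 * (t + 0)) * (real n * C))"
 proof (rule EE_cluster_dev[where m = "%_. 0", OF tb r t _ l1])
  fix c assume c: "c \<in> clusters t 0"
  then obtain i w where e: "c = (i, w, [])" "i < n" "w \<in> saws M i t" unfolding clusters_def saws_0 by auto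
  show "depends_on (cverts c) (?g c)" using saws_dest_in[OF e(3)]
   unfolding e by (auto simp: cverts_def intro!: depends_on_spin)
  show "\<bar>?g c \<sigma>\<bar> \<le> 1" if "\<sigma> \<in> spins n" for \<sigma> using sp_abs[OF that] unfolding e by simp
  show "0 = spin_avg n (%\<sigma>. ?g c \<sigma> * (\<Prod>e\<in>cedges c. pr \<sigma> e))" unfolding e by (simp add: avg_flip_odd)
 qed (use pb_pos in auto)
 also have "... \<le> (1 + real l) * (\<alpha> ^ (2 * t) * (real n * C))" using var_le[OF t] by simp
 also have "... \<le> \<alpha> ^ (2*t) * (real n * (dev l + (1 + real l) * C))"
 proof -
  have "0 \<le> \<alpha> ^ (2*t) * (real n * dev l)" unfolding dev_def using alpha1 by simp
  then show ?thesis by (simp add: algebra_simps)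
 qed
 finally show ?thesis unfolding X by simp
qed

text \<open>Two walks leave the same root, which is why clusters carry two walks. The product
  contains a single spin, so \<open>avg_flip_odd\<close> makes its mean zero: the spikes are nearly
  orthogonal.\<close>

lemma EE_sd:
 "EE (%\<sigma> H. (ip n (mv n (Bt H l) ee) (mv n (Bt H l) (sr \<sigma>)))^2) \<le> (1 + 2 * real l) * (\<alpha> ^ (4*l) * (real n * C))"
proof -
 let ?g = "%(i, w::(nat set \<times> nat) list, w') \<sigma>. sr \<sigma> (dest i w')"
 have X: "ip n (mv n (Bt H l) ee) (mv n (Bt H l) (sr \<sigma>)) = (\<Sum>c\<in>clusters l l. ?g c \<sigma> * cprod H c)" for H \<sigma>
 proof -
  have "ip n (mv n (Bt H l) ee) (mv n (Bt H l) (sr \<sigma>))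
   = (\<Sum>i<n. (\<Sum>w\<in>saws M i l. cw (ind H) w) * (\<Sum>w\<in>saws M i l. cw (ind H) w * sr \<sigma> (dest i w)))"
   unfolding ip_def by (intro sum.cong refl) (simp add: sawmat_row)
  also have "... = (\<Sum>i<n. \<Sum>z\<in>saws M i l \<times> saws M i l. ?g (i, z) \<sigma> * cprod H (i, z))"
   unfolding sum_product sum.cartesian_product by (intro sum.cong refl) (auto simp: cprod_def mult_ac)
  also have "... = (\<Sum>c\<in>clusters l l. ?g c \<sigma> * cprod H c)"
   unfolding clusters_def by (subst sum.Sigma) (auto intro!: sum.cong)
  finally show ?thesis .
 qed
 have "EE (%\<sigma> H. ((\<Sum>c\<in>clusters l l. ?g c \<sigma> * cprod H c) - 0)^2)
  \<le> ((\<Sum>c\<in>clusters l l. 0) - 0)^2 + (1 + real l + real l) * (\<alpha> ^ (2 * (l + l)) * (real n * C))"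
 proof (rule EE_cluster_dev[where m = "%_. 0", OF tb r order.refl order.refl l1])
  fix c assume c: "c \<in> clusters l l"
  then obtain i w w' where e: "c = (i, w, w')" "i < n" "w \<in> saws M i l" "w' \<in> saws M i l" unfolding clusters_def by auto
  show "depends_on (cverts c) (?g c)" using saws_dest_in[OF e(4)]
   unfolding e by (auto simp: cverts_def intro!: depends_on_spin)
  show "\<bar>?g c \<sigma>\<bar> \<le> 1" if "\<sigma> \<in> spins n" for \<sigma> using sp_abs[OF that] unfolding e by simp
  show "0 = spin_avg n (%\<sigma>. ?g c \<sigma> * (\<Prod>e\<in>cedges c. pr \<sigma> e))" unfolding e by (simp add: avg_flip_odd)
 qed (use pb_pos in auto)
 moreover have "(1 + real l + real l) * (\<alpha> ^ (2 * (l + l)) * (real n * C)) = (1 + 2 * real l) * (\<alpha> ^ (4*l) * (real n * C))"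
  by (simp add: mult_2[symmetric])
 moreover have "EE (%\<sigma> H. (ip n (mv n (Bt H l) ee) (mv n (Bt H l) (sr \<sigma>)))^2) = EE (%\<sigma> H. ((\<Sum>c\<in>clusters l l. ?g c \<sigma> * cprod H c) - 0)^2)"
  by (rule EE_cong) (simp only: X diff_zero)
 ultimately show ?thesis by (simp only: sum.neutral_const diff_zero power_zero_numeral add_0)
qed

lemma EE_snorm: "EE (%\<sigma> H. ip n (mv n (Bt H l) ee) (mv n (Bt H l) ee)) \<le> \<alpha> ^ (2*l) * (real n * C)"
proof -
 have "ip n (mv n (Bt H l) ee) (mv n (Bt H l) ee) = (\<Sum>i<n. (\<Sum>w\<in>saws M i l. cw (ind H) w)\<^sup>2)" for H
  unfolding ip_def by (intro sum.cong refl) (simp add: sawmat_row power2_eq_square)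
 then show ?thesis using EE_row_sums[OF tb _ order.refl] r by simp
qed

end

text \<open>Applied to a sum of nonnegative statistics, each divided by its threshold: if the sum is
  below 1, every statistic obeys its threshold.\<close>

lemma markov:
 assumes Z: "!!\<sigma> H. \<sigma> \<in> spins n ==> H \<subseteq> M ==> 0 \<le> Z \<sigma> H"
  and A: "!!\<sigma> H. \<sigma> \<in> spins n ==> H \<subseteq> M ==> Z \<sigma> H < 1 ==> (\<sigma>, H) \<in> A"
 shows "1 - EE Z \<le> measure_pmf.prob (hsbm n d a b) A"
proof -
 have "measure_pmf.prob (hsbm n d a b) (- A) = EE (%\<sigma> H. indicator (- A) (\<sigma>, H))"
  unfolding EE_def by (simp add: split_beta)
 also have "... \<le> EE Z"
 proof (rule EE_mono)
  fix \<sigma> H assume h: "\<sigma> \<in> spins n" "H \<subseteq> M"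
  show "indicator (- A) (\<sigma>, H) \<le> Z \<sigma> H" using Z[OF h] A[OF h] by (cases "Z \<sigma> H < 1") (auto simp: indicator_def)
 qed
 finally show ?thesis using measure_pmf.prob_compl[of A "hsbm n d a b"] by (simp add: Compl_eq_Diff_UNIV)
qed

end

section \<open>The good event\<close>

lemma nm_sqrt_le:
 assumes "!!i. i < n ==> \<bar>x i\<bar> \<le> y i" "(\<Sum>i<n. (y i)^2) \<le> K^2" "0 \<le> K"
 shows "nm n x \<le> K"
proof (rule power2_le_imp_le)
 have "(nm n x)^2 = (\<Sum>i<n. (x i)^2)" unfolding nm_sq ip_def by (simp add: power2_eq_square)
 also have "... \<le> (\<Sum>i<n. (y i)^2)"
 proof (rule sum_mono)
  fix i assume "i \<in> {..<n}"
  then have "\<bar>x i\<bar>^2 \<le> (y i)^2" by (intro power_mono assms(1)) auto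
  then show "(x i)^2 \<le> (y i)^2" by simp
 qed
 finally show "(nm n x)^2 \<le> K^2" using assms(2) by simp
qed (rule assms)

lemma term_lt:
 fixes f b :: "'a => real"
 assumes "(\<Sum>t\<in>T. (1 / b t) * f t) < 1" "finite T" "t \<in> T" "!!t. t \<in> T ==> 0 \<le> f t" "!!t. t \<in> T ==> 0 < b t"
 shows "f t \<le> b t"
proof -
 have nn: "0 \<le> (1 / b x) * f x" if "x \<in> T" for x using assms(4,5)[OF that] by simp
 have "(1 / b t) * f t \<le> (\<Sum>t\<in>T. (1 / b t) * f t)"
  by (rule member_le_sum[OF assms(3) _ assms(2)]) (use nn in blast)
 then have "f t / b t < 1" using assms(1) by simp
 then show ?thesis using assms(3,5) by (simp add: divide_less_eq)
qed

context hsbm_params begin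

lemma EE_piece:
 assumes "!!t. t \<in> T ==> 0 < w t" "!!t. t \<in> T ==> EE (X t) \<le> w t * z"
 shows "EE (%\<sigma> H. \<Sum>t\<in>T. (1 / w t) * X t \<sigma> H) \<le> real (card T) * z"
proof -
 have "EE (%\<sigma> H. \<Sum>t\<in>T. (1 / w t) * X t \<sigma> H) = (\<Sum>t\<in>T. (1 / w t) * EE (X t))"
  unfolding EE_sum EE_cmult ..
 also have "... \<le> (\<Sum>t\<in>T. z)"
 proof (rule sum_mono)
  fix t assume t: "t \<in> T"
  have "(1 / w t) * EE (X t) \<le> (1 / w t) * (w t * z)" using assms(1)[OF t] assms(2)[OF t] by (intro mult_left_mono) (auto simp: less_imp_le)
  then show "(1 / w t) * EE (X t) \<le> z" using assms(1)[OF t] by simp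
 qed
 finally show ?thesis by simp
qed

definition good :: "nat => real => real => real => ((nat => int) \<times> nat set set) set" where
 "good l \<rho> \<delta> L = {(\<sigma>, H). \<alpha> ^ l / 2 \<le> kth_eig (Bl_mat n H l) 1 \<and> kth_eig (Bl_mat n H l) 1 \<le> 8 * L^2 * \<alpha> ^ l
   \<and> \<beta> ^ l / 8 \<le> kth_eig (Bl_mat n H l) 2
   \<and> (\<forall>k. 3 \<le> k \<and> k \<le> n --> \<bar>kth_eig (Bl_mat n H l) k\<bar> \<le> \<rho>)
   \<and> (\<forall>x. eigenvector (Bl_mat n H l) x (kth_eig (Bl_mat n H l) 1) --> 1 - 14 * \<delta> \<le> cos_angle x (S_vec n H l))
   \<and> (\<forall>x. eigenvector (Bl_mat n H l) x (kth_eig (Bl_mat n H l) 2) --> 1 - 28 * \<delta> \<le> cos_angle x (D_vec n \<sigma> H l))}"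

definition Er :: "(nat => int) => nat => nat => real" where
 "Er \<sigma> u v = link M (pr \<sigma>) u v - codeg * pb - codeg * qb * real_of_int (\<sigma> u * \<sigma> v)"

lemma EE_Er: "EE (%\<sigma> H. \<Sum>u<n. \<Sum>v<n. (Er \<sigma> u v)^2) \<le> (2 * (real d)^2 + 4) * c1^2 / real n"
proof -
 have cod: "real ((n - 3) choose (d - 3)) \<le> codeg * (2 * real d / real n)"
 proof -
  have "(d - 2) * ((n - 2) choose (d - 2)) = (n - 2) * ((n - 3) choose (d - 3))"
   using times_binomial_minus1_eq[of "d - 2" "n - 2"] d3 by (simp add: numeral_3_eq_3 numeral_2_eq_2)
  then have "real (d - 2) * codeg = real (n - 2) * real ((n - 3) choose (d - 3))" by (metis of_nat_mult)
  moreover have "real n / 2 * real ((n - 3) choose (d - 3)) \<le> real (n - 2) * real ((n - 3) choose (d - 3)) \<or> n = 3"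
  proof (cases "n = 3")
   case False
   then have "real n / 2 \<le> real (n - 2)" using d3 nd by (simp add: of_nat_diff)
   then show ?thesis by (intro disjI1 mult_right_mono) auto
  qed simp
  moreover have "real (d - 2) * codeg \<le> real d * codeg" by (intro mult_right_mono) auto
  ultimately have "n ~= 3 ==> real n / 2 * real ((n - 3) choose (d - 3)) \<le> real d * codeg" by linarith
  then show ?thesis using n3 d3 nd by (cases "n = 3") (auto simp: field_simps)
 qed
 have cp: "(codeg * p)^2 \<le> (c1 / real n)^2" using codeg_p p_pos by (intro power_mono) auto
 have "(real n)\<^sup>2 * (codeg * (d * real ((n - 3) choose (d - 3))) * p\<^sup>2) \<le> (real n)\<^sup>2 * (codeg * (d * (codeg * (2 * real d / real n))) * p\<^sup>2)"
  using cod p_pos by (intro mult_left_mono mult_right_mono) auto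
 also have "... = 2 * (real d)^2 * real n * (codeg * p)^2" using n3 by (simp add: power2_eq_square field_simps)
 also have "... \<le> 2 * (real d)^2 * real n * (c1 / real n)^2" using cp by (intro mult_left_mono) auto
 finally have 1: "(real n)\<^sup>2 * (codeg * (d * real ((n - 3) choose (d - 3))) * p\<^sup>2) \<le> 2 * (real d)^2 * c1^2 / real n"
  using n3 by (simp add: power2_eq_square field_simps)
 have "n * (2 * codeg * p)\<^sup>2 = 4 * real n * (codeg * p)^2" by (simp add: power2_eq_square)
 also have "... \<le> 4 * real n * (c1 / real n)^2" using cp by (intro mult_left_mono) auto
 finally have 2: "n * (2 * codeg * p)\<^sup>2 \<le> 4 * c1^2 / real n" using n3 by (simp add: power2_eq_square field_simps)
 show ?thesis unfolding Er_def using EE_link 1 2 by (simp add: distrib_right add_divide_distrib)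
qed

text \<open>The subtracted terms bound the expectations of \<open>Z1\<close> to \<open>Z10\<close>:
  norms of the centred and the plain walk matrices, corrections, error of the expected adjacency,
  three quadratic forms, inner product of the spikes, norm of B 1, and bad pairs.\<close>

lemma main_event:
 fixes r l k :: nat and y C \<eta> \<delta> L rt :: real
 assumes tb: "tuple_bound r l y C" and r: "6 \<le> r" "0 < k" "2 * k \<le> r" and l1: "1 \<le> l" and kl: "kap l \<le> 1"
  and rt: "1 \<le> rt" "rt^2 = \<alpha>" "rt \<le> \<beta>" and eta: "1 \<le> \<eta>" and dl: "0 < \<delta>" "\<delta> \<le> 1/100" "1 \<le> L" "\<delta> * L \<le> 1/100"
  and remd: "real l * (\<eta> * rt ^ l * (\<eta> / sqrt (real n)) * (\<eta> * \<alpha> ^ l * sqrt (sqrt (real n))) + \<eta> * \<alpha> ^ l / sqrt (real n)) \<le> 1"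
  and bign: "10 * (real l + 1) * \<eta>^2 * \<alpha> ^ l \<le> sqrt (real n)" and dn: "2 * real d \<le> sqrt (real n)"
  and rtbe: "8 * (22 * (real l + 1)^2 * \<eta>^2 * \<alpha> * rt ^ l) \<le> \<delta> * \<beta> ^ l"
  and beal: "2 * (22 * (real l + 1)^2 * \<eta>^2 * \<alpha> * \<beta> ^ l) \<le> \<delta> * \<alpha> ^ l"
 shows "1 - ((real l + 1) * (real n * C / \<eta> ^ (2*k)) + (real l + 1) * (C / \<eta>^4)
   + real (l * l) * ((p * (real n)^2 + (real n / y)^2) * C / \<eta>^2) + (2 * (real d)^2 + 4) * c1^2 / \<eta>^2
   + 3 * ((real l + 1) * ((dev l + (1 + real l) * C) / \<eta>^2))
   + (1 + 2 * real l) * \<alpha> ^ (2*l) * C / (\<delta>^2 * real n) + C / L^2 + (real l + 1)^4 * \<alpha> ^ (4*l) * C / (y * \<delta>^2))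
  \<le> measure_pmf.prob (hsbm n d a b) (good l (22 * (real l + 1)^2 * \<eta>^2 * \<alpha> * rt ^ l) \<delta> L)"
proof -
 let ?N = "sqrt (real n)"
 have N: "0 < ?N" "?N * ?N = real n" "0 < real n" using n3 by auto
 have N2: "?N^2 = real n" "sqrt ?N ^ 4 = real n" using n3 by (simp_all add: power4_eq_xxxx mult.assoc)
 have rtp: "rt ^ (2 * m) = \<alpha> ^ m" for m unfolding power_mult rt(2) ..
 have ap: "0 < \<alpha> ^ m" "1 \<le> \<alpha> ^ m" for m using alpha1 by auto
 have bp: "1 \<le> \<beta>" "0 < \<beta> ^ m" "1 \<le> \<beta> ^ m" for m using rt by auto
 have y1: "1 \<le> y" and C0: "0 \<le> C" using tb by (auto simp: tuple_bound_def)
 define G where "G \<sigma> H m k' = gam M (ind H) (%e. ind H e - pr \<sigma> e) m k'" for \<sigma> H m k'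
 define T3 where "T3 = {(m, k'). m + k' + 1 \<le> l}"
 have T3: "finite T3" "card T3 \<le> l * l"
 proof -
  have s: "T3 \<subseteq> {..<l} \<times> {..<l}" unfolding T3_def by auto
  show "finite T3" by (rule finite_subset[OF s]) simp
  show "card T3 \<le> l * l" using card_mono[OF _ s] by simp
 qed
 \<comment> \<open>The thresholds are powers of the bounds demanded by
   \<open>recursion_spikes\<close>. For the plain walk matrices a fourth moment suffices, at the
   price of n^(1/4) in \<open>b2\<close>.\<close>
 define b1 where "b1 t = (\<eta> * rt ^ t) ^ (2*k)" for t
 define b2 where "b2 = (%t::nat. (\<eta> * \<alpha> ^ l * sqrt ?N) ^ 4)"
 define b3 where "b3 = (%x::nat \<times> nat. (\<eta> * \<alpha> ^ l / ?N)^2)"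
 define b4 where "b4 = (%x::unit. (\<eta> / ?N)^2)"
 define b5 where "b5 t = (?N * \<eta> * \<alpha> ^ t)^2" for t
 define b8 where "b8 = (%x::unit. (\<delta> * (real n * \<alpha> ^ l * \<beta> ^ l))^2)"
 define b9 where "b9 = (%x::unit. (L * ?N * \<alpha> ^ l)^2)"
 define b10 where "b10 = (%x::unit. (\<delta> * ?N)^2)"
 have bpos: "0 < b1 t" "0 < b2 t" "0 < b3 x" "0 < b4 ()" "0 < b5 t" "0 < b8 ()" "0 < b9 ()" "0 < b10 ()" for t x
 proof -
  have e0: "0 < \<eta>" "0 < rt" "0 < L" "0 < sqrt ?N" using eta rt dl N by auto
  show "0 < b1 t" "0 < b2 t" "0 < b3 x" "0 < b4 ()" "0 < b5 t" "0 < b8 ()" "0 < b9 ()" "0 < b10 ()"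
   unfolding b1_def b2_def b3_def b4_def b5_def b8_def b9_def b10_def
   by (intro zero_less_power mult_pos_pos divide_pos_pos e0 N dl(1) ap(1) bp(2))+
 qed
 define X1 where "X1 t \<sigma> H = (\<Sum>i<n. mpow n (Dt \<sigma> H t) (2 * k) i i)" for t and \<sigma> :: "nat => int" and H
 define X2 where "X2 t \<sigma> H = (\<Sum>i<n. mpow n (Bt H t) (2 * 2) i i)" for t and \<sigma> :: "nat => int" and H
 define X3 where "X3 x \<sigma> H = (\<Sum>i<n. \<Sum>j<n. (G \<sigma> H (fst x) (snd x) i j)^2)" for x :: "nat \<times> nat" and \<sigma> H
 define X4 where "X4 x \<sigma> H = (\<Sum>u<n. \<Sum>v<n. (Er \<sigma> u v)^2)" for x :: unit and \<sigma> and H :: "nat set set"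
 define X5 where "X5 t \<sigma> H = (ip n ee (mv n (Bt H t) ee) - real n * \<alpha> ^ t)^2" for t and \<sigma> :: "nat => int" and H
 define X6 where "X6 t \<sigma> H = (ip n ee (mv n (Bt H t) (sr \<sigma>)))^2" for t \<sigma> H
 define X7 where "X7 t \<sigma> H = (ip n (sr \<sigma>) (mv n (Bt H t) (sr \<sigma>)) - real n * \<beta> ^ t)^2" for t \<sigma> H
 define X8 where "X8 x \<sigma> H = (ip n (mv n (Bt H l) ee) (mv n (Bt H l) (sr \<sigma>)))^2" for x :: unit and \<sigma> H
 define X9 where "X9 x \<sigma> H = ip n (mv n (Bt H l) ee) (mv n (Bt H l) ee)" for x :: unit and \<sigma> :: "nat => int" and H
 define X10 where "X10 x \<sigma> H = (\<Sum>i<n. (\<Sum>(w, w')\<in>bad_pairs l i. cw (ind H) w * cw (ind H) w')\<^sup>2)" for x :: unit and \<sigma> :: "nat => int" and H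
 define Z1 where "Z1 \<sigma> H = (\<Sum>t\<in>{..l}. (1 / b1 t) * X1 t \<sigma> H)" for \<sigma> H
 define Z2 where "Z2 \<sigma> H = (\<Sum>t\<in>{..l}. (1 / b2 t) * X2 t \<sigma> H)" for \<sigma> H
 define Z3 where "Z3 \<sigma> H = (\<Sum>t\<in>T3. (1 / b3 t) * X3 t \<sigma> H)" for \<sigma> H
 define Z4 where "Z4 \<sigma> H = (\<Sum>t\<in>{()}. (1 / b4 t) * X4 t \<sigma> H)" for \<sigma> H
 define Z5 where "Z5 \<sigma> H = (\<Sum>t\<in>{..l}. (1 / b5 t) * X5 t \<sigma> H)" for \<sigma> H
 define Z6 where "Z6 \<sigma> H = (\<Sum>t\<in>{..l}. (1 / b5 t) * X6 t \<sigma> H)" for \<sigma> H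
 define Z7 where "Z7 \<sigma> H = (\<Sum>t\<in>{..l}. (1 / b5 t) * X7 t \<sigma> H)" for \<sigma> H
 define Z8 where "Z8 \<sigma> H = (\<Sum>t\<in>{()}. (1 / b8 t) * X8 t \<sigma> H)" for \<sigma> H
 define Z9 where "Z9 \<sigma> H = (\<Sum>t\<in>{()}. (1 / b9 t) * X9 t \<sigma> H)" for \<sigma> H
 define Z10 where "Z10 \<sigma> H = (\<Sum>t\<in>{()}. (1 / b10 t) * X10 t \<sigma> H)" for \<sigma> H
 have symD: "symm n (Dt \<sigma> H t)" and symB: "symm n (Bt H t)" for \<sigma> H t
  unfolding symm_def by (metis sawmat_sym)+
 have Xp: "0 \<le> X1 t \<sigma> H" "0 \<le> X2 t \<sigma> H" "0 \<le> X3 x \<sigma> H" "0 \<le> X4 v \<sigma> H" "0 \<le> X5 t \<sigma> H" "0 \<le> X6 t \<sigma> H" "0 \<le> X7 t \<sigma> H"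
   "0 \<le> X8 v \<sigma> H" "0 \<le> X9 v \<sigma> H" "0 \<le> X10 v \<sigma> H" for t x v \<sigma> H
  unfolding X1_def X2_def X3_def X4_def X5_def X6_def X7_def X8_def X9_def X10_def
  by (rule trace_nonneg[OF symD] trace_nonneg[OF symB] sum_nonneg zero_le_power2 ip_nonneg)+
 have Zp: "0 \<le> Z1 \<sigma> H" "0 \<le> Z2 \<sigma> H" "0 \<le> Z3 \<sigma> H" "0 \<le> Z4 \<sigma> H" "0 \<le> Z5 \<sigma> H" "0 \<le> Z6 \<sigma> H" "0 \<le> Z7 \<sigma> H"
   "0 \<le> Z8 \<sigma> H" "0 \<le> Z9 \<sigma> H" "0 \<le> Z10 \<sigma> H" for \<sigma> H
  unfolding Z1_def Z2_def Z3_def Z4_def Z5_def Z6_def Z7_def Z8_def Z9_def Z10_def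
  using bpos[THEN less_imp_le] by (auto intro!: sum_nonneg mult_nonneg_nonneg divide_nonneg_nonneg Xp)
 let ?z3 = "(p * (real n)^2 + (real n / y)^2) * C / \<eta>^2"
 let ?z5 = "(dev l + (1 + real l) * C) / \<eta>^2"
 have E1: "EE Z1 \<le> (real l + 1) * (real n * C / \<eta> ^ (2*k))"
 proof -
  have "EE Z1 \<le> real (card {..l}) * (real n * C / \<eta> ^ (2*k))" unfolding Z1_def
  proof (rule EE_piece)
   fix t assume "t \<in> {..l}"
   have "b1 t * (real n * C / \<eta> ^ (2*k)) = (rt ^ t) ^ (2*k) * (real n * C)"
    unfolding b1_def power_mult_distrib using eta by simp
   also have "(rt ^ t) ^ (2*k) = \<alpha> ^ (k * t)" unfolding rtp[symmetric] power_mult[symmetric] by (simp add: mult_ac)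
   finally show "EE (X1 t) \<le> b1 t * (real n * C / \<eta> ^ (2*k))"
    unfolding X1_def using EE_trace(1)[OF tb r(2,3)] \<open>t \<in> {..l}\<close> by simp
  qed (rule bpos)
  then show ?thesis unfolding card_atMost of_nat_Suc by (simp only: add.commute)
 qed
 have E2: "EE Z2 \<le> (real l + 1) * (C / \<eta>^4)"
 proof -
  have "EE Z2 \<le> real (card {..l}) * (C / \<eta>^4)" unfolding Z2_def
  proof (rule EE_piece)
   fix t assume t: "t \<in> {..l}"
   have "EE (X2 t) \<le> \<alpha> ^ (2 * 2 * t) * (real n * C)" unfolding X2_def by (rule EE_trace(2)[OF tb]) (use t r in auto)
   also have "... \<le> \<alpha> ^ (l * 4) * (real n * C)"
    using t alpha1 C0 by (intro mult_right_mono power_increasing) auto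
   also have "... = b2 t * (C / \<eta>^4)" unfolding b2_def power_mult_distrib N2 power_mult using eta by simp
   finally show "EE (X2 t) \<le> b2 t * (C / \<eta>^4)" .
  qed (rule bpos)
  then show ?thesis unfolding card_atMost of_nat_Suc by (simp only: add.commute)
 qed
 have z3p: "0 \<le> ?z3" using C0 p_pos by simp
 have E3: "EE Z3 \<le> real (l * l) * ?z3"
 proof -
  have "EE Z3 \<le> real (card T3) * ?z3" unfolding Z3_def
  proof (rule EE_piece)
   fix x assume "x \<in> T3"
   then have x: "fst x + snd x + 1 \<le> l" unfolding T3_def by auto
   have "EE (X3 x) \<le> \<alpha> ^ (2 * l) * (p + 1 / y\<^sup>2) * (real n * C)"
    unfolding X3_def G_def by (rule EE_gam[OF tb r(1) x])
   also have "... = (\<eta>^2 * (\<alpha> ^ l)^2 / real n) * ?z3"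
   proof -
    have "\<alpha> ^ (2 * l) = (\<alpha> ^ l)^2" by (simp add: power_mult[symmetric] mult.commute)
    then show ?thesis using eta N y1 by (simp add: field_simps power2_eq_square)
   qed
   also have "... = b3 x * ?z3" unfolding b3_def power_divide power_mult_distrib N2 ..
   finally show "EE (X3 x) \<le> b3 x * ?z3" .
  qed (rule bpos)
  also have "... \<le> real (l * l) * ?z3" using T3 z3p by (intro mult_right_mono) (auto simp only: of_nat_le_iff)
  finally show ?thesis .
 qed
 have E4: "EE Z4 \<le> (2 * (real d)^2 + 4) * c1^2 / \<eta>^2"
 proof -
  have "EE Z4 \<le> real (card {()}) * ((2 * (real d)^2 + 4) * c1^2 / \<eta>^2)" unfolding Z4_def
  proof (rule EE_piece)
   fix x :: unit
   have "b4 x * ((2 * (real d)^2 + 4) * c1^2 / \<eta>^2) = (2 * (real d)^2 + 4) * c1^2 / real n"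
    unfolding b4_def power_divide N2 using eta by simp
   then show "EE (X4 x) \<le> b4 x * ((2 * (real d)^2 + 4) * c1^2 / \<eta>^2)" unfolding X4_def using EE_Er by simp
  qed (simp add: bpos)
  then show ?thesis by simp
 qed
 have b5z: "b5 t * ?z5 = \<alpha> ^ (2*t) * (real n * (dev l + (1 + real l) * C))" for t
 proof -
  have "\<alpha> ^ (2 * t) = (\<alpha> ^ t)^2" by (simp add: power_mult[symmetric] mult.commute)
  then show ?thesis unfolding b5_def power_mult_distrib N2 using eta by simp
 qed
 have E5: "EE Z5 \<le> (real l + 1) * ?z5" "EE Z6 \<le> (real l + 1) * ?z5" "EE Z7 \<le> (real l + 1) * ?z5"
 proof -
  have "EE Z5 \<le> real (card {..l}) * ?z5" unfolding Z5_def
   by (rule EE_piece, rule bpos) (unfold X5_def b5z, rule EE_E[OF tb r(1) l1 kl], simp)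
  then show "EE Z5 \<le> (real l + 1) * ?z5" unfolding card_atMost of_nat_Suc by (simp only: add.commute)
  have "EE Z6 \<le> real (card {..l}) * ?z5" unfolding Z6_def
   by (rule EE_piece, rule bpos) (unfold X6_def b5z, rule EE_G[OF tb r(1) l1 kl], simp)
  then show "EE Z6 \<le> (real l + 1) * ?z5" unfolding card_atMost of_nat_Suc by (simp only: add.commute)
  have "EE Z7 \<le> real (card {..l}) * ?z5" unfolding Z7_def
   by (rule EE_piece, rule bpos) (unfold X7_def b5z, rule EE_K[OF tb r(1) l1 kl], simp)
  then show "EE Z7 \<le> (real l + 1) * ?z5" unfolding card_atMost of_nat_Suc by (simp only: add.commute)
 qed
 have E8: "EE Z8 \<le> (1 + 2 * real l) * \<alpha> ^ (2*l) * C / (\<delta>^2 * real n)"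
 proof -
  have "EE Z8 \<le> real (card {()}) * ((1 + 2 * real l) * \<alpha> ^ (2*l) * C / (\<delta>^2 * real n))" unfolding Z8_def
  proof (rule EE_piece)
   fix x :: unit
   have "EE (X8 x) \<le> (1 + 2 * real l) * (\<alpha> ^ (4*l) * (real n * C))" unfolding X8_def by (rule EE_sd[OF tb r(1) l1 kl])
   also have "... = (1 + 2 * real l) * (\<alpha> ^ (4*l) * (real n * C)) * 1" by simp
   \<comment> \<open>The factor \<open>(\<beta> ^ l)^2\<close>, at least 1, is inserted to match the
     threshold \<open>b8\<close>.\<close>
   also have "... \<le> (1 + 2 * real l) * (\<alpha> ^ (4*l) * (real n * C)) * (\<beta> ^ l)^2"
    using bp(3)[of l] by (intro mult_left_mono mult_nonneg_nonneg zero_le_power C0) (use alpha1 in auto)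
   also have "\<alpha> ^ (4*l) = (\<alpha> ^ l)^2 * \<alpha> ^ (2*l)" by (simp add: power_mult[symmetric] power_add[symmetric] mult.commute)
   also have "(1 + 2 * real l) * ((\<alpha> ^ l)^2 * \<alpha> ^ (2*l) * (real n * C)) * (\<beta> ^ l)^2
     = b8 x * ((1 + 2 * real l) * \<alpha> ^ (2*l) * C / (\<delta>^2 * real n))"
    unfolding b8_def power_mult_distrib using dl N by (simp add: power2_eq_square field_simps)
   finally show "EE (X8 x) \<le> b8 x * ((1 + 2 * real l) * \<alpha> ^ (2*l) * C / (\<delta>^2 * real n))" .
  qed (simp add: bpos)
  then show ?thesis by simp
 qed
 have E9: "EE Z9 \<le> C / L^2"
 proof -
  have "EE Z9 \<le> real (card {()}) * (C / L^2)" unfolding Z9_def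
  proof (rule EE_piece)
   fix x :: unit
   have "EE (X9 x) \<le> \<alpha> ^ (2*l) * (real n * C)" unfolding X9_def by (rule EE_snorm[OF tb r(1) l1 kl])
   also have "\<alpha> ^ (2 * l) = (\<alpha> ^ l)^2" by (simp add: power_mult[symmetric] mult.commute)
   also have "(\<alpha> ^ l)^2 * (real n * C) = b9 x * (C / L^2)" unfolding b9_def power_mult_distrib N2 using dl by simp
   finally show "EE (X9 x) \<le> b9 x * (C / L^2)" .
  qed (simp add: bpos)
  then show ?thesis by simp
 qed
 have E10: "EE Z10 \<le> (real l + 1)^4 * \<alpha> ^ (4*l) * C / (y * \<delta>^2)"
 proof -
  have "EE Z10 \<le> real (card {()}) * ((real l + 1)^4 * \<alpha> ^ (4*l) * C / (y * \<delta>^2))" unfolding Z10_def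
  proof (rule EE_piece)
   fix x :: unit
   have "EE (X10 x) \<le> (real l + 1) ^ 4 * (\<alpha> ^ (4 * l) / y * (real n * C))"
    unfolding X10_def by (rule EE_bad_pairs[OF tb]) (use r in simp)
   also have "... = b10 x * ((real l + 1)^4 * \<alpha> ^ (4*l) * C / (y * \<delta>^2))"
    unfolding b10_def power_mult_distrib N2 using dl y1 by simp
   finally show "EE (X10 x) \<le> b10 x * ((real l + 1)^4 * \<alpha> ^ (4*l) * C / (y * \<delta>^2))" .
  qed (simp add: bpos)
  then show ?thesis by simp
 qed
 define Z where "Z \<sigma> H = Z1 \<sigma> H + Z2 \<sigma> H + Z3 \<sigma> H + Z4 \<sigma> H + Z5 \<sigma> H + Z6 \<sigma> H + Z7 \<sigma> H + Z8 \<sigma> H + Z9 \<sigma> H + Z10 \<sigma> H" for \<sigma> H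
 have EZ: "EE Z = EE Z1 + EE Z2 + EE Z3 + EE Z4 + EE Z5 + EE Z6 + EE Z7 + EE Z8 + EE Z9 + EE Z10"
  unfolding Z_def EE_add ..
 have "1 - EE Z \<le> measure_pmf.prob (hsbm n d a b) (good l (22 * (real l + 1)^2 * \<eta>^2 * \<alpha> * rt ^ l) \<delta> L)"
 proof (rule markov)
  fix \<sigma> H assume sH: "\<sigma> \<in> spins n" "H \<subseteq> M"
  show "0 \<le> Z \<sigma> H" unfolding Z_def using Zp[of \<sigma> H] by linarith
  assume "Z \<sigma> H < 1"
  then have Zl: "Z1 \<sigma> H < 1" "Z2 \<sigma> H < 1" "Z3 \<sigma> H < 1" "Z4 \<sigma> H < 1" "Z5 \<sigma> H < 1" "Z6 \<sigma> H < 1" "Z7 \<sigma> H < 1"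
   "Z8 \<sigma> H < 1" "Z9 \<sigma> H < 1" "Z10 \<sigma> H < 1" unfolding Z_def using Zp[of \<sigma> H] by linarith+
  have F1: "X1 t \<sigma> H \<le> b1 t" if "t \<le> l" for t
   by (rule term_lt[OF Zl(1)[unfolded Z1_def]]) (use that Xp bpos in auto)
  have F2: "X2 t \<sigma> H \<le> b2 t" if "t \<le> l" for t
   by (rule term_lt[OF Zl(2)[unfolded Z2_def]]) (use that Xp bpos in auto)
  have F3: "X3 x \<sigma> H \<le> b3 x" if "x \<in> T3" for x
   by (rule term_lt[OF Zl(3)[unfolded Z3_def]]) (use that Xp bpos T3 in auto)
  have F4: "X4 () \<sigma> H \<le> b4 ()" by (rule term_lt[OF Zl(4)[unfolded Z4_def]]) (use Xp bpos in auto)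
  have F5: "X5 t \<sigma> H \<le> b5 t" if "t \<le> l" for t
   by (rule term_lt[OF Zl(5)[unfolded Z5_def]]) (use that Xp bpos in auto)
  have F6: "X6 t \<sigma> H \<le> b5 t" if "t \<le> l" for t
   by (rule term_lt[OF Zl(6)[unfolded Z6_def]]) (use that Xp bpos in auto)
  have F7: "X7 t \<sigma> H \<le> b5 t" if "t \<le> l" for t
   by (rule term_lt[OF Zl(7)[unfolded Z7_def]]) (use that Xp bpos in auto)
  have F8: "X8 () \<sigma> H \<le> b8 ()" by (rule term_lt[OF Zl(8)[unfolded Z8_def]]) (use Xp bpos in auto)
  have F9: "X9 () \<sigma> H \<le> b9 ()" by (rule term_lt[OF Zl(9)[unfolded Z9_def]]) (use Xp bpos in auto)
  have F10: "X10 () \<sigma> H \<le> b10 ()" by (rule term_lt[OF Zl(10)[unfolded Z10_def]]) (use Xp bpos in auto)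
  have sq: "\<bar>x\<bar> \<le> c" if "x^2 \<le> c^2" "0 \<le> c" for x c :: real
   using that by (metis abs_le_square_iff abs_of_nonneg)
  let ?S = "%i. real (card {j \<in> {0..<n}. hdist_eq H i j l})"
  let ?D = "%i. real_of_int (\<Sum>j \<in> {j \<in> {0..<n}. hdist_eq H i j l}. \<sigma> j)"
  have near: "nm n (%i. mv n (Bt H l) x i - X i) \<le> \<delta> * ?N"
   if x: "!!j. \<bar>x j\<bar> \<le> 1" and X: "!!i. X i = (\<Sum>j\<in>{j \<in> {0..<n}. hdist_eq H i j l}. x j)" for x X
  proof (rule nm_sqrt_le[where y = "%i. \<Sum>(w, w')\<in>bad_pairs l i. cw (ind H) w * cw (ind H) w'"])
   fix i assume i: "i < n"
   have "\<bar>X i - mv n (Bt H l) x i\<bar> \<le> (\<Sum>(w, w')\<in>bad_pairs l i. cw (ind H) w * cw (ind H) w')"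
    using sphere_diff[OF sH(2) i _ x] l1 unfolding X mv_def by simp
   then show "\<bar>mv n (Bt H l) x i - X i\<bar> \<le> (\<Sum>(w, w')\<in>bad_pairs l i. cw (ind H) w * cw (ind H) w')"
    by (simp add: abs_minus_commute)
  qed (use F10 dl N in \<open>simp_all add: X10_def b10_def\<close>)
  have cpos: "0 \<le> codeg * pb" "0 \<le> codeg * qb" using pb_pos qb_nonneg by simp_all
  \<comment> \<open>\<open>codeg_le\<close> gives errors of order 1 / n; \<open>dn\<close> brings
    them to the 1 / sqrt n form of the recursion.\<close>
  have small: "2 * \<mu> * real d / real n \<le> \<alpha> / ?N" if "0 \<le> \<mu>" "\<mu> \<le> \<alpha>" for \<mu>
  proof -
   have "2 * real d * \<mu> \<le> ?N * \<alpha>" using dn that alpha1 by (intro mult_mono) auto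
   then have "2 * real d * \<mu> / (?N * ?N) \<le> ?N * \<alpha> / (?N * ?N)" using N by (intro divide_right_mono) auto
   moreover have "?N * \<alpha> / (?N * ?N) = \<alpha> / ?N" by (rule mult_divide_mult_cancel_left) (use N(1) in auto)
   ultimately show ?thesis unfolding N(2) by (simp only: mult_ac)
  qed
  note ca = codeg_le[OF pb_alpha _ less_imp_le[OF pb_pos]] and cb = codeg_le[OF qb_beta beta_nonneg qb_nonneg]
  interpret R: recursion_spikes n l "Bt H" "Dt \<sigma> H" "Er \<sigma>" "G \<sigma> H" "sr \<sigma>" rt \<beta> "codeg * pb" "codeg * qb" \<eta>
   "\<eta> * \<alpha> ^ l * sqrt ?N" "\<eta> / ?N" "\<eta> * \<alpha> ^ l / ?N" ?S ?D \<delta> L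
  proof unfold_locales
   show "2 \<le> n" using d3 nd by simp
   show "sr \<sigma> i * sr \<sigma> i = 1" if "i < n" for i using spins_sq[OF sH(1) that] by (simp flip: of_int_mult)
   show "Bt H t i j = Dt \<sigma> H t i j
    + (\<Sum>m<t. \<Sum>u<n. \<Sum>v<n. Dt \<sigma> H m i u * (codeg * pb + codeg * qb * sr \<sigma> u * sr \<sigma> v + Er \<sigma> u v) * Bt H (t - 1 - m) v j)
    - (\<Sum>m<t. G \<sigma> H m (t - 1 - m) i j)" if i: "i < n" for t i j
    unfolding G_def Er_def using sawmat_decomp[OF i, of d "ind H" t j "%e. ind H e - pr \<sigma> e"]
    by (simp add: mult.assoc)
   show "symm n (Bt H t)" for t by (rule symB)
   show "opb n (Dt \<sigma> H t) (\<eta> * rt ^ t)" if "t \<le> l" for t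
    by (rule opb_trace[OF symD _ _ r(2)]) (use F1[OF that] eta rt in \<open>auto simp: X1_def b1_def\<close>)
   show "opb n (Bt H t) (\<eta> * \<alpha> ^ l * sqrt ?N)" if "t \<le> l" for t
    by (rule opb_trace[OF symB, where k = 2]) (use F2[OF that] eta ap[of l] N in \<open>auto simp: X2_def b2_def\<close>)
   show "opb n (Er \<sigma>) (\<eta> / ?N)" by (rule opb_frobenius) (use F4 eta N in \<open>auto simp: X4_def b4_def\<close>)
   show "opb n (G \<sigma> H m k') (\<eta> * \<alpha> ^ l / ?N)" if "m + k' + 1 \<le> l" for m k'
    by (rule opb_frobenius) (use F3[of "(m, k')"] that eta N ap[of l] in \<open>auto simp: X3_def b3_def T3_def\<close>)
   show "real l * (\<eta> * rt ^ l * (\<eta> / ?N) * (\<eta> * \<alpha> ^ l * sqrt ?N) + \<eta> * \<alpha> ^ l / ?N) \<le> 1" by (rule remd)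
   show "\<bar>ip n ee (mv n (Bt H t) ee) - real n * rt ^ (2*t)\<bar> \<le> ?N * \<eta> * rt ^ (2*t)" if "t \<le> l" for t
    unfolding rtp by (rule sq) (use F5[OF that] eta N ap[of t] in \<open>auto simp: X5_def b5_def\<close>)
   show "\<bar>ip n ee (mv n (Bt H t) (sr \<sigma>))\<bar> \<le> ?N * \<eta> * rt ^ (2*t)" if "t \<le> l" for t
    unfolding rtp by (rule sq) (use F6[OF that] eta N ap[of t] in \<open>auto simp: X6_def b5_def\<close>)
   show "\<bar>ip n (sr \<sigma>) (mv n (Bt H t) (sr \<sigma>)) - real n * \<beta> ^ t\<bar> \<le> ?N * \<eta> * rt ^ (2*t)" if "t \<le> l" for t
    unfolding rtp by (rule sq) (use F7[OF that] eta N ap[of t] in \<open>auto simp: X7_def b5_def\<close>)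
   show "\<bar>codeg * pb * real n - rt^2\<bar> \<le> rt^2 / ?N" "codeg * pb * real n \<le> 2 * rt^2"
    unfolding rt(2) using ca(1,2) small[of \<alpha>] alpha1 by auto
   show "\<bar>codeg * qb * real n - \<beta>\<bar> \<le> rt^2 / ?N" "codeg * qb * real n \<le> 2 * rt^2"
    unfolding rt(2) using cb(1,2) small[OF beta_nonneg beta_le] beta_le alpha1 by linarith+
   show "10 * (real l + 1) * \<eta>^2 * rt ^ (2*l) \<le> ?N" unfolding rtp by (rule bign)
   show "8 * (22 * (real l + 1)^2 * \<eta>^2 * rt^2 * rt ^ l) \<le> \<delta> * \<beta> ^ l" unfolding rt(2) by (rule rtbe)
   show "2 * (22 * (real l + 1)^2 * \<eta>^2 * rt^2 * \<beta> ^ l) \<le> \<delta> * rt ^ (2*l)" unfolding rt(2) rtp by (rule beal)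
   show "\<bar>ip n (mv n (Bt H l) ee) (mv n (Bt H l) (sr \<sigma>))\<bar> \<le> \<delta> * (real n * rt ^ (2*l) * \<beta> ^ l)"
    unfolding rtp by (rule sq) (use F8 dl N ap[of l] bp(2)[of l] in \<open>auto simp: X8_def b8_def\<close>)
   show "nm n (mv n (Bt H l) ee) \<le> L * ?N * rt ^ (2*l)"
    unfolding rtp by (rule power2_le_imp_le) (use F9 dl N ap[of l] in \<open>auto simp: X9_def b9_def nm_sq\<close>)
   show "nm n (%i. mv n (Bt H l) ee i - ?S i) \<le> \<delta> * ?N" by (rule near) auto
   show "nm n (%i. mv n (Bt H l) (sr \<sigma>) i - ?D i) \<le> \<delta> * ?N" by (rule near) (use sp_abs[OF sH(1)] in auto)
   show "\<beta> \<le> rt^2" unfolding rt(2) by (rule beta_le)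
  qed (use cpos rt eta dl in auto)
  \<comment> \<open>Positive length matters: at length 0 the walk matrix is the identity, while
    \<open>Bl\<close> has zero diagonal.\<close>
  have B: "Matrix.mat n n (%(i, j). Bt H l i j) = Bl_mat n H l"
   unfolding Bl_mat_def by (rule cong_mat) (use Bl_sawmat[OF sH(2)] l1 in auto)
  note RC = R.spectral_conclusion[unfolded B rtp rt(2)]
  show "(\<sigma>, H) \<in> good l (22 * (real l + 1)^2 * \<eta>^2 * \<alpha> * rt ^ l) \<delta> L"
   unfolding good_def S_vec_def D_vec_def using RC by blast
 qed
 then show ?thesis using EZ E1 E2 E3 E4 E5 E8 E9 E10 by linarith
qed

end

section \<open>Polylogarithmic factors\<close>

context hsbm_params begin

text \<open>\<open>R\<close> bounds the vertices that r walks of length l can see, \<open>Q\<close>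
  is the least value the count allows, and \<open>W\<close> is the product that makes its smallness
  condition hold for y = n / W. All three are polylogarithmic when l is of order log n.\<close>

lemma tuple_bound_concrete:
 fixes r l :: nat
 defines "R \<equiv> 1 + real d * real r * real l"
 defines "Q \<equiv> 2 * (real l + 1) * R * (2 + R * real d)"
 defines "W \<equiv> 2 * (real l + 1)^2 * R^2 * (R * Q) ^ r * (2 ^ (d - 1) * real d)"
 assumes W: "W \<le> real n"
 shows "tuple_bound r l (real n / W) (2 * (R * Q) ^ r)"
proof -
 have R1: "1 \<le> R" unfolding R_def by simp
 have Q1: "1 \<le> Q"
 proof -
  have "1 * 1 * 1 * 1 \<le> 2 * (real l + 1) * R * (2 + R * real d)" using R1 by (intro mult_mono) auto
  then show ?thesis unfolding Q_def by simp
 qed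
 have RQ: "1 \<le> R * Q" using mult_mono[OF R1 Q1] R1 by simp
 have W0: "0 < W" unfolding W_def by (intro mult_pos_pos zero_less_power) (use R1 Q1 d3 in simp_all)
 show ?thesis unfolding tuple_bound_def
 proof (intro conjI allI impI)
  show "1 \<le> real n / W" using W W0 by simp
  show "0 \<le> 2 * (R * Q) ^ r" using RQ by simp
  fix ts assume ts: "length ts \<le> r" "\<forall>t\<in>set ts. t \<le> l"
  have "sum_list ts \<le> length ts * l" using ts(2) by (induction ts) auto
  also have "... \<le> r * l" using ts(1) by simp
  finally have sl: "d * sum_list ts \<le> d * (r * l)" by simp
  have c1: "real (1 + d * sum_list ts) \<le> R"
   using of_nat_mono[OF sl, where 'a = real] unfolding R_def by (simp add: mult.assoc)
  have h: "2 ^ (d - 1) * pb / \<alpha> * real ((d - 1) * ((n - 2) choose (d - 2))) \<le> 2 ^ (d - 1) * real d / real n"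
  proof -
   have "2 ^ (d - 1) / \<alpha> * (real (d - 1) * codeg * pb) \<le> 2 ^ (d - 1) / \<alpha> * (\<alpha> * real d / real n)"
    using codeg_le(3)[OF pb_alpha] alpha1 pb_pos by (intro mult_left_mono) auto
   then show ?thesis using alpha1 by (simp add: mult_ac)
  qed
  have c2: "2 * (real l + 1)\<^sup>2 * R * (real n / W * (R * Q) ^ r * (2 ^ (d - 1) * pb / \<alpha>) * (R * real ((d - 1) * ((n - 2) choose (d - 2))))) \<le> 1"
  proof -
   have "2 * (real l + 1)\<^sup>2 * R * (real n / W * (R * Q) ^ r * (2 ^ (d - 1) * pb / \<alpha>) * (R * real ((d - 1) * ((n - 2) choose (d - 2)))))
    = (2 * (real l + 1)\<^sup>2 * R^2 * (R * Q) ^ r * (real n / W)) * (2 ^ (d - 1) * pb / \<alpha> * real ((d - 1) * ((n - 2) choose (d - 2))))"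
    by (simp only: power2_eq_square mult_ac)
   also have "... \<le> (2 * (real l + 1)\<^sup>2 * R^2 * (R * Q) ^ r * (real n / W)) * (2 ^ (d - 1) * real d / real n)"
    by (rule mult_left_mono[OF h], intro mult_nonneg_nonneg divide_nonneg_nonneg zero_le_power)
     (use R1 Q1 W0 in simp_all)
   also have "... = 1"
   proof -
    have gen: "A * (z / V) * (E / z) = 1" if "A * E = V" "0 < V" "0 < z" for A E V z :: real
     using that by (simp add: field_simps)
    show ?thesis by (rule gen[OF _ W0]) (use W_def n3 in simp_all)
   qed
   finally show ?thesis .
  qed
  have "(\<Sum>x<n. \<Sum>ws\<in>tuples M {x} ts. psi (tedges ws) * (real n / W) ^ bdt {x} {} ws) \<le> real n * ((R * Q) ^ length ts * psi {})"
   by (rule sum_over_all_tuples[OF _ c1 _ c2 ts(2,1)]) (use W0 in \<open>simp_all add: Q_def\<close>)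
  also have "... \<le> real n * ((R * Q) ^ r * 2)"
   unfolding psi_empty using RQ ts by (intro mult_left_mono mult_right_mono power_increasing) auto
  finally show "(\<Sum>x<n. \<Sum>ws\<in>tuples M {x} ts. psi (tedges ws) * (real n / W) ^ bdt {x} {} ws) \<le> real n * (2 * (R * Q) ^ r)"
   by (simp add: mult_ac)
 qed
qed

end

definition polylog :: "(nat => real) => bool" where
 "polylog f \<longleftrightarrow> (\<exists>K k. 0 \<le> K \<and> (\<forall>n\<ge>3. \<bar>f n\<bar> \<le> K * ln (real n) ^ k))"

lemma ln_ge_1: "3 \<le> n ==> 1 \<le> ln (real n)"
proof -
 assume "3 \<le> n"
 then have "exp 1 \<le> real n" using exp_le by linarith
 moreover have "0 < real n" using \<open>3 \<le> n\<close> by simp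
 ultimately show ?thesis by (simp add: ln_ge_iff)
qed

lemma polylog_const: "polylog (%_. x)"
 unfolding polylog_def by (rule exI[of _ "\<bar>x\<bar>"], rule exI[of _ 0]) simp

lemma polylog_add: assumes "polylog f" "polylog g" shows "polylog (%n. f n + g n)"
proof -
 obtain K k K' k' where h: "0 \<le> K" "!!n. n \<ge> 3 ==> \<bar>f n\<bar> \<le> K * ln (real n) ^ k"
  "0 \<le> K'" "!!n. n \<ge> 3 ==> \<bar>g n\<bar> \<le> K' * ln (real n) ^ k'" using assms unfolding polylog_def by blast
 have "\<bar>f n + g n\<bar> \<le> (K + K') * ln (real n) ^ (k + k')" if n: "n \<ge> 3" for n
 proof -
  have "K * ln (real n) ^ k \<le> K * ln (real n) ^ (k + k')" "K' * ln (real n) ^ k' \<le> K' * ln (real n) ^ (k + k')"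
   using ln_ge_1[OF n] h by (intro mult_left_mono power_increasing; simp)+
  then show ?thesis using h(2)[OF n] h(4)[OF n] unfolding distrib_right by linarith
 qed
 then show ?thesis unfolding polylog_def
  by (intro exI[of _ "K + K'"] exI[of _ "k + k'"] conjI allI impI) (rule add_nonneg_nonneg[OF h(1,3)])
qed

lemma polylog_mult: assumes "polylog f" "polylog g" shows "polylog (%n. f n * g n)"
proof -
 obtain K k K' k' where h: "0 \<le> K" "!!n. n \<ge> 3 ==> \<bar>f n\<bar> \<le> K * ln (real n) ^ k"
  "0 \<le> K'" "!!n. n \<ge> 3 ==> \<bar>g n\<bar> \<le> K' * ln (real n) ^ k'" using assms unfolding polylog_def by blast
 have "\<bar>f n * g n\<bar> \<le> (K * K') * ln (real n) ^ (k + k')" if n: "n \<ge> 3" for n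
  using mult_mono[OF h(2)[OF n] h(4)[OF n]] ln_ge_1[OF n] h by (simp add: abs_mult power_add mult_ac)
 then show ?thesis unfolding polylog_def
  by (intro exI[of _ "K * K'"] exI[of _ "k + k'"] conjI allI impI) (rule mult_nonneg_nonneg[OF h(1,3)])
qed

lemma polylog_power: "polylog f ==> polylog (%n. f n ^ m)"
proof (induction m)
 case 0
 show ?case using polylog_const[of 1] by simp
next
 case (Suc m)
 show ?case unfolding power_Suc by (rule polylog_mult) (use Suc in simp_all)
qed

lemmas polylog_intros = polylog_const polylog_add polylog_mult polylog_power

lemma polylog_small:
 assumes f: "polylog f" and e: "e < 0"
 shows "(%n. f n * real n powr e) \<longlonglongrightarrow> 0"
proof -
 obtain K k where h: "0 \<le> K" "!!n. n \<ge> 3 ==> \<bar>f n\<bar> \<le> K * ln (real n) ^ k" using f unfolding polylog_def by blast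
 \<comment> \<open>Chosen so that the k-th power of the logarithm uses at most half of the available
   decay.\<close>
 define s where "s = - e / (2 * (real k + 1))"
 have s: "0 < s" unfolding s_def by (intro divide_pos_pos) (use e in auto)
 have sk: "s * real k + e \<le> e / 2"
 proof -
  have "s * real k \<le> s * (real k + 1)" using s by simp
  also have "... = - e / 2" unfolding s_def by (simp add: field_simps)
  finally show ?thesis by simp
 qed
 have b: "\<bar>f n * real n powr e\<bar> \<le> (K / s ^ k) * real n powr (e / 2)" if n: "n \<ge> 3" for n
 proof -
  have "ln (real n) \<le> real n powr s / s" using n s by (intro ln_powr_bound) auto
  then have "ln (real n) ^ k \<le> (real n powr s / s) ^ k" using ln_ge_1[OF n] by (intro power_mono) auto
  also have "... = real n powr (s * real k) / s ^ k" using n by (simp add: power_divide powr_power mult.commute)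
  finally have "K * ln (real n) ^ k \<le> K * (real n powr (s * real k) / s ^ k)" using h by (intro mult_left_mono)
  then have "\<bar>f n\<bar> * real n powr e \<le> K * (real n powr (s * real k) / s ^ k) * real n powr e"
   using h(2)[OF n] by (intro mult_right_mono) auto
  also have "... = (K / s ^ k) * real n powr (s * real k + e)" by (simp add: powr_add)
  also have "... \<le> (K / s ^ k) * real n powr (e / 2)" using sk n h s by (intro mult_left_mono powr_mono) auto
  finally show ?thesis by (simp add: abs_mult)
 qed
 have "(%n. (K / s ^ k) * real n powr (e / 2)) \<longlonglongrightarrow> (K / s ^ k) * 0"
  using e by (intro tendsto_mult tendsto_const tendsto_neg_powr filterlim_real_sequentially) auto
 then have z: "(%n. (K / s ^ k) * real n powr (e / 2)) \<longlonglongrightarrow> 0" by simp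
 show ?thesis
  by (rule Lim_null_comparison[OF _ z], rule eventually_sequentiallyI[of 3]) (unfold real_norm_def, rule b)
qed

lemma polylog_ev: "polylog f ==> e < 0 ==> 0 < \<epsilon> ==> eventually (%n. f n * real n powr e \<le> \<epsilon>) sequentially"
 by (rule eventually_mono[OF order_tendstoD(2)[OF polylog_small]]) (assumption+, simp)

lemma polylog_floor_ln: assumes c: "0 < c" shows "polylog (%n. real (nat \<lfloor>c * ln (real n)\<rfloor>))"
 unfolding polylog_def
proof (intro exI[of _ c] exI[of _ 1] conjI allI impI)
 fix n :: nat assume n: "3 \<le> n"
 then have "0 \<le> c * ln (real n)" using ln_ge_1[OF n] c by simp
 then show "\<bar>real (nat \<lfloor>c * ln (real n)\<rfloor>)\<bar> \<le> c * ln (real n) ^ 1" by (simp add: of_nat_nat)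
qed (use c in simp)

lemma pow_floor_upper:
 assumes c: "0 < c" and x: "1 \<le> x" and n: "1 \<le> n" and g: "c * ln x \<le> g"
 shows "x ^ nat \<lfloor>c * ln (real n)\<rfloor> \<le> real n powr g"
proof -
 have ln0: "0 \<le> ln (real n)" using n by simp
 have "real (nat \<lfloor>c * ln (real n)\<rfloor>) \<le> c * ln (real n)" using c ln0 by (simp add: of_nat_nat)
 then have "x powr real (nat \<lfloor>c * ln (real n)\<rfloor>) \<le> x powr (c * ln (real n))" using x by (intro powr_mono) auto
 also have "... = real n powr (c * ln x)" using x n by (simp add: powr_def mult_ac)
 also have "... \<le> real n powr g" using n g by (intro powr_mono) auto
 finally show ?thesis using x by (simp add: powr_realpow)
qed

text \<open>For x < 1 the floor works against the bound: the exponent may fall short by one, which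
  costs 1 / x.\<close>

lemma pow_floor_ratio:
 assumes c: "0 < c" and x: "0 < x" "x \<le> 1" and n: "1 \<le> n" and g: "c * ln x \<le> g"
 shows "x ^ nat \<lfloor>c * ln (real n)\<rfloor> \<le> (1 / x) * real n powr g"
proof -
 have ln0: "0 \<le> ln (real n)" using n by simp
 have "c * ln (real n) - 1 \<le> real (nat \<lfloor>c * ln (real n)\<rfloor>)" using c ln0 by (simp add: of_nat_nat)
 then have "x powr real (nat \<lfloor>c * ln (real n)\<rfloor>) \<le> x powr (c * ln (real n) - 1)" using x by (intro powr_mono') auto
 also have "... = (1 / x) * real n powr (c * ln x)" using x n by (simp add: powr_diff) (simp add: powr_def mult_ac)
 also have "... \<le> (1 / x) * real n powr g" using n g x by (intro mult_left_mono powr_mono) auto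
 finally show ?thesis using x by (simp add: powr_realpow)
qed

lemma hsbm_params_large:
 assumes "3 \<le> d" "b \<le> a" "0 < b" "1 < alpha d a b" "d < n" "a \<le> real n"
 shows "hsbm_params n d a b"
proof
 have le: "real n \<le> real (n choose (d - 1))" using le_choose[of "d - 1" n] assms by simp
 then have "a / real (n choose (d - 1)) \<le> a / real n" using assms by (intro divide_left_mono mult_pos_pos) auto
 also have "... \<le> 1" using assms by simp
 finally show "p_n n d a \<le> 1" unfolding p_n_def .
qed (use assms in auto)

text \<open>The parameters are delta = n^(-theta), eta = n^e0 and a polylogarithmic
  \<open>L\<close>. \<open>\<theta>\<close> is fixed first and e0 stays free below it, because the
  bulk bound needs e0 arbitrarily small.\<close>

lemma core:
 fixes d :: nat and a b c :: real
 assumes d: "d \<ge> 3" and ab: "a \<ge> b" "b > 0" and al1: "alpha d a b > 1" and be1: "beta d a b > 1"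
  and ks: "(beta d a b)\<^sup>2 > alpha d a b" and c: "c > 0" "c * ln (alpha d a b) < 1 / 8"
 defines "l \<equiv> %n::nat. nat \<lfloor>c * ln (real n)\<rfloor>"
 shows "\<exists>\<theta>>0. \<forall>e0. 0 < e0 \<and> e0 \<le> \<theta> / 8 --> (\<exists>L. polylog L \<and> (\<forall>n\<ge>3. 1 \<le> L n) \<and>
  (%n. measure_pmf.prob (hsbm n d a b) (hsbm_params.good n d a b (l n)
   (22 * (real (l n) + 1)^2 * (real n powr e0)^2 * alpha d a b * sqrt (alpha d a b) ^ l n) (real n powr (-\<theta>)) (L n))) \<longlonglongrightarrow> 1)"
proof -
 define al be rt where "al = alpha d a b" and "be = beta d a b" and "rt = sqrt (alpha d a b)"
 have al: "1 < al" and be: "1 < be" using al1 be1 by (simp_all add: al_def be_def)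
 have rt2: "rt^2 = al" and rt1: "1 \<le> rt" using al1 by (simp_all add: rt_def al_def)
 have rtbe: "rt < be" using ks be unfolding rt_def be_def by (intro real_less_lsqrt) auto
 have beal: "be < al"
 proof -
  have "al - be = (real d - 1) * b"
   unfolding al_def be_def alpha_def beta_def by (simp add: field_simps)
  moreover have "0 < (real d - 1) * b" using d ab by simp
  ultimately show ?thesis by simp
 qed
 \<comment> \<open>Decay exponents of the gaps: (rt / be)^l and (be / al)^l are at most a constant
   times n^(-g1) and n^(-g2). They are positive since sqrt alpha < beta < alpha.\<close>
 define g1 g2 where "g1 = - (c * ln (rt / be))" and "g2 = - (c * ln (be / al))"
 have g1: "0 < g1" unfolding g1_def using c rt1 rtbe be by (simp add: mult_pos_neg ln_less_zero)
 have g2: "0 < g2" unfolding g2_def using c al beal be by (simp add: mult_pos_neg ln_less_zero)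
 \<comment> \<open>delta uses at most half of each gap; 1/32 keeps alpha^(2 l) / delta^2 and
   alpha^(4 l) / delta^2 below n by a power of n.\<close>
 define \<theta> where "\<theta> = min (min (g1 / 2) (g2 / 2)) (1 / 32)"
 have th: "0 < \<theta>" "\<theta> \<le> g1 / 2" "\<theta> \<le> g2 / 2" "\<theta> \<le> 1 / 32" unfolding \<theta>_def using g1 g2 by auto
 show ?thesis
 proof (intro exI[of _ \<theta>] conjI allI impI)
  show "0 < \<theta>" by (rule th)
  fix e0 :: real assume e0: "0 < e0 \<and> e0 \<le> \<theta> / 8"
  \<comment> \<open>k e0 >= 1 makes n / eta^(2 k) at most 1 / n, which absorbs the factor n of the
    trace.\<close>
  obtain k0 :: nat where k0: "1 / e0 < real k0" using reals_Archimedean2 by blast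
  define k where "k = Suc k0"
  have k: "0 < k" "1 \<le> real k * e0"
  proof -
   have "1 / e0 \<le> real k" using k0 unfolding k_def by simp
   then show "1 \<le> real k * e0" using e0 by (simp add: divide_le_eq)
  qed (simp add: k_def)
  define r where "r = max 6 (2 * k)"
  define lr where "lr n = real (l n)" for n
  define R where "R n = 1 + real d * real r * lr n" for n
  define Q where "Q n = 2 * (lr n + 1) * R n * (2 + R n * real d)" for n
  define W where "W n = 2 * (lr n + 1)^2 * (R n)^2 * (R n * Q n) ^ r * (2 ^ (d - 1) * real d)" for n
  define C where "C n = 2 * (R n * Q n) ^ r" for n
  \<comment> \<open>The extra logarithm makes the failure term C / L^2 tend to 0.\<close>
  define L where "L n = C n * ln (real n)" for n
  define D where "D = 2 ^ (d - 1) * al * real d"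
  have P_l: "polylog lr" unfolding lr_def l_def by (rule polylog_floor_ln[OF c(1)])
  have P_R: "polylog R" unfolding R_def by (intro polylog_intros P_l)
  have P_Q: "polylog Q" unfolding Q_def by (intro polylog_intros P_l P_R)
  have P_W: "polylog W" unfolding W_def by (intro polylog_intros P_l P_R P_Q)
  have P_C: "polylog C" unfolding C_def by (intro polylog_intros P_R P_Q)
  have "polylog (%n. ln (real n))" unfolding polylog_def
   by (rule exI[of _ 1], rule exI[of _ 1]) (use ln_ge_1 in force)
  then have P_L: "polylog L" unfolding L_def by (intro polylog_intros P_C)
  have lr0: "0 \<le> lr n" for n unfolding lr_def by simp
  have R1: "1 \<le> R n" for n unfolding R_def using lr0[of n] by simp
  have Q1: "1 \<le> Q n" for n
  proof -
   have "1 * 1 * 1 * 1 \<le> 2 * (lr n + 1) * R n * (2 + R n * real d)"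
    using R1[of n] lr0[of n] by (intro mult_mono) auto
   then show ?thesis unfolding Q_def by simp
  qed
  have RQ: "1 \<le> (R n * Q n) ^ r" for n using mult_mono[OF R1[of n] Q1[of n]] R1[of n] by (simp add: one_le_power)
  have C2: "2 \<le> C n" for n unfolding C_def using RQ[of n] by simp
  have W0: "0 < W n" for n unfolding W_def using R1[of n] Q1[of n] lr0[of n] d
   by (intro mult_pos_pos zero_less_power) (auto intro: less_le_trans[OF zero_less_one])
  have L1: "1 \<le> L n" if "3 \<le> n" for n
   using mult_mono[of 1 "C n" 1 "ln (real n)"] C2[of n] ln_ge_1[OF that] unfolding L_def by simp
  \<comment> \<open>The summands dominate the failure terms of \<open>main_event\<close>. All but 1
    / log n are polylogarithmic times a negative power of n.\<close>
  define U where "U n = (lr n + 1) * C n * real n powr (1 - 2 * real k * e0) + (lr n + 1) * C n * real n powr (- 4 * e0)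
   + (lr n)^2 * (4 * D + (W n)^2) * C n * real n powr (- 2 * e0) + (2 * (real d)^2 + 4) * D^2 * real n powr (- 2 * e0)
   + 3 * ((lr n + 1) * ((lr n * (real d * (real d * lr n + 2)))^2 + (1 + lr n) * C n)) * real n powr (- 2 * e0)
   + (1 + 2 * lr n) * C n * real n powr (1/4 + 2 * \<theta> - 1) + 1 / ln (real n)
   + (lr n + 1)^4 * C n * W n * real n powr (1/2 - 1 + 2 * \<theta>)" for n
  have "U \<longlonglongrightarrow> 0 + 0 + 0 + 0 + 0 + 0 + 0 + 0" unfolding U_def
  proof (intro tendsto_add polylog_small polylog_intros P_l P_C P_W)
   show "1 - 2 * real k * e0 < 0" using k by simp
   have "filterlim (%n. ln (real n)) at_top sequentially"
    by (rule filterlim_compose[OF ln_at_top filterlim_real_sequentially])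
   then show "(%n. 1 / ln (real n)) \<longlonglongrightarrow> 0"
    by (intro tendsto_divide_0[OF tendsto_const] filterlim_at_top_imp_at_infinity)
  qed (use e0 th in auto)
  then have U0: "(%n. 1 - U n) \<longlonglongrightarrow> 1" using tendsto_diff[OF tendsto_const[of 1], of U 0] by simp
  note pl = polylog_intros P_l
  have ev: "eventually (%n. max (max 4 (Suc d)) (max (nat \<lceil>a\<rceil>) (nat \<lceil>exp (1 / c)\<rceil>)) \<le> n) sequentially"
   "eventually (%n. (real d * (real d * lr n + 2)) * real n powr (-1) \<le> 1) sequentially"
   "eventually (%n. W n * real n powr (-1) \<le> 1) sequentially"
   "eventually (%n. lr n * real n powr (3 * e0 - 1/16) \<le> 1/2) sequentially"
   "eventually (%n. lr n * real n powr (e0 + 1/8 - 1/2) \<le> 1/2) sequentially"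
   "eventually (%n. (10 * (lr n + 1)) * real n powr (2 * e0 + 1/8 - 1/2) \<le> 1) sequentially"
   "eventually (%n. (2 * real d) * real n powr (-1/2) \<le> 1) sequentially"
   "eventually (%n. (176 * (lr n + 1)^2 * al * (be / rt)) * real n powr (2 * e0 - g1 + \<theta>) \<le> 1) sequentially"
   "eventually (%n. (44 * (lr n + 1)^2 * al * (al / be)) * real n powr (2 * e0 - g2 + \<theta>) \<le> 1) sequentially"
   "eventually (%n. 1 * real n powr (-\<theta>) \<le> 1/100) sequentially"
   "eventually (%n. L n * real n powr (-\<theta>) \<le> 1/100) sequentially"
   by (rule eventually_ge_at_top, (rule polylog_ev, (intro pl P_W P_L), use e0 th in simp, simp)+)
  have "eventually (%n. 1 - U n \<le> measure_pmf.prob (hsbm n d a b) (hsbm_params.good n d a b (l n)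
   (22 * (real (l n) + 1)^2 * (real n powr e0)^2 * al * rt ^ l n) (real n powr (-\<theta>)) (L n))) sequentially"
   using ev
  proof (eventually_elim, goal_cases)
   case (1 n)
   let ?P = "%e. real n powr e"
   have n: "4 \<le> n" "d < n" "a \<le> real n" "exp (1 / c) \<le> real n" using 1(1) by (auto simp: nat_le_iff ceiling_le_iff)
   have n0: "0 < real n" "1 \<le> real n" "3 \<le> n" using n by auto
   have pa: "?P x * ?P y = ?P (x + y)" for x y by (simp add: powr_add)
   have sN: "sqrt (real n) = ?P (1/2)" "sqrt (?P (1/2)) = ?P (1/4)" using n0 by (simp_all add: powr_half_sqrt[symmetric] powr_powr)
   interpret hsbm_params n d a b by (rule hsbm_params_large) (use d ab n al1 in auto)
   have E2: "3 * e0 - 1/16 < 0" "e0 + 1/8 - 1/2 < 0" "2 * e0 + 1/8 - 1/2 < 0" "2 * e0 - g1 + \<theta> < 0" "2 * e0 - g2 + \<theta> < 0" "-\<theta> < 0"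
    using e0 th by auto
   have l1: "1 \<le> l n"
   proof -
    have "1 / c \<le> ln (real n)" using n(4) n0 by (simp add: ln_ge_iff)
    then have "1 \<le> c * ln (real n)" using c by (simp add: divide_le_eq mult.commute)
    then show ?thesis unfolding l_def by (simp add: le_nat_iff le_floor_iff)
   qed
   have A: "al ^ l n \<le> ?P (1/8)" unfolding l_def
    by (rule pow_floor_upper[OF c(1)]) (use al n0 c(2) in \<open>auto simp: al_def\<close>)
   have A4: "al ^ (m * l n) \<le> ?P (real m / 8)" for m
   proof -
    have "al ^ (m * l n) = (al ^ l n) ^ m" by (simp add: power_mult[symmetric] mult.commute)
    also have "... \<le> (?P (1/8)) ^ m" using A al by (intro power_mono) auto
    also have "... = ?P (real m / 8)" using n0 by (simp add: powr_power mult.commute)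
    finally show ?thesis .
   qed
   have RT: "rt ^ l n \<le> ?P (1/16)" unfolding l_def
   proof (rule pow_floor_upper[OF c(1) rt1])
    have "ln al = 2 * ln rt" using rt2 rt1 by (metis less_le_trans ln_realpow of_nat_numeral zero_less_one)
    then show "c * ln rt \<le> 1/16" using c(2) unfolding al_def[symmetric] by (simp add: field_simps)
   qed (use n0 in simp)
   have ratio1: "rt ^ l n \<le> (be / rt) * ?P (- g1) * be ^ l n"
   proof -
    have "(rt / be) ^ l n \<le> (1 / (rt / be)) * ?P (- g1)" unfolding l_def
     by (rule pow_floor_ratio[OF c(1)]) (use rt1 rtbe be n0 in \<open>auto simp: g1_def\<close>)
    then have "(rt / be) ^ l n * be ^ l n \<le> (1 / (rt / be)) * ?P (- g1) * be ^ l n" using be by (intro mult_right_mono) auto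
    then show ?thesis using be by (simp add: power_divide)
   qed
   have ratio2: "be ^ l n \<le> (al / be) * ?P (- g2) * al ^ l n"
   proof -
    have "(be / al) ^ l n \<le> (1 / (be / al)) * ?P (- g2)" unfolding l_def
     by (rule pow_floor_ratio[OF c(1)]) (use beal be al n0 in \<open>auto simp: g2_def\<close>)
    then have "(be / al) ^ l n * al ^ l n \<le> (1 / (be / al)) * ?P (- g2) * al ^ l n" using al by (intro mult_right_mono) auto
    then show ?thesis using al by (simp add: power_divide)
   qed
   have eta1: "1 \<le> ?P e0" using n0 e0 by (simp add: ge_one_powr_ge_zero)
   have eta2: "(?P e0)^2 = ?P (2 * e0)" using n0 by (simp add: powr_power mult.commute)
   have d2: "(?P (-\<theta>))^2 = ?P (- 2 * \<theta>)" using n0 by (simp add: powr_power mult.commute)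
   have kl: "kap (l n) \<le> 1" using 1(2) n0 unfolding kap_def lr_def by (simp add: powr_minus_divide)
   have Wn: "W n \<le> real n" using 1(3) n0 by (simp add: powr_minus_divide divide_le_eq)
   have tb: "tuple_bound r (l n) (real n / W n) (C n)"
    using tuple_bound_concrete[of "l n" r] Wn unfolding W_def C_def Q_def R_def lr_def by simp
   have remd: "real (l n) * (?P e0 * rt ^ l n * (?P e0 / sqrt (real n)) * (?P e0 * \<alpha> ^ l n * sqrt (sqrt (real n))) + ?P e0 * \<alpha> ^ l n / sqrt (real n)) \<le> 1"
   proof -
    have "?P e0 * rt ^ l n * (?P e0 / sqrt (real n)) * (?P e0 * \<alpha> ^ l n * sqrt (sqrt (real n)))
     \<le> ?P e0 * ?P (1/16) * (?P e0 * ?P (-1/2)) * (?P e0 * ?P (1/8) * ?P (1/4))"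
     using A RT rt1 al unfolding sN divide_powr_uminus al_def[symmetric]
     by (intro mult_mono) auto
    also have "... = ?P (3 * e0 - 1/16)" unfolding pa by (rule arg_cong[of _ _ ?P]) simp
    finally have a: "?P e0 * rt ^ l n * (?P e0 / sqrt (real n)) * (?P e0 * \<alpha> ^ l n * sqrt (sqrt (real n))) \<le> ?P (3 * e0 - 1/16)" .
    have "?P e0 * \<alpha> ^ l n / sqrt (real n) \<le> ?P e0 * ?P (1/8) * ?P (-1/2)"
     using A al unfolding sN divide_powr_uminus al_def[symmetric] by (intro mult_mono) auto
    also have "... = ?P (e0 + 1/8 - 1/2)" unfolding pa by (rule arg_cong[of _ _ ?P]) simp
    finally have "real (l n) * (?P e0 * rt ^ l n * (?P e0 / sqrt (real n)) * (?P e0 * \<alpha> ^ l n * sqrt (sqrt (real n))) + ?P e0 * \<alpha> ^ l n / sqrt (real n))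
     \<le> real (l n) * (?P (3 * e0 - 1/16) + ?P (e0 + 1/8 - 1/2))" using a by (intro mult_left_mono add_mono) auto
    also have "... \<le> 1/2 + 1/2" unfolding distrib_left using 1(4,5) E2 unfolding lr_def by (intro add_mono) auto
    finally show ?thesis by simp
   qed
   have bign: "10 * (real (l n) + 1) * (?P e0)^2 * \<alpha> ^ l n \<le> sqrt (real n)"
   proof -
    have "10 * (real (l n) + 1) * (?P e0)^2 * \<alpha> ^ l n \<le> 10 * (real (l n) + 1) * ?P (2 * e0) * ?P (1/8)"
     unfolding eta2 using A unfolding al_def by (intro mult_left_mono) auto
    also have "... = (10 * (lr n + 1) * ?P (2 * e0 + 1/8 - 1/2)) * ?P (1/2)"
     unfolding lr_def by (simp add: mult.assoc pa add.commute)
    also have "... \<le> 1 * ?P (1/2)" using 1(6) E2 by (intro mult_right_mono) auto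
    finally show ?thesis unfolding sN by simp
   qed
   have dn: "2 * real d \<le> sqrt (real n)"
   proof -
    have "2 * real d * ?P (-1/2) * ?P (1/2) \<le> 1 * ?P (1/2)" using 1(7) by (intro mult_right_mono) auto
    then show ?thesis unfolding sN mult.assoc pa using n0 by simp
   qed
   have c1e: "8 * (22 * (real (l n) + 1)^2 * (?P e0)^2 * \<alpha> * rt ^ l n) \<le> ?P (-\<theta>) * \<beta> ^ l n"
   proof -
    have "8 * (22 * (real (l n) + 1)^2 * (?P e0)^2 * \<alpha> * rt ^ l n) = 176 * (lr n + 1)^2 * al * ?P (2 * e0) * rt ^ l n"
     unfolding eta2 lr_def al_def by simp
    also have "... \<le> 176 * (lr n + 1)^2 * al * ?P (2 * e0) * ((be / rt) * ?P (- g1) * be ^ l n)"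
     using ratio1 al by (intro mult_left_mono) auto
    also have "... = (176 * (lr n + 1)^2 * al * (be / rt) * ?P (2 * e0 - g1 + \<theta>)) * (?P (-\<theta>) * be ^ l n)"
     by (simp add: mult_ac powr_add[symmetric] pa)
    also have "... \<le> 1 * (?P (-\<theta>) * be ^ l n)" using 1(8) E2 be by (intro mult_right_mono) auto
    finally show ?thesis unfolding be_def by simp
   qed
   have c2e: "2 * (22 * (real (l n) + 1)^2 * (?P e0)^2 * \<alpha> * \<beta> ^ l n) \<le> ?P (-\<theta>) * \<alpha> ^ l n"
   proof -
    have "2 * (22 * (real (l n) + 1)^2 * (?P e0)^2 * \<alpha> * \<beta> ^ l n) = 44 * (lr n + 1)^2 * al * ?P (2 * e0) * be ^ l n"
     unfolding eta2 lr_def al_def be_def by simp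
    also have "... \<le> 44 * (lr n + 1)^2 * al * ?P (2 * e0) * ((al / be) * ?P (- g2) * al ^ l n)"
     using ratio2 al by (intro mult_left_mono) auto
    also have "... = (44 * (lr n + 1)^2 * al * (al / be) * ?P (2 * e0 - g2 + \<theta>)) * (?P (-\<theta>) * al ^ l n)"
     by (simp add: mult_ac powr_add[symmetric] pa)
    also have "... \<le> 1 * (?P (-\<theta>) * al ^ l n)" using 1(9) E2 al by (intro mult_right_mono) auto
    finally show ?thesis unfolding al_def by simp
   qed
   have dd: "0 < ?P (-\<theta>)" "?P (-\<theta>) \<le> 1/100" "?P (-\<theta>) * L n \<le> 1/100"
    using 1(10,11) E2 n0 by (simp_all add: mult.commute)
   note ME = main_event[OF tb _ k(1) _ l1 kl rt1 rt2[unfolded al_def] _ eta1 dd(1,2) L1[OF n0(3)] dd(3) remd bign dn c1e c2e]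
   have C0: "0 \<le> C n" and D0: "0 \<le> D" using C2[of n] al unfolding D_def by auto
   have cD: "c1 = D" unfolding c1_def D_def al_def ..
   have T1: "(real (l n) + 1) * (real n * C n / ?P e0 ^ (2*k)) = (lr n + 1) * C n * ?P (1 - 2 * real k * e0)"
   proof -
    have "?P e0 ^ (2*k) = ?P (2 * real k * e0)" using n0 by (simp add: powr_power mult_ac)
    then show ?thesis using n0 by (simp add: powr_diff lr_def)
   qed
   have T2: "(real (l n) + 1) * (C n / ?P e0 ^ 4) = (lr n + 1) * C n * ?P (- 4 * e0)"
   proof -
    have "?P e0 ^ 4 = ?P (4 * e0)" using n0 by (simp add: powr_power mult.commute)
    then show ?thesis by (simp add: lr_def divide_powr_uminus)
   qed
   have T3: "real (l n * l n) * ((p * (real n)^2 + (real n / (real n / W n))^2) * C n / (?P e0)^2)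
     \<le> (lr n)^2 * (4 * D + (W n)^2) * C n * ?P (- 2 * e0)"
   proof -
    have "p * (real n)^2 + (real n / (real n / W n))^2 \<le> 4 * D + (W n)^2" using p_small[OF n(1,2)] n0 unfolding cD by simp
    then have "real (l n * l n) * ((p * (real n)^2 + (real n / (real n / W n))^2) * C n / (?P e0)^2)
     \<le> real (l n * l n) * ((4 * D + (W n)^2) * C n / (?P e0)^2)"
     using C0 by (intro mult_left_mono divide_right_mono mult_right_mono) auto
    also have "... = (lr n)^2 * (4 * D + (W n)^2) * C n * ?P (- 2 * e0)"
     unfolding eta2 divide_powr_uminus by (simp add: lr_def power2_eq_square mult_ac)
    finally show ?thesis .
   qed
   have T4: "(2 * (real d)^2 + 4) * c1^2 / (?P e0)^2 = (2 * (real d)^2 + 4) * D^2 * ?P (- 2 * e0)"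
    unfolding eta2 divide_powr_uminus cD by simp
   have T5: "3 * ((real (l n) + 1) * ((dev (l n) + (1 + real (l n)) * C n) / (?P e0)^2))
     \<le> 3 * ((lr n + 1) * ((lr n * (real d * (real d * lr n + 2)))^2 + (1 + lr n) * C n)) * ?P (- 2 * e0)"
   proof -
    have "dev (l n) = (lr n * (real d * (real d * lr n + 2)))^2 / real n"
     unfolding dev_def kap_def lr_def using n0 by (simp add: power2_eq_square)
    also have "... \<le> (lr n * (real d * (real d * lr n + 2)))^2 / 1" using n0 by (intro divide_left_mono) auto
    finally have "3 * ((real (l n) + 1) * ((dev (l n) + (1 + real (l n)) * C n) / (?P e0)^2))
     \<le> 3 * ((real (l n) + 1) * (((lr n * (real d * (real d * lr n + 2)))^2 + (1 + real (l n)) * C n) / (?P e0)^2))"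
     by (intro mult_left_mono divide_right_mono add_right_mono) auto
    then show ?thesis unfolding eta2 divide_powr_uminus by (simp add: lr_def mult.assoc)
   qed
   have T6: "(1 + 2 * real (l n)) * \<alpha> ^ (2 * l n) * C n / ((?P (-\<theta>))^2 * real n) \<le> (1 + 2 * lr n) * C n * ?P (1/4 + 2 * \<theta> - 1)"
   proof -
    have qe: "(?P (-\<theta>))^2 * real n = ?P (1 - 2 * \<theta>)" unfolding d2 using n0 by (simp add: powr_diff powr_minus_divide)
    have "(1 + 2 * real (l n)) * \<alpha> ^ (2 * l n) * C n / ?P (1 - 2 * \<theta>) \<le> (1 + 2 * real (l n)) * ?P (real 2 / 8) * C n / ?P (1 - 2 * \<theta>)"
     using A4[of 2] C0 unfolding al_def by (intro divide_right_mono mult_right_mono mult_left_mono) auto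
    also have "(1 + 2 * real (l n)) * ?P (real 2 / 8) * C n / ?P (1 - 2 * \<theta>) = (1 + 2 * lr n) * C n * (?P (real 2 / 8) * ?P (- (1 - 2 * \<theta>)))"
     unfolding divide_powr_uminus lr_def by simp
    also have "?P (real 2 / 8) * ?P (- (1 - 2 * \<theta>)) = ?P (1/4 + 2 * \<theta> - 1)" unfolding pa by (rule arg_cong[of _ _ ?P]) simp
    finally show ?thesis unfolding qe .
   qed
   have T7: "C n / (L n)^2 \<le> 1 / ln (real n)"
   proof -
    have g: "1 \<le> ln (real n)" by (rule ln_ge_1[OF n0(3)])
    have "C n / (L n)^2 = 1 / (C n * ln (real n) * ln (real n))" unfolding L_def using C2[of n] by (simp add: power2_eq_square)
    also have "... \<le> 1 / (1 * 1 * ln (real n))" using C2[of n] g by (intro divide_left_mono mult_mono mult_pos_pos) auto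
    finally show ?thesis by simp
   qed
   have T8: "(real (l n) + 1)^4 * \<alpha> ^ (4 * l n) * C n / (real n / W n * (?P (-\<theta>))^2) \<le> (lr n + 1)^4 * C n * W n * ?P (1/2 - 1 + 2 * \<theta>)"
   proof -
    have qe: "real n / W n * (?P (-\<theta>))^2 = ?P (1 - 2 * \<theta>) / W n" unfolding d2 using n0 by (simp add: powr_diff powr_minus_divide)
    have "(real (l n) + 1)^4 * \<alpha> ^ (4 * l n) * C n / (?P (1 - 2 * \<theta>) / W n) \<le> (real (l n) + 1)^4 * ?P (real 4 / 8) * C n / (?P (1 - 2 * \<theta>) / W n)"
     using A4[of 4] C0 W0[of n] unfolding al_def by (intro divide_right_mono mult_right_mono mult_left_mono) auto
    also have "(real (l n) + 1)^4 * ?P (real 4 / 8) * C n / (?P (1 - 2 * \<theta>) / W n) = (lr n + 1)^4 * C n * W n * (?P (real 4 / 8) / ?P (1 - 2 * \<theta>))"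
     unfolding lr_def by simp
    also have "?P (real 4 / 8) / ?P (1 - 2 * \<theta>) = ?P (1/2 - 1 + 2 * \<theta>)" unfolding divide_powr_uminus pa by (rule arg_cong[of _ _ ?P]) simp
    finally show ?thesis unfolding qe .
   qed
   have "6 \<le> r" "2 * k \<le> r" "rt \<le> \<beta>" unfolding r_def using rtbe be_def by auto
   from ME[OF this] show ?case unfolding U_def al_def using T1 T2 T3 T4 T5 T6 T7 T8 by linarith
  qed
  then have "(%n. measure_pmf.prob (hsbm n d a b) (hsbm_params.good n d a b (l n)
   (22 * (real (l n) + 1)^2 * (real n powr e0)^2 * al * rt ^ l n) (real n powr (-\<theta>)) (L n))) \<longlonglongrightarrow> 1"
   by (rule tendsto_sandwich[OF _ _ U0 tendsto_const]) (simp add: measure_pmf.prob_le_1)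
  then show "\<exists>L. polylog L \<and> (\<forall>n\<ge>3. 1 \<le> L n) \<and> (%n. measure_pmf.prob (hsbm n d a b) (hsbm_params.good n d a b (l n)
   (22 * (real (l n) + 1)^2 * (real n powr e0)^2 * alpha d a b * sqrt (alpha d a b) ^ l n) (real n powr (-\<theta>)) (L n))) \<longlonglongrightarrow> 1"
   unfolding al_def rt_def using P_L L1 by blast
 qed
qed

section \<open>The main theorem\<close>

lemma prob_superset_limit:
 fixes P :: "nat => 'a pmf"
 assumes "(%n. measure_pmf.prob (P n) (G n)) \<longlonglongrightarrow> 1" "eventually (%n. G n \<subseteq> A n) sequentially"
 shows "(%n. measure_pmf.prob (P n) (A n)) \<longlonglongrightarrow> 1"
proof (rule tendsto_sandwich[OF _ _ assms(1) tendsto_const])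
 show "eventually (%n. measure_pmf.prob (P n) (G n) \<le> measure_pmf.prob (P n) (A n)) sequentially"
  using assms(2) by eventually_elim (rule measure_pmf.finite_measure_mono, auto)
qed (simp add: measure_pmf.prob_le_1)

theorem theorem6p1:
  fixes d :: nat and a b c :: real
  assumes "d \<ge> 3" and "a \<ge> b" and "b > 0"
    and "alpha d a b > 1" and "beta d a b > 1"
    and "(beta d a b)\<^sup>2 > alpha d a b"
    and "c > 0" and "c * ln (alpha d a b) < 1 / 8"
  defines "l \<equiv> \<lambda>n::nat. nat \<lfloor>c * ln (real n)\<rfloor>"
  defines "B \<equiv> \<lambda>n::nat. \<lambda>H. Bl_mat n H (l n)"
  shows
    \<comment> \<open>eigenvectors of the two largest eigenvalues align with S_l and D_l\<close>
    "(\<forall>\<epsilon>>0. (\<lambda>n. measure_pmf.prob (hsbm n d a b)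
        {(\<sigma>, H). (\<forall>x. eigenvector (B n H) x (kth_eig (B n H) 1) \<longrightarrow>
                        cos_angle x (S_vec n H (l n)) \<ge> 1 - \<epsilon>) \<and>
                  (\<forall>y. eigenvector (B n H) y (kth_eig (B n H) 2) \<longrightarrow>
                        cos_angle y (D_vec n \<sigma> H (l n)) \<ge> 1 - \<epsilon>)})
      \<longlonglongrightarrow> 1)
   \<and>
    \<comment> \<open>largest eigenvalue: Theta(alpha^l) up to a logarithmic factor\<close>
    (\<exists>C>0. \<exists>k::nat. (\<lambda>n. measure_pmf.prob (hsbm n d a b)
        {(\<sigma>, H). alpha d a b ^ l n / (C * ln (real n) ^ k) \<le> kth_eig (B n H) 1 \<and>
                  kth_eig (B n H) 1 \<le> C * ln (real n) ^ k * alpha d a b ^ l n})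
      \<longlonglongrightarrow> 1)
   \<and>
    \<comment> \<open>second largest eigenvalue: Omega(beta^l)\<close>
    (\<exists>C>0. (\<lambda>n. measure_pmf.prob (hsbm n d a b)
        {(\<sigma>, H). kth_eig (B n H) 2 \<ge> C * beta d a b ^ l n})
      \<longlonglongrightarrow> 1)
   \<and>
    \<comment> \<open>all other eigenvalues: O(n^eps alpha^(l/2)) for every eps > 0\<close>
    (\<forall>\<epsilon>>0. \<exists>C>0. (\<lambda>n. measure_pmf.prob (hsbm n d a b)
        {(\<sigma>, H). \<forall>k. 3 \<le> k \<and> k \<le> n \<longrightarrow>
            \<bar>kth_eig (B n H) k\<bar> \<le> C * real n powr \<epsilon> * alpha d a b powr (real (l n) / 2)})
      \<longlonglongrightarrow> 1)"
proof -
 let ?al = "alpha d a b" and ?be = "beta d a b"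
 from core[OF assms(1-8)] obtain \<theta> where th: "0 < \<theta>" and core: "!!e0. 0 < e0 \<and> e0 \<le> \<theta> / 8 ==> (\<exists>L. polylog L \<and> (\<forall>n\<ge>3. 1 \<le> L n) \<and>
  (%n. measure_pmf.prob (hsbm n d a b) (hsbm_params.good n d a b (l n)
   (22 * (real (l n) + 1)^2 * (real n powr e0)^2 * ?al * sqrt ?al ^ l n) (real n powr (-\<theta>)) (L n))) \<longlonglongrightarrow> 1)"
  unfolding l_def by blast
 have par: "eventually (%n. hsbm_params n d a b \<and> 3 \<le> n) sequentially"
  using eventually_ge_at_top[of "max (Suc d) (nat \<lceil>a\<rceil>)"]
  by eventually_elim (use assms in \<open>auto simp: nat_le_iff ceiling_le_iff intro!: hsbm_params_large\<close>)
 \<comment> \<open>One choice of the slack serves the first three claims.\<close>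
 obtain L where L: "polylog L" "!!n. 3 \<le> n ==> 1 \<le> L n" and
  lim: "(%n. measure_pmf.prob (hsbm n d a b) (hsbm_params.good n d a b (l n)
   (22 * (real (l n) + 1)^2 * (real n powr (\<theta> / 8))^2 * ?al * sqrt ?al ^ l n) (real n powr (-\<theta>)) (L n))) \<longlonglongrightarrow> 1"
  using core[of "\<theta> / 8"] th by auto
 show ?thesis
 proof (intro conjI allI impI)
  fix \<epsilon> :: real assume e: "0 < \<epsilon>"
  have "eventually (%n. 28 * real n powr (-\<theta>) \<le> \<epsilon>) sequentially"
   by (rule polylog_ev[OF polylog_const]) (use th e in auto)
  then have sub: "eventually (%n. hsbm_params.good n d a b (l n)
   (22 * (real (l n) + 1)^2 * (real n powr (\<theta> / 8))^2 * ?al * sqrt ?al ^ l n) (real n powr (-\<theta>)) (L n)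
   \<subseteq> {(\<sigma>, H). (\<forall>x. eigenvector (B n H) x (kth_eig (B n H) 1) --> cos_angle x (S_vec n H (l n)) \<ge> 1 - \<epsilon>) \<and>
         (\<forall>y. eigenvector (B n H) y (kth_eig (B n H) 2) --> cos_angle y (D_vec n \<sigma> H (l n)) \<ge> 1 - \<epsilon>)}) sequentially"
   using par
  proof eventually_elim
   case (elim n)
   then interpret hsbm_params n d a b by simp
   have "0 \<le> real n powr (-\<theta>)" by simp
   then have le: "1 - \<epsilon> \<le> 1 - 14 * real n powr (-\<theta>)" "1 - \<epsilon> \<le> 1 - 28 * real n powr (-\<theta>)" using elim(1) by linarith+
   show ?case unfolding good_def B_def by (auto intro: order.trans[OF le(1)] order.trans[OF le(2)])
  qed
  show "(%n. measure_pmf.prob (hsbm n d a b) {(\<sigma>, H). (\<forall>x. eigenvector (B n H) x (kth_eig (B n H) 1) -->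
            cos_angle x (S_vec n H (l n)) \<ge> 1 - \<epsilon>) \<and>
         (\<forall>y. eigenvector (B n H) y (kth_eig (B n H) 2) -->
            cos_angle y (D_vec n \<sigma> H (l n)) \<ge> 1 - \<epsilon>)}) \<longlonglongrightarrow> 1"
   by (rule prob_superset_limit[OF lim sub])
 next
  obtain K k where Kk: "0 \<le> K" "!!n. n \<ge> 3 ==> \<bar>L n\<bar> \<le> K * ln (real n) ^ k" using L(1) unfolding polylog_def by blast
  \<comment> \<open>The bound 8 L^2 doubles the power of the logarithm; the summand 2 accommodates
    the lower bound alpha^l / 2.\<close>
  define C where "C = 8 * K^2 + 2"
  have C: "2 \<le> C" unfolding C_def by simp
  have sub: "eventually (%n. hsbm_params.good n d a b (l n)
   (22 * (real (l n) + 1)^2 * (real n powr (\<theta> / 8))^2 * ?al * sqrt ?al ^ l n) (real n powr (-\<theta>)) (L n)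
   \<subseteq> {(\<sigma>, H). ?al ^ l n / (C * ln (real n) ^ (2*k)) \<le> kth_eig (B n H) 1 \<and>
         kth_eig (B n H) 1 \<le> C * ln (real n) ^ (2*k) * ?al ^ l n}) sequentially"
   using par
  proof eventually_elim
   case (elim n)
   then interpret hsbm_params n d a b by simp
   have n: "3 \<le> n" using elim by simp
   have lg: "1 \<le> ln (real n) ^ (2*k)" using ln_ge_1[OF n] by simp
   have ap: "0 < ?al ^ l n" using assms by simp
   have "\<bar>L n\<bar>^2 \<le> (K * ln (real n) ^ k)^2" using Kk(2)[OF n] by (intro power_mono) auto
   then have "8 * (L n)^2 \<le> 8 * K^2 * ln (real n) ^ (2*k)" by (simp add: power_mult_distrib power_mult[symmetric] mult.commute)
   also have "... \<le> C * ln (real n) ^ (2*k)" unfolding C_def using lg by (intro mult_right_mono) auto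
   finally have up: "8 * (L n)^2 * ?al ^ l n \<le> C * ln (real n) ^ (2*k) * ?al ^ l n" using ap by (intro mult_right_mono) auto
   have "2 * 1 \<le> C * ln (real n) ^ (2*k)" using C lg by (intro mult_mono) auto
   then have low: "?al ^ l n / (C * ln (real n) ^ (2*k)) \<le> ?al ^ l n / 2" using ap by (intro divide_left_mono) auto
   show ?case unfolding good_def B_def by (auto intro: order.trans[OF low] order.trans[OF _ up])
  qed
  show "\<exists>C>0. \<exists>k::nat. (%n. measure_pmf.prob (hsbm n d a b)
    {(\<sigma>, H). ?al ^ l n / (C * ln (real n) ^ k) \<le> kth_eig (B n H) 1 \<and>
         kth_eig (B n H) 1 \<le> C * ln (real n) ^ k * ?al ^ l n}) \<longlonglongrightarrow> 1"
   by (rule exI[of _ C], rule conjI, use C in simp, rule exI[of _ "2*k"], rule prob_superset_limit[OF lim sub])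
 next
  have sub: "eventually (%n. hsbm_params.good n d a b (l n)
   (22 * (real (l n) + 1)^2 * (real n powr (\<theta> / 8))^2 * ?al * sqrt ?al ^ l n) (real n powr (-\<theta>)) (L n)
   \<subseteq> {(\<sigma>, H). kth_eig (B n H) 2 \<ge> 1/8 * ?be ^ l n}) sequentially"
   using par
  proof eventually_elim
   case (elim n)
   then interpret hsbm_params n d a b by simp
   show ?case unfolding good_def B_def by auto
  qed
  show "\<exists>C>0. (%n. measure_pmf.prob (hsbm n d a b) {(\<sigma>, H). kth_eig (B n H) 2 \<ge> C * ?be ^ l n}) \<longlonglongrightarrow> 1"
   by (rule exI[of _ "1/8"], rule conjI, simp, rule prob_superset_limit[OF lim sub])
 next
  fix \<epsilon> :: real assume e: "0 < \<epsilon>"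
  \<comment> \<open>The bulk bound carries eta^2 = n^(2 e0) and a polylogarithm; e0 <= epsilon / 4
    leaves n^(epsilon / 2) for the latter.\<close>
  define e0 where "e0 = min (\<theta> / 8) (\<epsilon> / 4)"
  have e0: "0 < e0" "e0 \<le> \<theta> / 8" "2 * e0 - \<epsilon> < 0" unfolding e0_def using th e by auto
  then obtain L' where lim': "(%n. measure_pmf.prob (hsbm n d a b) (hsbm_params.good n d a b (l n)
   (22 * (real (l n) + 1)^2 * (real n powr e0)^2 * ?al * sqrt ?al ^ l n) (real n powr (-\<theta>)) (L' n))) \<longlonglongrightarrow> 1"
   using core[of e0] by blast
  have "eventually (%n. (22 * (real (l n) + 1)^2 * ?al) * real n powr (2 * e0 - \<epsilon>) \<le> 1) sequentially"
   unfolding l_def by (rule polylog_ev, (intro polylog_intros polylog_floor_ln assms), rule e0(3), simp)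
  then have sub: "eventually (%n. hsbm_params.good n d a b (l n)
   (22 * (real (l n) + 1)^2 * (real n powr e0)^2 * ?al * sqrt ?al ^ l n) (real n powr (-\<theta>)) (L' n)
   \<subseteq> {(\<sigma>, H). \<forall>k. 3 \<le> k \<and> k \<le> n --> \<bar>kth_eig (B n H) k\<bar> \<le> 1 * real n powr \<epsilon> * ?al powr (real (l n) / 2)}) sequentially"
   using par
  proof eventually_elim
   case (elim n)
   then interpret hsbm_params n d a b by simp
   have n: "0 < real n" using elim by simp
   have al0: "0 < ?al" using assms by simp
   have sq: "sqrt ?al ^ l n = ?al powr (real (l n) / 2)"
    using al0 by (simp add: powr_half_sqrt[symmetric] powr_power)
   have "22 * (real (l n) + 1)^2 * (real n powr e0)^2 * ?al = (22 * (real (l n) + 1)^2 * ?al) * real n powr (2 * e0 - \<epsilon>) * real n powr \<epsilon>"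
    using n by (simp add: powr_diff powr_power mult.commute)
   also have "... \<le> 1 * real n powr \<epsilon>" using elim(1) by (intro mult_right_mono) auto
   finally have le: "22 * (real (l n) + 1)^2 * (real n powr e0)^2 * ?al * sqrt ?al ^ l n \<le> 1 * real n powr \<epsilon> * ?al powr (real (l n) / 2)"
    unfolding sq by (intro mult_right_mono) auto
   show ?case unfolding good_def B_def by (auto intro: order.trans[OF _ le[simplified]])
  qed
  show "\<exists>C>0. (%n. measure_pmf.prob (hsbm n d a b)
    {(\<sigma>, H). \<forall>k. 3 \<le> k \<and> k \<le> n -->
      \<bar>kth_eig (B n H) k\<bar> \<le> C * real n powr \<epsilon> * ?al powr (real (l n) / 2)}) \<longlonglongrightarrow> 1"
   by (rule exI[of _ 1], rule conjI, simp, rule prob_superset_limit[OF lim' sub])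
 qed
qed

end
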